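(* There is a randomized polynomial time $O(\log\log(n))$-approximation algorithm for the restricted assignment case of the submodular Santa Claus problem with a monotone submodular utility function. That is, there is a randomized polynomial-time algorithm which, given an instance (players $P$ with $|P|=n$, resources $R$ with $|R|=m$, a monotone submodular function $f:2^R\to\mathbb{R}_{\ge 0}$ with $f(\emptyset)=0$, and sets $\Gamma_i\subseteq R$ for $i\in P$), outputs a partition $\{S_i\}_{i\in P}$ of $R$ with $\min_{i\in P} f(S_i\cap\Gamma_i)\ge \mathrm{OPT}/\alpha$ for some $\alpha=O(\log\log(n))$, where $\mathrm{OPT}$ is the maximum of $\min_{i\in P} f(S_i\cap \Gamma_i)$ over all partitions $\{S_i\}_{i\in P}$ of $R$.
   Context: Restricted assignment submodular Santa Claus problem: we are given a set $P$ of $n$ players, a set $R$ of $m$ indivisible resources, a monotone submodular function $f:2^R\to\mathbb{R}_{\ge0}$ with $f(\emptyset)=0$ (accessed via a value oracle), and for each player $i$ a set $\Gamma_i\subseteq R$. Player $i$'s utility for a set $S$ is $f_i(S)=f(S\cap\Gamma_i)$. The goal is to find a partition $\{S_i\}_{i\in P}$ of the resources maximizing $\min_{i\in P} f_i(S_i)$. Monotone means $f(S)\le f(T)$ for $S\subseteq T$; submodular means $f(S\cup\{a\})-f(S)\ge f(T\cup\{a\})-f(T)$ for $S\subseteq T$, $a\notin T$. Following the paper's introduction, $n$ denotes the number of players. *)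

theory Defs
  imports
    "HOL-Probability.Probability"
    "HOL-Computational_Algebra.Polynomial"
    "HOL-Library.Landau_Symbols"
begin

section \<open>The restricted assignment submodular Santa Claus problem\<close>

definition monotone_set_function :: "'r set \<Rightarrow> ('r set \<Rightarrow> real) \<Rightarrow> bool" where
  "monotone_set_function R f \<longleftrightarrow> (\<forall>S T. S \<subseteq> T \<and> T \<subseteq> R \<longrightarrow> f S \<le> f T)"

definition submodular :: "'r set \<Rightarrow> ('r set \<Rightarrow> real) \<Rightarrow> bool" where
  "submodular R f \<longleftrightarrow>
     (\<forall>S T a. S \<subseteq> T \<and> T \<subseteq> R \<and> a \<in> R - T \<longrightarrow>
        f (S \<union> {a}) - f S \<ge> f (T \<union> {a}) - f T)"

definition santa_instance ::
  "'p set \<Rightarrow> 'r set \<Rightarrow> ('r set \<Rightarrow> real) \<Rightarrow> ('p \<Rightarrow> 'r set) \<Rightarrow> bool" where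
  "santa_instance P R f \<Gamma> \<longleftrightarrow>
     finite P \<and> P \<noteq> {} \<and> finite R \<and>
     (\<forall>S\<subseteq>R. f S \<ge> 0) \<and> f {} = 0 \<and> monotone_set_function R f \<and> submodular R f \<and>
     (\<forall>i\<in>P. \<Gamma> i \<subseteq> R)"

text \<open>The parts of a partition are indexed by the players; they may be empty.\<close>

definition allocation :: "'p set \<Rightarrow> 'r set \<Rightarrow> ('p \<Rightarrow> 'r set) \<Rightarrow> bool" where
  "allocation P R S \<longleftrightarrow> (\<Union>i\<in>P. S i) = R \<and> disjoint_family_on S P"

definition santa_value ::
  "'p set \<Rightarrow> ('r set \<Rightarrow> real) \<Rightarrow> ('p \<Rightarrow> 'r set) \<Rightarrow> ('p \<Rightarrow> 'r set) \<Rightarrow> real" where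
  "santa_value P f \<Gamma> S = Min ((\<lambda>i. f (S i \<inter> \<Gamma> i)) ` P)"

definition santa_opt ::
  "'p set \<Rightarrow> 'r set \<Rightarrow> ('r set \<Rightarrow> real) \<Rightarrow> ('p \<Rightarrow> 'r set) \<Rightarrow> real" where
  "santa_opt P R f \<Gamma> = Max {santa_value P f \<Gamma> S |S. allocation P R S}"

lemma santa_values_finite_nonempty:
  assumes "santa_instance P R f \<Gamma>"
  shows "finite {santa_value P f \<Gamma> S |S. allocation P R S}"
    and "{santa_value P f \<Gamma> S |S. allocation P R S} \<noteq> {}"
proof -
  have fin: "finite P" "P \<noteq> {}" "finite R"
    using assms by (auto simp: santa_instance_def)
  have "santa_value P f \<Gamma> S \<in> f ` Pow R" if "allocation P R S" for S
  proof -
    have "santa_value P f \<Gamma> S \<in> (\<lambda>i. f (S i \<inter> \<Gamma> i)) ` P"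
      unfolding santa_value_def using fin by (intro Min_in) auto
    moreover have "S i \<subseteq> R" if "i \<in> P" for i
      using \<open>allocation P R S\<close> that by (auto simp: allocation_def)
    ultimately show ?thesis by auto
  qed
  then have "{santa_value P f \<Gamma> S |S. allocation P R S} \<subseteq> f ` Pow R" by blast
  then show "finite {santa_value P f \<Gamma> S |S. allocation P R S}"
    by (rule finite_subset) (use fin in simp)
  obtain p where "p \<in> P" using fin by blast
  then have "allocation P R (\<lambda>i. if i = p then R else {})"
    by (auto simp: allocation_def disjoint_family_on_def)
  then show "{santa_value P f \<Gamma> S |S. allocation P R S} \<noteq> {}" by blast
qed

lemma santa_opt_attained:
  assumes "santa_instance P R f \<Gamma>"
  obtains S where "allocation P R S" "santa_value P f \<Gamma> S = santa_opt P R f \<Gamma>"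
  using Max_in[OF santa_values_finite_nonempty[OF assms]] that
  unfolding santa_opt_def by auto

lemma santa_opt_upper:
  assumes "santa_instance P R f \<Gamma>" "allocation P R S"
  shows "santa_value P f \<Gamma> S \<le> santa_opt P R f \<Gamma>"
  unfolding santa_opt_def
  by (intro Max_ge santa_values_finite_nonempty(1)[OF assms(1)]) (use assms(2) in blast)


section \<open>Randomized programs with access to a value oracle\<close>

text \<open>
  A random access machine with a structured control flow and unit-cost steps. Its memory consists
  of arrays of natural numbers and arrays of real numbers, each array having a fixed name (a
  number occurring in the program text) and unbounded length.

  The instruction set is limited so that a unit-cost step count is an honest measure of time.
  There is no multiplication: one step lengthens a natural number by at most a constant number of
  bits, and a real number computed in \<open>t\<close> steps is an integer combination of oracle answers with
  coefficients of \<open>O(t)\<close> bits. Real numbers can only be obtained from the oracle, added, subtracted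
  and compared; there is no rounding and no other conversion to natural numbers. Hence programs
  running in polynomial time can be simulated by polynomial-time oracle Turing machines whenever
  the oracle answers are rational numbers, with the length of the answers counting as input length.
\<close>

datatype aexp =
    Num nat
  | Get nat aexp
  | Add aexp aexp
  | Sub aexp aexp
  | Half aexp

datatype rexp =
    RZero
  | RGet nat aexp
  | RAdd rexp rexp
  | RSub rexp rexp

datatype bexp =
    Less aexp aexp
  | RLess rexp rexp
  | Neg bexp
  | Conj bexp bexp

datatype com =
    Skip
  | Assign nat aexp aexp
  | RAssign nat aexp rexp
  | Query nat aexp nat
  | Flip nat aexp
  | Seq com com
  | Cond bexp com com
  | Loop bexp com

record store =
  nats :: "nat \<Rightarrow> nat \<Rightarrow> nat"
  reals :: "nat \<Rightarrow> nat \<Rightarrow> real"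

primrec aval :: "aexp \<Rightarrow> store \<Rightarrow> nat" where
  "aval (Num k) s = k"
| "aval (Get x e) s = nats s x (aval e s)"
| "aval (Add e e') s = aval e s + aval e' s"
| "aval (Sub e e') s = aval e s - aval e' s"
| "aval (Half e) s = aval e s div 2"

primrec rval :: "rexp \<Rightarrow> store \<Rightarrow> real" where
  "rval RZero s = 0"
| "rval (RGet x e) s = reals s x (aval e s)"
| "rval (RAdd r r') s = rval r s + rval r' s"
| "rval (RSub r r') s = rval r s - rval r' s"

primrec bval :: "bexp \<Rightarrow> store \<Rightarrow> bool" where
  "bval (Less e e') s \<longleftrightarrow> aval e s < aval e' s"
| "bval (RLess r r') s \<longleftrightarrow> rval r s < rval r' s"
| "bval (Neg b) s \<longleftrightarrow> \<not> bval b s"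
| "bval (Conj b b') s \<longleftrightarrow> bval b s \<and> bval b' s"

definition put_nat :: "nat \<Rightarrow> nat \<Rightarrow> nat \<Rightarrow> store \<Rightarrow> store" where
  "put_nat x i v s = s\<lparr>nats := (nats s)(x := (nats s x)(i := v))\<rparr>"

definition put_real :: "nat \<Rightarrow> nat \<Rightarrow> real \<Rightarrow> store \<Rightarrow> store" where
  "put_real x i v s = s\<lparr>reals := (reals s)(x := (reals s x)(i := v))\<rparr>"

text \<open>
  Small-step semantics for the value oracle \<open>f\<close> on subsets of \<open>{..<m}\<close>. \<open>Query x e y\<close> asks for the
  value of the set whose characteristic vector is stored in the first \<open>m\<close> cells of the array \<open>y\<close>;
  \<open>Flip x e\<close> stores a fair random bit, independent of all others. A terminated program \<open>Skip\<close> stays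
  put, so being in \<open>Skip\<close> after \<open>t\<close> steps means termination within \<open>t\<close> steps.
\<close>

primrec step :: "(nat set \<Rightarrow> real) \<Rightarrow> nat \<Rightarrow> com \<Rightarrow> store \<Rightarrow> (com \<times> store) pmf" where
  "step f m Skip s = return_pmf (Skip, s)"
| "step f m (Assign x e a) s = return_pmf (Skip, put_nat x (aval e s) (aval a s) s)"
| "step f m (RAssign x e r) s = return_pmf (Skip, put_real x (aval e s) (rval r s) s)"
| "step f m (Query x e y) s =
     return_pmf (Skip, put_real x (aval e s) (f {j. j < m \<and> nats s y j \<noteq> 0}) s)"
| "step f m (Flip x e) s =
     map_pmf (\<lambda>b. (Skip, put_nat x (aval e s) (of_bool b) s)) (bernoulli_pmf (1/2))"
| "step f m (Seq c d) s =
     (if c = Skip then return_pmf (d, s)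
      else map_pmf (\<lambda>(c', s'). (Seq c' d, s')) (step f m c s))"
| "step f m (Cond b c d) s = return_pmf (if bval b s then c else d, s)"
| "step f m (Loop b c) s = return_pmf (if bval b s then Seq c (Loop b c) else Skip, s)"

primrec run :: "(nat set \<Rightarrow> real) \<Rightarrow> nat \<Rightarrow> nat \<Rightarrow> com \<times> store \<Rightarrow> (com \<times> store) pmf" where
  "run f m 0 cfg = return_pmf cfg"
| "run f m (Suc t) cfg = bind_pmf (step f m (fst cfg) (snd cfg)) (run f m t)"

text \<open>
  Input with players \<open>{..<n}\<close> and resources \<open>{..<m}\<close>: array 0 holds \<open>n\<close> and \<open>m\<close>, array 1 holds the
  row-major incidence matrix of the sets \<open>\<Gamma> i\<close>. The function \<open>f\<close> is not part of the input.
  Output: array 2 holds for each resource the player who receives it.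
\<close>

definition input_store :: "nat \<Rightarrow> nat \<Rightarrow> (nat \<Rightarrow> nat set) \<Rightarrow> store" where
  "input_store n m \<Gamma> =
     \<lparr>nats = (\<lambda>x k.
        if x = 0 then (if k = 0 then n else if k = 1 then m else 0)
        else if x = 1 then of_bool (k < n * m \<and> k mod m \<in> \<Gamma> (k div m))
        else 0),
      reals = (\<lambda>_ _. 0)\<rparr>"

definition output_parts :: "nat \<Rightarrow> store \<Rightarrow> nat \<Rightarrow> nat set" where
  "output_parts m s i = {j. j < m \<and> nats s 2 j = i}"

text \<open>
  Every computation of \<open>A\<close> terminates within \<open>poly p (n + m)\<close> steps and outputs a partition, and
  with probability at least 2/3 the value of the partition is at least \<open>1 / \<alpha> n\<close> times the optimum.
\<close>

definition randomized_poly_time_santa_approx :: "com \<Rightarrow> (nat \<Rightarrow> real) \<Rightarrow> bool" where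
  "randomized_poly_time_santa_approx A \<alpha> \<longleftrightarrow>
     (\<exists>p :: nat poly. \<forall>n m f \<Gamma>. santa_instance {..<n} {..<m} f \<Gamma> \<longrightarrow>
        (let D = run f m (poly p (n + m)) (A, input_store n m \<Gamma>) in
           (\<forall>(c, s) \<in> set_pmf D. c = Skip \<and> allocation {..<n} {..<m} (output_parts m s)) \<and>
           measure_pmf.prob D
             {(c, s). santa_value {..<n} f \<Gamma> (output_parts m s)
                        \<ge> santa_opt {..<n} {..<m} f \<Gamma> / \<alpha> n} \<ge> 2 / 3))"

end

theory Submission imports Defs
begin

text \<open>
Guess \<open>T\<close> with \<open>T \<le> OPT < 2 T\<close> and let \<open>K\<close> be of the order of \<open>log log n\<close>. A resource is fat if its value is
at least \<open>T / O(K)\<close>, otherwise thin.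

A fractional solution is computed by multiplicative weights. In every round the fat resources
serve a maximal matchable set of players, greedily chosen so that the others are cheap, and every other player buys
a configuration of thin resources worth about \<open>T / 4\<close>. Exponential prices keep the load of every thin
resource within a constant factor of the number of rounds.

The averaged assignment of fat resources is a flow with a forest as minimal support. The forest splits
the players into clusters such that the fat resources can serve all players except one player of every
cluster, whom we may choose; and the members of a cluster buy thin configurations in at least half as
many cases as there are rounds. So it suffices to select one of these configurations for every cluster.

First \<open>polylog n\<close> configurations per cluster are sampled, then one of them is drawn. A cluster is bad if the
weighted overlap of its configuration with the others exceeds \<open>2 K\<close>. This has probability \<open>1 / polylog n\<close>, so the bad
clusters shatter: counting chains of pairwise unrelated bad clusters shows that they form components of size \<open>polylog n\<close>,
which are redrawn until their overlap is below \<open>K\<close>; light overlaps between components sum to at most 1.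

Now resources contested too often are dropped at the cost of half of the value, and every resource is claimed
\<open>O(K)\<close> times. Cutting the claims of a cluster, sorted by weight, into groups of that size, Hall's theorem
gives every group a resource of its own, hence every cluster a fraction \<open>1 / O(K)\<close> of the value.
\<close>

text \<open>One independent draw per cluster is not enough: a union bound over \<open>n\<close>
  clusters would only control loads far above log log n. Sampling \<open>be\<close> > log n
  configurations per cluster first makes the instance local, since entries of size at least 1 /
  \<open>be\<close> then join only few clusters. With \<open>KK\<close> = 60 + 28 log
  \<open>be\<close> a cluster is bad with probability at most \<open>be\<close>^-28, which beats the
  at most \<open>be\<close>^24 ways to continue a chain of bad clusters.

  Overlaps are asymmetric: a configuration suffers only from those that value the contested resource
  at least as much. This bounds rows and columns of the load matrix alike, and it limits the number
  of claims, since a claimant of least weight sees all the others.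

  The machine neither multiplies nor divides nor rounds reals. Hence random ranges are powers of
  two, prices are given by exponents, fractional values are counts over rounds, flows are matchings
  of copies, and a guess of the optimum is an oracle value doubled a few times. All guesses are run
  on the same random words and the best outcome is kept.\<close>

abbreviation (input) mprob :: "'a pmf => 'a set => real" where "mprob M == measure_pmf.prob M"
abbreviation (input) mexp :: "'a pmf => ('a => real) => real" where "mexp M == measure_pmf.expectation M"

section \<open>Polynomial-time computable functions\<close>

text \<open>A terminated program idles in \<open>Skip\<close>, so \<open>t\<close> is an upper bound
  that may be enlarged; branches of different running times thus share one bound.\<close>

definition outs :: "(nat set => real) => nat => com => store => nat => store pmf => bool" where
 "outs f m c s t D \<longleftrightarrow> run f m t (c, s) = map_pmf (Pair Skip) D"

lemma run_Skip: "run f m t (Skip, s) = return_pmf (Skip, s)"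
 by (induction t) (auto simp: bind_return_pmf)

lemma run_add: "run f m (t + u) cfg = bind_pmf (run f m t cfg) (run f m u)"
 by (induction t arbitrary: cfg) (simp_all add: bind_return_pmf bind_assoc_pmf cong: bind_pmf_cong)

lemma outs_mono: "outs f m c s t D ==> t <= t' ==> outs f m c s t' D"
 unfolding outs_def using run_add[of f m t "t' - t" "(c, s)"]
 by (simp add: bind_map_pmf run_Skip) (simp add: map_pmf_def)

text \<open>Induction on the bound for \<open>c\<close>: one step of \<open>c\<close> splits
  \<open>D\<close> into the distributions \<open>D'\<close> of the continuations, and each of these
  still ends in \<open>Skip\<close> with certainty. The additional step is the one in which
  \<open>Seq\<close> discards \<open>Skip\<close>.\<close>

lemma outs_Seq:
 "outs f m c s t D ==> (!!s'. s' \<in> set_pmf D ==> outs f m d s' u (E s')) ==>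
  outs f m (Seq c d) s (Suc (t + u)) (bind_pmf D E)"
proof (induction t arbitrary: c s D)
 case 0
 then have *: "return_pmf (c, s) = map_pmf (Pair Skip) D" by (simp add: outs_def)
 then have "D = map_pmf snd (return_pmf (c, s))" by (simp add: pmf.map_comp o_def)
 then have D: "D = return_pmf s" by simp
 with * have "c = Skip" by simp
 with D 0(2)[of s] show ?case by (simp add: outs_def bind_return_pmf)
next
 case (Suc t)
 show ?case
 proof (cases "c = Skip")
  case True
  then have "return_pmf (Skip, s) = map_pmf (Pair Skip) D"
   using Suc.prems(1) by (simp add: outs_def run_Skip bind_return_pmf)
  then have "D = map_pmf snd (return_pmf (Skip, s))" by (simp add: pmf.map_comp o_def)
  then have D: "D = return_pmf s" by simp
  then have "outs f m d s (Suc t + u) (E s)" using Suc.prems(2)[of s] by (auto intro: outs_mono)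
  then show ?thesis using True D by (simp add: outs_def bind_return_pmf)
 next
  case False
  define D' where "D' cfg = map_pmf snd (run f m t cfg)" for cfg
  have eq: "bind_pmf (step f m c s) (run f m t) = map_pmf (Pair Skip) D"
   using Suc.prems(1) by (simp add: outs_def)
  have run: "run f m t cfg = map_pmf (Pair Skip) (D' cfg)" if "cfg \<in> set_pmf (step f m c s)" for cfg
  proof -
   have "set_pmf (run f m t cfg) \<subseteq> set_pmf (bind_pmf (step f m c s) (run f m t))"
    using that by auto
   then have "x = Pair Skip (snd x)" if "x \<in> set_pmf (run f m t cfg)" for x
    using that by (auto simp: eq)
   then have "map_pmf (%x. Pair Skip (snd x)) (run f m t cfg) = map_pmf (%x. x) (run f m t cfg)"
    by (intro map_pmf_cong) auto
   then show ?thesis by (simp add: D'_def pmf.map_comp o_def)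
  qed
  have "D = map_pmf snd (map_pmf (Pair Skip) D)" by (simp add: pmf.map_comp o_def)
  then have D: "D = bind_pmf (step f m c s) D'" by (simp add: eq[symmetric] map_bind_pmf D'_def[abs_def])
  have IH: "run f m (Suc (t + u)) (Seq (fst cfg) d, snd cfg) = map_pmf (Pair Skip) (bind_pmf (D' cfg) E)"
   if "cfg \<in> set_pmf (step f m c s)" for cfg
  proof -
   have "outs f m (fst cfg) (snd cfg) t (D' cfg)" using run[OF that] by (simp add: outs_def)
   then have "outs f m (Seq (fst cfg) d) (snd cfg) (Suc (t + u)) (bind_pmf (D' cfg) E)"
    by (rule Suc.IH) (use Suc.prems(2) D that in auto)
   then show ?thesis by (simp only: outs_def)
  qed
  have "run f m (Suc (Suc t + u)) (Seq c d, s) =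
    bind_pmf (step f m c s) (%cfg. run f m (Suc (t + u)) (Seq (fst cfg) d, snd cfg))"
   using False by (simp add: bind_map_pmf case_prod_beta)
  also have "... = bind_pmf (step f m c s) (%cfg. map_pmf (Pair Skip) (bind_pmf (D' cfg) E))"
   using IH by (intro bind_pmf_cong) auto
  also have "... = map_pmf (Pair Skip) (bind_pmf D E)"
   by (simp add: D map_bind_pmf bind_assoc_pmf)
  finally show ?thesis by (simp add: outs_def)
 qed
qed

definition exec :: "(nat set => real) => nat => com => store => nat => store => bool" where
 "exec f m c s t s' \<longleftrightarrow> outs f m c s t (return_pmf s')"

lemma exec_mono: "exec f m c s t s' ==> t <= t' ==> exec f m c s t' s'"
 unfolding exec_def by (rule outs_mono)

lemma exec_Seq: "exec f m c s t s' ==> exec f m d s' u s'' ==> exec f m (Seq c d) s (Suc (t + u)) s''"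
 unfolding exec_def using outs_Seq[of f m c s t "return_pmf s'" d u "%_. return_pmf s''"]
 by (simp add: bind_return_pmf)

lemma exec_Assign: "exec f m (Assign x e a) s (Suc 0) (put_nat x (aval e s) (aval a s) s)"
 by (simp add: exec_def outs_def bind_return_pmf)

lemma exec_RAssign: "exec f m (RAssign x e a) s (Suc 0) (put_real x (aval e s) (rval a s) s)"
 by (simp add: exec_def outs_def bind_return_pmf)

lemma exec_Query:
 "exec f m (Query x e y) s (Suc 0) (put_real x (aval e s) (f {j. j < m & nats s y j ~= 0}) s)"
 by (simp add: exec_def outs_def bind_return_pmf)

lemma exec_Cond:
 "exec f m (if bval b s then c else d) s t s' ==> exec f m (Cond b c d) s (Suc t) s'"
 by (simp add: exec_def outs_def bind_return_pmf)

lemma exec_Skip: "exec f m Skip s t s"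
 by (simp add: exec_def outs_def run_Skip)

lemma exec_Loop_False: "~ bval b s ==> exec f m (Loop b c) s (Suc 0) s"
 by (simp add: exec_def outs_def bind_return_pmf)

lemma outs_Loop_True:
 "bval b s ==> outs f m (Seq c (Loop b c)) s t D ==> outs f m (Loop b c) s (Suc t) D"
 by (simp add: outs_def bind_return_pmf)

lemma put_nat_simps [simp]:
 "nats (put_nat x i v s) = (nats s)(x := (nats s x)(i := v))" "reals (put_nat x i v s) = reals s"
 "nats (put_real x i u s) = nats s" "reals (put_real x i u s) = (reals s)(x := (reals s x)(i := u))"
 by (auto simp: put_nat_def put_real_def)

definition For :: "nat => nat => com => com" where
 "For x y c = Loop (Less (Get x (Num 0)) (Get y (Num 0)))
   (Seq c (Assign x (Num 0) (Add (Get x (Num 0)) (Num 1))))"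

text \<open>An iteration adds four steps to its body: the test, the increment and twice the removal
  of \<open>Skip\<close>. The remaining step is the failing last test. The invariant is imposed on
  the store after the increment, so that it may mention the counter.\<close>

lemma exec_For:
 assumes "i <= N" "P i s"
  and cnt: "!!i s. P i s ==> nats s x 0 = i & nats s y 0 = N"
  and body: "!!i s. i < N ==> P i s ==>
   \<exists>s'. exec f m c s t s' & nats s' x 0 = i & P (Suc i) (put_nat x 0 (Suc i) s')"
 shows "\<exists>s'. exec f m (For x y c) s (Suc ((N - i) * (t + 4))) s' & P N s'"
 using assms(1,2)
proof (induction "N - i" arbitrary: i s)
 case 0
 then have "i = N" by simp
 moreover have "exec f m (For x y c) s (Suc 0) s"
  unfolding For_def using cnt[OF \<open>P i s\<close>] \<open>i = N\<close> by (intro exec_Loop_False) auto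
 ultimately show ?case using 0 by auto
next
 case (Suc k)
 then have "i < N" by simp
 from body[OF this Suc.prems(2)] obtain s1 where s1:
  "exec f m c s t s1" "nats s1 x 0 = i" "P (Suc i) (put_nat x 0 (Suc i) s1)" by blast
 define s2 where "s2 = put_nat x 0 (Suc i) s1"
 have s2: "exec f m (Assign x (Num 0) (Add (Get x (Num 0)) (Num 1))) s1 (Suc 0) s2"
  using exec_Assign[of f m x "Num 0" "Add (Get x (Num 0)) (Num 1)" s1] s1(2) by (simp add: s2_def)
 have "k = N - Suc i" "Suc i <= N" using Suc by auto
 from Suc.hyps(1)[OF this] s1(3) obtain s3 where s3:
  "exec f m (For x y c) s2 (Suc ((N - Suc i) * (t + 4))) s3" "P N s3" by (auto simp: s2_def)
 have "exec f m (Seq (Seq c (Assign x (Num 0) (Add (Get x (Num 0)) (Num 1)))) (For x y c)) s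
   (Suc (Suc (t + Suc 0) + Suc ((N - Suc i) * (t + 4)))) s3"
  by (intro exec_Seq[OF exec_Seq[OF s1(1) s2] s3(1)])
 then have "exec f m (For x y c) s (Suc (Suc (Suc (t + Suc 0) + Suc ((N - Suc i) * (t + 4))))) s3"
  unfolding exec_def For_def using cnt[OF Suc.prems(2)] \<open>i < N\<close> by (intro outs_Loop_True) auto
 moreover have "N - i = Suc (N - Suc i)" using \<open>i < N\<close> by simp
 ultimately have "exec f m (For x y c) s (Suc ((N - i) * (t + 4))) s3"
  by (elim exec_mono) simp
 then show ?case using s3(2) by blast
qed

section \<open>Instances, contexts and polynomially bounded programs\<close>

record inst =
 nn :: nat
 mm :: nat
 ff :: "nat set => real"
 gg :: "nat => nat set"

text \<open>The summand 2 lets powers of the size absorb constants and sums even for the smallest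
  instances.\<close>

definition isz :: "inst => nat" where "isz I = nn I + mm I + 2"

text \<open>Arrays are used like a stack: a program compiled above \<open>b\<close> leaves
  everything stored below \<open>b\<close> intact.\<close>

definition agree :: "nat => store => store => bool" where
 "agree b s s' \<longleftrightarrow> (\<forall>x<b. nats s' x = nats s x & reals s' x = reals s x)"

lemma agree_refl [simp]: "agree b s s" by (simp add: agree_def)
lemma agree_trans: "agree b s s' ==> agree b' s' s'' ==> b <= b' ==> agree b s s''"
 by (simp add: agree_def)
lemma agree_mono: "agree b' s s' ==> b <= b' ==> agree b s s'" by (simp add: agree_def)
lemma agree_put: "b <= x ==> agree b s (put_nat x i v s)" "b <= x ==> agree b s (put_real x i u s)"
 by (auto simp: agree_def)
lemma agreeD: "agree b s s' ==> x < b ==> nats s' x = nats s x" "agree b s s' ==> x < b ==> reals s' x = reals s x"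
 by (auto simp: agree_def)

definition rdn :: "nat => store => nat" where "rdn b s = nats s b 0"
definition rdr :: "nat => store => real" where "rdr b s = reals s b 0"
definition rda :: "nat => store => nat => nat" where
 "rda b s i = (if i < nats s b 0 then nats s b (Suc i) else 0)"

definition localrd :: "(nat => store => 'v) => bool" where
 "localrd rd \<longleftrightarrow> (\<forall>b s s'. nats s b = nats s' b --> reals s b = reals s' b --> rd b s = rd b s')"

lemma localrd [simp]: "localrd rdn" "localrd rdr" "localrd rda"
 by (auto simp: localrd_def rdn_def rdr_def rda_def fun_eq_iff)

lemma localrdD: "localrd rd ==> agree b s s' ==> x < b ==> rd x s' = rd x s"
 by (metis agreeD localrd_def)

definition stable :: "nat => ('c => store => bool) => bool" where
 "stable k R \<longleftrightarrow> (\<forall>c s s'. R c s --> agree k s s' --> R c s')"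

lemma stableD: "stable k R ==> R c s ==> agree b s s' ==> k <= b ==> R c s'"
 unfolding stable_def using agree_mono by blast

text \<open>Contexts are nested pairs with one component per bound variable: \<open>snd\<close> is
  the innermost variable, held in array \<open>b\<close>, and \<open>fst\<close> leads to the
  surrounding context.\<close>

definition ext :: "nat => (nat => store => 'v) => ('c => store => bool) => 'c \<times> 'v => store => bool" where
 "ext b rd R p s \<longleftrightarrow> R (fst p) s & rd b s = snd p"

text \<open>\<open>comp k R I rd \<sigma>\<close>: in every context \<open>c\<close> that is represented by the arrays below \<open>k\<close>, the value
 \<open>\<sigma> c\<close> can be computed in polynomial time without touching the arrays below any given \<open>b \<ge> k\<close>.\<close>
definition comp :: "nat => ('c => store => bool) => ('c => inst) => (nat => store => 'v) => ('c => 'v) => bool" where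
 "comp k R I rd \<sigma> \<longleftrightarrow> stable k R & localrd rd &
   (\<forall>b\<ge>k. \<exists>c e r. (\<forall>x s. R x s -->
    (\<exists>s'. exec (ff (I x)) (mm (I x)) c s (isz (I x) ^ e) s' & agree b s s' & rd r s' = \<sigma> x)))"

lemma isz_ge2: "2 <= isz I" by (simp add: isz_def)

lemma isz_pow_add: "isz I ^ a + isz I ^ b <= isz I ^ (a + b + 1)"
proof -
 have "isz I ^ a <= isz I ^ (a+b)" "isz I ^ b <= isz I ^ (a+b)"
  using isz_ge2[of I] by (auto intro!: power_increasing)
 then have "isz I ^ a + isz I ^ b <= 2 * isz I ^ (a+b)" by simp
 also have "... <= isz I * isz I ^ (a+b)" using isz_ge2[of I] by simp
 finally show ?thesis by simp
qed

lemma isz_const: "k <= isz I ^ k"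
proof -
 have "k <= 2 ^ k" using less_exp[of k] by simp
 also have "... <= isz I ^ k" using isz_ge2[of I] by (simp add: power_mono)
 finally show ?thesis .
qed

definition pbd :: "('c => inst) => ('c => nat) => bool" where
 "pbd I \<sigma> \<longleftrightarrow> (\<exists>e. \<forall>x. \<sigma> x <= isz (I x) ^ e)"

lemma pbd_const: "pbd I (%x. k)" using isz_const by (auto simp: pbd_def)
lemma pbd_pow: "pbd I (%x. isz (I x) ^ e)" by (auto simp: pbd_def)

lemma pbd_add: assumes "pbd I \<sigma>" "pbd I \<tau>" shows "pbd I (%x. \<sigma> x + \<tau> x)"
proof -
 obtain a b where "\<forall>x. \<sigma> x <= isz (I x) ^ a" "\<forall>x. \<tau> x <= isz (I x) ^ b"
  using assms by (auto simp: pbd_def)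
 then have "\<sigma> x + \<tau> x <= isz (I x) ^ (a + b + 1)" for x
  using isz_pow_add[of "I x" a b] by (meson add_mono le_trans)
 then show ?thesis unfolding pbd_def by blast
qed

lemma pbd_mult: assumes "pbd I \<sigma>" "pbd I \<tau>" shows "pbd I (%x. \<sigma> x * \<tau> x)"
proof -
 obtain a b where "\<forall>x. \<sigma> x <= isz (I x) ^ a" "\<forall>x. \<tau> x <= isz (I x) ^ b"
  using assms by (auto simp: pbd_def)
 then have "\<sigma> x * \<tau> x <= isz (I x) ^ (a + b)" for x
  by (simp add: power_add mult_mono)
 then show ?thesis unfolding pbd_def by blast
qed

lemma pbd_mono: "pbd I \<tau> ==> (!!x. \<sigma> x <= \<tau> x) ==> pbd I \<sigma>"
 unfolding pbd_def by (meson le_trans)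

lemma pbd_Suc: "pbd I \<sigma> ==> pbd I (%x. Suc (\<sigma> x))"
 using pbd_add[OF _ pbd_const[of I 1]] by simp

lemma pbd_obtain:
 assumes "pbd I \<sigma>" obtains e where "!!x. \<sigma> x <= isz (I x) ^ e"
 using assms by (auto simp: pbd_def)

lemma comp_stable: "comp k R I rd \<sigma> ==> stable k R" by (simp add: comp_def)
lemma comp_local: "comp k R I rd \<sigma> ==> localrd rd" by (simp add: comp_def)

lemma compE:
 assumes "comp k R I rd \<sigma>" "k <= b"
 obtains c e r where "!!x s. R x s ==>
   \<exists>s'. exec (ff (I x)) (mm (I x)) c s (isz (I x) ^ e) s' & agree b s s' & rd r s' = \<sigma> x"
 using assms unfolding comp_def by meson

lemma compI:
 assumes "stable k R" "localrd rd"
  and "!!b. k <= b ==> \<exists>c t r. pbd I t & (\<forall>x s. R x s -->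
   (\<exists>s'. exec (ff (I x)) (mm (I x)) c s (t x) s' & agree b s s' & rd r s' = \<sigma> x))"
 shows "comp k R I rd \<sigma>"
proof -
 have "\<exists>c e r. (\<forall>x s. R x s -->
    (\<exists>s'. exec (ff (I x)) (mm (I x)) c s (isz (I x) ^ e) s' & agree b s s' & rd r s' = \<sigma> x))"
  if "k <= b" for b
 proof -
  obtain c t r where 1: "pbd I t" and 2: "!!x s. R x s ==>
   (\<exists>s'. exec (ff (I x)) (mm (I x)) c s (t x) s' & agree b s s' & rd r s' = \<sigma> x)"
   using assms(3)[OF \<open>k <= b\<close>] by meson
  obtain e where "!!x. t x <= isz (I x) ^ e" using 1 unfolding pbd_def by blast
  with 2 show ?thesis by (meson exec_mono)
 qed
 then show ?thesis using assms(1,2) unfolding comp_def by blast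
qed

lemma stable_mono: "stable k R ==> k <= k' ==> stable k' R"
 unfolding stable_def using agree_mono by blast

lemma stable_ext: "stable k R ==> localrd rd ==> k <= k' ==> r < k' ==> stable k' (ext r rd R)"
 using localrdD[of rd k' _ _ r] agree_mono[of k' _ _ k] unfolding stable_def ext_def by simp

lemma comp_mono: "comp k R I rd \<sigma> ==> k <= k' ==> comp k' R I rd \<sigma>"
 using stable_mono[of k R k'] le_trans[of k k'] unfolding comp_def by blast

lemma comp_lift:
 assumes "comp k R I rd \<sigma>" "k <= k'" "r < k'" "localrd rd'"
 shows "comp k' (ext r rd' R) (%p. I (fst p)) rd (%p. \<sigma> (fst p))"
proof (rule compI)
 show "stable k' (ext r rd' R)" using assms by (intro stable_ext[of k] comp_stable)
 show "localrd rd" by (rule comp_local[OF assms(1)])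
 fix b' assume "k' <= b'"
 then obtain c e r' where "!!x s. R x s ==>
   \<exists>s'. exec (ff (I x)) (mm (I x)) c s (isz (I x) ^ e) s' & agree b' s s' & rd r' s' = \<sigma> x"
  using compE[OF assms(1) le_trans[OF assms(2) \<open>k' <= b'\<close>]] by blast
 then show "\<exists>c t r'. pbd (%p. I (fst p)) t & (\<forall>x s. ext r rd' R x s -->
   (\<exists>s'. exec (ff (I (fst x))) (mm (I (fst x))) c s (t x) s' & agree b' s s' & rd r' s' = \<sigma> (fst x)))"
  by (intro exI[of _ c] exI[of _ "%p. isz (I (fst p)) ^ e"] exI[of _ r']) (auto simp: ext_def pbd_def)
qed

lemma comp_var:
 assumes "stable k R" "k <= k'" "r < k'" "localrd rd"
 shows "comp k' (ext r rd R) I rd snd"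
proof (rule compI)
 show "stable k' (ext r rd R)" using assms by (intro stable_ext)
 show "\<exists>c t r'. pbd I t & (\<forall>x s. ext r rd R x s -->
   (\<exists>s'. exec (ff (I x)) (mm (I x)) c s (t x) s' & agree b s s' & rd r' s' = snd x))" if "k' <= b" for b
  using pbd_const[of I 0]
  by (intro exI[of _ Skip] exI[of _ "%_. 0"] exI[of _ r] conjI allI impI exI)
    (assumption, rule exec_Skip, auto simp: ext_def)
qed (fact assms)

lemma comp_let:
 assumes 1: "comp k R I rd1 \<sigma>"
  and 2: "!!r k'. k <= k' ==> r < k' ==> comp k' (ext r rd1 R) (%p. I (fst p)) rd (%p. g (fst p) (snd p))"
 shows "comp k R I rd (%c. g c (\<sigma> c))"
proof (rule compI)
 show "stable k R" by (rule comp_stable[OF 1])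
 show "localrd rd" using comp_local[OF 2[of "Suc k" k]] by simp
 fix b assume b: "k <= b"
 obtain c e r where c: "!!x s. R x s ==>
   \<exists>s'. exec (ff (I x)) (mm (I x)) c s (isz (I x) ^ e) s' & agree b s s' & rd1 r s' = \<sigma> x"
  using compE[OF 1 b] by blast
 \<comment> \<open>The second program stays above \<open>r\<close>, where the first one has left its
   result.\<close>
 define b' where "b' = max b (Suc r)"
 have "comp b' (ext r rd1 R) (%p. I (fst p)) rd (%p. g (fst p) (snd p))"
  using 2[of b' r] b by (simp add: b'_def le_max_iff_disj)
 then obtain c' e' r' where c': "!!x s. ext r rd1 R x s ==>
   \<exists>s'. exec (ff (I (fst x))) (mm (I (fst x))) c' s (isz (I (fst x)) ^ e') s' & agree b' s s' & rd r' s' = g (fst x) (snd x)"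
  using compE[of b' "ext r rd1 R" "%p. I (fst p)" rd "%p. g (fst p) (snd p)" b'] by blast
 have "\<exists>s'. exec (ff (I x)) (mm (I x)) (Seq c c') s (Suc (isz (I x) ^ e + isz (I x) ^ e')) s' &
   agree b s s' & rd r' s' = g x (\<sigma> x)" if "R x s" for x s
 proof -
  from c[OF that] obtain s1 where s1: "exec (ff (I x)) (mm (I x)) c s (isz (I x) ^ e) s1" "agree b s s1" "rd1 r s1 = \<sigma> x"
   by blast
  have "ext r rd1 R (x, \<sigma> x) s1" using stableD[OF comp_stable[OF 1] that s1(2) b] s1(3) by (simp add: ext_def)
  from c'[OF this] obtain s2 where s2: "exec (ff (I x)) (mm (I x)) c' s1 (isz (I x) ^ e') s2" "agree b' s1 s2" "rd r' s2 = g x (\<sigma> x)"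
   by auto
  show ?thesis using exec_Seq[OF s1(1) s2(1)] agree_trans[OF s1(2) s2(2)] s2(3) by (auto simp: b'_def)
 qed
 then show "\<exists>c t r. pbd I t & (\<forall>x s. R x s -->
   (\<exists>s'. exec (ff (I x)) (mm (I x)) c s (t x) s' & agree b s s' & rd r s' = g x (\<sigma> x)))"
  by (intro exI[of _ "Seq c c'"] exI[of _ "%x. Suc (isz (I x) ^ e + isz (I x) ^ e')"] exI[of _ r'])
    (auto intro!: pbd_Suc pbd_add pbd_pow)
qed

lemma comp_cmd:
 assumes "stable k R" "localrd rd"
  and "!!b. k <= b ==> \<exists>c. \<forall>x s. R x s --> (\<exists>s'. exec (ff (I x)) (mm (I x)) c s t s' & agree b s s' & rd b s' = \<sigma> x)"
 shows "comp k R I rd \<sigma>"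
 using assms by (intro compI) (blast intro: pbd_const)+

lemma comp_aexp:
 assumes "stable k R" "!!x s. R x s ==> aval e s = \<sigma> x"
 shows "comp k R I rdn \<sigma>"
proof (rule comp_cmd[where t = "Suc 0"])
 show "\<exists>c. \<forall>x s. R x s --> (\<exists>s'. exec (ff (I x)) (mm (I x)) c s (Suc 0) s' & agree b s s' & rdn b s' = \<sigma> x)" for b
  using exec_Assign[of _ _ b "Num 0" e] assms(2)
  by (intro exI[of _ "Assign b (Num 0) e"] allI impI exI conjI) (assumption, auto simp: agree_put rdn_def)
qed (use assms in auto)

lemma comp_rexp:
 assumes "stable k R" "!!x s. R x s ==> rval e s = \<sigma> x"
 shows "comp k R I rdr \<sigma>"
proof (rule comp_cmd[where t = "Suc 0"])
 show "\<exists>c. \<forall>x s. R x s --> (\<exists>s'. exec (ff (I x)) (mm (I x)) c s (Suc 0) s' & agree b s s' & rdr b s' = \<sigma> x)" for b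
  using exec_RAssign[of _ _ b "Num 0" e] assms(2)
  by (intro exI[of _ "RAssign b (Num 0) e"] allI impI exI conjI) (assumption, auto simp: agree_put rdr_def)
qed (use assms in auto)

lemma comp_let2:
 assumes 1: "comp k R I rd1 \<sigma>" and 2: "comp k R I rd2 \<tau>"
  and 3: "!!r r' k'. k <= k' ==> r < k' ==> r' < k' ==> stable k' (ext r' rd2 (ext r rd1 R)) ==>
   comp k' (ext r' rd2 (ext r rd1 R)) (%p. I (fst (fst p))) rd (%p. g (fst (fst p)) (snd (fst p)) (snd p))"
 shows "comp k R I rd (%c. g c (\<sigma> c) (\<tau> c))"
proof (rule comp_let[OF 1, where g = "%c v. g c v (\<tau> c)"])
 fix r k' assume k': "k <= k'" "r < k'"
 have l: "comp k' (ext r rd1 R) (%p. I (fst p)) rd2 (%p. \<tau> (fst p))"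
  using comp_lift[OF 2 k'] comp_local[OF 1] by blast
 show "comp k' (ext r rd1 R) (%p. I (fst p)) rd (%p. g (fst p) (snd p) (\<tau> (fst p)))"
 proof (rule comp_let[OF l, where g = "%p v. g (fst p) (snd p) v"])
  fix r' k'' assume "k' <= k''" "r' < k''"
  then show "comp k'' (ext r' rd2 (ext r rd1 R)) (%p. I (fst (fst p))) rd (%p. g (fst (fst p)) (snd (fst p)) (snd p))"
   using k' by (intro 3 stable_ext[of k'] stable_ext[of k] comp_stable[OF 1] comp_local[OF 1] comp_local[OF 2]) auto
 qed
qed

lemma comp_num: "stable k R ==> comp k R I rdn (%c. v)"
 by (rule comp_aexp[where e = "Num v"]) auto

lemma comp_add: "comp k R I rdn \<sigma> ==> comp k R I rdn \<tau> ==> comp k R I rdn (%c. \<sigma> c + \<tau> c)"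
 by (rule comp_let2[where g = "%c v w. v + w"], assumption+, rule_tac e = "Add (Get r (Num 0)) (Get r' (Num 0))" in comp_aexp)
   (auto simp: ext_def rdn_def)

lemma comp_sub: "comp k R I rdn \<sigma> ==> comp k R I rdn \<tau> ==> comp k R I rdn (%c. \<sigma> c - \<tau> c)"
 by (rule comp_let2[where g = "%c v w. v - w"], assumption+, rule_tac e = "Sub (Get r (Num 0)) (Get r' (Num 0))" in comp_aexp)
   (auto simp: ext_def rdn_def)

lemma comp_half: "comp k R I rdn \<sigma> ==> comp k R I rdn (%c. \<sigma> c div 2)"
 by (rule comp_let2[where g = "%c v w. v div 2"], assumption+, rule_tac e = "Half (Get r (Num 0))" in comp_aexp)
   (auto simp: ext_def rdn_def)

lemma comp_radd: "comp k R I rdr \<sigma> ==> comp k R I rdr \<tau> ==> comp k R I rdr (%c. \<sigma> c + \<tau> c)"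
 by (rule comp_let2[where g = "%c v w. v + w"], assumption+, rule_tac e = "RAdd (RGet r (Num 0)) (RGet r' (Num 0))" in comp_rexp)
   (auto simp: ext_def rdr_def)

lemma comp_rsub: "comp k R I rdr \<sigma> ==> comp k R I rdr \<tau> ==> comp k R I rdr (%c. \<sigma> c - \<tau> c)"
 by (rule comp_let2[where g = "%c v w. v - w"], assumption+, rule_tac e = "RSub (RGet r (Num 0)) (RGet r' (Num 0))" in comp_rexp)
   (auto simp: ext_def rdr_def)

lemma comp_rzero: "stable k R ==> comp k R I rdr (%c. 0)"
 by (rule comp_rexp[where e = RZero]) auto

lemma comp_nth: "comp k R I rda \<sigma> ==> comp k R I rdn \<tau> ==> comp k R I rdn (%c. \<sigma> c (\<tau> c))"
proof (rule comp_let2[where g = "%c a i. a i"], assumption+)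
 fix r r' k' assume "stable k' (ext r' rdn (ext r rda R))"
 then show "comp k' (ext r' rdn (ext r rda R)) (%p. I (fst (fst p))) rdn (%p. snd (fst p) (snd p))"
 proof (rule comp_cmd[where t = 2])
  fix b
  let ?i = "Get r' (Num 0)"
  let ?c = "Cond (Less ?i (Get r (Num 0))) (Assign b (Num 0) (Get r (Add ?i (Num 1)))) (Assign b (Num 0) (Num 0))"
  have "exec f m ?c s 2 (put_nat b 0 (rda r s (rdn r' s)) s)" for f m s
   using exec_Cond[of f m "Less ?i (Get r (Num 0))" s "Assign b (Num 0) (Get r (Add ?i (Num 1)))"
     "Assign b (Num 0) (Num 0)" "Suc 0"]
    exec_Assign[of f m b "Num 0" "Get r (Add ?i (Num 1))" s] exec_Assign[of f m b "Num 0" "Num 0" s]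
   by (auto simp: rda_def rdn_def numeral_2_eq_2)
  then show "\<exists>c. \<forall>x s. ext r' rdn (ext r rda R) x s -->
    (\<exists>s'. exec (ff (I (fst (fst x)))) (mm (I (fst (fst x)))) c s 2 s' & agree b s s' & rdn b s' = snd (fst x) (snd x))"
   by (intro exI[of _ ?c] allI impI exI[of _ "put_nat b 0 (rda r _ (rdn r' _)) _"] conjI)
     (auto simp: ext_def rdn_def intro!: agree_put)
 qed simp
qed

text \<open>A loop needs its state in a fixed array, but the program for one round leaves its result
  in an array of its own choice. This property provides the copying, with \<open>z\<close> as
  scratch space and \<open>len\<close> as the cost.\<close>

definition movable :: "(nat => store => 'v) => ('v => nat) => bool" where
 "movable rd len \<longleftrightarrow> (\<forall>r y z. r ~= y --> r ~= z --> y ~= z --> (\<exists>c. \<forall>f m s. \<exists>s'.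
   exec f m c s (len (rd r s)) s' & rd y s' = rd r s &
   (\<forall>x. x ~= y --> x ~= z --> nats s' x = nats s x & reals s' x = reals s x)))"

lemma movable_rdn: "movable rdn (%_. 1)"
 unfolding movable_def
proof (intro allI impI)
 fix r y z :: nat assume "r ~= y"
 show "\<exists>c. \<forall>f m s. \<exists>s'. exec f m c s 1 s' & rdn y s' = rdn r s &
   (\<forall>x. x ~= y --> x ~= z --> nats s' x = nats s x & reals s' x = reals s x)"
  using exec_Assign[of _ _ y "Num 0" "Get r (Num 0)"]
  by (intro exI[of _ "Assign y (Num 0) (Get r (Num 0))"] allI exI conjI) (unfold One_nat_def, assumption, auto simp: rdn_def)
qed

lemma movable_rdr: "movable rdr (%_. 1)"
 unfolding movable_def
proof (intro allI impI)
 fix r y z :: nat assume "r ~= y"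
 show "\<exists>c. \<forall>f m s. \<exists>s'. exec f m c s 1 s' & rdr y s' = rdr r s &
   (\<forall>x. x ~= y --> x ~= z --> nats s' x = nats s x & reals s' x = reals s x)"
  using exec_RAssign[of _ _ y "Num 0" "RGet r (Num 0)"]
  by (intro exI[of _ "RAssign y (Num 0) (RGet r (Num 0))"] allI exI conjI) (unfold One_nat_def, assumption, auto simp: rdr_def)
qed

text \<open>The function read by \<open>rda\<close> does not determine the length of the stored
  array, on which the cost of copying depends; the list does.\<close>

definition rdl :: "nat => store => nat list" where
 "rdl b s = map (%i. nats s b (Suc i)) [0..<nats s b 0]"

definition nth0 :: "nat list => nat => nat" where
 "nth0 xs i = (if i < length xs then xs ! i else 0)"

lemma rda_rdl: "rda b s = nth0 (rdl b s)"
 by (auto simp: rda_def rdl_def nth0_def fun_eq_iff)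

lemma localrdl [simp]: "localrd rdl" by (auto simp: localrd_def rdl_def)

lemma movable_rdl: "movable rdl (%l. 6 * length l + 6)"
 unfolding movable_def
proof (intro allI impI)
 fix r y z :: nat assume d: "r ~= y" "r ~= z" "y ~= z"
 let ?i = "Get z (Num 0)"
 let ?b = "Assign y (Add ?i (Num 1)) (Get r (Add ?i (Num 1)))"
 let ?c = "Seq (Assign y (Num 0) (Get r (Num 0))) (Seq (Assign z (Num 0) (Num 0)) (For z r ?b))"
 have "\<exists>s'. exec f m ?c s (6 * length (rdl r s) + 6) s' & rdl y s' = rdl r s &
   (\<forall>x. x ~= y --> x ~= z --> nats s' x = nats s x & reals s' x = reals s x)" for f m s
 proof -
  define N where "N = nats s r 0"
  define s1 where "s1 = put_nat y 0 N s"
  define s2 where "s2 = put_nat z 0 0 s1"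
  define P where "P i t \<longleftrightarrow> nats t z 0 = i & nats t y 0 = N & (\<forall>j<i. nats t y (Suc j) = nats s r (Suc j)) &
   (\<forall>x. x ~= y --> x ~= z --> nats t x = nats s x & reals t x = reals s x)" for i and t :: store
  have "\<exists>s'. exec f m (For z r ?b) s2 (Suc ((N - 0) * (1 + 4))) s' & P N s'"
  proof (rule exec_For[where P = P])
   show "P 0 s2" using d by (simp add: P_def s2_def s1_def)
   show "P i t ==> nats t z 0 = i & nats t r 0 = N" for i t using d by (simp add: P_def N_def)
   show "\<exists>s'. exec f m ?b t 1 s' & nats s' z 0 = i & P (Suc i) (put_nat z 0 (Suc i) s')"
    if "i < N" "P i t" for i t
    using exec_Assign[of f m y "Add ?i (Num 1)" "Get r (Add ?i (Num 1))" t] that d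
    by (intro exI conjI) (unfold One_nat_def, assumption, auto simp: P_def less_Suc_eq)
  qed simp
  then obtain s3 where s3: "exec f m (For z r ?b) s2 (Suc (N * 5)) s3" "P N s3" by auto
  have "exec f m ?c s (Suc (Suc 0 + Suc (Suc 0 + Suc (N * 5)))) s3"
   using exec_Assign[of f m y "Num 0" "Get r (Num 0)" s] exec_Assign[of f m z "Num 0" "Num 0" s1]
   by (intro exec_Seq[where s' = s1] exec_Seq[where s' = s2] s3(1)) (auto simp: s1_def s2_def N_def)
  then have "exec f m ?c s (6 * length (rdl r s) + 6) s3" by (elim exec_mono) (simp add: rdl_def N_def)
  moreover have "rdl y s3 = rdl r s" using s3(2) by (auto simp: P_def rdl_def N_def)
  ultimately show ?thesis using s3(2) unfolding P_def by blast
 qed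
 then show "\<exists>c. \<forall>f m s. \<exists>s'. exec f m c s (6 * length (rdl r s) + 6) s' & rdl y s' = rdl r s &
   (\<forall>x. x ~= y --> x ~= z --> nats s' x = nats s x & reals s' x = reals s x)" by blast
qed

section \<open>Loops and tables of computed values\<close>

primrec iter :: "nat => (nat => 'v => 'v) => 'v => 'v" where
 "iter 0 F a = a"
| "iter (Suc t) F a = F t (iter t F a)"

text \<open>The round is compiled once, in the context extended by the counter and the state.
  Besides the number of rounds, the cost of copying the state back has to be polynomial, hence the
  bound \<open>L\<close> on all iterates.\<close>

lemma comp_iter:
 assumes 1: "comp k R I rdn \<tau>" and 2: "comp k R I rd ini" and mv: "movable rd len"
  and 3: "!!r r' k'. k <= k' ==> r < k' ==> r' < k' ==>
   comp k' (ext r' rd (ext r rdn R)) (%p. I (fst (fst p))) rd (%p. g (fst (fst p)) (snd (fst p)) (snd p))"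
  and pb: "pbd I \<tau>" "pbd I L" "!!x i. len (iter i (g x) (ini x)) <= L x"
 shows "comp k R I rd (%x. iter (\<tau> x) (g x) (ini x))"
proof (rule compI)
 show st: "stable k R" by (rule comp_stable[OF 1])
 show lo: "localrd rd" by (rule comp_local[OF 2])
 fix b assume b: "k <= b"
 obtain c1 e1 r1 where c1: "!!x s. R x s ==>
   \<exists>s'. exec (ff (I x)) (mm (I x)) c1 s (isz (I x) ^ e1) s' & agree b s s' & rdn r1 s' = \<tau> x"
  using compE[OF 1 b] by blast
 define b1 where "b1 = max b (Suc r1)"
 have b1: "b <= b1" "r1 < b1" by (auto simp: b1_def)
 obtain c2 e2 r2 where c2: "!!x s. R x s ==>
   \<exists>s'. exec (ff (I x)) (mm (I x)) c2 s (isz (I x) ^ e2) s' & agree b1 s s' & rd r2 s' = ini x"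
  using compE[OF 2 le_trans[OF b b1(1)]] by blast
 \<comment> \<open>\<open>xx\<close> holds the counter and \<open>y\<close> the state. The round is
   compiled above \<open>b3\<close>, so it preserves both; \<open>z\<close> lies beyond its result
   and is scratch space for copying.\<close>
 define xx where "xx = max b1 (Suc r2)"
 define y where "y = Suc xx"
 define b3 where "b3 = Suc y"
 have xx: "b1 <= xx" "r2 < xx" "xx < y" "y < b3" by (auto simp: xx_def y_def b3_def)
 have "comp b3 (ext y rd (ext xx rdn R)) (%p. I (fst (fst p))) rd (%p. g (fst (fst p)) (snd (fst p)) (snd p))"
  using 3[of b3 xx y] b b1 xx by simp
 then obtain c3 e3 r3 where c3: "!!p s. ext y rd (ext xx rdn R) p s ==>
   \<exists>s'. exec (ff (I (fst (fst p)))) (mm (I (fst (fst p)))) c3 s (isz (I (fst (fst p))) ^ e3) s' & agree b3 s s'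
    & rd r3 s' = g (fst (fst p)) (snd (fst p)) (snd p)"
  by (rule compE[OF _ order_refl]) blast
 define z where "z = Suc (b3 + r3)"
 have "\<exists>c. \<forall>f m s. \<exists>s'. exec f m c s (Suc (len (rd r3 s))) s' & rd y s' = rd r3 s &
   (\<forall>x. x ~= y --> x ~= z --> nats s' x = nats s x & reals s' x = reals s x)"
 proof (cases "r3 = y")
  case True
  then show ?thesis by (intro exI[of _ Skip] allI exI conjI) (rule exec_Skip, auto)
 next
  case False
  then have "\<exists>c. \<forall>f m s. \<exists>s'. exec f m c s (len (rd r3 s)) s' & rd y s' = rd r3 s &
   (\<forall>x. x ~= y --> x ~= z --> nats s' x = nats s x & reals s' x = reals s x)"
   using mv[unfolded movable_def, rule_format, of r3 y z] xx by (auto simp: z_def)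
  then show ?thesis using exec_mono[OF _ le_SucI[OF order_refl]] by meson
 qed
 then obtain mv3 where mv3: "!!f m s. \<exists>s'. exec f m mv3 s (Suc (len (rd r3 s))) s' & rd y s' = rd r3 s &
   (\<forall>x. x ~= y --> x ~= z --> nats s' x = nats s x & reals s' x = reals s x)" by blast
 have "\<exists>c. \<forall>f m s. \<exists>s'. exec f m c s (len (rd r2 s)) s' & rd y s' = rd r2 s &
   (\<forall>x. x ~= y --> x ~= z --> nats s' x = nats s x & reals s' x = reals s x)"
  using mv[unfolded movable_def, rule_format, of r2 y z] xx by (auto simp: z_def)
 then obtain mv2 where mv2: "!!f m s. \<exists>s'. exec f m mv2 s (len (rd r2 s)) s' & rd y s' = rd r2 s &
   (\<forall>x. x ~= y --> x ~= z --> nats s' x = nats s x & reals s' x = reals s x)" by blast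
 define prog where "prog = Seq c1 (Seq c2 (Seq mv2 (Seq (Assign xx (Num 0) (Num 0)) (For xx r1 (Seq c3 mv3)))))"
 define t where "t x = Suc (isz (I x) ^ e1 + Suc (isz (I x) ^ e2 + Suc (L x + Suc (Suc 0 + Suc (\<tau> x * (Suc (isz (I x) ^ e3 + Suc (L x)) + 4))))))" for x
 have "\<exists>s'. exec (ff (I x)) (mm (I x)) prog s (t x) s' & agree b s s' & rd y s' = iter (\<tau> x) (g x) (ini x)"
  if Rs: "R x s" for x s
 proof -
  let ?f = "ff (I x)" let ?m = "mm (I x)"
  from c1[OF Rs] obtain s1 where s1: "exec ?f ?m c1 s (isz (I x) ^ e1) s1" "agree b s s1" "rdn r1 s1 = \<tau> x" by blast
  have R1: "R x s1" by (rule stableD[OF st Rs s1(2) b])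
  from c2[OF this] obtain s2 where s2: "exec ?f ?m c2 s1 (isz (I x) ^ e2) s2" "agree b1 s1 s2" "rd r2 s2 = ini x" by blast
  from mv2[of ?f ?m s2] obtain s3 where s3: "exec ?f ?m mv2 s2 (len (ini x)) s3" "rd y s3 = ini x"
   "\<forall>x. x ~= y --> x ~= z --> nats s3 x = nats s2 x & reals s3 x = reals s2 x" by (auto simp: s2(3))
  define s4 where "s4 = put_nat xx 0 0 s3"
  have s4: "exec ?f ?m (Assign xx (Num 0) (Num 0)) s3 (Suc 0) s4"
   using exec_Assign[of ?f ?m xx "Num 0" "Num 0" s3] by (simp add: s4_def)
  have a24: "agree xx s2 s4" using s3(3) xx by (auto simp: agree_def s4_def z_def)
  have a14: "agree b1 s1 s4" using agree_trans[OF s2(2) a24] xx by simp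
  have a4: "agree b s s4" by (rule agree_trans[OF s1(2) a14 b1(1)])
  define P where "P i u \<longleftrightarrow> agree b1 s1 u & nats u xx 0 = i & rd y u = iter i (g x) (ini x)" for i u
  have "\<exists>s'. exec ?f ?m (For xx r1 (Seq c3 mv3)) s4 (Suc ((\<tau> x - 0) * (Suc (isz (I x) ^ e3 + Suc (L x)) + 4))) s' & P (\<tau> x) s'"
  proof (rule exec_For[where P = P])
   have "rd y s4 = rd y s3" using lo xx unfolding localrd_def s4_def by (metis fun_upd_other less_not_refl put_nat_simps(1,2))
   then show "P 0 s4" using a14 s3(2) by (simp add: P_def s4_def)
   show "P i u ==> nats u xx 0 = i & nats u r1 0 = \<tau> x" for i u
    using s1(3) b1 agreeD(1)[of b1 s1 u r1] by (simp add: P_def rdn_def)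
   fix i u assume i: "i < \<tau> x" and P: "P i u"
   have Ru: "R x u" using stableD[OF st R1 _ le_trans[OF b b1(1)]] P by (simp add: P_def)
   have "ext y rd (ext xx rdn R) ((x, i), iter i (g x) (ini x)) u" using P Ru by (simp add: ext_def P_def rdn_def)
   from c3[OF this] obtain u1 where u1: "exec ?f ?m c3 u (isz (I x) ^ e3) u1" "agree b3 u u1"
    "rd r3 u1 = iter (Suc i) (g x) (ini x)" by auto
   from mv3[of ?f ?m u1] obtain u2 where u2: "exec ?f ?m mv3 u1 (Suc (len (iter (Suc i) (g x) (ini x)))) u2"
    "rd y u2 = iter (Suc i) (g x) (ini x)"
    "\<forall>x. x ~= y --> x ~= z --> nats u2 x = nats u1 x & reals u2 x = reals u1 x" unfolding u1(3) by auto
   have "exec ?f ?m mv3 u1 (Suc (L x)) u2" by (rule exec_mono[OF u2(1)]) (use pb(3)[of "Suc i" x] in simp)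
   then have ex: "exec ?f ?m (Seq c3 mv3) u (Suc (isz (I x) ^ e3 + Suc (L x))) u2" by (rule exec_Seq[OF u1(1)])
   have au: "agree y u u2" using u1(2) u2(3) xx by (auto simp: agree_def z_def)
   have "rd y (put_nat xx 0 (Suc i) u2) = rd y u2" using lo xx unfolding localrd_def
    by (metis fun_upd_other less_not_refl put_nat_simps(1,2))
   moreover have "agree b1 s1 (put_nat xx 0 (Suc i) u2)"
   proof -
    have "agree b1 s1 u2" by (rule agree_trans[where s' = u and b' = y]) (use P au xx in \<open>auto simp: P_def\<close>)
    then show ?thesis using xx by (rule_tac agree_trans[OF _ agree_put(1)]) auto
   qed
   ultimately have "P (Suc i) (put_nat xx 0 (Suc i) u2)" using u2(2) by (simp add: P_def)
   moreover have "nats u2 xx 0 = i" using agreeD(1)[OF au xx(3)] P by (simp add: P_def)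
   ultimately show "\<exists>s'. exec ?f ?m (Seq c3 mv3) u (Suc (isz (I x) ^ e3 + Suc (L x))) s' & nats s' xx 0 = i & P (Suc i) (put_nat xx 0 (Suc i) s')"
    using ex by blast
  qed simp
  then obtain s5 where s5: "exec ?f ?m (For xx r1 (Seq c3 mv3)) s4 (Suc (\<tau> x * (Suc (isz (I x) ^ e3 + Suc (L x)) + 4))) s5" "P (\<tau> x) s5" by auto
  have "exec ?f ?m mv2 s2 (L x) s3" by (rule exec_mono[OF s3(1)]) (use pb(3)[where i = 0] in simp)
  from exec_Seq[OF s1(1) exec_Seq[OF s2(1) exec_Seq[OF this exec_Seq[OF s4 s5(1)]]]]
  have "exec ?f ?m prog s (t x) s5" by (simp add: prog_def t_def)
  moreover have "agree b s s5" using s5(2) agree_trans[OF s1(2) _ b1(1)] by (simp add: P_def)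
  ultimately show ?thesis using s5(2) by (auto simp: P_def)
 qed
 moreover have "pbd I t" unfolding t_def
  by (intro pbd_Suc pbd_add pbd_mult pbd_pow pbd_const pb)
 ultimately show "\<exists>c t r. pbd I t & (\<forall>x s. R x s -->
   (\<exists>s'. exec (ff (I x)) (mm (I x)) c s (t x) s' & agree b s s' & rd r s' = iter (\<tau> x) (g x) (ini x)))" by blast
qed

text \<open>The offset \<open>d\<close> serves two formats: 1 for tables that keep their length in
  cell 0, and 0 for the characteristic vector of an oracle query and for the final output.\<close>

lemma comp_fill:
 assumes 1: "comp k R I rdn \<tau>" and pb: "pbd I \<tau>" and b: "k <= b"
  and 2: "!!r k'. k <= k' ==> r < k' ==> comp k' (ext r rdn R) (%p. I (fst p)) rdn (%p. h (fst p) (snd p))"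
 obtains c t y r where "pbd I t" "b <= y" "r < y" "!!x s. R x s ==>
   \<exists>s'. exec (ff (I x)) (mm (I x)) c s (t x) s' & agree b s s' & nats s' r 0 = \<tau> x & (\<forall>j<\<tau> x. nats s' y (j + d) = h x j)"
proof -
 have st: "stable k R" by (rule comp_stable[OF 1])
 obtain c1 e1 r1 where c1: "!!x s. R x s ==>
   \<exists>s'. exec (ff (I x)) (mm (I x)) c1 s (isz (I x) ^ e1) s' & agree b s s' & rdn r1 s' = \<tau> x"
  using compE[OF 1 b] by blast
 define xx where "xx = max b (Suc r1)"
 define y where "y = Suc xx"
 have xx: "b <= xx" "r1 < xx" "xx < y" by (auto simp: xx_def y_def)
 have "comp (Suc y) (ext xx rdn R) (%p. I (fst p)) rdn (%p. h (fst p) (snd p))"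
  using 2[of "Suc y" xx] b xx by simp
 then obtain c3 e3 r3 where c3: "!!p s. ext xx rdn R p s ==>
   \<exists>s'. exec (ff (I (fst p))) (mm (I (fst p))) c3 s (isz (I (fst p)) ^ e3) s' & agree (Suc y) s s'
    & rdn r3 s' = h (fst p) (snd p)"
  by (rule compE[OF _ order_refl]) blast
 define as where "as = Assign y (Add (Get xx (Num 0)) (Num d)) (Get r3 (Num 0))"
 define prog where "prog = Seq c1 (Seq (Assign xx (Num 0) (Num 0)) (For xx r1 (Seq c3 as)))"
 define t where "t x = Suc (isz (I x) ^ e1 + Suc (Suc 0 + Suc (\<tau> x * (Suc (isz (I x) ^ e3 + Suc 0) + 4))))" for x
 have "\<exists>s'. exec (ff (I x)) (mm (I x)) prog s (t x) s' & agree b s s' & nats s' r1 0 = \<tau> x & (\<forall>j<\<tau> x. nats s' y (j + d) = h x j)"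
  if Rs: "R x s" for x s
 proof -
  let ?f = "ff (I x)" let ?m = "mm (I x)"
  from c1[OF Rs] obtain s1 where s1: "exec ?f ?m c1 s (isz (I x) ^ e1) s1" "agree b s s1" "rdn r1 s1 = \<tau> x" by blast
  have R1: "R x s1" by (rule stableD[OF st Rs s1(2) b])
  define s4 where "s4 = put_nat xx 0 0 s1"
  have s4: "exec ?f ?m (Assign xx (Num 0) (Num 0)) s1 (Suc 0) s4"
   using exec_Assign[of ?f ?m xx "Num 0" "Num 0" s1] by (simp add: s4_def)
  define P where "P i u \<longleftrightarrow> agree xx s1 u & nats u xx 0 = i & (\<forall>j<i. nats u y (j + d) = h x j)" for i and u :: store
  have "\<exists>s'. exec ?f ?m (For xx r1 (Seq c3 as)) s4 (Suc ((\<tau> x - 0) * (Suc (isz (I x) ^ e3 + Suc 0) + 4))) s' & P (\<tau> x) s'"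
  proof (rule exec_For[where P = P])
   show "P 0 s4" by (simp add: P_def s4_def agree_put)
   show "P i u ==> nats u xx 0 = i & nats u r1 0 = \<tau> x" for i u
    using s1(3) xx agreeD(1)[of xx s1 u r1] by (simp add: P_def rdn_def)
   fix i u assume i: "i < \<tau> x" and P: "P i u"
   have "R x u" by (rule stableD[OF st R1, of xx]) (use P b xx in \<open>auto simp: P_def\<close>)
   then have "ext xx rdn R (x, i) u" using P by (simp add: ext_def P_def rdn_def)
   from c3[OF this] obtain u1 where u1: "exec ?f ?m c3 u (isz (I x) ^ e3) u1" "agree (Suc y) u u1"
    "nats u1 r3 0 = h x i" by (auto simp: rdn_def)
   have x1: "nats u1 xx 0 = i" using agreeD(1)[OF u1(2)] xx P by (simp add: P_def)
   define u2 where "u2 = put_nat y (i + d) (h x i) u1"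
   have "exec ?f ?m as u1 (Suc 0) u2"
    using exec_Assign[of ?f ?m y "Add (Get xx (Num 0)) (Num d)" "Get r3 (Num 0)" u1] x1 u1(3) by (simp add: as_def u2_def)
   then have ex: "exec ?f ?m (Seq c3 as) u (Suc (isz (I x) ^ e3 + Suc 0)) u2" by (rule exec_Seq[OF u1(1)])
   have "agree xx s1 (put_nat xx 0 (Suc i) u2)"
    using P u1(2) xx unfolding P_def agree_def u2_def by auto
   moreover have "nats u2 y (j + d) = h x j" if "j < Suc i" for j
    using P that agreeD(1)[OF u1(2), of y] by (auto simp: P_def u2_def less_Suc_eq)
   ultimately have "P (Suc i) (put_nat xx 0 (Suc i) u2)" using xx by (simp add: P_def)
   moreover have "nats u2 xx 0 = i" using x1 xx by (simp add: u2_def)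
   ultimately show "\<exists>s'. exec ?f ?m (Seq c3 as) u (Suc (isz (I x) ^ e3 + Suc 0)) s' & nats s' xx 0 = i & P (Suc i) (put_nat xx 0 (Suc i) s')"
    using ex by blast
  qed simp
  then obtain s5 where s5: "exec ?f ?m (For xx r1 (Seq c3 as)) s4 (Suc (\<tau> x * (Suc (isz (I x) ^ e3 + Suc 0) + 4))) s5" "P (\<tau> x) s5" by auto
  have "exec ?f ?m prog s (t x) s5" unfolding prog_def t_def by (rule exec_Seq[OF s1(1) exec_Seq[OF s4 s5(1)]])
  moreover have "agree b s s5" using s5(2) agree_trans[OF s1(2) _ xx(1)] by (simp add: P_def)
  moreover have "nats s5 r1 0 = \<tau> x" using s5(2) s1(3) agreeD(1)[of xx s1 s5 r1] xx by (simp add: P_def rdn_def)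
  ultimately show ?thesis using s5(2) by (auto simp: P_def)
 qed
 moreover have "pbd I t" unfolding t_def
  by (intro pbd_Suc pbd_add pbd_mult pbd_pow pbd_const pb)
 ultimately show ?thesis using that[of t y r1 prog] xx by auto
qed

lemma comp_tabl:
 assumes 1: "comp k R I rdn \<tau>" and pb: "pbd I \<tau>"
  and 2: "!!r k'. k <= k' ==> r < k' ==> comp k' (ext r rdn R) (%p. I (fst p)) rdn (%p. h (fst p) (snd p))"
 shows "comp k R I rdl (%x. map (h x) [0..<\<tau> x])"
proof (rule compI)
 show "stable k R" by (rule comp_stable[OF 1])
 fix b assume "k <= b"
 then obtain c t y r where c: "pbd I t" "b <= y" "r < y"
  "!!x s. R x s ==> \<exists>s'. exec (ff (I x)) (mm (I x)) c s (t x) s' & agree b s s' & nats s' r 0 = \<tau> x & (\<forall>j<\<tau> x. nats s' y (j + 1) = h x j)"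
  by (rule comp_fill[OF 1 pb _ 2, where d = 1]) (assumption | rule that)+
 let ?c = "Seq c (Assign y (Num 0) (Get r (Num 0)))"
 have "\<exists>s'. exec (ff (I x)) (mm (I x)) ?c s (Suc (t x + Suc 0)) s' & agree b s s' & rdl y s' = map (h x) [0..<\<tau> x]" if "R x s" for x s
 proof -
  from c(4)[OF that] obtain s1 where s1: "exec (ff (I x)) (mm (I x)) c s (t x) s1" "agree b s s1" "nats s1 r 0 = \<tau> x"
   "\<forall>j<\<tau> x. nats s1 y (Suc j) = h x j" by auto
  have "exec (ff (I x)) (mm (I x)) ?c s (Suc (t x + Suc 0)) (put_nat y 0 (\<tau> x) s1)"
   using exec_Assign[of _ _ y "Num 0" "Get r (Num 0)" s1] s1(3) by (intro exec_Seq[OF s1(1)]) simp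
  moreover have "agree b s (put_nat y 0 (\<tau> x) s1)" by (rule agree_trans[OF s1(2) agree_put(1)[OF c(2)]]) simp
  ultimately show ?thesis using s1(4) by (intro exI conjI) (assumption+, simp add: rdl_def)
 qed
 then show "\<exists>c t r. pbd I t & (\<forall>x s. R x s -->
   (\<exists>s'. exec (ff (I x)) (mm (I x)) c s (t x) s' & agree b s s' & rdl r s' = map (h x) [0..<\<tau> x]))"
  by (intro exI[of _ ?c] exI[of _ "%x. Suc (t x + Suc 0)"] exI[of _ y] conjI pbd_Suc pbd_add pbd_const c(1)) blast
qed simp

lemma comp_query:
 assumes 1: "comp k R I rdn (%x. mm (I x))"
  and 2: "!!r k'. k <= k' ==> r < k' ==> comp k' (ext r rdn R) (%p. I (fst p)) rdn (%p. of_bool (h (fst p) (snd p)))"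
 shows "comp k R I rdr (%x. ff (I x) {j. j < mm (I x) & h x j})"
proof (rule compI)
 show "stable k R" by (rule comp_stable[OF 1])
 fix b assume "k <= b"
 have pb: "pbd I (%x. mm (I x))" unfolding pbd_def by (rule exI[of _ 1]) (simp add: isz_def)
 obtain c t y r where c: "pbd I t" "b <= y" "r < y"
  "!!x s. R x s ==> \<exists>s'. exec (ff (I x)) (mm (I x)) c s (t x) s' & agree b s s' & nats s' r 0 = mm (I x) & (\<forall>j<mm (I x). nats s' y (j + 0) = of_bool (h x j))"
  by (rule comp_fill[OF 1 pb \<open>k <= b\<close> 2, where d = 0]) (assumption | rule that)+
 let ?c = "Seq c (Query y (Num 0) y)"
 have "\<exists>s'. exec (ff (I x)) (mm (I x)) ?c s (Suc (t x + Suc 0)) s' & agree b s s' & rdr y s' = ff (I x) {j. j < mm (I x) & h x j}" if "R x s" for x s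
 proof -
  from c(4)[OF that] obtain s1 where s1: "exec (ff (I x)) (mm (I x)) c s (t x) s1" "agree b s s1"
   "\<forall>j<mm (I x). nats s1 y j = of_bool (h x j)" by auto
  have "{j. j < mm (I x) & nats s1 y j ~= 0} = {j. j < mm (I x) & h x j}" using s1(3) by auto
  then have "exec (ff (I x)) (mm (I x)) ?c s (Suc (t x + Suc 0)) (put_real y 0 (ff (I x) {j. j < mm (I x) & h x j}) s1)"
   using exec_Query[of "ff (I x)" "mm (I x)" y "Num 0" y s1] by (intro exec_Seq[OF s1(1)]) simp
  moreover have "agree b s (put_real y 0 (ff (I x) {j. j < mm (I x) & h x j}) s1)" by (rule agree_trans[OF s1(2) agree_put(2)[OF c(2)]]) simp
  ultimately show ?thesis by (intro exI conjI) (assumption+, simp add: rdr_def)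
 qed
 then show "\<exists>c t r. pbd I t & (\<forall>x s. R x s -->
   (\<exists>s'. exec (ff (I x)) (mm (I x)) c s (t x) s' & agree b s s' & rdr r s' = ff (I x) {j. j < mm (I x) & h x j}))"
  by (intro exI[of _ ?c] exI[of _ "%x. Suc (t x + Suc 0)"] exI[of _ y] conjI pbd_Suc pbd_add pbd_const c(1)) blast
qed simp

lemma comp_rda:
 assumes "comp k R I rdl \<sigma>" shows "comp k R I rda (%x. nth0 (\<sigma> x))"
proof (rule compI)
 show "stable k R" by (rule comp_stable[OF assms])
 fix b assume "k <= b"
 from compE[OF assms this] obtain c e r where "!!x s. R x s ==>
   \<exists>s'. exec (ff (I x)) (mm (I x)) c s (isz (I x) ^ e) s' & agree b s s' & rdl r s' = \<sigma> x" by blast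
 then have "\<exists>s'. exec (ff (I x)) (mm (I x)) c s (isz (I x) ^ e) s' & agree b s s' & rda r s' = nth0 (\<sigma> x)" if "R x s" for x s
  using that unfolding rda_rdl by metis
 then show "\<exists>c t r. pbd I t & (\<forall>x s. R x s -->
   (\<exists>s'. exec (ff (I x)) (mm (I x)) c s (t x) s' & agree b s s' & rda r s' = nth0 (\<sigma> x)))"
  by (intro exI[of _ c] exI[of _ "%x. isz (I x) ^ e"] exI[of _ r] conjI pbd_pow) blast
qed simp

definition tab :: "nat => (nat => nat) => nat => nat" where
 "tab n h i = (if i < n then h i else 0)"

lemma nth0_map: "nth0 (map h [0..<n]) = tab n h"
 by (auto simp: nth0_def tab_def fun_eq_iff)

lemma comp_tab:
 assumes "comp k R I rdn \<tau>" "pbd I \<tau>"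
  "!!r k'. k <= k' ==> r < k' ==> comp k' (ext r rdn R) (%p. I (fst p)) rdn (%p. h (fst p) (snd p))"
 shows "comp k R I rda (%x. tab (\<tau> x) (h x))"
 using comp_rda[OF comp_tabl[OF assms]] by (simp add: nth0_map)

text \<open>The state is kept as a list, which can be copied, while the round sees it as a function.
  Since \<open>rda\<close> is \<open>nth0\<close> of \<open>rdl\<close>, one and the same store
  represents both contexts.\<close>

lemma comp_aiter:
 assumes 1: "comp k R I rdn \<tau>" "pbd I \<tau>" and 2: "comp k R I rdn \<mu>" "pbd I \<mu>"
  and 3: "!!r k'. k <= k' ==> r < k' ==> comp k' (ext r rdn R) (%p. I (fst p)) rdn (%p. h (fst p) (snd p))"
  and 4: "!!r r' r'' k'. k <= k' ==> r < k' ==> r' < k' ==> r'' < k' ==>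
   comp k' (ext r'' rdn (ext r' rda (ext r rdn R))) (%p. I (fst (fst (fst p)))) rdn
    (%p. g (fst (fst (fst p))) (snd (fst (fst p))) (snd (fst p)) (snd p))"
 shows "comp k R I rda (%x. iter (\<tau> x) (%t A. tab (\<mu> x) (g x t A)) (tab (\<mu> x) (h x)))"
proof -
 let ?g = "%x t l. map (g x t (nth0 l)) [0..<\<mu> x]"
 have len: "length (iter i (?g x) (map (h x) [0..<\<mu> x])) = \<mu> x" for x i by (cases i) simp_all
 have *: "comp k R I rdl (%x. iter (\<tau> x) (?g x) (map (h x) [0..<\<mu> x]))"
 proof (rule comp_iter[OF 1(1) comp_tabl[OF 2 3] movable_rdl _ 1(2)])
  show "pbd I (%x. 6 * \<mu> x + 6)" by (intro pbd_add pbd_mult pbd_const 2)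
  fix r r' k' assume k: "k <= k'" "r < k'" "r' < k'"
  have st: "stable k' (ext r rdn R)" using k by (intro stable_ext[of k] comp_stable[OF 1(1)]) auto
  have m: "comp k' (ext r' rdl (ext r rdn R)) (%p. I (fst (fst p))) rdn (%p. \<mu> (fst (fst p)))"
   using comp_lift[OF comp_lift[OF 2(1) k(1,2)], of rdn k' r' rdl] k by simp
  have pb: "pbd (%p. I (fst (fst p))) (%p. \<mu> (fst (fst p)))" using 2(2) by (auto simp: pbd_def)
  show "comp k' (ext r' rdl (ext r rdn R)) (%p. I (fst (fst p))) rdl
    (%p. map (g (fst (fst p)) (snd (fst p)) (nth0 (snd p))) [0..<\<mu> (fst (fst p))])"
  proof (rule comp_tabl[OF m pb])
   fix r'' k'' assume k'': "k' <= k''" "r'' < k''"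
   let ?R1 = "ext r'' rdn (ext r' rda (ext r rdn R))"
   have c: "comp k'' ?R1 (%p. I (fst (fst (fst p)))) rdn
    (%p. g (fst (fst (fst p))) (snd (fst (fst p))) (snd (fst p)) (snd p))" using 4[of k'' r r' r''] k k'' by simp
   show "comp k'' (ext r'' rdn (ext r' rdl (ext r rdn R))) (%p. I (fst (fst (fst p)))) rdn
    (%p. g (fst (fst (fst p))) (snd (fst (fst p))) (nth0 (snd (fst p))) (snd p))"
   proof (rule compI)
    show "stable k'' (ext r'' rdn (ext r' rdl (ext r rdn R)))"
     using k k'' by (intro stable_ext[of k'] st stable_ext[of k']) auto
    fix b assume "k'' <= b"
    from compE[OF c this] obtain c0 e r0 where c0: "!!x s. ?R1 x s ==>
     \<exists>s'. exec (ff (I (fst (fst (fst x))))) (mm (I (fst (fst (fst x))))) c0 s (isz (I (fst (fst (fst x)))) ^ e) s' &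
      agree b s s' & rdn r0 s' = g (fst (fst (fst x))) (snd (fst (fst x))) (snd (fst x)) (snd x)" by blast
    have "\<exists>s'. exec (ff (I (fst (fst (fst x))))) (mm (I (fst (fst (fst x))))) c0 s (isz (I (fst (fst (fst x)))) ^ e) s' &
      agree b s s' & rdn r0 s' = g (fst (fst (fst x))) (snd (fst (fst x))) (nth0 (snd (fst x))) (snd x)"
     if "ext r'' rdn (ext r' rdl (ext r rdn R)) x s" for x s
    proof -
     have "?R1 ((fst (fst x), nth0 (snd (fst x))), snd x) s" using that by (simp add: ext_def rda_rdl)
     from c0[OF this] show ?thesis by simp
    qed
    then show "\<exists>c t ra. pbd (%p. I (fst (fst (fst p)))) t & (\<forall>x s. ext r'' rdn (ext r' rdl (ext r rdn R)) x s -->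
     (\<exists>s'. exec (ff (I (fst (fst (fst x))))) (mm (I (fst (fst (fst x))))) c s (t x) s' &
      agree b s s' & rdn ra s' = g (fst (fst (fst x))) (snd (fst (fst x))) (nth0 (snd (fst x))) (snd x)))"
     by (intro exI[of _ c0] exI[of _ "%x. isz (I (fst (fst (fst x)))) ^ e"] exI[of _ r0] conjI allI impI pbd_pow)
   qed simp
  qed
 qed (assumption+, subst len, simp)
 have "nth0 (iter i (?g x) (map (h x) [0..<\<mu> x])) = iter i (%t A. tab (\<mu> x) (g x t A)) (tab (\<mu> x) (h x))" for x i
  by (induction i) (simp_all only: iter.simps nth0_map)
 then show ?thesis using comp_rda[OF *] by (simp only:)
qed

section \<open>Tests, sums and bounded quantifiers\<close>

lemma comp_test:
 assumes 1: "comp k R I rd1 \<sigma>" and 2: "comp k R I rd2 \<tau>"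
  and t: "!!r r' s. bval (B r r') s \<longleftrightarrow> Q (rd1 r s) (rd2 r' s)"
 shows "comp k R I rdn (%x. of_bool (Q (\<sigma> x) (\<tau> x)))"
proof (rule comp_let2[OF 1 2, where g = "%c v w. of_bool (Q v w)"])
 fix r r' k' assume st: "stable k' (ext r' rd2 (ext r rd1 R))"
 show "comp k' (ext r' rd2 (ext r rd1 R)) (%p. I (fst (fst p))) rdn (%p. of_bool (Q (snd (fst p)) (snd p)))"
 proof (rule comp_cmd[OF st])
  fix b
  let ?c = "Cond (B r r') (Assign b (Num 0) (Num 1)) (Assign b (Num 0) (Num 0))"
  have "exec f m ?c s 2 (put_nat b 0 (of_bool (Q (rd1 r s) (rd2 r' s))) s)" for f m s
   using exec_Cond[of f m "B r r'" s "Assign b (Num 0) (Num 1)" "Assign b (Num 0) (Num 0)" "Suc 0"]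
    exec_Assign[of f m b "Num 0" "Num 1" s] exec_Assign[of f m b "Num 0" "Num 0" s]
   by (auto simp: t numeral_2_eq_2)
  then show "\<exists>c. \<forall>x s. ext r' rd2 (ext r rd1 R) x s -->
    (\<exists>s'. exec (ff (I (fst (fst x)))) (mm (I (fst (fst x)))) c s 2 s' & agree b s s' & rdn b s' = of_bool (Q (snd (fst x)) (snd x)))"
   by (intro exI[of _ ?c] allI impI exI conjI) (assumption, auto simp: ext_def rdn_def intro!: agree_put)
 qed simp
qed

abbreviation compb :: "nat => ('c => store => bool) => ('c => inst) => ('c => bool) => bool" where
 "compb k R I P == comp k R I rdn (%x. of_bool (P x))"

lemma comp_less: "comp k R I rdn \<sigma> ==> comp k R I rdn \<tau> ==> compb k R I (%x. \<sigma> x < \<tau> x)"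
 by (rule comp_test[where ?rd1.0 = rdn and ?rd2.0 = rdn and Q = "(<)" and B = "%r r'. Less (Get r (Num 0)) (Get r' (Num 0))"]) (auto simp: rdn_def)

lemma comp_rless: "comp k R I rdr \<sigma> ==> comp k R I rdr \<tau> ==> compb k R I (%x. \<sigma> x < \<tau> x)"
 by (rule comp_test[where ?rd1.0 = rdr and ?rd2.0 = rdr and Q = "(<)" and B = "%r r'. RLess (RGet r (Num 0)) (RGet r' (Num 0))"]) (auto simp: rdr_def)

lemma comp_not: "compb k R I P ==> compb k R I (%x. ~ P x)"
proof -
 assume 1: "compb k R I P"
 have "comp k R I rdn (%x. 1 - of_bool (P x))"
  by (intro comp_sub 1 comp_num comp_stable[OF 1])
 moreover have "(%x. 1 - of_bool (P x) :: nat) = (%x. of_bool (~ P x))" by auto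
 ultimately show ?thesis by simp
qed

lemma comp_conj: "compb k R I P ==> compb k R I Q ==> compb k R I (%x. P x & Q x)"
proof -
 assume 1: "compb k R I P" and 2: "compb k R I Q"
 have "comp k R I rdn (%x. of_bool (P x) + of_bool (Q x) - 1)"
  by (intro comp_sub comp_add 1 2 comp_num comp_stable[OF 1])
 moreover have "(%x. of_bool (P x) + of_bool (Q x) - 1 :: nat) = (%x. of_bool (P x & Q x))" by auto
 ultimately show ?thesis by simp
qed

lemma comp_disj: assumes "compb k R I P" "compb k R I Q" shows "compb k R I (%x. P x | Q x)"
proof -
 have "compb k R I (%x. ~ (~ P x & ~ Q x))" by (rule comp_not comp_conj assms)+
 then show ?thesis by (simp only: de_Morgan_conj not_not)
qed

lemma comp_imp: assumes "compb k R I P" "compb k R I Q" shows "compb k R I (%x. P x --> Q x)"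
 unfolding imp_conv_disj by (rule comp_not comp_disj assms)+

lemma comp_le: assumes "comp k R I rdn \<sigma>" "comp k R I rdn \<tau>" shows "compb k R I (%x. \<sigma> x <= \<tau> x)"
 unfolding not_less[symmetric] by (rule comp_not comp_less assms)+

lemma comp_rle: assumes "comp k R I rdr \<sigma>" "comp k R I rdr \<tau>" shows "compb k R I (%x. \<sigma> x <= \<tau> x)"
 unfolding not_less[symmetric] by (rule comp_not comp_rless assms)+

lemma comp_eq: assumes "comp k R I rdn \<sigma>" "comp k R I rdn \<tau>" shows "compb k R I (%x. \<sigma> x = \<tau> x)"
 unfolding eq_iff by (rule comp_conj comp_le assms)+

lemma comp_sum:
 assumes "comp k R I rdn \<tau>" "pbd I \<tau>"
  "!!r k'. k <= k' ==> r < k' ==> comp k' (ext r rdn R) (%p. I (fst p)) rdn (%p. h (fst p) (snd p))"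
 shows "comp k R I rdn (%x. \<Sum>i<\<tau> x. h x i)"
proof -
 have "comp k R I rdn (%x. iter (\<tau> x) (%i v. v + h x i) 0)"
 proof (rule comp_iter[OF assms(1) _ movable_rdn _ assms(2) pbd_const[of I 1]])
  show "comp k R I rdn (%x. 0)" by (rule comp_num[OF comp_stable[OF assms(1)]])
  fix r r' k' assume k: "k <= k'" "r < k'" "r' < k'"
  have c: "comp k' (ext r rdn R) (%p. I (fst p)) rdn (%p. h (fst p) (snd p))" by (rule assms(3)) fact+
  show "comp k' (ext r' rdn (ext r rdn R)) (%p. I (fst (fst p))) rdn (%p. snd p + h (fst (fst p)) (snd (fst p)))"
   using comp_lift[OF c, of k' r' rdn] comp_var[OF comp_stable[OF c], of k' r' rdn] k by (intro comp_add) auto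
 qed simp
 moreover have "iter n (%i v. v + h x i) 0 = (\<Sum>i<n. h x i)" for n x by (induction n) auto
 ultimately show ?thesis by simp
qed

lemma comp_rsum:
 assumes "comp k R I rdn \<tau>" "pbd I \<tau>"
  "!!r k'. k <= k' ==> r < k' ==> comp k' (ext r rdn R) (%p. I (fst p)) rdr (%p. h (fst p) (snd p))"
 shows "comp k R I rdr (%x. \<Sum>i<\<tau> x. h x i)"
proof -
 have "comp k R I rdr (%x. iter (\<tau> x) (%i v. v + h x i) 0)"
 proof (rule comp_iter[OF assms(1) _ movable_rdr _ assms(2) pbd_const[of I 1]])
  show "comp k R I rdr (%x. 0)" by (rule comp_rzero[OF comp_stable[OF assms(1)]])
  fix r r' k' assume k: "k <= k'" "r < k'" "r' < k'"
  have c: "comp k' (ext r rdn R) (%p. I (fst p)) rdr (%p. h (fst p) (snd p))" by (rule assms(3)) fact+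
  show "comp k' (ext r' rdr (ext r rdn R)) (%p. I (fst (fst p))) rdr (%p. snd p + h (fst (fst p)) (snd (fst p)))"
   using comp_lift[OF c, of k' r' rdr] comp_var[OF comp_stable[OF c], of k' r' rdr] k by (intro comp_radd) auto
 qed simp
 moreover have "iter n (%i v. v + h x i) 0 = (\<Sum>i<n. h x i)" for n x by (induction n) auto
 ultimately show ?thesis by simp
qed

text \<open>Doubling and halving are the cheap scalings of the machine; iterating them yields
  factors and divisors that are powers of two, for reals as well as for naturals.\<close>

lemma comp_scal:
 fixes rd :: "nat => store => 'v"
 assumes "comp k R I rdn \<tau>" "pbd I \<tau>" "comp k R I rd \<sigma>" "movable rd (%_. 1)"
  and g: "!!k (R :: ('c \<times> nat) \<times> 'v => store => bool) I \<sigma>. comp k R I rd \<sigma> ==> comp k R I rd (%x. G (\<sigma> x))"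
 shows "comp k R I rd (%x :: 'c. iter (\<tau> x) (%i. G) (\<sigma> x))"
proof (rule comp_iter[OF assms(1,3,4) _ assms(2) pbd_const[of I 1]])
 fix r r' k' assume k: "k <= k'" "r < k'" "r' < k'"
 have "stable k' (ext r rdn R)" using k by (intro stable_ext[of k] comp_stable[OF assms(1)]) auto
 then have "comp k' (ext r' rd (ext r rdn R)) (%p. I (fst (fst p))) rd snd"
  using k by (intro comp_var[of k'] comp_local[OF assms(3)]) auto
 from g[OF this] show "comp k' (ext r' rd (ext r rdn R)) (%p. I (fst (fst p))) rd (%p. G (snd p))" .
qed simp

lemma comp_dbl: "comp k R I rdn \<sigma> ==> comp k R I rdn \<tau> ==> pbd I \<tau> ==> comp k R I rdn (%x. \<sigma> x * 2 ^ \<tau> x)"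
proof -
 assume a: "comp k R I rdn \<sigma>" "comp k R I rdn \<tau>" "pbd I \<tau>"
 have "comp k R I rdn (%x. iter (\<tau> x) (%i v. v + v) (\<sigma> x))"
  by (rule comp_scal[OF a(2,3,1) movable_rdn]) (rule comp_add, assumption+)
 moreover have "iter n (%i v. v + v) w = w * 2 ^ n" for n and w :: nat by (induction n) auto
 ultimately show ?thesis by simp
qed

lemma comp_rdbl: "comp k R I rdr \<sigma> ==> comp k R I rdn \<tau> ==> pbd I \<tau> ==> comp k R I rdr (%x. \<sigma> x * 2 ^ \<tau> x)"
proof -
 assume a: "comp k R I rdr \<sigma>" "comp k R I rdn \<tau>" "pbd I \<tau>"
 have "comp k R I rdr (%x. iter (\<tau> x) (%i v. v + v) (\<sigma> x))"
  by (rule comp_scal[OF a(2,3,1) movable_rdr]) (rule comp_radd, assumption+)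
 moreover have "iter n (%i v. v + v) w = w * 2 ^ n" for n and w :: real by (induction n) auto
 ultimately show ?thesis by simp
qed

lemma comp_halves: "comp k R I rdn \<sigma> ==> comp k R I rdn \<tau> ==> pbd I \<tau> ==> comp k R I rdn (%x. \<sigma> x div 2 ^ \<tau> x)"
proof -
 assume a: "comp k R I rdn \<sigma>" "comp k R I rdn \<tau>" "pbd I \<tau>"
 have "comp k R I rdn (%x. iter (\<tau> x) (%i v. v div 2) (\<sigma> x))"
  by (rule comp_scal[OF a(2,3,1) movable_rdn]) (rule comp_half)
 moreover have "iter n (%i v. v div 2) w = w div 2 ^ n" for n and w :: nat
  by (induction n) (auto simp: div_mult2_eq[symmetric] mult.commute)
 ultimately show ?thesis by simp
qed

lemma comp_mod_pow: "comp k R I rdn \<sigma> ==> comp k R I rdn \<tau> ==> pbd I \<tau> ==> comp k R I rdn (%x. \<sigma> x mod 2 ^ \<tau> x)"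
proof -
 assume a: "comp k R I rdn \<sigma>" "comp k R I rdn \<tau>" "pbd I \<tau>"
 have "comp k R I rdn (%x. \<sigma> x - \<sigma> x div 2 ^ \<tau> x * 2 ^ \<tau> x)"
  by (intro comp_sub comp_dbl comp_halves a)
 then show ?thesis by (simp only: minus_div_mult_eq_mod)
qed

text \<open>Repeated addition, hence the polynomial bound on one factor.\<close>

lemma comp_mult: "comp k R I rdn \<sigma> ==> pbd I \<sigma> ==> comp k R I rdn \<tau> ==> comp k R I rdn (%x. \<sigma> x * \<tau> x)"
proof -
 assume a: "comp k R I rdn \<sigma>" "pbd I \<sigma>" "comp k R I rdn \<tau>"
 have "comp k R I rdn (%x. \<Sum>i<\<sigma> x. \<tau> x)"
  by (rule comp_sum[OF a(1,2)]) (rule comp_lift[OF a(3)], auto)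
 then show ?thesis by simp
qed

lemma comp_rmult: "comp k R I rdn \<sigma> ==> pbd I \<sigma> ==> comp k R I rdr \<tau> ==> comp k R I rdr (%x. real (\<sigma> x) * \<tau> x)"
proof -
 assume a: "comp k R I rdn \<sigma>" "pbd I \<sigma>" "comp k R I rdr \<tau>"
 have "comp k R I rdr (%x. \<Sum>i<\<sigma> x. \<tau> x)"
  by (rule comp_rsum[OF a(1,2)]) (rule comp_lift[OF a(3)], auto)
 then show ?thesis by simp
qed

lemma comp_Ball:
 assumes "comp k R I rdn \<tau>" "pbd I \<tau>"
  "!!r k'. k <= k' ==> r < k' ==> compb k' (ext r rdn R) (%p. I (fst p)) (%p. P (fst p) (snd p))"
 shows "compb k R I (%x. \<forall>i<\<tau> x. P x i)"
proof -
 have "compb k R I (%x. (\<Sum>i<\<tau> x. of_bool (~ P x i)) <= (0::nat))"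
  by (intro comp_le comp_sum comp_not assms comp_num comp_stable[OF assms(1)])
 moreover have "((\<Sum>i<n. of_bool (~ P x i)) <= (0::nat)) \<longleftrightarrow> (\<forall>i<n. P x i)" for n x by (auto simp: sum_eq_0_iff)
 ultimately show ?thesis by (simp only:)
qed

lemma comp_Bex:
 assumes "comp k R I rdn \<tau>" "pbd I \<tau>"
  "!!r k'. k <= k' ==> r < k' ==> compb k' (ext r rdn R) (%p. I (fst p)) (%p. P (fst p) (snd p))"
 shows "compb k R I (%x. \<exists>i<\<tau> x. P x i)"
proof -
 have "compb k R I (%x. ~ (\<forall>i<\<tau> x. ~ P x i))" by (rule comp_not comp_Ball assms | assumption)+
 then show ?thesis by (simp only: not_all not_imp not_not)
qed

text \<open>Both alternatives are computed before the condition selects one, so neither may rely on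
  the condition to be polynomial.\<close>

lemma comp_if:
 assumes P: "compb k R I P" and 1: "comp k R I rdn \<sigma>" and 2: "comp k R I rdn \<tau>"
 shows "comp k R I rdn (%x. if P x then \<sigma> x else \<tau> x)"
proof -
 have "comp k R I rdn (%x. if of_bool (P x) = (1::nat) then \<sigma> x else \<tau> x)"
 proof (rule comp_let[OF P, where g = "%x v. if v = 1 then \<sigma> x else \<tau> x"])
  fix r k' assume k: "k <= k'" "r < k'"
  let ?R = "ext r rdn R"
  show "comp k' ?R (%p. I (fst p)) rdn (%p. if snd p = 1 then \<sigma> (fst p) else \<tau> (fst p))"
  proof (rule comp_let2[OF comp_lift[OF 1 k] comp_lift[OF 2 k], where g = "%p v w. if snd p = 1 then v else w"])
   fix ra r' k'' assume st: "stable k'' (ext r' rdn (ext ra rdn ?R))"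
   show "comp k'' (ext r' rdn (ext ra rdn ?R)) (%p. I (fst (fst (fst p)))) rdn
    (%p. if snd (fst (fst p)) = 1 then snd (fst p) else snd p)"
   proof (rule comp_cmd[OF st])
    fix b
    let ?B = "Conj (Less (Num 0) (Get r (Num 0))) (Less (Get r (Num 0)) (Num 2))"
    let ?c = "Cond ?B (Assign b (Num 0) (Get ra (Num 0))) (Assign b (Num 0) (Get r' (Num 0)))"
    have "exec f m ?c s 2 (put_nat b 0 (if rdn r s = 1 then rdn ra s else rdn r' s) s)" for f m s
     using exec_Cond[of f m ?B s "Assign b (Num 0) (Get ra (Num 0))" "Assign b (Num 0) (Get r' (Num 0))" "Suc 0"]
      exec_Assign[of f m b "Num 0" "Get ra (Num 0)" s] exec_Assign[of f m b "Num 0" "Get r' (Num 0)" s]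
     by (auto simp: numeral_2_eq_2 rdn_def)
    then show "\<exists>c. \<forall>x s. ext r' rdn (ext ra rdn ?R) x s -->
     (\<exists>s'. exec (ff (I (fst (fst (fst x))))) (mm (I (fst (fst (fst x))))) c s 2 s' & agree b s s' &
       rdn b s' = (if snd (fst (fst x)) = 1 then snd (fst x) else snd x))"
     by (intro exI[of _ ?c] allI impI exI conjI) (assumption, auto simp: ext_def rdn_def intro!: agree_put)
   qed simp
  qed auto
 qed
 then show ?thesis by (simp only: of_bool_eq_1_iff)
qed

lemma comp_rif:
 assumes P: "compb k R I P" and 1: "comp k R I rdr \<sigma>" and st: "stable k R"
 shows "comp k R I rdr (%x. if P x then \<sigma> x else 0)"
proof -
 have "comp k R I rdr (%x. if of_bool (P x) = (1::nat) then \<sigma> x else 0)"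
 proof (rule comp_let2[OF P 1, where g = "%x v w. if v = 1 then w else 0"])
  fix r r' k' assume st: "stable k' (ext r' rdr (ext r rdn R))"
  show "comp k' (ext r' rdr (ext r rdn R)) (%p. I (fst (fst p))) rdr (%p. if snd (fst p) = 1 then snd p else 0)"
  proof (rule comp_cmd[OF st])
   fix b
   let ?B = "Conj (Less (Num 0) (Get r (Num 0))) (Less (Get r (Num 0)) (Num 2))"
   let ?c = "Cond ?B (RAssign b (Num 0) (RGet r' (Num 0))) (RAssign b (Num 0) RZero)"
   have "exec f m ?c s 2 (put_real b 0 (if rdn r s = 1 then rdr r' s else 0) s)" for f m s
    using exec_Cond[of f m ?B s "RAssign b (Num 0) (RGet r' (Num 0))" "RAssign b (Num 0) RZero" "Suc 0"]
     exec_RAssign[of f m b "Num 0" "RGet r' (Num 0)" s] exec_RAssign[of f m b "Num 0" RZero s]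
    by (auto simp: numeral_2_eq_2 rdn_def rdr_def)
   then show "\<exists>c. \<forall>x s. ext r' rdr (ext r rdn R) x s -->
    (\<exists>s'. exec (ff (I (fst (fst x)))) (mm (I (fst (fst x)))) c s 2 s' & agree b s s' &
      rdr b s' = (if snd (fst x) = 1 then snd x else 0))"
    by (intro exI[of _ ?c] allI impI exI conjI) (assumption, auto simp: ext_def rdr_def intro!: agree_put)
  qed simp
 qed
 then show ?thesis by (simp only: of_bool_eq_1_iff)
qed

section \<open>Bipartite matchings by auctions\<close>

text \<open>The least index with \<open>P\<close>, or \<open>n\<close> if there is none, as the
  number of indices before the first hit. In this form it needs only sums and bounded
  quantifiers.\<close>

definition lst :: "nat => (nat => bool) => nat" where
 "lst n P = (\<Sum>i<n. of_bool (\<forall>j<n. j <= i --> ~ P j))"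

lemma lst_eqI:
 assumes "k < n" "P k" "!!j. j < k ==> ~ P j" shows "lst n P = k"
proof -
 have "(\<forall>j<n. j <= i --> ~ P j) \<longleftrightarrow> i < k" if "i < n" for i
  using assms that by (auto simp: not_less[symmetric])
 then have "lst n P = (\<Sum>i<n. of_bool (i < k))" unfolding lst_def by (intro sum.cong) simp_all
 also have "... = (\<Sum>i | i < n & i < k. 1)" by (simp add: sum.inter_filter[symmetric] of_bool_def)
 also have "... = k" using assms(1) by (simp add: Collect_conj_eq lessThan_def[symmetric] min_def Int_absorb1 Int_absorb2 subset_iff)
 finally show ?thesis .
qed

lemma lst_none: "(!!j. j < n ==> ~ P j) ==> lst n P = n"
 by (simp add: lst_def)

lemma lst_cases:
 obtains "lst n P = n" "!!j. j < n ==> ~ P j"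
 | "lst n P < n" "P (lst n P)" "!!j. j < lst n P ==> ~ P j"
proof (cases "\<exists>j<n. P j")
 case True
 define k where "k = (LEAST j. P j)"
 have k: "P k" "k < n" "!!j. j < k ==> ~ P j"
  using True unfolding k_def by (auto intro: LeastI dest: not_less_Least) (metis LeastI Least_le le_less_trans)
 then have "lst n P = k" by (intro lst_eqI) auto
 then show ?thesis using k that(2) by simp
qed (use that lst_none in blast)

lemma lst_less: "lst n P < n ==> P (lst n P)"
 by (rule lst_cases[of n P]) auto

lemma lst_ex: "j < n ==> P j ==> lst n P < n"
 by (rule lst_cases[of n P]) auto

definition mleft :: "nat => nat => (nat => nat) => (nat => nat) => nat" where
 "mleft nl nr act A = lst nl (%u. act u ~= 0 & (\<forall>r<nr. A r ~= u + 1))"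

definition mright :: "nat => (nat => nat) => (nat => nat) => nat => nat" where
 "mright nr adj A u = lst nr (%r. adj (u * nr + r) ~= 0 &
   (\<forall>r'<nr. adj (u * nr + r') ~= 0 --> A (nr + r) <= A (nr + r')))"

definition mcell :: "nat => nat => (nat => nat) => nat => nat => nat => nat" where
 "mcell nl nr A u r i = (if u < nl & r < nr & A (nr + r) <= nl then
   (if i = r then u + 1 else if i = nr + r then A i + 1 else A i) else A i)"

definition mnext :: "nat => nat => (nat => nat) => (nat => nat) => nat => (nat => nat) => nat => nat" where
 "mnext nl nr act adj t A i = mcell nl nr A (mleft nl nr act A) (mright nr adj A (mleft nl nr act A)) i"

text \<open>An auction: an unmatched left vertex takes a neighbour of least label, whose label then
 grows. Cells below \<open>nr\<close> hold the successor of the owner (0 if there is none), the next \<open>nr\<close> cells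
 the labels.\<close>
definition auction :: "nat => nat => (nat => nat) => (nat => nat) => nat => nat" where
 "auction nl nr act adj =
   iter (nr * (nl + 1) + 1) (%t A. tab (2 * nr) (mnext nl nr act adj t A)) (tab (2 * nr) (%_. 0))"

definition perfect :: "nat => nat => (nat => nat) => (nat => nat) => bool" where
 "perfect nl nr act A \<longleftrightarrow> (\<forall>u<nl. act u ~= 0 --> (\<exists>r<nr. A r = u + 1))"

text \<open>The fourth clause is approximate complementary slackness: the vertex held by an owner
  has a label at most one above that of any neighbour of the owner. The last clause holds because
  labels grow only while they are at most \<open>nl\<close>.\<close>

definition ainv :: "nat => nat => (nat => nat) => (nat => nat) => (nat => nat) => bool" where
 "ainv nl nr act adj A \<longleftrightarrow>
   (\<forall>r<nr. \<forall>u. A r = Suc u --> u < nl & act u ~= 0 & adj (u * nr + r) ~= 0) &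
   (\<forall>r<nr. \<forall>r'<nr. A r = A r' & A r ~= 0 --> r = r') &
   (\<forall>r<nr. A (nr + r) ~= 0 --> A r ~= 0) &
   (\<forall>r<nr. \<forall>r'<nr. \<forall>u. A r = Suc u & adj (u * nr + r') ~= 0 --> A (nr + r) <= A (nr + r') + 1) &
   (\<forall>r<nr. A (nr + r) <= nl + 1)"

lemma ainvD:
 assumes "ainv nl nr act adj A"
 shows "!!r u. r < nr ==> A r = Suc u ==> u < nl & act u ~= 0 & adj (u * nr + r) ~= 0"
  and "!!r r'. r < nr ==> r' < nr ==> A r = A r' ==> A r ~= 0 ==> r = r'"
  and "!!r. r < nr ==> A (nr + r) ~= 0 ==> A r ~= 0"
  and "!!r r' u. r < nr ==> r' < nr ==> A r = Suc u ==> adj (u * nr + r') ~= 0 ==> A (nr + r) <= A (nr + r') + 1"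
  and "!!r. r < nr ==> A (nr + r) <= nl + 1"
 using assms unfolding ainv_def by blast+

lemma ainv_step:
 fixes t
 assumes inv: "ainv nl nr act adj A"
 defines "u == mleft nl nr act A" defines "r == mright nr adj A u"
 defines "A' == tab (2 * nr) (mnext nl nr act adj t A)"
 shows "ainv nl nr act adj A'"
  and "u < nl & r < nr & A (nr + r) <= nl ==> (\<Sum>r<nr. A' (nr + r)) = (\<Sum>r<nr. A (nr + r)) + 1"
  and "~ (u < nl & r < nr & A (nr + r) <= nl) ==> \<forall>i < 2 * nr. A' i = A i"
proof -
 let ?c = "u < nl & r < nr & A (nr + r) <= nl"
 have A': "A' i = mcell nl nr A u r i" if "i < 2 * nr" for i
  using that by (simp add: A'_def tab_def mnext_def u_def r_def)
 show 3: "\<forall>i < 2 * nr. A' i = A i" if "~ ?c" using A' that by (simp add: mcell_def)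
 have own: "A' i = (if i = r then u + 1 else A i)" and lab: "A' (nr + i) = (if i = r then A (nr + r) + 1 else A (nr + i))"
  if ?c "i < nr" for i using that A'[of i] A'[of "nr + i"] by (auto simp: mcell_def)
 have u: "act u ~= 0" "!!r. r < nr ==> A r ~= u + 1" if "u < nl"
  using lst_less[of nl "%u. act u ~= 0 & (\<forall>r<nr. A r ~= u + 1)"] that
  unfolding u_def mleft_def by blast+
 have r: "adj (u * nr + r) ~= 0" "!!r'. r' < nr ==> adj (u * nr + r') ~= 0 ==> A (nr + r) <= A (nr + r')" if "r < nr"
  using lst_less[of nr "%r. adj (u * nr + r) ~= 0 &
   (\<forall>r'<nr. adj (u * nr + r') ~= 0 --> A (nr + r) <= A (nr + r'))"] that
  unfolding r_def mright_def by blast+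
 show "(\<Sum>r<nr. A' (nr + r)) = (\<Sum>r<nr. A (nr + r)) + 1" if ?c
 proof -
  have "(\<Sum>i<nr. A' (nr + i)) = (\<Sum>i<nr. A (nr + i) + of_bool (i = r))"
   using lab[OF that] by (intro sum.cong) auto
  also have "... = (\<Sum>i<nr. A (nr + i)) + 1" using that by (simp add: sum.distrib of_bool_def)
  finally show ?thesis .
 qed
 show "ainv nl nr act adj A'"
 proof (cases ?c)
  case False
  with 3 inv show ?thesis unfolding ainv_def by simp
 next
  case True
  note i = ainvD[OF inv]
  have 1: "\<forall>r'<nr. \<forall>v. A' r' = Suc v --> v < nl & act v ~= 0 & adj (v * nr + r') ~= 0"
  proof (intro allI impI)
   fix a v assume a: "a < nr" "A' a = Suc v"
   show "v < nl & act v ~= 0 & adj (v * nr + a) ~= 0"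
   proof (cases "a = r")
    case True': True
    then have "v = u" using own[OF True a(1)] a(2) by simp
    then show ?thesis using True True' u(1) r(1) by blast
   next
    case False
    then show ?thesis using own[OF True a(1)] a i(1)[of a v] by presburger
   qed
  qed
  have 2: "\<forall>a<nr. \<forall>b<nr. A' a = A' b & A' a ~= 0 --> a = b"
  proof (intro allI impI)
   fix a b assume ab: "a < nr" "b < nr" "A' a = A' b & A' a ~= 0"
   show "a = b"
    using ab own[OF True ab(1)] own[OF True ab(2)] u(2)[OF conjunct1[OF True] ab(1)] u(2)[OF conjunct1[OF True] ab(2)] i(2)[OF ab(1,2)]
    by metis
  qed
  have 3: "\<forall>a<nr. A' (nr + a) ~= 0 --> A' a ~= 0"
   using own[OF True] lab[OF True] i(3) by (metis Suc_eq_plus1 nat.distinct(1))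
  have 4: "\<forall>a<nr. \<forall>b<nr. \<forall>v. A' a = Suc v & adj (v * nr + b) ~= 0 --> A' (nr + a) <= A' (nr + b) + 1"
  proof (intro allI impI)
   fix a b v assume ab: "a < nr" "b < nr" "A' a = Suc v & adj (v * nr + b) ~= 0"
   have mono: "A (nr + b) <= A' (nr + b)" using lab[OF True ab(2)] by auto
   show "A' (nr + a) <= A' (nr + b) + 1"
   proof (cases "a = r")
    case True': True
    then have "v = u" using own[OF True ab(1)] ab(3) by simp
    then have "A (nr + r) <= A (nr + b)" using r(2) True ab by auto
    then show ?thesis using lab[OF True ab(1)] True' mono by simp
   next
    case False
    then have "A (nr + a) <= A (nr + b) + 1" using own[OF True ab(1)] ab i(4)[of a b v] by simp
    then show ?thesis using lab[OF True ab(1)] False mono by simp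
   qed
  qed
  have 5: "\<forall>a<nr. A' (nr + a) <= nl + 1" using lab[OF True] True i(5) by simp
  show ?thesis unfolding ainv_def using 1 2 3 4 5 by blast
 qed
qed

text \<open>Every live round raises the sum of the labels by one, and this sum never exceeds
  \<open>nr * (nl + 1)\<close>; a round that is not live leaves the state unchanged. With one round
  more than this bound the auction has come to rest.\<close>

lemma auction_stuck:
 fixes nl nr act adj defines "A == auction nl nr act adj"
 shows "ainv nl nr act adj A"
  and "~ (mleft nl nr act A < nl & mright nr adj A (mleft nl nr act A) < nr &
     A (nr + mright nr adj A (mleft nl nr act A)) <= nl)"
proof -
 define F where "F t A = tab (2 * nr) (mnext nl nr act adj t A)" for t A
 define X where "X t = iter t F (tab (2 * nr) (%_. 0))" for t
 define live where "live A \<longleftrightarrow> mleft nl nr act A < nl & mright nr adj A (mleft nl nr act A) < nr &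
     A (nr + mright nr adj A (mleft nl nr act A)) <= nl" for A
 have X: "X (Suc t) = tab (2 * nr) (mnext nl nr act adj t (X t))" "X 0 = tab (2 * nr) (%_. 0)" for t
  by (simp_all add: X_def F_def)
 have inv: "ainv nl nr act adj (X t)" for t
 proof (induction t)
  case 0 show ?case by (auto simp: X ainv_def tab_def)
 next
  case (Suc t) then show ?case unfolding X(1) by (rule ainv_step(1))
 qed
 have fix_pt: "X (Suc t) = X t" if "~ live (X t)" for t
 proof -
  have "X t i = tab (2 * nr) (X t) i" for i by (cases t) (auto simp: X tab_def)
  moreover have "X (Suc t) i = tab (2 * nr) (X t) i" for i
   using ainv_step(3)[OF inv[of t], of t] that unfolding live_def X(1) by (auto simp: tab_def)
  ultimately show ?thesis by auto
 qed
 have "live (X t) ==> (\<Sum>r<nr. X t (nr + r)) = t" for t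
 proof (induction t)
  case 0 show ?case by (simp add: X tab_def)
 next
  case (Suc t)
  then have "live (X t)" using fix_pt[of t] by metis
  then have "(\<Sum>r<nr. X (Suc t) (nr + r)) = (\<Sum>r<nr. X t (nr + r)) + 1"
   unfolding X(1) live_def by (intro ainv_step(2) inv)
  then show ?case using Suc.IH \<open>live (X t)\<close> by simp
 qed
 moreover have "(\<Sum>r<nr. X t (nr + r)) <= nr * (nl + 1)" for t
  using sum_bounded_above[of "{..<nr}" "%r. X t (nr + r)" "nl + 1"] inv[of t] by (simp add: ainv_def)
 ultimately have "~ live (X (nr * (nl + 1) + 1))" by (metis add.commute less_add_one linorder_not_less)
 moreover have "A = X (nr * (nl + 1) + 1)" by (simp only: A_def auction_def X_def F_def[abs_def])
 ultimately show "ainv nl nr act adj A" "~ (mleft nl nr act A < nl & mright nr adj A (mleft nl nr act A) < nr &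
     A (nr + mright nr adj A (mleft nl nr act A)) <= nl)" using inv by (auto simp: live_def)
qed

lemma auction_owner:
 assumes "r < nr" "auction nl nr act adj r = Suc u"
 shows "u < nl" "act u ~= 0" "adj (u * nr + r) ~= 0"
 using auction_stuck(1)[of nl nr act adj] assms unfolding ainv_def by blast+

lemma auction_inj:
 assumes "r < nr" "r' < nr" "auction nl nr act adj r = Suc u" "auction nl nr act adj r' = Suc u"
 shows "r = r'"
 using auction_stuck(1)[of nl nr act adj] assms unfolding ainv_def by (metis nat.distinct(1))

text \<open>If the active vertex \<open>u\<close> is unmatched at rest, all its neighbours have
  labels above \<open>nl\<close>. Positive labels belong to owned vertices, of which there are fewer
  than \<open>nl\<close>, so some \<open>k\<close> between 1 and \<open>nl\<close> is not a label.
  By slackness and this gap, \<open>u\<close> and the owners of vertices with label above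
  \<open>k\<close> have all their neighbours above \<open>k\<close>. These neighbours are all owned
  by the latter, so they are too few for Hall's condition.\<close>

lemma auction_perfect:
 assumes hall: "!!U. U \<subseteq> {u. u < nl & act u ~= 0} ==> card U <= card {r. r < nr & (\<exists>u\<in>U. adj (u * nr + r) ~= 0)}"
 shows "perfect nl nr act (auction nl nr act adj)"
proof (rule ccontr)
 define A where "A = auction nl nr act adj"
 note st = auction_stuck[of nl nr act adj, folded A_def]
 note i = ainvD[OF st(1)]
 assume "~ perfect nl nr act (auction nl nr act adj)"
 then have ex: "\<exists>u<nl. act u ~= 0 & (\<forall>r<nr. A r ~= u + 1)" by (auto simp: perfect_def A_def)
 define u where "u = mleft nl nr act A"
 have "u < nl" using ex lst_ex[of _ nl "%u. act u ~= 0 & (\<forall>r<nr. A r ~= u + 1)"]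
  unfolding u_def mleft_def by blast
 moreover from this have "act u ~= 0 & (\<forall>r<nr. A r ~= u + 1)" unfolding u_def mleft_def by (rule lst_less)
 ultimately have u: "u < nl" "act u ~= 0" "!!r. r < nr ==> A r ~= u + 1" by blast+
 define N where "N = {r. r < nr & adj (u * nr + r) ~= 0}"
 have big: "A (nr + r) > nl" if "r \<in> N" for r
 proof -
  have fin: "finite N" "N ~= {}" using that by (auto simp: N_def)
  let ?P = "%r. adj (u * nr + r) ~= 0 & (\<forall>r'<nr. adj (u * nr + r') ~= 0 --> A (nr + r) <= A (nr + r'))"
  define r0 where "r0 = arg_min_on (%r. A (nr + r)) N"
  have "r0 < nr" "?P r0"
   using arg_min_if_finite(1)[OF fin, of "%r. A (nr + r)"] arg_min_least[OF fin, of _ "%r. A (nr + r)"]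
   unfolding r0_def[symmetric] by (auto simp: N_def)
  then have "mright nr adj A u < nr" unfolding mright_def by (rule lst_ex)
  moreover from this have "?P (mright nr adj A u)" unfolding mright_def by (rule lst_less)
  ultimately have "A (nr + mright nr adj A u) > nl" "A (nr + mright nr adj A u) <= A (nr + r)"
   using st(2) u(1) that unfolding u_def[symmetric] N_def by auto
  then show ?thesis by simp
 qed
 define Lb where "Lb = (%r. A (nr + r)) ` {r. r < nr & A (nr + r) ~= 0}"
 have "card Lb <= card {r. r < nr & A r ~= 0}"
 proof -
  have "{r. r < nr & A (nr + r) ~= 0} \<subseteq> {r. r < nr & A r ~= 0}" using i(3) by blast
  then show ?thesis unfolding Lb_def by (intro order_trans[OF card_image_le card_mono]) simp_all
 qed
 also have "... <= card ({..<nl} - {u})"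
 proof (rule card_inj_on_le[where f = "%r. A r - 1"])
  show "inj_on (%r. A r - 1) {r. r < nr & A r ~= 0}"
  proof (rule inj_onI)
   fix a b assume ab: "a \<in> {r. r < nr & A r ~= 0}" "b \<in> {r. r < nr & A r ~= 0}" "A a - 1 = A b - 1"
   from ab have "A a = A b" by (cases "A a"; cases "A b") simp_all
   then show "a = b" using i(2)[of a b] ab(1,2) by simp
  qed
  show "(%r. A r - 1) ` {r. r < nr & A r ~= 0} \<subseteq> {..<nl} - {u}"
  proof (rule image_subsetI)
   fix r assume "r \<in> {r. r < nr & A r ~= 0}"
   then have r: "r < nr" "A r = Suc (A r - 1)" by auto
   show "A r - 1 \<in> {..<nl} - {u}" using i(1)[OF r] u(3)[OF r(1)] r(2) by auto
  qed
 qed simp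
 also have "... < card {1..nl}" using u(1) by simp
 finally have lt: "card Lb < card {1..nl}" .
 have "finite Lb" by (simp add: Lb_def)
 then have "~ {1..nl} \<subseteq> Lb" using card_mono[of Lb "{1..nl}"] lt by linarith
 then obtain k where k: "1 <= k" "k <= nl" "k \<notin> Lb" by (meson atLeastAtMost_iff subsetI)
 have gap: "A (nr + r) ~= k" if "r < nr" for r
 proof
  assume "A (nr + r) = k"
  with that k(1) have "k \<in> Lb" unfolding Lb_def by (intro image_eqI[of _ _ r]) auto
  with k(3) show False by simp
 qed
 define W where "W = {u'. \<exists>r<nr. A r = Suc u' & A (nr + r) > k}"
 have W: "W \<subseteq> {u. u < nl & act u ~= 0}" "u \<notin> W" using i(1) u(3) by (auto simp: W_def)
 have finW: "finite W" by (rule finite_subset[OF W(1)]) auto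
 have N: "{r. r < nr & (\<exists>u'\<in>insert u W. adj (u' * nr + r) ~= 0)} \<subseteq> {r. r < nr & A (nr + r) > k}"
 proof safe
  fix r u' assume "r < nr" "u' \<in> W" "0 < adj (u' * nr + r)"
  then obtain r' where r': "r' < nr" "A r' = Suc u'" "A (nr + r') > k" by (auto simp: W_def)
  then have "A (nr + r') <= A (nr + r) + 1" using i(4)[of r' r u'] \<open>r < nr\<close> \<open>0 < adj (u' * nr + r)\<close> by simp
  then show "k < A (nr + r)" using r'(3) gap[OF \<open>r < nr\<close>] by simp
 next
  fix r assume "r < nr" "0 < adj (u * nr + r)"
  then show "k < A (nr + r)" using big[of r] k(2) by (simp add: N_def)
 qed
 have "card {r. r < nr & A (nr + r) > k} <= card W"
 proof (rule card_inj_on_le[where f = "%r. A r - 1", OF _ _ finW])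
  show "inj_on (%r. A r - 1) {r. r < nr & A (nr + r) > k}"
  proof (rule inj_onI)
   fix a b assume ab: "a \<in> {r. r < nr & A (nr + r) > k}" "b \<in> {r. r < nr & A (nr + r) > k}" "A a - 1 = A b - 1"
   then have "A a ~= 0" "A b ~= 0" using i(3)[of a] i(3)[of b] by fastforce+
   with ab(3) have eq: "A a = A b" by (cases "A a"; cases "A b") simp_all
   with \<open>A a ~= 0\<close> show "a = b" using i(2)[of a b] ab(1,2) by simp
  qed
  show "(%r. A r - 1) ` {r. r < nr & A (nr + r) > k} \<subseteq> W"
  proof (rule image_subsetI)
   fix r assume "r \<in> {r. r < nr & A (nr + r) > k}"
   then have r: "r < nr" "k < A (nr + r)" by auto
   then have "A r ~= 0" using i(3)[of r] by linarith
   then have "A r = Suc (A r - 1)" by simp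
   then show "A r - 1 \<in> W" using r unfolding W_def by blast
  qed
 qed
 moreover have "card {r. r < nr & (\<exists>u'\<in>insert u W. adj (u' * nr + r) ~= 0)} <= card {r. r < nr & A (nr + r) > k}"
  by (rule card_mono[OF _ N]) simp
 moreover have "card (insert u W) = Suc (card W)" using W finW by simp
 ultimately show False using hall[of "insert u W"] W u by simp
qed

section \<open>Concentration and chains of bad events\<close>

lemma exp_le_linear: assumes "0 <= x" "x <= (1::real)" shows "exp x <= 1 + 2 * x"
proof -
 have "x\<^sup>2 <= x" using assms by (simp add: power2_eq_square mult_left_le)
 then show ?thesis using exp_bound[of x] assms by simp
qed

text \<open>The summands share the coordinate \<open>k\<close>, so the value \<open>v\<close> of
  this coordinate is fixed by a factor \<open>indicator {v}\<close>; then the exponential moment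
  factorises over the coordinates without conditional distributions. Each factor is estimated by
  \<open>exp y <= 1 + 2 * y\<close> on the unit interval, which gives the factor 2 in front of the
  mean.\<close>

lemma chernoff_Pi_pmf:
 fixes h :: "'i => 'v => 'v => real"
 assumes fin: "finite A" "!!i. i \<in> A ==> finite (set_pmf (p i))" and J: "J \<subseteq> A" "k \<in> A" "k \<notin> J"
  and h: "!!i v x. i \<in> J ==> 0 <= h i v x" "!!i v x. i \<in> J ==> h i v x <= 1"
  and mu: "!!v. v \<in> set_pmf (p k) ==> (\<Sum>i\<in>J. mexp (p i) (h i v)) <= \<mu>"
 shows "mprob (Pi_pmf A d p) {x. (\<Sum>i\<in>J. h i (x k) (x i)) \<ge> z} <= exp (2 * \<mu> - z)"
proof -
 let ?P = "Pi_pmf A d p"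
 have finP: "finite (set_pmf ?P)"
  by (rule finite_subset[OF set_Pi_pmf_subset'[OF fin(1)]]) (use fin in \<open>auto intro: finite_PiE_dflt\<close>)
 have finJ: "finite J" using J fin finite_subset by blast
 have int: "integrable (measure_pmf ?P) g" for g :: "('i => 'v) => real"
  by (rule integrable_measure_pmf_finite[OF finP])
 have *: "mexp ?P (%x. indicator {v} (x k) * exp (\<Sum>i\<in>J. h i v (x i))) <= pmf (p k) v * exp (2 * \<mu>)"
  if v: "v \<in> set_pmf (p k)" for v
 proof -
  define g where "g i y = (if i = k then indicator {v} y else if i \<in> J then exp (h i v y) else 1)" for i y
  have "indicator {v} (x k) * exp (\<Sum>i\<in>J. h i v (x i)) = (\<Prod>i\<in>A. g i (x i))" for x
  proof -
   have "(\<Prod>i\<in>A. g i (x i)) = g k (x k) * (\<Prod>i\<in>A - {k}. g i (x i))" using J fin by (simp add: prod.remove)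
   also have "(\<Prod>i\<in>A - {k}. g i (x i)) = (\<Prod>i\<in>J. g i (x i))"
    using J fin by (intro prod.mono_neutral_right) (auto simp: g_def)
   also have "... = (\<Prod>i\<in>J. exp (h i v (x i)))" using J by (intro prod.cong) (auto simp: g_def)
   finally show ?thesis using finJ by (simp add: g_def exp_sum)
  qed
  then have "mexp ?P (%x. indicator {v} (x k) * exp (\<Sum>i\<in>J. h i v (x i)))
   = mexp ?P (%x. \<Prod>i\<in>A. g i (x i))" by simp
  also have "... = (\<Prod>i\<in>A. mexp (p i) (g i))"
   using fin by (intro expectation_prod_Pi_pmf integrable_measure_pmf_finite) (auto simp: g_def)
  also have "... = mexp (p k) (g k) * (\<Prod>i\<in>A - {k}. mexp (p i) (g i))"
   using J fin by (simp add: prod.remove)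
  also have "(\<Prod>i\<in>A - {k}. mexp (p i) (g i)) = (\<Prod>i\<in>J. mexp (p i) (g i))"
   using J fin by (intro prod.mono_neutral_right) (auto simp: g_def[abs_def])
  finally have eq: "mexp ?P (%x. indicator {v} (x k) * exp (\<Sum>i\<in>J. h i v (x i)))
   = mexp (p k) (g k) * (\<Prod>i\<in>J. mexp (p i) (g i))" .
  have "(\<Prod>i\<in>J. mexp (p i) (g i)) <= (\<Prod>i\<in>J. exp (2 * mexp (p i) (h i v)))"
  proof (intro prod_mono conjI)
   fix i assume i: "i \<in> J"
   then have g: "g i = (%y. exp (h i v y))" using J by (auto simp: g_def)
   have fi: "finite (set_pmf (p i))" using fin J i by auto
   show "0 <= mexp (p i) (g i)" by (simp add: g)
   have "mexp (p i) (g i) <= mexp (p i) (%y. 1 + 2 * h i v y)"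
    unfolding g using h i by (intro integral_mono integrable_measure_pmf_finite fi exp_le_linear) auto
   also have "... = 1 + 2 * mexp (p i) (h i v)"
    using fi by (simp add: integrable_measure_pmf_finite)
   also have "... <= exp (2 * mexp (p i) (h i v))" by (rule exp_ge_add_one_self)
   finally show "mexp (p i) (g i) <= exp (2 * mexp (p i) (h i v))" .
  qed
  also have "... = exp (2 * (\<Sum>i\<in>J. mexp (p i) (h i v)))"
   using finJ by (simp add: exp_sum sum_distrib_left)
  also have "... <= exp (2 * \<mu>)" using mu[OF v] by simp
  finally have le: "(\<Prod>i\<in>J. mexp (p i) (g i)) <= exp (2 * \<mu>)" .
  have "mexp (p k) (g k) = pmf (p k) v"
  proof -
   have "g k = indicator {v}" by (auto simp: g_def)
   then show ?thesis by (simp add: measure_pmf_single)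
  qed
  with eq le show ?thesis by (simp add: mult_left_mono)
 qed
 have xk: "x k \<in> set_pmf (p k)" if "x \<in> set_pmf ?P" for x
  using that J by (simp add: set_Pi_pmf[OF fin(1)] PiE_dflt_def)
 have "mprob ?P {x. (\<Sum>i\<in>J. h i (x k) (x i)) \<ge> z} = mexp ?P (indicator {x. (\<Sum>i\<in>J. h i (x k) (x i)) \<ge> z})"
  by simp
 also have "... <= mexp ?P (%x. \<Sum>v\<in>set_pmf (p k). indicator {v} (x k) * exp (\<Sum>i\<in>J. h i v (x i)) * exp (- z))"
 proof (rule integral_mono_AE[OF int int], rule AE_pmfI)
  fix x assume x: "x \<in> set_pmf ?P"
  have "(\<Sum>v\<in>set_pmf (p k). indicator {v} (x k) * exp (\<Sum>i\<in>J. h i v (x i)) * exp (- z))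
   = (\<Sum>v\<in>{x k}. indicator {v} (x k) * exp (\<Sum>i\<in>J. h i v (x i)) * exp (- z))"
   using fin J xk[OF x] by (intro sum.mono_neutral_right) (auto simp: indicator_def)
  also have "... = exp ((\<Sum>i\<in>J. h i (x k) (x i)) - z)" by (simp add: exp_diff exp_minus field_simps)
  finally show "indicator {x. (\<Sum>i\<in>J. h i (x k) (x i)) \<ge> z} x
   <= (\<Sum>v\<in>set_pmf (p k). indicator {v} (x k) * exp (\<Sum>i\<in>J. h i v (x i)) * exp (- z))"
   by (auto simp: indicator_def)
 qed
 also have "... = (\<Sum>v\<in>set_pmf (p k). mexp ?P (%x. indicator {v} (x k) * exp (\<Sum>i\<in>J. h i v (x i)))) * exp (- z)"
  by (subst Bochner_Integration.integral_sum) (auto simp: int sum_distrib_right)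
 also have "... <= (\<Sum>v\<in>set_pmf (p k). pmf (p k) v * exp (2 * \<mu>)) * exp (- z)"
  by (intro mult_right_mono sum_mono *) auto
 also have "... = exp (2 * \<mu> - z)"
  using fin J sum_pmf_eq_1[of "set_pmf (p k)" "p k"] by (simp add: sum_distrib_right[symmetric] exp_diff exp_minus field_simps)
 finally show ?thesis .
qed

section \<open>Chains of independent bad events\<close>

definition depends_on :: "'i set => (('i => 'v) => bool) => bool" where
 "depends_on N E \<longleftrightarrow> (\<forall>x y. (\<forall>i\<in>N. x i = y i) --> E x = E y)"

lemma prob_indep_Pi_pmf:
 assumes fin: "finite A" and E: "depends_on N E" and F: "depends_on (- N) F"
 shows "mprob (Pi_pmf A d p) {x. E x & F x} = mprob (Pi_pmf A d p) {x. E x} * mprob (Pi_pmf A d p) {x. F x}"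
proof -
 define B where "B = A \<inter> N" define C where "C = A - N"
 have BC: "finite B" "finite C" "B \<inter> C = {}" "B \<union> C = A" using fin by (auto simp: B_def C_def)
 let ?m = "%(f, g) x. if x \<in> B then f x else g x"
 let ?Q = "pair_pmf (Pi_pmf B d p) (Pi_pmf C d p)"
 have P: "Pi_pmf A d p = map_pmf ?m ?Q" using Pi_pmf_union[OF BC(1-3), of d p] BC(4) by (simp add: map_pmf_def case_prod_beta)
 have sB: "f i = d" if "f \<in> set_pmf (Pi_pmf B d p)" "i \<notin> B" for f i
  using set_Pi_pmf_subset[OF BC(1), of d p] that by auto
 have sC: "f i = d" if "f \<in> set_pmf (Pi_pmf C d p)" "i \<notin> C" for f i
  using set_Pi_pmf_subset[OF BC(2), of d p] that by auto
 have e: "E (?m z) = E (fst z)" if "z \<in> set_pmf ?Q" for z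
  using that sB[of "fst z"] sC[of "snd z"] unfolding B_def C_def by (cases z) (auto intro!: E[unfolded depends_on_def, rule_format])
 have f: "F (?m z) = F (snd z)" if "z \<in> set_pmf ?Q" for z
  using that sB[of "fst z"] sC[of "snd z"] unfolding B_def C_def by (cases z) (auto intro!: F[unfolded depends_on_def, rule_format])
 have 1: "mprob (Pi_pmf A d p) {x. G x} = mprob ?Q {z. H z}"
  if "!!z. z \<in> set_pmf ?Q ==> G (?m z) = H z" for G H
  unfolding P measure_map_pmf using that by (intro measure_pmf.finite_measure_eq_AE AE_pmfI) auto
 have "mprob (Pi_pmf A d p) {x. E x & F x} = mprob ?Q {z. E (fst z) & F (snd z)}"
  by (rule 1) (use e f in auto)
 also have "... = mprob ?Q (({x. E x} \<inter> set_pmf (Pi_pmf B d p)) \<times> ({x. F x} \<inter> set_pmf (Pi_pmf C d p)))"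
  by (intro measure_pmf.finite_measure_eq_AE AE_pmfI) auto
 also have "... = mprob (Pi_pmf B d p) {x. E x} * mprob (Pi_pmf C d p) {x. F x}"
  by (subst measure_pmf_prob_product) (auto simp: measure_Int_set_pmf)
 also have "mprob (Pi_pmf B d p) {x. E x} = mprob ?Q {z. E (fst z)}"
  using measure_map_pmf[of fst ?Q "{x. E x}"] by (simp add: map_fst_pair_pmf vimage_def)
 also have "... = mprob (Pi_pmf A d p) {x. E x}" by (rule 1[symmetric]) (rule e)
 also have "mprob (Pi_pmf C d p) {x. F x} = mprob ?Q {z. F (snd z)}"
  using measure_map_pmf[of snd ?Q "{x. F x}"] by (simp add: map_snd_pair_pmf vimage_def)
 also have "... = mprob (Pi_pmf A d p) {x. F x}" by (rule 1[symmetric]) (rule f)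
 finally show ?thesis .
qed

text \<open>Elements without conflict look at disjoint sets of coordinates, so the head of the list
  is independent of all the rest and contributes one factor.\<close>

lemma prob_all_bad:
 fixes bad :: "('i => 'v) => 'c => bool" and N :: "'c => 'i set"
 assumes fin: "finite A"
  and dep: "!!c. c \<in> V ==> depends_on (N c) (%x. bad x c)"
  and cf: "!!c c'. c \<in> V ==> c' \<in> V ==> ~ cf c c' ==> N c \<inter> N c' = {}"
  and pr: "!!c. c \<in> V ==> mprob (Pi_pmf A d p) {x. bad x c} <= \<rho>" and rho: "0 <= \<rho>"
  and "set F \<subseteq> V" "sorted_wrt (%c f. ~ cf f c) F"
 shows "mprob (Pi_pmf A d p) {x. \<forall>f\<in>set F. bad x f} <= \<rho> ^ length F"
 using assms(6,7)
proof (induction F)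
 case (Cons c F)
 have "depends_on (- N c) (%x. \<forall>f\<in>set F. bad x f)"
  unfolding depends_on_def
 proof (intro allI impI)
  fix x y :: "'i => 'v" assume xy: "\<forall>i\<in>- N c. x i = y i"
  have "bad x f = bad y f" if "f \<in> set F" for f
  proof -
   have "N f \<inter> N c = {}" using cf[of f c] Cons.prems that by auto
   then show ?thesis using dep[of f] Cons.prems(1) that xy unfolding depends_on_def by (auto simp: subset_iff disjoint_iff)
  qed
  then show "(\<forall>f\<in>set F. bad x f) = (\<forall>f\<in>set F. bad y f)" by blast
 qed
 then have "mprob (Pi_pmf A d p) {x. bad x c & (\<forall>f\<in>set F. bad x f)} = mprob (Pi_pmf A d p) {x. bad x c} * mprob (Pi_pmf A d p) {x. \<forall>f\<in>set F. bad x f}"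
  using Cons.prems(1) dep[of c] by (intro prob_indep_Pi_pmf[OF fin]) auto
 also have "... <= \<rho> * \<rho> ^ length F" using Cons rho pr[of c] by (intro mult_mono) auto
 finally show ?case by simp
qed simp

text \<open>Weighted number of ways to extend \<open>F\<close> by \<open>q\<close> bad elements, each of them in no conflict with
 the earlier ones.\<close>
primrec chains :: "'c set => ('c => 'c => bool) => ('c list => 'c => real) => ('c => bool) => nat => 'c list => real" where
 "chains V cf wt bad 0 F = 1"
| "chains V cf wt bad (Suc q) F = (\<Sum>c\<in>V. if bad c & (\<forall>f\<in>set F. ~ cf f c) then wt F c * chains V cf wt bad q (c # F) else 0)"

text \<open>Every element of a chain contributes a factor \<open>\<rho>\<close> for being bad, by
  independence, and a factor for the total weight of its possible choices: \<open>W0\<close> for the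
  first element and \<open>W\<close> for every later one.\<close>

lemma expectation_chains:
 fixes bad :: "('i => 'v) => 'c => bool" and N :: "'c => 'i set"
 assumes fin: "finite A" "!!i. i \<in> A ==> finite (set_pmf (p i))" "finite V"
  and dep: "!!c. c \<in> V ==> depends_on (N c) (%x. bad x c)"
  and cf: "!!c c'. c \<in> V ==> c' \<in> V ==> ~ cf c c' ==> N c \<inter> N c' = {}"
  and pr: "!!c. c \<in> V ==> mprob (Pi_pmf A d p) {x. bad x c} <= \<rho>"
  and wt: "!!F c. 0 <= wt F c" "!!F. set F \<subseteq> V ==> F ~= [] ==> length F <= Q ==> (\<Sum>c\<in>V. wt F c) <= W" "0 <= W" "(\<Sum>c\<in>V. wt [] c) <= W0"
  and "q <= Q" and rho: "0 <= \<rho>"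
 shows "mexp (Pi_pmf A d p) (%x. chains V cf wt (bad x) (Suc q) []) <= \<rho> ^ Suc q * (W0 * W ^ q)"
proof -
 let ?P = "Pi_pmf A d p"
 have finP: "finite (set_pmf ?P)"
  by (rule finite_subset[OF set_Pi_pmf_subset'[OF fin(1)]]) (use fin in \<open>auto intro: finite_PiE_dflt\<close>)
 have int: "integrable (measure_pmf ?P) g" for g :: "('i => 'v) => real"
  by (rule integrable_measure_pmf_finite[OF finP])
 have base: "mprob ?P {x. \<forall>f\<in>set F. bad x f} <= \<rho> ^ length F"
  if "set F \<subseteq> V" "sorted_wrt (%c f. ~ cf f c) F" for F
  using that by (intro prob_all_bad[OF fin(1) dep cf pr rho]) auto
 have ifE: "mexp ?P (%x. if b then w * g x else 0) = (if b then w * mexp ?P g else 0)"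
  for b and w :: real and g by (cases b) auto
 \<comment> \<open>The recursion tests only the new element for badness, so the event that all of
   \<open>F\<close> is bad is carried along and absorbs one test in every step.\<close>
 have main: "mexp ?P (%x. of_bool (\<forall>f\<in>set F. bad x f) * chains V cf wt (bad x) q F) <= \<rho> ^ (length F + q) * W ^ q"
  if "set F \<subseteq> V" "F ~= []" "sorted_wrt (%c f. ~ cf f c) F" "length F + q <= Suc Q" for F q using that
 proof (induction q arbitrary: F)
  case 0
  have "(%x. of_bool (\<forall>f\<in>set F. bad x f)) = (indicator {x. \<forall>f\<in>set F. bad x f} :: _ => real)" by (auto simp: indicator_def)
  then show ?case using base[of F] 0 by simp
 next
  case (Suc q)
  have "mexp ?P (%x. of_bool (\<forall>f\<in>set F. bad x f) * chains V cf wt (bad x) (Suc q) F)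
   = mexp ?P (%x. \<Sum>c\<in>V. if \<forall>f\<in>set F. ~ cf f c then wt F c * (of_bool (\<forall>f\<in>set (c # F). bad x f) * chains V cf wt (bad x) q (c # F)) else 0)"
  proof (intro Bochner_Integration.integral_cong refl)
   fix x
   show "of_bool (\<forall>f\<in>set F. bad x f) * chains V cf wt (bad x) (Suc q) F = (\<Sum>c\<in>V. if \<forall>f\<in>set F. ~ cf f c then wt F c * (of_bool (\<forall>f\<in>set (c # F). bad x f) * chains V cf wt (bad x) q (c # F)) else 0)"
    unfolding chains.simps sum_distrib_left by (rule sum.cong) auto
  qed
  also have "... = (\<Sum>c\<in>V. if \<forall>f\<in>set F. ~ cf f c then wt F c * mexp ?P (%x. of_bool (\<forall>f\<in>set (c # F). bad x f) * chains V cf wt (bad x) q (c # F)) else 0)"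
   by (subst Bochner_Integration.integral_sum[OF int], rule sum.cong[OF refl], rule ifE)
  also have "... <= (\<Sum>c\<in>V. wt F c * (\<rho> ^ (length F + Suc q) * W ^ q))"
  proof (rule sum_mono)
   fix c assume c: "c \<in> V"
   show "(if \<forall>f\<in>set F. ~ cf f c then wt F c * mexp ?P (%x. of_bool (\<forall>f\<in>set (c # F). bad x f) * chains V cf wt (bad x) q (c # F)) else 0)
    <= wt F c * (\<rho> ^ (length F + Suc q) * W ^ q)"
   proof (cases "\<forall>f\<in>set F. ~ cf f c")
    case True
    then have "mexp ?P (%x. of_bool (\<forall>f\<in>set (c # F). bad x f) * chains V cf wt (bad x) q (c # F)) <= \<rho> ^ (length (c # F) + q) * W ^ q"
     using Suc.prems c by (intro Suc.IH) auto
    then show ?thesis using True wt(1) by (auto intro: mult_left_mono simp del: set_simps)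
   next
    case False
    then show ?thesis using wt(1,3) rho by auto
   qed
  qed
  also have "... = (\<Sum>c\<in>V. wt F c) * (\<rho> ^ (length F + Suc q) * W ^ q)" by (simp add: sum_distrib_right)
  also have "... <= W * (\<rho> ^ (length F + Suc q) * W ^ q)"
   using Suc.prems wt rho by (intro mult_right_mono mult_nonneg_nonneg zero_le_power) (cases F, auto)+
  finally show ?case by (simp add: algebra_simps)
 qed
 have "mexp ?P (%x. chains V cf wt (bad x) (Suc q) [])
  = mexp ?P (%x. \<Sum>c\<in>V. wt [] c * (of_bool (\<forall>f\<in>set [c]. bad x f) * chains V cf wt (bad x) q [c]))"
  by (intro Bochner_Integration.integral_cong refl) (auto intro!: sum.cong)
 also have "... = (\<Sum>c\<in>V. wt [] c * mexp ?P (%x. of_bool (\<forall>f\<in>set [c]. bad x f) * chains V cf wt (bad x) q [c]))"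
  by (subst Bochner_Integration.integral_sum[OF int]) (auto intro!: sum.cong simp del: set_simps)
 also have "... <= (\<Sum>c\<in>V. wt [] c * (\<rho> ^ Suc q * W ^ q))"
 proof (intro sum_mono mult_left_mono wt)
  fix c assume "c \<in> V"
  then show "mexp ?P (%x. of_bool (\<forall>f\<in>set [c]. bad x f) * chains V cf wt (bad x) q [c]) <= \<rho> ^ Suc q * W ^ q"
   using main[of "[c]" q] \<open>q <= Q\<close> by simp
 qed
 also have "... = (\<Sum>c\<in>V. wt [] c) * (\<rho> ^ Suc q * W ^ q)" by (simp add: sum_distrib_right)
 also have "... <= W0 * (\<rho> ^ Suc q * W ^ q)"
  using wt rho by (intro mult_right_mono mult_nonneg_nonneg zero_le_power) auto
 finally show ?thesis by (simp add: algebra_simps)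
qed

text \<open>The deterministic counterpart of \<open>expectation_chains\<close>: where every
  admissible chain shorter than \<open>Q\<close> can be prolonged with weight
  \<open>\<delta>\<close>, many chains exist, which by Markov's inequality is a rare event.\<close>

lemma chains_lower:
 assumes V: "finite V" and wt: "!!F c. 0 <= wt F c" and "0 <= \<delta>"
  and step: "!!F. Inv F ==> length F < Q ==> \<delta> <= (\<Sum>c\<in>{c\<in>V. bad c & (\<forall>f\<in>set F. ~ cf f c) & Inv (c # F)}. wt F c)"
 shows "Inv F ==> length F + q <= Q ==> \<delta> ^ q <= chains V cf wt bad q F"
proof (induction q arbitrary: F)
 case (Suc q)
 have nn: "0 <= chains V cf wt bad q F" for q F by (induction q arbitrary: F) (auto intro!: sum_nonneg mult_nonneg_nonneg wt)
 let ?C = "{c\<in>V. bad c & (\<forall>f\<in>set F. ~ cf f c) & Inv (c # F)}"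
 have "\<delta> ^ Suc q <= (\<Sum>c\<in>?C. wt F c) * \<delta> ^ q"
  using step[of F] Suc.prems \<open>0 <= \<delta>\<close> by (simp add: mult_right_mono)
 also have "... = (\<Sum>c\<in>?C. wt F c * \<delta> ^ q)" by (simp add: sum_distrib_right)
 also have "... <= (\<Sum>c\<in>?C. wt F c * chains V cf wt bad q (c # F))"
  using Suc by (intro sum_mono mult_left_mono wt) auto
 also have "... = (\<Sum>c\<in>?C. if bad c & (\<forall>f\<in>set F. ~ cf f c) then wt F c * chains V cf wt bad q (c # F) else 0)"
  by (intro sum.cong) auto
 also have "... <= chains V cf wt bad (Suc q) F"
  unfolding chains.simps using V by (intro sum_mono2) (auto intro!: mult_nonneg_nonneg wt nn)
 finally show ?case .
qed simp

text \<open>The range \<open>2 ^ w\<close> consists of full residue systems modulo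
  \<open>2 ^ b\<close>. So a random word reduces exactly to a smaller uniform index, without
  rejection or rounding error.\<close>

lemma sum_mod_uniform:
 fixes g :: "nat => real"
 assumes "b <= w"
 shows "mexp (pmf_of_set {..<2 ^ w :: nat}) (%x. g (x mod 2 ^ b)) = (\<Sum>r<2 ^ b. g r) / 2 ^ b"
proof -
 define k :: nat where "k = 2 ^ (w - b)"
 have k: "(2::nat) ^ w = k * 2 ^ b" using assms by (simp add: k_def power_add[symmetric])
 have "(\<Sum>x<2 ^ w. g (x mod 2 ^ b)) = (\<Sum>m<k. \<Sum>x\<in>{m * 2 ^ b..<m * 2 ^ b + 2 ^ b}. g (x mod 2 ^ b))"
  unfolding k by (rule sum.nat_group[symmetric])
 also have "... = (\<Sum>m<k. \<Sum>r<2 ^ b. g r)"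
 proof (rule sum.cong[OF refl])
  fix m
  have "(\<Sum>x\<in>{m * 2 ^ b..<m * 2 ^ b + 2 ^ b}. g (x mod 2 ^ b)) = (\<Sum>r\<in>{0..<2 ^ b}. g ((r + m * 2 ^ b) mod 2 ^ b))"
   using sum.shift_bounds_nat_ivl[of "%x. g (x mod 2 ^ b)" 0 "m * 2 ^ b" "2 ^ b"] by (simp add: add.commute)
  also have "... = (\<Sum>r<2 ^ b. g r)" by (rule sum.cong) auto
  finally show "(\<Sum>x\<in>{m * 2 ^ b..<m * 2 ^ b + 2 ^ b}. g (x mod 2 ^ b)) = (\<Sum>r<2 ^ b. g r)" .
 qed
 finally have "(\<Sum>x<2 ^ w. g (x mod 2 ^ b)) = real k * (\<Sum>r<2 ^ b. g r)" by simp
 moreover have "real (2 ^ w) = real k * 2 ^ b" using arg_cong[OF k, of real] by simp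
 ultimately show ?thesis by (subst integral_pmf_of_set) (auto simp: k_def lessThan_empty_iff)
qed

lemma markov_chains:
 assumes "finite (set_pmf P)" "!!x. 0 <= g x" "mexp P g <= e" "0 < z"
 shows "mprob P {x. z <= g x} <= e / z"
proof -
 have int: "integrable (measure_pmf P) h" for h :: "_ => real" by (rule integrable_measure_pmf_finite[OF assms(1)])
 have "z * mprob P {x. z <= g x} = mexp P (%x. z * indicator {x. z <= g x} x)" by simp
 also have "... <= mexp P g"
  using assms(2) by (intro integral_mono int) (auto simp: indicator_def)
 finally show ?thesis using assms by (simp add: field_simps)
qed

section \<open>Rounding\<close>

lemma card_ge_threshold:
 fixes g :: "'x => real"
 assumes "finite X" "!!x. x \<in> X ==> 0 <= g x" "(\<Sum>x\<in>X. g x) <= W" "0 < e"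
 shows "real (card {x\<in>X. e <= g x}) <= W / e"
proof -
 have "e * real (card {x\<in>X. e <= g x}) = (\<Sum>x\<in>{x\<in>X. e <= g x}. e)" by simp
 also have "... <= (\<Sum>x\<in>{x\<in>X. e <= g x}. g x)" by (rule sum_mono) auto
 also have "... <= (\<Sum>x\<in>X. g x)" by (rule sum_mono2) (use assms in auto)
 also have "... <= W" by fact
 finally show ?thesis using assms(4) by (simp add: field_simps)
qed

text \<open>\<open>a c r c' r'\<close> is the load on sample \<open>r\<close> of cluster
  \<open>c\<close> caused by sample \<open>r'\<close> of \<open>c'\<close>, so drawing one of the
  \<open>B\<close> samples per cluster gives every cluster an expected load of at most 30. The first
  condition on \<open>K\<close> turns the resulting Chernoff bound \<open>exp (60 - K)\<close> into
  \<open>B\<close>^-28.\<close>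

locale rmatrix =
 fixes V :: "nat set" and B b n :: nat and K :: real and a :: "nat => nat => nat => nat => real"
 assumes V: "finite V" "card V <= n" and B: "B = 2 ^ b" "64 <= B" and n: "n <= 2 ^ B" "0 < n"
  and K: "exp (60 - K) <= 1 / real B ^ 28" "61 <= K"
  and a: "!!c r c' r'. 0 <= a c r c' r'" "!!c r c' r'. a c r c' r' <= 1"
  and row: "!!c r. c \<in> V ==> r < B ==> (\<Sum>c'\<in>V - {c}. \<Sum>r'<B. a c r c' r') <= 30 * B"
  and col: "!!c r. c \<in> V ==> r < B ==> (\<Sum>c'\<in>V - {c}. \<Sum>r'<B. a c' r' c r) <= 30 * B"
begin

definition "nbr e c = {c'\<in>V - {c}. \<exists>r<B. \<exists>r'<B. e <= a c r c' r'}"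
definition "rnbr e c = {c'\<in>V - {c}. \<exists>r<B. \<exists>r'<B. e <= a c' r' c r}"

lemma card_nbr_aux:
 fixes g :: "nat => nat => nat => real"
 assumes g: "!!r c' r'. 0 <= g r c' r'" "!!r. r < B ==> (\<Sum>c'\<in>V - {c}. \<Sum>r'<B. g r c' r') <= 30 * B" and e: "0 < e"
 shows "real (card {c'\<in>V - {c}. \<exists>r<B. \<exists>r'<B. e <= g r c' r'}) <= 30 * real B ^ 2 / e"
proof -
 let ?X = "%r. {c'\<in>V - {c}. e <= (\<Sum>r'<B. g r c' r')}"
 have "{c'\<in>V - {c}. \<exists>r<B. \<exists>r'<B. e <= g r c' r'} \<subseteq> (\<Union>r<B. ?X r)"
 proof (rule subsetI)
  fix c' assume "c' \<in> {c'\<in>V - {c}. \<exists>r<B. \<exists>r'<B. e <= g r c' r'}"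
  then obtain r r' where *: "c' \<in> V" "c' ~= c" "r < B" "r' < B" "e <= g r c' r'" by blast
  have "e <= (\<Sum>r'<B. g r c' r')"
   using *(5) member_le_sum[of r' "{..<B}" "g r c'"] g(1) *(4) by force
  then show "c' \<in> (\<Union>r<B. ?X r)" using * by auto
 qed
 then have "card {c'\<in>V - {c}. \<exists>r<B. \<exists>r'<B. e <= g r c' r'} <= (\<Sum>r<B. card (?X r))"
  using V by (intro order_trans[OF card_mono card_UN_le]) auto
 then have "real (card {c'\<in>V - {c}. \<exists>r<B. \<exists>r'<B. e <= g r c' r'}) <= (\<Sum>r<B. real (card (?X r)))"
  unfolding of_nat_sum[symmetric] by (rule of_nat_mono)
 also have "... <= (\<Sum>r<B. 30 * real B / e)"
 proof (rule sum_mono)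
  fix r assume "r \<in> {..<B}"
  then show "real (card (?X r)) <= 30 * real B / e"
   using V e g(2)[of r] by (intro card_ge_threshold) (auto intro: sum_nonneg g(1))
 qed
 also have "... = 30 * real B ^ 2 / e" by (simp add: power2_eq_square)
 finally show ?thesis .
qed

lemma card_nbr: "c \<in> V ==> 0 < e ==> real (card (nbr e c)) <= 30 * real B ^ 2 / e"
 unfolding nbr_def using a row by (intro card_nbr_aux) auto

lemma card_rnbr: "c \<in> V ==> 0 < e ==> real (card (rnbr e c)) <= 30 * real B ^ 2 / e"
 unfolding rnbr_def using a col by (intro card_nbr_aux) auto

text \<open>The clusters whose draws can decide whether \<open>c\<close> is heavy. Two clusters
  conflict if these sets meet; otherwise their events are independent.\<close>

definition "N1 c = insert c (nbr (1 / B) c)"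
definition "cf c c' \<longleftrightarrow> N1 c \<inter> N1 c' ~= {}"
text \<open>Loads below \<open>lo\<close> do not make clusters adjacent. The exponent 11 balances
  two needs: degrees stay polynomial in \<open>B\<close>, and the up to \<open>B\<close>^9 clusters
  in conflict with a chain carry ignored loads of at most \<open>B\<close>^-10 each, hence 1 /
  \<open>B\<close> in total.\<close>

definition "lo = 1 / real B ^ 11"
definition "adj2 c c' \<longleftrightarrow> (\<exists>r<B. \<exists>r'<B. lo <= a c r c' r' | lo <= a c' r' c r)"

lemma b1: "real B \<ge> 64" using B(2) by simp

lemma pow_bound1: "1 + 30 * real B ^ 3 <= real B ^ 4"
proof -
 have "1 <= real B ^ 3" using b1 by simp
 then have "1 + 30 * real B ^ 3 <= 31 * real B ^ 3" by simp
 also have "... <= real B * real B ^ 3" using b1 by (intro mult_right_mono) auto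
 finally show ?thesis by (simp flip: power_Suc)
qed

text \<open>\<open>N1 c\<close> has at most \<open>B\<close>^4 elements, and each of them lies in at
  most \<open>B\<close>^4 sets of this kind.\<close>

lemma card_cf: assumes "c \<in> V" shows "real (card {c'\<in>V. cf c c'}) <= real B ^ 8"
proof -
 have sub: "{c'\<in>V. cf c c'} \<subseteq> (\<Union>u\<in>N1 c. insert u (rnbr (1 / B) u))"
 proof (rule subsetI)
  fix c' assume "c' \<in> {c'\<in>V. cf c c'}"
  then obtain u where u: "c' \<in> V" "u \<in> N1 c" "u \<in> N1 c'" by (auto simp: cf_def)
  then have "u = c' | c' \<in> rnbr (1 / B) u" unfolding N1_def nbr_def rnbr_def by blast
  then show "c' \<in> (\<Union>u\<in>N1 c. insert u (rnbr (1 / B) u))" using u by blast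
 qed
 have N1V: "N1 c \<subseteq> V" "finite (N1 c)" using assms V by (auto simp: N1_def nbr_def)
 have c1: "real (card (insert u (rnbr (1 / B) u))) <= real B ^ 4" if "u \<in> V" for u
 proof -
  have "real (card (insert u (rnbr (1 / B) u))) <= 1 + real (card (rnbr (1 / B) u))"
   using V by (simp add: card_insert_if rnbr_def)
  also have "... <= 1 + 30 * real B ^ 3" using card_rnbr[OF that, of "1 / B"] b1 by (simp add: power2_eq_square power3_eq_cube)
  finally show ?thesis using pow_bound1 by linarith
 qed
 have c2: "real (card (N1 c)) <= real B ^ 4"
 proof -
  have "real (card (N1 c)) <= 1 + real (card (nbr (1 / B) c))"
   using V by (simp add: card_insert_if nbr_def N1_def)
  also have "... <= 1 + 30 * real B ^ 3" using card_nbr[OF assms, of "1 / B"] b1 by (simp add: power2_eq_square power3_eq_cube)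
  finally show ?thesis using pow_bound1 by linarith
 qed
 have "card {c'\<in>V. cf c c'} <= (\<Sum>u\<in>N1 c. card (insert u (rnbr (1 / B) u)))"
  using sub N1V V by (intro order_trans[OF card_mono card_UN_le]) (auto simp: rnbr_def)
 then have "real (card {c'\<in>V. cf c c'}) <= (\<Sum>u\<in>N1 c. real (card (insert u (rnbr (1 / B) u))))"
  unfolding of_nat_sum[symmetric] by (rule of_nat_mono)
 also have "... <= (\<Sum>u\<in>N1 c. real B ^ 4)" using c1 N1V by (intro sum_mono) auto
 also have "... = real (card (N1 c)) * real B ^ 4" by simp
 also have "... <= real B ^ 4 * real B ^ 4" using c2 by (intro mult_right_mono) auto
 finally show ?thesis by (simp add: power_add[symmetric])
qed

lemma card_adj2: assumes "c \<in> V" shows "real (card {c'\<in>V. adj2 c c'}) <= real B ^ 15"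
proof -
 have lo: "0 < lo" using b1 by (simp add: lo_def)
 have "{c'\<in>V. adj2 c c'} \<subseteq> insert c (nbr lo c \<union> rnbr lo c)" using assms by (auto simp: adj2_def nbr_def rnbr_def)
 then have "card {c'\<in>V. adj2 c c'} <= card (insert c (nbr lo c \<union> rnbr lo c))"
  using V by (intro card_mono) (auto simp: nbr_def rnbr_def)
 also have "... <= 1 + (card (nbr lo c) + card (rnbr lo c))"
  using card_Un_le[of "nbr lo c" "rnbr lo c"] card_insert_le_m1[of "1 + (card (nbr lo c) + card (rnbr lo c))" "nbr lo c \<union> rnbr lo c" c] by simp
 finally have "real (card {c'\<in>V. adj2 c c'}) <= 1 + (real (card (nbr lo c)) + real (card (rnbr lo c)))" by linarith
 also have "... <= 1 + (30 * real B ^ 2 / lo + 30 * real B ^ 2 / lo)"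
  using card_nbr[OF assms lo] card_rnbr[OF assms lo] by simp
 also have "... = 1 + 60 * real B ^ 13" by (simp add: lo_def power_add[symmetric] field_simps)
 also have "... <= 61 * real B ^ 13" using b1 by simp
 also have "... <= real B ^ 2 * real B ^ 13" 
 proof (rule mult_right_mono)
  have "61 <= real B * real B" using mult_mono[OF b1 b1] by simp
  then show "61 <= real B ^ 2" by (simp add: power2_eq_square)
 qed simp
 finally show ?thesis by (simp add: power_add[symmetric])
qed

end

locale rdraw = rmatrix +
 fixes A :: "nat set" and w :: nat
 assumes A: "finite A" "V \<subseteq> A" and w: "b <= w"
begin

abbreviation "U == pmf_of_set {..<2 ^ w :: nat}"
abbreviation "PA == Pi_pmf A 0 (%_. U)"

definition "entry x c c' = a c (x c mod B) c' (x c' mod B)"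
text \<open>The load is split at entries of size 1 / \<open>B\<close>. Large entries come from the
  few clusters in \<open>N1 c\<close>, which makes the event local. Small entries still lie in the
  unit interval when scaled by \<open>B\<close>, and then they concentrate so well that a union
  bound over all clusters suffices.\<close>

definition "heavy x c \<longleftrightarrow> K <= (\<Sum>c'\<in>V - {c}. if 1 / B <= entry x c c' then entry x c c' else 0)"
definition "lightb x c \<longleftrightarrow> K <= (\<Sum>c'\<in>V - {c}. if 1 / B <= entry x c c' then 0 else entry x c c')"

lemma setU: "set_pmf U = {..<2 ^ w}" "finite (set_pmf U)"
 by (simp_all add: set_pmf_of_set lessThan_empty_iff)

lemma finPA: "finite (set_pmf PA)"
 by (rule finite_subset[OF set_Pi_pmf_subset'[OF A(1)]]) (use A setU in \<open>auto intro!: finite_PiE_dflt\<close>)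

lemma mod_lt: "x mod B < B" using b1 by simp

lemma expectation_U: "mexp U (%x. g (x mod B)) = (\<Sum>r<B. g r) / B"
 using sum_mod_uniform[OF w, of g] unfolding B(1) by simp

lemma sum_expectation_le:
 assumes "c \<in> V" "C \<subseteq> V - {c}" "r < B"
 shows "(\<Sum>c'\<in>C. mexp U (%y. a c r c' (y mod B))) <= 30"
proof -
 have "(\<Sum>c'\<in>C. mexp U (%y. a c r c' (y mod B))) = (\<Sum>c'\<in>C. \<Sum>r'<B. a c r c' r') / B"
  by (simp only: expectation_U sum_divide_distrib)
 also have "... <= (\<Sum>c'\<in>V - {c}. \<Sum>r'<B. a c r c' r') / B"
  using assms V a by (intro divide_right_mono sum_mono2) (auto intro: sum_nonneg)
 also have "... <= 30" using row[OF assms(1,3)] b1 by (simp add: field_simps)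
 finally show ?thesis .
qed

lemma prob_heavy: assumes "c \<in> V" shows "mprob PA {x. heavy x c} <= 1 / real B ^ 28"
proof -
 let ?h = "%c' v y. if 1 / B <= a c (v mod B) c' (y mod B) then a c (v mod B) c' (y mod B) else 0"
 have "mprob PA {x. K <= (\<Sum>c'\<in>V - {c}. ?h c' (x c) (x c'))} <= exp (2 * 30 - K)"
 proof (rule chernoff_Pi_pmf[OF A(1)])
  fix v :: nat assume "v \<in> set_pmf U"
  have "(\<Sum>c'\<in>V - {c}. mexp U (?h c' v)) <= (\<Sum>c'\<in>V - {c}. mexp U (%y. a c (v mod B) c' (y mod B)))"
   using a by (intro sum_mono integral_mono integrable_measure_pmf_finite setU) auto
  also have "... <= 30" by (rule sum_expectation_le[OF assms order_refl mod_lt])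
  finally show "(\<Sum>c'\<in>V - {c}. mexp U (?h c' v)) <= 30" .
 qed (use A assms a setU in auto)
 also have "... <= 1 / real B ^ 28" using K by simp
 finally show ?thesis unfolding heavy_def entry_def .
qed

lemma prob_lightb: assumes "c \<in> V" shows "mprob PA {x. lightb x c} <= exp (- real B)"
proof -
 let ?h = "%c' v y. if 1 / B <= a c (v mod B) c' (y mod B) then 0 else B * a c (v mod B) c' (y mod B)"
 have "mprob PA {x. B * K <= (\<Sum>c'\<in>V - {c}. ?h c' (x c) (x c'))} <= exp (2 * (real B * 30) - real B * K)"
 proof (rule chernoff_Pi_pmf[OF A(1)])
  fix v :: nat assume "v \<in> set_pmf U"
  have "(\<Sum>c'\<in>V - {c}. mexp U (?h c' v)) <= (\<Sum>c'\<in>V - {c}. mexp U (%y. B * a c (v mod B) c' (y mod B)))"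
   using a by (intro sum_mono integral_mono integrable_measure_pmf_finite setU) auto
  also have "... = B * (\<Sum>c'\<in>V - {c}. mexp U (%y. a c (v mod B) c' (y mod B)))" by (simp add: sum_distrib_left)
  also have "... <= real B * 30" by (intro mult_left_mono sum_expectation_le[OF assms order_refl mod_lt]) auto
  finally show "(\<Sum>c'\<in>V - {c}. mexp U (?h c' v)) <= real B * 30" .
 next
  fix c' v y show "?h c' v y <= 1" using b1 by (auto simp: field_simps not_le)
 qed (use A assms a setU in auto)
 \<comment> \<open>Here \<open>61 <= K\<close> makes the exponent \<open>60 * B - B * K\<close> at
   most \<open>- B\<close>, so that later \<open>n <= 2 ^ B\<close> clusters can be summed
   over.\<close>
 also have "... <= exp (- real B)" using K(2) b1 mult_left_mono[of 61 K B] by (simp add: algebra_simps)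
 also have "{x. B * K <= (\<Sum>c'\<in>V - {c}. ?h c' (x c) (x c'))} = {x. lightb x c}"
 proof -
  have "(\<Sum>c'\<in>V - {c}. ?h c' (x c) (x c')) = B * (\<Sum>c'\<in>V - {c}. if 1 / B <= entry x c c' then 0 else entry x c c')" for x
   unfolding sum_distrib_left by (rule sum.cong) (auto simp: entry_def)
  then show ?thesis using b1 by (simp add: lightb_def)
 qed
 finally show ?thesis .
qed

definition "hgraph x = {(u, v). u \<in> V & v \<in> V & heavy x u & heavy x v & adj2 u v}"

lemma rtrancl_cut:
 "(x, y) \<in> r\<^sup>* ==> x \<in> S ==> y \<notin> S ==> \<exists>u v. (x, u) \<in> r\<^sup>* & (u, v) \<in> r & u \<in> S & v \<notin> S"
proof (induction rule: rtrancl_induct)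
 case (step y z)
 then show ?case by (cases "y \<in> S") auto
qed simp

lemma depends_heavy: "c \<in> V ==> depends_on (N1 c) (%x. heavy x c)"
 unfolding depends_on_def
proof (intro allI impI)
 fix x y :: "nat => nat" assume c: "c \<in> V" and xy: "\<forall>i\<in>N1 c. x i = y i"
 have "(if 1 / B <= entry x c c' then entry x c c' else 0) = (if 1 / B <= entry y c c' then entry y c c' else 0)"
  if "c' \<in> V - {c}" for c'
 proof (cases "c' \<in> N1 c")
  case True
  then have "x c' = y c'" "x c = y c" using xy by (auto simp: N1_def)
  then have "entry x c c' = entry y c c'" by (simp add: entry_def)
  then show ?thesis by simp
 next
  case False
  then have "~ 1 / B <= entry x c c'" "~ 1 / B <= entry y c c'"
   using that mod_lt unfolding N1_def nbr_def entry_def by blast+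
  then show ?thesis by simp
 qed
 then have "(\<Sum>c'\<in>V - {c}. if 1 / B <= entry x c c' then entry x c c' else 0) = (\<Sum>c'\<in>V - {c}. if 1 / B <= entry y c c' then entry y c c' else 0)"
  by (rule sum.cong[OF refl])
 then show "heavy x c = heavy y c" unfolding heavy_def by (simp only:)
qed

lemma cf_refl: "cf c c" by (auto simp: cf_def N1_def)

lemma card_conf:
 assumes "set F \<subseteq> V" shows "real (card {u\<in>V. \<exists>f\<in>set F. cf f u}) <= real (length F) * real B ^ 8"
 using assms
proof (induction F)
 case (Cons f F)
 have "{u\<in>V. \<exists>f\<in>set (f # F). cf f u} = {u\<in>V. cf f u} \<union> {u\<in>V. \<exists>f\<in>set F. cf f u}" by auto
 then have "card {u\<in>V. \<exists>f\<in>set (f # F). cf f u} <= card {u\<in>V. cf f u} + card {u\<in>V. \<exists>f\<in>set F. cf f u}"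
  by (simp only: card_Un_le)
 then have "real (card {u\<in>V. \<exists>f\<in>set (f # F). cf f u}) <= real (card {u\<in>V. cf f u}) + real (card {u\<in>V. \<exists>f\<in>set F. cf f u})" by linarith
 also have "... <= real B ^ 8 + real (length F) * real B ^ 8" using Cons card_cf[of f] by (intro add_mono) auto
 finally show ?case by (simp add: algebra_simps)
qed simp

text \<open>The next element of a chain has to be adjacent to some cluster in conflict with the
  chain. Chains thus stay close together although their elements are pairwise free of conflict, and
  there are few ways to continue.\<close>

definition "wtA F c = (if F = [] then 1 else of_bool (\<exists>f\<in>set F. \<exists>u\<in>V. cf f u & adj2 u c) :: real)"

lemma sum_wtA:
 assumes "set F \<subseteq> V" "F ~= []" "length F <= B" shows "(\<Sum>c\<in>V. wtA F c) <= real B ^ 24"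
proof -
 let ?U = "{u\<in>V. \<exists>f\<in>set F. cf f u}"
 have eq: "(\<Sum>c\<in>V. wtA F c) = real (card {c\<in>V. \<exists>f\<in>set F. \<exists>u\<in>V. cf f u & adj2 u c})"
  using assms(2) V by (simp add: wtA_def of_bool_def sum.If_cases Int_def)
 have "card {c\<in>V. \<exists>f\<in>set F. \<exists>u\<in>V. cf f u & adj2 u c} <= card (\<Union>u\<in>?U. {c\<in>V. adj2 u c})"
  using V by (intro card_mono) auto
 also have "... <= (\<Sum>u\<in>?U. card {c\<in>V. adj2 u c})" by (rule card_UN_le) (use V in simp)
 finally have "real (card {c\<in>V. \<exists>f\<in>set F. \<exists>u\<in>V. cf f u & adj2 u c}) <= real (\<Sum>u\<in>?U. card {c\<in>V. adj2 u c})" by (rule of_nat_mono)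
 then have "(\<Sum>c\<in>V. wtA F c) <= (\<Sum>u\<in>?U. real (card {c\<in>V. adj2 u c}))" by (simp only: eq of_nat_sum)
 also have "... <= (\<Sum>u\<in>?U. real B ^ 15)" by (intro sum_mono card_adj2) auto
 also have "... = real (card ?U) * real B ^ 15" by simp
 also have "... <= (real (length F) * real B ^ 8) * real B ^ 15"
  by (rule mult_right_mono[OF card_conf[OF assms(1)]]) simp
 also have "... <= (real B * real B ^ 8) * real B ^ 15"
  by (rule mult_right_mono[OF mult_right_mono]) (use assms(3) in auto)
 also have "... = real B ^ (1 + 8 + 15)" by (simp only: power_add power_one_right)
 finally show ?thesis by (simp only: add_numeral_special arith_simps)
qed

lemma heavy_chains:
 assumes wt: "!!F c. 0 <= wt F c" "!!F. set F \<subseteq> V ==> F ~= [] ==> length F <= B ==> (\<Sum>c\<in>V. wt F c) <= W" "0 <= W" "(\<Sum>c\<in>V. wt [] c) <= W0" and "0 < z"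
 shows "mprob PA {x. z <= chains V cf wt (heavy x) B []} <= (1 / real B ^ 28) ^ B * (W0 * W ^ (B - 1)) / z"
proof (rule markov_chains[OF finPA _ _ \<open>0 < z\<close>])
 show "0 <= chains V cf wt (heavy x) B []" for x
 proof -
  have "0 <= chains V cf wt (heavy x) q F" for q F by (induction q arbitrary: F) (auto intro!: sum_nonneg mult_nonneg_nonneg wt(1))
  then show ?thesis .
 qed
 have "mexp PA (%x. chains V cf wt (heavy x) (Suc (B - 1)) []) <= (1 / real B ^ 28) ^ Suc (B - 1) * (W0 * W ^ (B - 1))"
 proof (rule expectation_chains[OF A(1) _ V(1), where N = N1 and Q = B])
  show "!!c. c \<in> V ==> depends_on (N1 c) (%x. heavy x c)" by (rule depends_heavy)
  show "!!c c'. ~ cf c c' ==> N1 c \<inter> N1 c' = {}" by (simp add: cf_def)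
  show "!!c. c \<in> V ==> mprob PA {x. heavy x c} <= 1 / real B ^ 28" by (rule prob_heavy)
 qed (use wt setU in auto)
 then show "mexp PA (%x. chains V cf wt (heavy x) B []) <= (1 / real B ^ 28) ^ B * (W0 * W ^ (B - 1))"
  using B(2) by simp
qed

lemma small_num: "(1 / 2) ^ B <= (1 / 100 :: real)" "(3 / 4) ^ B <= (1 / 100 :: real)"
proof -
 have "(1 / 2) ^ B <= (1 / 2 :: real) ^ 64" "(3 / 4) ^ B <= (3 / 4 :: real) ^ 64"
  by (rule power_decreasing[OF B(2)]; simp)+
 moreover have "(1 / 2 :: real) ^ 64 <= 1 / 100" "(3 / 4 :: real) ^ 64 <= 1 / 100" by (simp_all add: power_divide)
 ultimately show "(1 / 2) ^ B <= (1 / 100 :: real)" "(3 / 4) ^ B <= (1 / 100 :: real)" by linarith+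
qed

lemma n_le: "real n <= 2 ^ B" using of_nat_mono[OF n(1), where 'a = real] by simp

text \<open>Fewer than \<open>B\<close> clusters are in conflict with at most \<open>B\<close>^9
  others, so a larger component of heavy clusters always lets a chain grow and contains a full chain
  of length \<open>B\<close>. The expected number of such chains is at most \<open>n\<close> times
  \<open>B\<close>^24 to the power \<open>B - 1\<close>, divided by \<open>B\<close>^28 to the power
  \<open>B\<close>.\<close>

lemma prob_shatter: "mprob PA {x. \<exists>c0\<in>V. heavy x c0 & real B ^ 9 < real (card ((hgraph x)\<^sup>* `` {c0}))} <= 1 / 100"
proof -
 have sub: "1 <= chains V cf wtA (heavy x) B []" if c0: "c0 \<in> V" "heavy x c0" "real B ^ 9 < real (card ((hgraph x)\<^sup>* `` {c0}))" for x c0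
 proof -
  let ?C = "(hgraph x)\<^sup>* `` {c0}"
  have CV: "?C \<subseteq> {c\<in>V. heavy x c}"
  proof
   fix c assume "c \<in> ?C"
   then have "(c0, c) \<in> (hgraph x)\<^sup>*" by simp
   then show "c \<in> {c\<in>V. heavy x c}" by (cases rule: rtranclE) (use c0 in \<open>auto simp: hgraph_def\<close>)
  qed
  have sym: "sym (hgraph x)" unfolding sym_def hgraph_def adj2_def by blast
  have "1 ^ B <= chains V cf wtA (heavy x) B []"
  proof (rule chains_lower[OF V(1), where Inv = "%F. set F \<subseteq> ?C" and Q = B])
   fix F assume F: "set F \<subseteq> ?C" "length F < B"
   have "\<exists>c\<in>{c\<in>V. heavy x c & (\<forall>f\<in>set F. ~ cf f c) & set (c # F) \<subseteq> ?C}. wtA F c = 1"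
   proof (cases F)
    case Nil
    then show ?thesis using c0 by (intro bexI[of _ c0]) (auto simp: wtA_def)
   next
    case (Cons f0 F')
    let ?S = "{u\<in>V. \<exists>f\<in>set F. cf f u}"
    have "set F \<subseteq> V" using F(1) CV by blast
    then have "real (card ?S) <= real (length F) * real B ^ 8" by (rule card_conf)
    also have "... <= real B * real B ^ 8" using F(2) by (intro mult_right_mono) auto
    also have "... < real (card ?C)" using c0(3) by (simp flip: power_Suc)
    finally have "card ?S < card ?C" by simp
    moreover have "finite ?S" using V(1) by simp
    ultimately have "~ ?C \<subseteq> ?S" using card_mono[of ?S ?C] by linarith
    then obtain c where c: "(c0, c) \<in> (hgraph x)\<^sup>*" "c \<notin> ?S" by blast
    have f0: "f0 \<in> ?S" "(c0, f0) \<in> (hgraph x)\<^sup>*" using F(1) Cons cf_refl[of f0] CV by auto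
    have "(f0, c0) \<in> (hgraph x)\<^sup>*" using f0(2) sym_rtrancl[OF sym] by (auto dest: symD)
    then have "(f0, c) \<in> (hgraph x)\<^sup>*" using c(1) by simp
    \<comment> \<open>The edge by which a path inside the component leaves the set of clusters in
      conflict with the chain ends in a cluster that \<open>wtA\<close> admits as the next
      element.\<close>
    from rtrancl_cut[OF this f0(1) c(2)] obtain u v where uv: "(f0, u) \<in> (hgraph x)\<^sup>*" "(u, v) \<in> hgraph x" "u \<in> ?S" "v \<notin> ?S" by blast
    have "(c0, v) \<in> (hgraph x)\<^sup>*" using f0(2) uv(1,2) by (meson rtrancl.rtrancl_into_rtrancl rtrancl_trans)
    moreover have "v \<in> V" "heavy x v" "adj2 u v" using uv(2) by (auto simp: hgraph_def)
    ultimately show ?thesis using uv(3,4) Cons F(1) by (intro bexI[of _ v]) (auto simp: wtA_def)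
   qed
   then obtain c where c: "c \<in> {c\<in>V. heavy x c & (\<forall>f\<in>set F. ~ cf f c) & set (c # F) \<subseteq> ?C}" "wtA F c = 1" by blast
   then show "1 <= (\<Sum>c\<in>{c\<in>V. heavy x c & (\<forall>f\<in>set F. ~ cf f c) & set (c # F) \<subseteq> ?C}. wtA F c)"
    using member_le_sum[OF c(1), of "wtA F"] V(1) by (auto simp: wtA_def)
  qed (auto simp: wtA_def)
  then show ?thesis by simp
 qed
 have "mprob PA {x. \<exists>c0\<in>V. heavy x c0 & real B ^ 9 < real (card ((hgraph x)\<^sup>* `` {c0}))}
  <= mprob PA {x. 1 <= chains V cf wtA (heavy x) B []}"
  by (intro measure_pmf.finite_measure_mono) (use sub in auto)
 also have "... <= (1 / real B ^ 28) ^ B * (real n * (real B ^ 24) ^ (B - 1)) / 1"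
 proof (rule heavy_chains)
  show "(\<Sum>c\<in>V. wtA [] c) <= real n" using V by (simp add: wtA_def)
  show "!!F. set F \<subseteq> V ==> F ~= [] ==> length F <= B ==> (\<Sum>c\<in>V. wtA F c) <= real B ^ 24" by (rule sum_wtA)
 qed (auto simp: wtA_def)
 also have "... <= (1 / real B ^ 28) ^ B * (2 ^ B * (real B ^ 24) ^ B)"
 proof -
  have "(real B ^ 24) ^ (B - 1) <= (real B ^ 24) ^ B" using b1 by (intro power_increasing) auto
  then have "real n * (real B ^ 24) ^ (B - 1) <= 2 ^ B * (real B ^ 24) ^ B" using n_le by (intro mult_mono) auto
  then show ?thesis unfolding div_by_1 by (intro mult_left_mono) auto
 qed
 also have "... = (1 / real B ^ 28 * (2 * real B ^ 24)) ^ B" by (simp only: power_mult_distrib)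
 also have "1 / real B ^ 28 * (2 * real B ^ 24) = 2 / real B ^ 4"
 proof -
  have *: "1 / (x * y) * (2 * x) = 2 / y" if "x ~= 0" for x y :: real using that by simp
  have "real B ^ 28 = real B ^ 24 * real B ^ 4" by (simp flip: power_add)
  then show ?thesis using *[of "real B ^ 24" "real B ^ 4"] b1 by (simp only:) simp
 qed
 also have "(2 / real B ^ 4) ^ B <= (1 / 2) ^ B"
 proof (rule power_mono)
  have "4 <= real B * 1" using b1 by simp
  also have "... <= real B * real B ^ 3" using b1 by (intro mult_left_mono) auto
  finally have "4 <= real B ^ 4" by (simp flip: power_Suc)
  then show "2 / real B ^ 4 <= 1 / 2" using b1 by (simp add: divide_le_eq_1_pos zero_less_power)
 qed simp
 also have "... <= 1 / 100" by (rule small_num)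
 finally show ?thesis .
qed

end

context rdraw
begin

text \<open>The ignored part of the load from \<open>c'\<close>, summed over all samples that
  \<open>c'\<close> might draw. It therefore bounds the load for every draw, in particular for the
  later redraws.\<close>

definition "wl c r c' = (if c' = c then 0 else \<Sum>r'<B. if lo <= a c r c' r' then 0 else a c r c' r')"

text \<open>Clusters in conflict with a chain of fewer than \<open>B\<close> elements carry at most
  half of the weight, so if the heavy clusters have weight 1, every such chain can be prolonged with
  weight 1/2. The expected weight of full chains is at most \<open>30 * B / B ^ 28\<close> to the
  power \<open>B\<close>, far below \<open>(1 / 2) ^ B\<close>.\<close>

lemma prob_lightsum:
 assumes c: "c \<in> V" "r < B"
 shows "mprob PA {x. 1 <= (\<Sum>c'\<in>{c'\<in>V. heavy x c'}. wl c r c')} <= (60 / real B ^ 27) ^ B"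
proof -
 have wl0: "0 <= wl c r c'" for c'
 proof -
  have "0 <= (\<Sum>r'<B. if lo <= a c r c' r' then 0 else a c r c' r')" by (rule sum_nonneg) (simp add: a(1))
  then show ?thesis unfolding wl_def by (cases "c' = c") simp_all
 qed
 have wl1: "wl c r c' <= 1 / real B ^ 10" for c'
 proof -
  have "(\<Sum>r'<B. if lo <= a c r c' r' then 0 else a c r c' r') <= (\<Sum>r'<B. lo)" by (rule sum_mono) (auto simp: lo_def)
  moreover have "0 <= (\<Sum>r'<B. lo)" by (simp add: lo_def)
  ultimately have "wl c r c' <= (\<Sum>r'<B. lo)" unfolding wl_def by (cases "c' = c") simp_all
  also have "... = real B * (1 / (real B * real B ^ 10))" by (simp add: lo_def flip: power_Suc)
  also have "... = 1 / real B ^ 10" using b1 by simp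
  finally show ?thesis .
 qed
 have wls: "(\<Sum>c'\<in>V. wl c r c') <= 30 * B"
 proof -
  have "(\<Sum>c'\<in>V. wl c r c') = (\<Sum>c'\<in>V - {c}. wl c r c')" using c V by (subst sum.remove[of _ c]) (auto simp: wl_def)
  also have "... <= (\<Sum>c'\<in>V - {c}. \<Sum>r'<B. a c r c' r')"
  proof (rule sum_mono)
   fix c' assume "c' \<in> V - {c}"
   then have "wl c r c' = (\<Sum>r'<B. if lo <= a c r c' r' then 0 else a c r c' r')" by (simp add: wl_def)
   also have "... <= (\<Sum>r'<B. a c r c' r')" by (rule sum_mono) (simp add: a(1))
   finally show "wl c r c' <= (\<Sum>r'<B. a c r c' r')" .
  qed
  finally show ?thesis using row[OF c] by simp
 qed
 have sub: "(1 / 2) ^ B <= chains V cf (%F. wl c r) (heavy x) B []" if x: "1 <= (\<Sum>c'\<in>{c'\<in>V. heavy x c'}. wl c r c')" for x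
 proof (rule chains_lower[OF V(1), where Inv = "%F. set F \<subseteq> V" and Q = B])
  fix F assume F: "set F \<subseteq> V" "length F < B"
  let ?S = "{u\<in>V. \<exists>f\<in>set F. cf f u}"
  have "(\<Sum>c'\<in>?S. wl c r c') <= real (card ?S) * (1 / real B ^ 10)" using wl1 by (intro sum_bounded_above) auto
  also have "... <= (real B * real B ^ 8) * (1 / real B ^ 10)"
   using F(2) by (intro mult_right_mono order_trans[OF card_conf[OF F(1)]]) auto
  also have "... = 1 / real B"
  proof -
   have *: "x * y * (1 / (x * y * x)) = 1 / x" if "x ~= 0" "y ~= 0" for x y :: real using that by simp
   have "real B ^ 10 = real B * real B ^ 8 * real B" by (simp flip: power_Suc power_Suc2)
   then show ?thesis using *[of "real B" "real B ^ 8"] b1 by (simp only:) simp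
  qed
  also have "... <= 1 / 2" using b1 by (simp add: field_simps)
  finally have S: "(\<Sum>c'\<in>?S. wl c r c') <= 1 / 2" .
  have "(\<Sum>c'\<in>{c'\<in>V. heavy x c'}. wl c r c') <= (\<Sum>c'\<in>{c'\<in>V. heavy x c' & (\<forall>f\<in>set F. ~ cf f c') & set (c' # F) \<subseteq> V} \<union> ?S. wl c r c')"
   using V F(1) wl0 by (intro sum_mono2) auto
  also have "... <= (\<Sum>c'\<in>{c'\<in>V. heavy x c' & (\<forall>f\<in>set F. ~ cf f c') & set (c' # F) \<subseteq> V}. wl c r c') + (\<Sum>c'\<in>?S. wl c r c')"
   using V wl0 sum_Un[of "{c'\<in>V. heavy x c' & (\<forall>f\<in>set F. ~ cf f c') & set (c' # F) \<subseteq> V}" ?S "wl c r"]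
   by (simp add: sum_nonneg)
  finally show "1 / 2 <= (\<Sum>c'\<in>{c'\<in>V. heavy x c' & (\<forall>f\<in>set F. ~ cf f c') & set (c' # F) \<subseteq> V}. wl c r c')" using x S by linarith
 qed (auto simp: wl0)
 have "mprob PA {x. 1 <= (\<Sum>c'\<in>{c'\<in>V. heavy x c'}. wl c r c')} <= mprob PA {x. (1 / 2) ^ B <= chains V cf (%F. wl c r) (heavy x) B []}"
  by (intro measure_pmf.finite_measure_mono) (use sub in auto)
 also have "... <= (1 / real B ^ 28) ^ B * ((30 * real B) * (30 * real B) ^ (B - 1)) / (1 / 2) ^ B"
  by (rule heavy_chains) (use wl0 wls in auto)
 also have "(30 * real B) * (30 * real B) ^ (B - 1) = (30 * real B) ^ B" using B(2) by (simp add: power_eq_if)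
 also have "(1 / real B ^ 28) ^ B * (30 * real B) ^ B / (1 / 2) ^ B = (1 / real B ^ 28 * (30 * real B) * 2) ^ B"
 proof -
  have "(1 / 2 :: real) ^ B * 2 ^ B = 1" by (simp flip: power_mult_distrib)
  then have "x / (1 / 2) ^ B = x * 2 ^ B" for x :: real by (simp add: field_simps)
  then show ?thesis by (simp only: power_mult_distrib)
 qed
 also have "1 / real B ^ 28 * (30 * real B) * 2 = 60 / real B ^ 27"
 proof -
  have *: "1 / (x * y) * (30 * x) * 2 = 60 / y" if "x ~= 0" for x y :: real using that by simp
  have "real B ^ 28 = real B * real B ^ 27" by (simp flip: power_Suc)
  then show ?thesis using *[of "real B" "real B ^ 27"] b1 by (simp only:)
 qed
 finally show ?thesis by simp
qed

definition "phase1_ok x \<longleftrightarrow> (\<forall>c\<in>V. ~ lightb x c) &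
  (\<forall>c0\<in>V. heavy x c0 --> real (card ((hgraph x)\<^sup>* `` {c0})) <= real B ^ 9) &
  (\<forall>c\<in>V. \<forall>r<B. (\<Sum>c'\<in>{c'\<in>V. heavy x c'}. wl c r c') < 1)"

lemma prob_phase1: "mprob PA {x. ~ phase1_ok x} <= 3 / 100"
proof -
 let ?X1 = "\<Union>c\<in>V. {x. lightb x c}"
 let ?X2 = "{x. \<exists>c0\<in>V. heavy x c0 & real B ^ 9 < real (card ((hgraph x)\<^sup>* `` {c0}))}"
 let ?X3 = "\<Union>(c, r)\<in>V \<times> {..<B}. {x. 1 <= (\<Sum>c'\<in>{c'\<in>V. heavy x c'}. wl c r c')}"
 have "{x. ~ phase1_ok x} \<subseteq> ?X1 \<union> (?X2 \<union> ?X3)" by (auto simp: phase1_ok_def not_le not_less)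
 then have "mprob PA {x. ~ phase1_ok x} <= mprob PA (?X1 \<union> (?X2 \<union> ?X3))"
  by (intro measure_pmf.finite_measure_mono) auto
 also have "... <= mprob PA ?X1 + (mprob PA ?X2 + mprob PA ?X3)"
  by (intro order_trans[OF measure_Un_le] add_left_mono) auto
 also have "mprob PA ?X1 <= 1 / 100"
 proof -
  have "mprob PA ?X1 <= (\<Sum>c\<in>V. mprob PA {x. lightb x c})"
   using V by (intro measure_pmf.finite_measure_subadditive_finite) auto
  also have "... <= (\<Sum>c\<in>V. exp (- real B))" by (intro sum_mono prob_lightb)
  also have "... <= real n * exp (- real B)" using V by (simp add: mult_right_mono)
  also have "... <= 2 ^ B * exp (- real B)" using n_le by (simp add: mult_right_mono)
  also have "... = (2 * exp (- 1)) ^ B" by (simp add: power_mult_distrib exp_of_nat_mult[symmetric])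
  also have "... <= (3 / 4) ^ B"
  proof (rule power_mono)
   have "8 / 3 <= exp (1 :: real)" using e_approx_32 by (simp add: abs_if split: if_splits)
   then show "2 * exp (- 1) <= (3 / 4 :: real)" by (simp add: exp_minus field_simps)
  qed simp
  finally show ?thesis using small_num by simp
 qed
 also have "mprob PA ?X2 <= 1 / 100" by (rule prob_shatter)
 also have "mprob PA ?X3 <= 1 / 100"
 proof -
  have "mprob PA ?X3 <= (\<Sum>z\<in>V \<times> {..<B}. mprob PA (case z of (c, r) => {x. 1 <= (\<Sum>c'\<in>{c'\<in>V. heavy x c'}. wl c r c')}))"
   using V by (intro measure_pmf.finite_measure_subadditive_finite) auto
  also have "... <= (\<Sum>z\<in>V \<times> {..<B}. (60 / real B ^ 27) ^ B)" by (intro sum_mono) (auto intro: prob_lightsum)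
  also have "... = real (card V) * real B * (60 / real B ^ 27) ^ B" by (simp add: card_cartesian_product)
  also have "... <= 2 ^ B * 2 ^ B * (60 / real B ^ 27) ^ B"
  proof (intro mult_right_mono mult_mono)
   show "real (card V) <= 2 ^ B" using V(2) n_le by linarith
   show "real B <= 2 ^ B" using of_nat_mono[OF less_imp_le[OF less_exp[of B]], where 'a = real] by simp
  qed auto
  also have "... = (240 / real B ^ 27) ^ B" by (simp add: power_mult_distrib[symmetric])
  also have "... <= (1 / 2) ^ B"
  proof (rule power_mono)
   have "480 <= real B * real B" using mult_mono[OF b1 b1] by simp
   also have "... = real B ^ 2" by (simp add: power2_eq_square)
   also have "... <= real B ^ 27" using b1 by (intro power_increasing) auto
   finally show "240 / real B ^ 27 <= 1 / 2" using b1 by (simp add: field_simps)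
  qed simp
  finally show ?thesis using small_num by simp
 qed
 finally show ?thesis by simp
qed

text \<open>The \<open>B\<close> tries read disjoint blocks of coordinates and are independent. A
  single try fails with probability at most \<open>B\<close>^9 times \<open>B\<close>^-28, by a
  union bound over the members of the component.\<close>

lemma prob_tries:
 assumes C: "C \<subseteq> V" "real (card C) <= real B ^ 9" and Vn: "V \<subseteq> {..<n}" and AA: "!!t c. t < B ==> c \<in> V ==> t * n + c \<in> A"
 shows "mprob PA {y. \<forall>t<B. \<exists>c\<in>C. K <= (\<Sum>c'\<in>C - {c}. a c (y (t * n + c) mod B) c' (y (t * n + c') mod B))} <= (1 / real B ^ 19) ^ B"
proof -
 define bd where "bd y t \<longleftrightarrow> (\<exists>c\<in>C. K <= (\<Sum>c'\<in>C - {c}. a c (y (t * n + c) mod B) c' (y (t * n + c') mod B)))" for y :: "nat => nat" and t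
 have finC: "finite C" using C V finite_subset by blast
 have "mprob PA {y. \<forall>t\<in>set [0..<B]. bd y t} <= (1 / real B ^ 19) ^ length [0..<B]"
 proof (rule prob_all_bad[OF A(1), where V = "{..<B}" and N = "%t. (%c. t * n + c) ` C" and cf = "(=)"])
  show "depends_on ((%c. t * n + c) ` C) (%y. bd y t)" for t
   unfolding depends_on_def
  proof (intro allI impI)
   fix x y :: "nat => nat" assume "\<forall>i\<in>(%c. t * n + c) ` C. x i = y i"
   then have xy: "x (t * n + c) = y (t * n + c)" if "c \<in> C" for c using that by blast
   have "(\<Sum>c'\<in>C - {c}. a c (x (t * n + c) mod B) c' (x (t * n + c') mod B)) = (\<Sum>c'\<in>C - {c}. a c (y (t * n + c) mod B) c' (y (t * n + c') mod B))"
    if "c \<in> C" for c using that xy by (intro sum.cong) auto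
   then show "bd x t = bd y t" unfolding bd_def by simp
  qed
  show "(%c. t * n + c) ` C \<inter> (%c. t' * n + c) ` C = {}" if "t ~= t'" for t t'
  proof -
   have "t * n + c ~= t' * n + c'" if "c \<in> C" "c' \<in> C" for c c'
   proof
    assume eq: "t * n + c = t' * n + c'"
    have "c < n" "c' < n" using that C Vn by auto
    then have "(t * n + c) div n = t" "(t' * n + c') div n = t'" by auto
    then show False using eq \<open>t ~= t'\<close> by simp
   qed
   then show ?thesis by blast
  qed
  show "sorted_wrt (%c f. f ~= c) [0..<B]"
   by (rule sorted_wrt_mono_rel[OF _ sorted_wrt_upt]) auto
  fix t assume t: "t \<in> {..<B}"
  have one: "mprob PA {y. K <= (\<Sum>c'\<in>C - {c}. a c (y (t * n + c) mod B) c' (y (t * n + c') mod B))} <= 1 / real B ^ 28"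
   if c: "c \<in> C" for c
  proof -
   have cV: "c \<in> V" using C c by blast
   let ?J = "(%c'. t * n + c') ` (C - {c})"
   let ?h = "%i v y. a c (v mod B) (i - t * n) (y mod B)"
   have inj: "inj_on (%c'. t * n + c') (C - {c})" by (simp add: inj_on_def)
   have "mprob PA {y. K <= (\<Sum>i\<in>?J. ?h i (y (t * n + c)) (y i))} <= exp (2 * 30 - K)"
   proof (rule chernoff_Pi_pmf[OF A(1)])
    show "?J \<subseteq> A" "t * n + c \<in> A" using AA t C c by auto
    show "t * n + c \<notin> ?J" by auto
    fix v :: nat
    have "(\<Sum>i\<in>?J. mexp U (?h i v)) = (\<Sum>c'\<in>C - {c}. mexp U (%y. a c (v mod B) c' (y mod B)))"
     by (subst sum.reindex[OF inj]) simp
    also have "... <= 30" by (rule sum_expectation_le[OF cV _ mod_lt]) (use C in auto)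
    finally show "(\<Sum>i\<in>?J. mexp U (?h i v)) <= 30" .
   qed (use a setU in auto)
   also have "... <= 1 / real B ^ 28" using K by simp
   finally have le: "mprob PA {y. K <= (\<Sum>i\<in>?J. ?h i (y (t * n + c)) (y i))} <= 1 / real B ^ 28" .
   have "(\<Sum>i\<in>?J. ?h i (y (t * n + c)) (y i)) = (\<Sum>c'\<in>C - {c}. a c (y (t * n + c) mod B) c' (y (t * n + c') mod B))" for y
    by (subst sum.reindex[OF inj]) simp
   then show ?thesis using le by (simp only:)
  qed
  have "mprob PA {y. bd y t} = mprob PA (\<Union>c\<in>C. {y. K <= (\<Sum>c'\<in>C - {c}. a c (y (t * n + c) mod B) c' (y (t * n + c') mod B))})"
   unfolding bd_def by (rule arg_cong[where f = "mprob PA"]) blast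
  also have "... <= (\<Sum>c\<in>C. mprob PA {y. K <= (\<Sum>c'\<in>C - {c}. a c (y (t * n + c) mod B) c' (y (t * n + c') mod B))})"
   using finC by (intro measure_pmf.finite_measure_subadditive_finite) auto
  also have "... <= (\<Sum>c\<in>C. 1 / real B ^ 28)" by (rule sum_mono) (rule one)
  also have "... = real (card C) * (1 / real B ^ 28)" by simp
  also have "... <= real B ^ 9 * (1 / real B ^ 28)" by (rule mult_right_mono[OF C(2)]) simp
  also have "... = 1 / real B ^ 19"
  proof -
   have *: "x * (1 / (x * y)) = 1 / y" if "x ~= 0" for x y :: real using that by simp
   have "real B ^ 28 = real B ^ 9 * real B ^ 19" by (simp flip: power_add)
   then show ?thesis using *[of "real B ^ 9" "real B ^ 19"] b1 by (simp only:) simp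
  qed
  finally show "mprob PA {y. bd y t} <= 1 / real B ^ 19" .
 qed auto
 then show ?thesis unfolding bd_def by (simp add: atLeast0LessThan Ball_def)
qed

text \<open>The threshold \<open>2 * K\<close> is the sum of the thresholds for large and for small
  entries. Hence outside the event \<open>lightb\<close> a bad cluster is heavy, and badness is a
  condition that the program can test directly.\<close>

definition "bad x = {c\<in>V. 2 * K <= (\<Sum>c'\<in>V - {c}. entry x c c')}"
definition "brel x = {(u, v). u \<in> bad x & v \<in> bad x & adj2 u v}"
definition "tcell y t c = y (t * n + c) mod B"
definition "try_ok x y t c \<longleftrightarrow> (\<Sum>c'\<in>(brel x)\<^sup>* `` {c} - {c}. a c (tcell y t c) c' (tcell y t c')) < K"
definition "tries_ok x y \<longleftrightarrow> (\<forall>c\<in>bad x. \<exists>t<B. \<forall>c'\<in>(brel x)\<^sup>* `` {c}. try_ok x y t c')"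

lemma bad_heavy: assumes "phase1_ok x" shows "bad x \<subseteq> {c\<in>V. heavy x c}"
proof
 fix c assume c: "c \<in> bad x"
 then have cV: "c \<in> V" by (simp add: bad_def)
 have "(\<Sum>c'\<in>V - {c}. entry x c c') = (\<Sum>c'\<in>V - {c}. if 1 / B <= entry x c c' then entry x c c' else 0) + (\<Sum>c'\<in>V - {c}. if 1 / B <= entry x c c' then 0 else entry x c c')"
  unfolding sum.distrib[symmetric] by (rule sum.cong) auto
 moreover have "(\<Sum>c'\<in>V - {c}. if 1 / B <= entry x c c' then 0 else entry x c c') < K"
  using assms cV unfolding phase1_ok_def lightb_def by (meson not_le)
 moreover have "2 * K <= (\<Sum>c'\<in>V - {c}. entry x c c')" using c by (simp add: bad_def)
 ultimately have "heavy x c" unfolding heavy_def by linarith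
 then show "c \<in> {c\<in>V. heavy x c}" using cV by simp
qed

lemma brel_sub: "phase1_ok x ==> brel x \<subseteq> hgraph x"
 using bad_heavy unfolding brel_def hgraph_def by blast

lemma brel_sym: "(u, v) \<in> (brel x)\<^sup>* ==> (v, u) \<in> (brel x)\<^sup>*"
proof -
 have "sym (brel x)" unfolding sym_def brel_def adj2_def by blast
 then show "(u, v) \<in> (brel x)\<^sup>* ==> (v, u) \<in> (brel x)\<^sup>*" using sym_rtrancl by (meson symE)
qed

lemma brel_eq: "(u, v) \<in> (brel x)\<^sup>* ==> (brel x)\<^sup>* `` {u} = (brel x)\<^sup>* `` {v}"
 using brel_sym by (auto intro: rtrancl_trans)

lemma brel_bad: "u \<in> bad x ==> (brel x)\<^sup>* `` {u} \<subseteq> bad x"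
proof
 fix v assume "u \<in> bad x" "v \<in> (brel x)\<^sup>* `` {u}"
 then have "(u, v) \<in> (brel x)\<^sup>*" by simp
 then show "v \<in> bad x" by (cases rule: rtranclE) (use \<open>u \<in> bad x\<close> in \<open>auto simp: brel_def\<close>)
qed

lemma prob_tries_ok:
 assumes x: "phase1_ok x" and Vn: "V \<subseteq> {..<n}" and AA: "!!t c. t < B ==> c \<in> V ==> t * n + c \<in> A"
 shows "mprob PA {y. ~ tries_ok x y} <= 1 / 100"
proof -
 let ?C = "%c. (brel x)\<^sup>* `` {c}"
 let ?E = "%C. {y. \<forall>t<B. \<exists>c\<in>C. K <= (\<Sum>c'\<in>C - {c}. a c (y (t * n + c) mod B) c' (y (t * n + c') mod B))}"
 have sub: "{y. ~ tries_ok x y} \<subseteq> (\<Union>c\<in>bad x. ?E (?C c))"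
 proof
  fix y assume "y \<in> {y. ~ tries_ok x y}"
  then obtain c where c: "c \<in> bad x" "\<forall>t<B. \<exists>c'\<in>?C c. ~ try_ok x y t c'" by (auto simp: tries_ok_def)
  have "y \<in> ?E (?C c)"
  proof (clarify)
   fix t assume "t < B"
   with c(2) obtain c' where c': "c' \<in> ?C c" "~ try_ok x y t c'" by blast
   have "?C c' = ?C c" using brel_eq c'(1) by blast
   then show "\<exists>c'\<in>?C c. K <= (\<Sum>c''\<in>?C c - {c'}. a c' (y (t * n + c') mod B) c'' (y (t * n + c'') mod B))"
    using c' unfolding try_ok_def tcell_def by (intro bexI[of _ c']) (auto simp: not_less)
  qed
  then show "y \<in> (\<Union>c\<in>bad x. ?E (?C c))" using c(1) by blast
 qed
 have finb: "finite (bad x)" "card (bad x) <= n" using V card_mono[of V "bad x"] by (auto simp: bad_def)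
 have "mprob PA {y. ~ tries_ok x y} <= mprob PA (\<Union>c\<in>bad x. ?E (?C c))"
  by (rule measure_pmf.finite_measure_mono[OF sub]) simp
 also have "... <= (\<Sum>c\<in>bad x. mprob PA (?E (?C c)))"
  using finb by (intro measure_pmf.finite_measure_subadditive_finite) auto
 also have "... <= (\<Sum>c\<in>bad x. (1 / real B ^ 19) ^ B)"
 proof (rule sum_mono, rule prob_tries[OF _ _ Vn AA])
  fix c assume c: "c \<in> bad x"
  show "?C c \<subseteq> V" using brel_bad[OF c] by (auto simp: bad_def)
  have h: "c \<in> V" "heavy x c" using bad_heavy[OF x] c by auto
  have CV: "(hgraph x)\<^sup>* `` {c} \<subseteq> V"
  proof
   fix v assume "v \<in> (hgraph x)\<^sup>* `` {c}"
   then have "(c, v) \<in> (hgraph x)\<^sup>*" by simp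
   then show "v \<in> V" by (cases rule: rtranclE) (use h in \<open>auto simp: hgraph_def\<close>)
  qed
  have "?C c \<subseteq> (hgraph x)\<^sup>* `` {c}" using rtrancl_mono[OF brel_sub[OF x]] by blast
  then have "card (?C c) <= card ((hgraph x)\<^sup>* `` {c})" by (rule card_mono[OF finite_subset[OF CV V(1)]])
  moreover have "real (card ((hgraph x)\<^sup>* `` {c})) <= real B ^ 9" using x h unfolding phase1_ok_def by blast
  ultimately show "real (card (?C c)) <= real B ^ 9" by linarith
 qed
 also have "... = real (card (bad x)) * (1 / real B ^ 19) ^ B" by simp
 also have "... <= 2 ^ B * (1 / real B ^ 19) ^ B" using finb(2) n_le by (intro mult_right_mono) auto
 also have "... = (2 / real B ^ 19) ^ B" by (simp flip: power_mult_distrib)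
 also have "... <= (1 / 2) ^ B"
 proof (rule power_mono)
  have "4 <= real B ^ 1" using b1 by simp
  also have "... <= real B ^ 19" using b1 by (intro power_increasing) auto
  finally show "2 / real B ^ 19 <= 1 / 2" using b1 by (simp add: divide_le_eq_1_pos zero_less_power)
 qed simp
 also have "... <= 1 / 100" by (rule small_num)
 finally show ?thesis .
qed

text \<open>All members of a component adopt the same try, so the load from within is below
  \<open>K\<close> by the test. Other bad clusters are not adjacent to \<open>c\<close>; their loads
  are below \<open>lo\<close> whatever they draw, and \<open>wl\<close> summed over all heavy
  clusters is below 1.\<close>

lemma phase2_load:
 assumes x: "phase1_ok x" and c: "c \<in> bad x"
  and ad: "!!u v. (u, v) \<in> (brel x)\<^sup>* ==> ad u = ad v" and ok: "try_ok x y (ad c) c"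
 shows "(\<Sum>c'\<in>bad x - {c}. a c (tcell y (ad c) c) c' (tcell y (ad c') c')) < K + 1"
proof -
 let ?C = "(brel x)\<^sup>* `` {c}"
 let ?g = "%c'. a c (tcell y (ad c) c) c' (tcell y (ad c') c')"
 have fin: "finite (bad x)" using V by (auto simp: bad_def)
 have CV: "?C \<subseteq> bad x" by (rule brel_bad[OF c])
 have "(\<Sum>c'\<in>bad x - {c}. ?g c') = (\<Sum>c'\<in>(?C - {c}) \<union> (bad x - ?C). ?g c')"
  using CV by (intro sum.cong) auto
 also have "... = (\<Sum>c'\<in>?C - {c}. ?g c') + (\<Sum>c'\<in>bad x - ?C. ?g c')"
  using fin CV by (intro sum.union_disjoint) (auto intro: finite_subset)
 also have "(\<Sum>c'\<in>?C - {c}. ?g c') = (\<Sum>c'\<in>?C - {c}. a c (tcell y (ad c) c) c' (tcell y (ad c) c'))"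
  using ad by (intro sum.cong) auto
 also have "... < K" using ok by (simp add: try_ok_def)
 also have "(\<Sum>c'\<in>bad x - ?C. ?g c') <= (\<Sum>c'\<in>bad x - ?C. wl c (tcell y (ad c) c) c')"
 proof (rule sum_mono)
  fix c' assume c': "c' \<in> bad x - ?C"
  then have ne: "c' ~= c" by auto
  have "(c, c') \<notin> brel x" using c' by auto
  then have "~ adj2 c c'" using c c' by (auto simp: brel_def)
  moreover have t: "tcell y (ad c) c < B" "tcell y (ad c') c' < B" by (simp_all add: tcell_def mod_lt)
  ultimately have "~ lo <= ?g c'" unfolding adj2_def by blast
  then have "?g c' = (if lo <= ?g c' then 0 else ?g c')" by simp
  also have "... <= (\<Sum>r'<B. if lo <= a c (tcell y (ad c) c) c' r' then 0 else a c (tcell y (ad c) c) c' r')"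
   using t(2) by (intro member_le_sum[of "tcell y (ad c') c'" "{..<B}" "%r'. if lo <= a c (tcell y (ad c) c) c' r' then 0 else a c (tcell y (ad c) c) c' r'"]) (auto simp: a(1))
  finally show "?g c' <= wl c (tcell y (ad c) c) c'" using ne by (simp add: wl_def)
 qed
 also have "... <= (\<Sum>c'\<in>{c'\<in>V. heavy x c'}. wl c (tcell y (ad c) c) c')"
 proof (rule sum_mono2)
  show "finite {c'\<in>V. heavy x c'}" using V by simp
  show "bad x - ?C \<subseteq> {c'\<in>V. heavy x c'}" using bad_heavy[OF x] by blast
  show "0 <= wl c (tcell y (ad c) c) c'" for c' by (auto simp: wl_def a(1) intro!: sum_nonneg)
 qed
 also have "... < 1"
  using x c unfolding phase1_ok_def bad_def by (simp add: tcell_def mod_lt)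
 finally show ?thesis by simp
qed

end

text \<open>The first sampling, from \<open>L\<close> configurations per cluster down to
  \<open>B\<close>. Rows and columns of total size \<open>10 * L\<close> become rows and columns of
  total size \<open>30 * B\<close>, which are the assumptions of \<open>rmatrix\<close>.\<close>

locale rsample =
 fixes V :: "nat set" and B b n L ll :: nat and a :: "nat => nat => nat => nat => real"
  and A :: "nat set" and w :: nat
 assumes V: "finite V" "card V <= n" and B: "64 <= B" and n: "n <= 2 ^ B" and L: "L = 2 ^ ll"
  and a: "!!c r c' r'. 0 <= a c r c' r'" "!!c r c' r'. a c r c' r' <= 1"
  and row: "!!c r. c \<in> V ==> r < L ==> (\<Sum>c'\<in>V - {c}. \<Sum>r'<L. a c r c' r') <= 10 * real L"
  and col: "!!c r. c \<in> V ==> r < L ==> (\<Sum>c'\<in>V - {c}. \<Sum>r'<L. a c' r' c r) <= 10 * real L"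
  and A: "finite A" "!!c r. c \<in> V ==> r < B ==> c * B + r \<in> A" and w: "ll <= w"
begin

abbreviation "U == pmf_of_set {..<2 ^ w :: nat}"
abbreviation "PA == Pi_pmf A 0 (%_. U)"

definition "smp x c r = x (c * B + r) mod L"

text \<open>Rows and columns are treated at once by abstracting the entries to \<open>g\<close>. The
  mean is at most \<open>10 * B\<close>, so the Chernoff exponent for \<open>30 * B\<close> is
  \<open>20 * B - 30 * B\<close>.\<close>

lemma prob_one:
 assumes c: "c \<in> V" "r < B" and g: "!!v c' y. 0 <= g v c' y" "!!v c' y. g v c' y <= (1::real)"
  and sum: "!!v. v < L ==> (\<Sum>c'\<in>V - {c}. \<Sum>r'<L. g v c' r') <= 10 * real L"
 shows "mprob PA {x. 30 * real B <= (\<Sum>c'\<in>V - {c}. \<Sum>r'<B. g (smp x c r) c' (smp x c' r'))} <= exp (- (10 * real B))"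
proof -
 let ?J = "(%(c', r'). c' * B + r') ` ((V - {c}) \<times> {..<B})"
 let ?h = "%i v y. g (v mod L) (i div B) (y mod L)"
 have inj: "inj_on (%(c', r'). c' * B + r') (X \<times> {..<B})" for X
 proof (rule inj_onI, clarsimp)
  fix c1 r1 c2 r2 assume *: "r1 < B" "r2 < B" "c1 * B + r1 = c2 * B + r2"
  have "(c1 * B + r1) div B = c1" "(c2 * B + r2) div B = c2" using *(1,2) by auto
  then show "c1 = c2 & r1 = r2" using *(3) by auto
 qed
 have re: "(\<Sum>i\<in>?J. h i) = (\<Sum>c'\<in>V - {c}. \<Sum>r'<B. h (c' * B + r'))" for h :: "nat => real"
  by (subst sum.reindex[OF inj]) (simp add: sum.cartesian_product case_prod_beta)
 have L0: "0 < L" by (simp add: L)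
 have setU: "set_pmf U = {..<2 ^ w}" by (simp add: set_pmf_of_set lessThan_empty_iff)
 have "mprob PA {x. 30 * real B <= (\<Sum>i\<in>?J. ?h i (x (c * B + r)) (x i))} <= exp (2 * (10 * real B) - 30 * real B)"
 proof (rule chernoff_Pi_pmf[OF A(1)])
  show "?J \<subseteq> A" "c * B + r \<in> A" using A(2) c by auto
  show "c * B + r \<notin> ?J"
  proof
   assume "c * B + r \<in> ?J"
   then obtain c' r' where *: "c' \<in> V - {c}" "r' < B" "c * B + r = c' * B + r'" by auto
   have "(c * B + r) div B = c" "(c' * B + r') div B = c'" using *(2) c(2) by auto
   then show False using *(1,3) by auto
  qed
  fix v :: nat
  have "(\<Sum>i\<in>?J. mexp U (?h i v)) = (\<Sum>c'\<in>V - {c}. \<Sum>r'<B. mexp U (%y. g (v mod L) c' (y mod L)))"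
   unfolding re by (intro sum.cong refl) auto
  also have "... = (\<Sum>c'\<in>V - {c}. real B * ((\<Sum>r'<L. g (v mod L) c' r') / real L))"
   unfolding L using sum_mod_uniform[OF w, of "g (v mod 2 ^ ll) _"] by simp
  also have "... = real B * ((\<Sum>c'\<in>V - {c}. \<Sum>r'<L. g (v mod L) c' r') / real L)"
   by (simp only: sum_distrib_left sum_divide_distrib)
  also have "... <= real B * (10 * real L / real L)"
   using sum[of "v mod L"] L0 by (intro mult_left_mono divide_right_mono) auto
  also have "... = 10 * real B" using L0 by simp
  finally show "(\<Sum>i\<in>?J. mexp U (?h i v)) <= 10 * real B" .
 qed (use g setU in auto)
 then have le: "mprob PA {x. 30 * real B <= (\<Sum>i\<in>?J. ?h i (x (c * B + r)) (x i))} <= exp (- (10 * real B))"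
  by simp
 have "(\<Sum>i\<in>?J. ?h i (x (c * B + r)) (x i)) = (\<Sum>c'\<in>V - {c}. \<Sum>r'<B. g (smp x c r) c' (smp x c' r'))" for x
  unfolding re smp_def by (intro sum.cong refl) auto
 then show ?thesis using le by (simp only:)
qed

definition "sample_ok x \<longleftrightarrow> (\<forall>c\<in>V. \<forall>r<B.
  (\<Sum>c'\<in>V - {c}. \<Sum>r'<B. a c (smp x c r) c' (smp x c' r')) <= 30 * real B &
  (\<Sum>c'\<in>V - {c}. \<Sum>r'<B. a c' (smp x c' r') c (smp x c r)) <= 30 * real B)"

lemma prob_sample_ok: "mprob PA {x. ~ sample_ok x} <= 2 / 100"
proof -
 let ?E = "%c r. {x. 30 * real B <= (\<Sum>c'\<in>V - {c}. \<Sum>r'<B. a c (smp x c r) c' (smp x c' r'))}"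
 let ?F = "%c r. {x. 30 * real B <= (\<Sum>c'\<in>V - {c}. \<Sum>r'<B. a c' (smp x c' r') c (smp x c r))}"
 have "{x. ~ sample_ok x} \<subseteq> (\<Union>z\<in>V \<times> {..<B}. ?E (fst z) (snd z) \<union> ?F (fst z) (snd z))"
 proof
  fix x assume "x \<in> {x. ~ sample_ok x}"
  then obtain c r where cr: "c \<in> V" "r < B" "x \<in> ?E c r \<union> ?F c r" unfolding sample_ok_def mem_Collect_eq Un_iff by (meson not_le less_imp_le)
  then show "x \<in> (\<Union>z\<in>V \<times> {..<B}. ?E (fst z) (snd z) \<union> ?F (fst z) (snd z))" by (intro UN_I[of "(c, r)"]) auto
 qed
 then have "mprob PA {x. ~ sample_ok x} <= mprob PA (\<Union>z\<in>V \<times> {..<B}. ?E (fst z) (snd z) \<union> ?F (fst z) (snd z))"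
  by (rule measure_pmf.finite_measure_mono) simp
 also have "... <= (\<Sum>z\<in>V \<times> {..<B}. mprob PA (?E (fst z) (snd z) \<union> ?F (fst z) (snd z)))"
  using V by (intro measure_pmf.finite_measure_subadditive_finite) auto
 also have "... <= (\<Sum>z\<in>V \<times> {..<B}. 2 * exp (- (10 * real B)))"
 proof (rule sum_mono)
  fix z assume "z \<in> V \<times> {..<B}"
  then have z: "fst z \<in> V" "snd z < B" by auto
  have "mprob PA (?E (fst z) (snd z) \<union> ?F (fst z) (snd z)) <= mprob PA (?E (fst z) (snd z)) + mprob PA (?F (fst z) (snd z))"
   by (rule measure_Un_le) auto
  also have "... <= exp (- (10 * real B)) + exp (- (10 * real B))"
  proof (rule add_mono)
   show "mprob PA (?E (fst z) (snd z)) <= exp (- (10 * real B))"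
    by (rule prob_one[where g = "%v c' y. a (fst z) v c' y", OF z a row[OF z(1)]])
   show "mprob PA (?F (fst z) (snd z)) <= exp (- (10 * real B))"
    by (rule prob_one[where g = "%v c' y. a c' y (fst z) v", OF z a col[OF z(1)]])
  qed
  finally show "mprob PA (?E (fst z) (snd z) \<union> ?F (fst z) (snd z)) <= 2 * exp (- (10 * real B))" by simp
 qed
 also have "... = real (card V) * real B * (2 * exp (- (10 * real B)))" by (simp add: card_cartesian_product)
 also have "... <= 2 ^ B * 2 ^ B * (2 * exp (- (10 * real B)))"
 proof (intro mult_right_mono mult_mono)
  have "real (card V) <= real (2 ^ B)" using V(2) n by (intro of_nat_mono) linarith
  then show "real (card V) <= 2 ^ B" by simp
  show "real B <= 2 ^ B" using of_nat_mono[OF less_imp_le[OF less_exp[of B]], where 'a = real] by simp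
 qed auto
 also have "... = 2 * (4 * exp (- 10)) ^ B"
 proof -
  have "exp (- (10 * real B)) = exp (- 10) ^ B" by (simp flip: exp_of_nat_mult add: mult.commute)
  moreover have "(2::real) ^ B * 2 ^ B = 4 ^ B" by (simp flip: power_mult_distrib)
  ultimately show ?thesis by (simp add: power_mult_distrib)
 qed
 also have "... <= 2 * (1 / 2) ^ B"
 proof (intro mult_left_mono power_mono)
  have "1 + (10::real) <= exp 10" by (rule exp_ge_add_one_self)
  then show "4 * exp (- 10) <= (1 / 2 :: real)" by (simp add: exp_minus field_simps)
 qed auto
 also have "(1 / 2 :: real) ^ B <= (1 / 2) ^ 64" by (rule power_decreasing[OF B]) auto
 also have "2 * (1 / 2 :: real) ^ 64 <= 2 / 100" by (simp add: power_divide)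
 finally show ?thesis by simp
qed

end

section \<open>The algorithm\<close>

text \<open>The bit length of \<open>x\<close>.\<close>

definition lgn :: "nat => nat" where "lgn x = (\<Sum>e<x. of_bool (2 ^ e <= x))"

text \<open>Division and remainder for quotients of at most \<open>B\<close>; the machine cannot divide.\<close>
definition idv :: "nat => nat => nat => nat" where "idv B x y = (\<Sum>i<B. of_bool (y * (i + 1) <= x))"
definition imd :: "nat => nat => nat => nat" where "imd B x y = x - y * idv B x y"

definition ing :: "inst => nat => nat => bool" where
 "ing I i j \<longleftrightarrow> i < nn I & j < mm I & j \<in> gg I i"

definition setf :: "inst => (nat => nat) => real" where "setf I C = ff I {j. j < mm I & C j ~= 0}"

locale alg = fixes I :: inst and T :: real
begin

abbreviation "n == nn I"
abbreviation "m == mm I"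

text \<open>\<open>be\<close> configurations are sampled per cluster. It exceeds \<open>log n\<close>, while \<open>KK\<close> is of the order of \<open>log be\<close>.
 There are \<open>l0\<close> rounds of multiplicative weights.\<close>
definition "bb = lgn (lgn n + 64)"
definition "be = (2::nat) ^ bb"
definition "KK = 60 + 28 * bb"
text \<open>The load of a configuration, its own overlap included, is at most
  \<open>3 * KK * T\<close>; dropping resources contested more than \<open>24 * KK\<close> times
  therefore costs at most \<open>T / 8\<close>. Two phases of draws allow \<open>GG = 2 * th\<close>
  claims per resource, and \<open>AA = 16 * GG\<close> keeps the loss of one group of thin resources
  below \<open>T / 16\<close>.\<close>

definition "th = 24 * KK"
definition "GG = 48 * KK"
definition "AA = 768 * KK"
definition "MM = n + m"
definition "l0 = (2::nat) ^ (2 * lgn (n + m))"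
text \<open>Half of \<open>l0\<close>: as many thin configurations are available to every cluster
  that has to buy one. Being a power of two, it allows random words to be reduced to uniform
  ranks.\<close>

definition "LL = (2::nat) ^ (2 * lgn (n + m) - 1)"
text \<open>Prices are at most \<open>2 ^ l0\<close> for each of \<open>m\<close> resources, so
  twice their total stays below \<open>2 ^ Kx\<close>.\<close>

definition "Kx = l0 + m + 2"

definition fat :: "nat => bool" where
 "fat j \<longleftrightarrow> j < m & T <= real AA * ff I {j'. j' < m & j' = j}"

text \<open>\<open>ld j\<close> counts how often the thin resource \<open>j\<close> has been bought; its price is 2 to the power \<open>price ld j\<close>.\<close>
definition price :: "(nat => nat) => nat => nat" where "price ld j = idv (n * l0) (ld j) MM"

text \<open>All divisions are cleared: the comparison with \<open>T / 4\<close> and that of value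
  per price with \<open>T / 2 ^ (\<kappa> + 1)\<close> only multiply by powers of two, that is, by
  repeated doubling.\<close>

definition gcond :: "(nat => nat) => nat => nat => nat => (nat => nat) => bool" where
 "gcond ld i \<kappa> j C \<longleftrightarrow> ing I i j & ~ fat j & setf I C * 2 ^ 2 < T &
   T * 2 ^ price ld j <= (ff I {j'. j' < m & (C j' ~= 0 | j' = j)} - setf I C) * 2 ^ (\<kappa> + 1)"

text \<open>One pass over the resources, buying for player \<open>i\<close> whatever has marginal value at least
 \<open>T / 2 ^ (\<kappa> + 1)\<close> per unit of price, up to a total value of about \<open>T / 4\<close>.\<close>
definition gset :: "(nat => nat) => nat => nat => nat => nat" where
 "gset ld i \<kappa> = iter m (%j C. tab m (%j'. if j' = j & gcond ld i \<kappa> j C then 1 else C j')) (tab m (%_. 0))"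

definition good :: "(nat => nat) => nat => nat => bool" where
 "good ld i \<kappa> \<longleftrightarrow> T <= setf I (gset ld i \<kappa>) * 2 ^ 2"

text \<open>The least power of two, as an exponent, at which the pass reaches its target.
  \<open>Kx\<close> signals failure, which \<open>Cf_good\<close> rules out for the players that
  have to buy.\<close>

definition cexp :: "(nat => nat) => nat => nat" where "cexp ld i = lst Kx (good ld i)"

definition fadj :: "nat => nat" where
 "fadj = tab (n * m) (%e. of_bool (fat (imd n e m) & ing I (idv n e m) (imd n e m)))"

definition mat :: "(nat => nat) => bool" where "mat S \<longleftrightarrow> perfect n m S (auction n m S fadj)"

text \<open>Greedy basis: players are offered a fat resource in the order of decreasing thin cost.\<close>
definition mset :: "(nat => nat) => nat => nat" where
 "mset ld = iter ((Kx + 1) * n) (%s S. tab n (%i. if i = imd (Kx + 1) s n & cexp ld i = Kx - idv (Kx + 1) s n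
    & mat (tab n (%i'. if i' = i then 1 else S i')) then 1 else S i)) (tab n (%_. 0))"

text \<open>The players who have to live on thin resources in this round.\<close>
definition inB :: "(nat => nat) => nat => bool" where "inB ld i \<longleftrightarrow> i < n & mset ld i = 0"

definition cfg :: "(nat => nat) => nat => nat => nat" where "cfg ld i = gset ld i (cexp ld i)"

definition ldt :: "nat => nat => nat" where
 "ldt t = iter t (%_ ld. tab m (%j. ld j + (\<Sum>i<n. of_bool (inB ld i & cfg ld i j ~= 0)))) (tab m (%_. 0))"

end

lemma idv_eq: assumes "0 < y" "x div y <= B" shows "idv B x y = x div y"
proof -
 have "idv B x y = (\<Sum>i<B. of_bool (i < x div y))"
  unfolding idv_def by (rule sum.cong) (auto simp: less_eq_div_iff_mult_less_eq[OF assms(1)] Suc_le_eq[symmetric] mult.commute)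
 also have "... = (\<Sum>i | i < B & i < x div y. 1)" by (simp add: sum.inter_filter[symmetric] of_bool_def)
 also have "{i. i < B & i < x div y} = {..<x div y}" using assms(2) by auto
 finally show ?thesis by simp
qed

lemma imd_eq: assumes "0 < y" "x div y <= B" shows "imd B x y = x mod y"
 unfolding imd_def idv_eq[OF assms] by (simp add: minus_mult_div_eq_mod)

lemma idv_pair: assumes "i < B" "j < y" shows "idv B (i * y + j) y = i" "imd B (i * y + j) y = j"
proof -
 have "(i * y + j) div y = i" "(i * y + j) mod y = j" using assms(2) by auto
 then show "idv B (i * y + j) y = i" "imd B (i * y + j) y = j"
  using idv_eq[of y "i * y + j" B] imd_eq[of y "i * y + j" B] assms by auto
qed

lemma lgn: "x < 2 ^ lgn x" "0 < x ==> 2 ^ lgn x <= 2 * x"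
proof -
 define k where "k = (LEAST e. x < 2 ^ e)"
 have k: "x < 2 ^ k" unfolding k_def by (rule LeastI[of _ x]) (rule less_exp)
 have kmin: "2 ^ e <= x \<longleftrightarrow> e < k" for e :: nat
 proof
  assume "2 ^ e <= x"
  then have "(2::nat) ^ e < 2 ^ k" using k by linarith
  then show "e < k" by simp
 next
  assume "e < k"
  then show "2 ^ e <= x" using not_less_Least[of e "%e. x < 2 ^ e"] by (auto simp: k_def)
 qed
 have kx: "k <= x" unfolding k_def by (rule Least_le) (rule less_exp)
 have "lgn x = (\<Sum>e<x. of_bool (e < k))" by (simp add: lgn_def kmin)
 also have "... = (\<Sum>e | e < x & e < k. 1)" by (simp add: sum.inter_filter[symmetric] of_bool_def)
 also have "{e. e < x & e < k} = {..<k}" using kx by auto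
 finally have lk: "lgn x = k" by simp
 show "x < 2 ^ lgn x" using k lk by simp
 assume "0 < x"
 then have "0 < k" using kmin[of 0] by simp
 then obtain k' where k': "k = Suc k'" by (cases k) auto
 then have "2 ^ k' <= x" using kmin[of k'] by simp
 then show "2 ^ lgn x <= 2 * x" using lk k' by simp
qed

section \<open>Matchable sets and greedy bases\<close>

lemma perfect_iff_hall:
 "perfect nl nr act (auction nl nr act adj) \<longleftrightarrow>
  (\<forall>X. X \<subseteq> {u. u < nl & act u ~= 0} --> card X <= card {r. r < nr & (\<exists>u\<in>X. adj (u * nr + r) ~= 0)})"
proof
 assume p: "perfect nl nr act (auction nl nr act adj)"
 show "\<forall>X. X \<subseteq> {u. u < nl & act u ~= 0} --> card X <= card {r. r < nr & (\<exists>u\<in>X. adj (u * nr + r) ~= 0)}"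
 proof (intro allI impI)
  fix X assume X: "X \<subseteq> {u. u < nl & act u ~= 0}"
  define g where "g u = (SOME r. r < nr & auction nl nr act adj r = Suc u)" for u
  have g: "g u < nr & auction nl nr act adj (g u) = Suc u" if "u \<in> X" for u
  proof -
   have "\<exists>r. r < nr & auction nl nr act adj r = Suc u" using p X that unfolding perfect_def by auto
   then show ?thesis unfolding g_def by (rule someI_ex)
  qed
  show "card X <= card {r. r < nr & (\<exists>u\<in>X. adj (u * nr + r) ~= 0)}"
  proof (rule card_inj_on_le[where f = g])
   show "inj_on g X" using g by (intro inj_onI) (metis Suc_inject)
   show "g ` X \<subseteq> {r. r < nr & (\<exists>u\<in>X. adj (u * nr + r) ~= 0)}"
    using g auction_owner(3) by (intro image_subsetI) blast
  qed simp
 qed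
next
 assume H: "\<forall>X. X \<subseteq> {u. u < nl & act u ~= 0} --> card X <= card {r. r < nr & (\<exists>u\<in>X. adj (u * nr + r) ~= 0)}"
 show "perfect nl nr act (auction nl nr act adj)" by (rule auction_perfect[OF H[rule_format]])
qed

text \<open>Matchable sets form a matroid, so a maximal one is maximum. A blocked \<open>u\<close>
  has all its neighbours in those of a tight subset of \<open>S\<close>. Tight sets are closed under
  union, so a single tight \<open>Z\<close> covers the neighbours of all of \<open>P - S\<close>;
  then \<open>S'\<close> has at most \<open>card Z\<close> elements in \<open>Z\<close> and
  \<open>P - S\<close> together.\<close>

lemma greedy_matching_max:
 fixes N :: "'a => 'r set"
 assumes fin: "finite P" "!!u. u \<in> P ==> finite (N u)" and S: "S \<subseteq> P" "!!X. X \<subseteq> S ==> card X <= card (\<Union>(N ` X))"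
  and bl: "!!u. u \<in> P - S ==> \<exists>X. X \<subseteq> insert u S & card (\<Union>(N ` X)) < card X"
  and S': "S' \<subseteq> P" "!!X. X \<subseteq> S' ==> card X <= card (\<Union>(N ` X))"
 shows "card S' <= card S"
proof -
 have fN: "finite (\<Union>(N ` X))" if "X \<subseteq> P" for X using that fin finite_subset by blast
 have fX: "finite X" if "X \<subseteq> P" for X using that fin finite_subset by blast
 have tight: "\<exists>A\<subseteq>S. card (\<Union>(N ` A)) = card A & N u \<subseteq> \<Union>(N ` A)" if u: "u \<in> P - S" for u
 proof -
  obtain X where X: "X \<subseteq> insert u S" "card (\<Union>(N ` X)) < card X" using bl[OF u] by blast
  define A where "A = X - {u}"
  have A: "A \<subseteq> S" using X by (auto simp: A_def)
  have "u \<in> X" using X S(2)[of X] by (metis insert_absorb insert_iff leD subset_insert)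
  moreover have "finite X" using X(1) S(1) u fin(1) by (meson DiffD1 finite_insert finite_subset insert_subset)
  ultimately have cA: "card X = Suc (card A)" unfolding A_def by (simp only: card_Suc_Diff1)
  have sub: "\<Union>(N ` A) \<subseteq> \<Union>(N ` X)" by (auto simp: A_def)
  have "X \<subseteq> P" using X S(1) u by auto
  then have fin': "finite (\<Union>(N ` X))" by (rule fN)
  have "card (\<Union>(N ` X)) <= card A" using X(2) cA by simp
  also have "... <= card (\<Union>(N ` A))" by (rule S(2)[OF A])
  finally have "\<Union>(N ` A) = \<Union>(N ` X)" using card_seteq[OF fin' sub] by simp
  moreover have "card (\<Union>(N ` A)) = card A"
   using \<open>card (\<Union>(N ` X)) <= card A\<close> \<open>card A <= card (\<Union>(N ` A))\<close> card_mono[OF fin' sub] by simp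
  ultimately show ?thesis using A \<open>u \<in> X\<close> by (intro exI[of _ A] conjI) auto
 qed
 have union: "\<exists>Z\<subseteq>S. card (\<Union>(N ` Z)) = card Z & \<Union>(N ` U) \<subseteq> \<Union>(N ` Z)" if "finite U" "U \<subseteq> P - S" for U
  using that
 proof (induction U rule: finite_induct)
  case empty then show ?case by (intro exI[of _ "{}"]) auto
 next
  case (insert u U)
  then obtain Z where Z: "Z \<subseteq> S" "card (\<Union>(N ` Z)) = card Z" "\<Union>(N ` U) \<subseteq> \<Union>(N ` Z)" by auto
  obtain A where A: "A \<subseteq> S" "card (\<Union>(N ` A)) = card A" "N u \<subseteq> \<Union>(N ` A)" using tight[of u] insert by auto
  have fin': "finite (\<Union>(N ` Z))" "finite (\<Union>(N ` A))" "finite Z" "finite A" using fN fX Z A S by auto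
  have "card (\<Union>(N ` (Z \<union> A))) + card (\<Union>(N ` Z) \<inter> \<Union>(N ` A)) = card (\<Union>(N ` Z)) + card (\<Union>(N ` A))"
   using card_Un_Int[OF fin'(1,2)] by (simp add: image_Un Union_Un_distrib)
  moreover have "card (\<Union>(N ` (Z \<inter> A))) <= card (\<Union>(N ` Z) \<inter> \<Union>(N ` A))"
   by (rule card_mono) (use fin' in auto)
  moreover have "card (Z \<inter> A) <= card (\<Union>(N ` (Z \<inter> A)))" by (rule S(2)) (use Z in auto)
  moreover have "card (Z \<union> A) + card (Z \<inter> A) = card Z + card A" using card_Un_Int[OF fin'(3,4)] by simp
  moreover have "card (Z \<union> A) <= card (\<Union>(N ` (Z \<union> A)))" by (rule S(2)) (use Z A in auto)
  ultimately have "card (\<Union>(N ` (Z \<union> A))) = card (Z \<union> A)" using Z(2) A(2) by linarith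
  then show ?case using Z A by (intro exI[of _ "Z \<union> A"]) auto
 qed
 obtain Z where Z: "Z \<subseteq> S" "card (\<Union>(N ` Z)) = card Z" "\<Union>(N ` (P - S)) \<subseteq> \<Union>(N ` Z)"
  using union[of "P - S"] fin by blast
 let ?B = "S' \<inter> (Z \<union> (P - S))"
 have "card ?B <= card (\<Union>(N ` ?B))" by (rule S'(2)) auto
 also have "... <= card (\<Union>(N ` Z))" by (rule card_mono[OF fN]) (use Z S in auto)
 finally have "card ?B <= card Z" using Z(2) by simp
 moreover have "card (S' \<inter> (S - Z)) <= card (S - Z)" by (rule card_mono) (use fX S in auto)
 moreover have "S' = ?B \<union> (S' \<inter> (S - Z))" using S'(1) by auto
 then have "card S' <= card ?B + card (S' \<inter> (S - Z))" by (metis card_Un_le)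
 moreover have "card (S - Z) + card Z = card S" using Z fX[OF S(1)] by (metis card_Diff_subset card_mono finite_subset le_add_diff_inverse2)
 ultimately show ?thesis by linarith
qed

lemma pow2_sum: "(2::nat) ^ c = 1 + (\<Sum>k<c. 2 ^ k)" by (induction c) auto

text \<open>A power of two is 1 plus all smaller powers, so both sums are nonnegative combinations
  of the numbers of elements above each threshold. This turns the cardinality comparison for a
  greedy basis into a comparison of costs.\<close>

lemma sum_pow2_mono:
 fixes e :: "nat => nat"
 assumes fin: "finite B" "finite B'" and e: "!!i. i \<in> B \<union> B' ==> e i <= q"
  and le: "!!k. card {i\<in>B. k <= e i} <= card {i\<in>B'. k <= e i}"
 shows "(\<Sum>i\<in>B. 2 ^ e i) <= (\<Sum>i\<in>B'. (2::nat) ^ e i)"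
proof -
 have *: "(\<Sum>i\<in>X. (2::nat) ^ e i) = card {i\<in>X. 0 <= e i} + (\<Sum>k<q. 2 ^ k * card {i\<in>X. Suc k <= e i})" if X: "finite X" "X \<subseteq> B \<union> B'" for X
 proof -
  have "(\<Sum>i\<in>X. (2::nat) ^ e i) = (\<Sum>i\<in>X. 1 + (\<Sum>k<q. if Suc k <= e i then 2 ^ k else 0))"
  proof (rule sum.cong[OF refl])
   fix i assume "i \<in> X"
   then have "e i <= q" using e X by auto
   then have "(\<Sum>k<e i. (2::nat) ^ k) = (\<Sum>k<q. if Suc k <= e i then 2 ^ k else 0)"
    by (intro sum.mono_neutral_cong_left) auto
   then show "(2::nat) ^ e i = 1 + (\<Sum>k<q. if Suc k <= e i then 2 ^ k else 0)" using pow2_sum[of "e i"] by simp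
  qed
  also have "... = card X + (\<Sum>i\<in>X. \<Sum>k<q. if Suc k <= e i then 2 ^ k else 0)" by (simp only: sum.distrib card_eq_sum)
  also have "(\<Sum>i\<in>X. \<Sum>k<q. if Suc k <= e i then (2::nat) ^ k else 0) = (\<Sum>k<q. \<Sum>i\<in>X. if Suc k <= e i then 2 ^ k else 0)" by (rule sum.swap)
  also have "... = (\<Sum>k<q. 2 ^ k * card {i\<in>X. Suc k <= e i})"
   using X(1) by (intro sum.cong refl) (simp add: sum.inter_filter[symmetric])
  finally show ?thesis by simp
 qed
 show ?thesis unfolding *[OF fin(1) Un_upper1] *[OF fin(2) Un_upper2]
  by (intro add_mono sum_mono mult_left_mono le) auto
qed

lemma sum_of_bool_card: "(\<Sum>i<(k::nat). of_bool (P i)) = card {i. i < k & P i}"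
proof -
 have "(\<Sum>i<k. of_bool (P i) :: nat) = (\<Sum>i\<in>{i\<in>{..<k}. P i}. 1)" unfolding of_bool_def by (rule sum.inter_filter[symmetric]) simp
 then show ?thesis by simp
qed

lemma pair_lt: "i < a ==> j < b ==> i * b + j < a * (b::nat)"
proof -
 assume "i < a" "j < b"
 then have "i * b + j < Suc i * b" by simp
 also have "... <= a * b" using \<open>i < a\<close> by (intro mult_le_mono1) simp
 finally show ?thesis .
qed

lemma pair_inj: "j < b ==> j' < b ==> i * b + j = i' * b + j' \<longleftrightarrow> i = i' & j = (j'::nat)"
proof
 assume a: "j < b" "j' < b" "i * b + j = i' * b + j'"
 then have "(i * b + j) div b = (i' * b + j') div b" "(i * b + j) mod b = (i' * b + j') mod b" by auto
 then show "i = i' & j = j'" using a(1,2) by auto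
qed auto

context alg
begin

text \<open>\<open>rq i\<close> is the number of rounds in which player \<open>i\<close> is served by a fat resource. Flows with these demands
 are matchings between \<open>l0\<close> copies of every player and of every resource.\<close>
definition "rq i = (\<Sum>t<l0. of_bool (~ inB (ldt t) i) :: nat)"
definition "cact = tab (n * l0) (%u. of_bool (imd n u l0 < rq (idv n u l0)))"
definition "cadj E = tab (n * l0 * (m * l0))
 (%e. E (idv n (idv (n * l0) e (m * l0)) l0 * m + idv m (imd (n * l0) e (m * l0)) l0))"
definition "cfl E = auction (n * l0) (m * l0) cact (cadj E)"
definition "feas E \<longleftrightarrow> perfect (n * l0) (m * l0) cact (cfl E)"
text \<open>An inclusion-minimal set of edges that carries a flow.\<close>
definition "emin k = iter k (%e E. tab (n * m) (%e'. if e' = e & feas (tab (n * m) (%e''. if e'' = e then 0 else E e''))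
  then 0 else E e')) fadj"
definition "ed i j \<longleftrightarrow> i < n & j < m & emin (n * m) (i * m + j) ~= 0"
definition "xf i j = (\<Sum>q<l0. of_bool (j < m & (\<exists>p<l0. cfl (emin (n * m)) (j * l0 + q) = i * l0 + p + 1)) :: nat)"
definition "dg j = (\<Sum>i<n. of_bool (ed i j) :: nat)"
text \<open>Every resource adopts all of its neighbours but one as children. Only the child with the largest
 flow is kept; it joins the cluster of the remaining neighbour.\<close>
definition "chact = tab (m * n) (%u. of_bool (imd m u n + 1 < dg (idv m u n)))"
definition "chadj = tab (m * n * n) (%e. of_bool (ed (imd (m * n) e n) (idv m (idv (m * n) e n) n)))"
definition "chown = auction (m * n) n chact chadj"
definition "chd i j \<longleftrightarrow> i < n & j < m & (\<exists>q<n. chown i = j * n + q + 1)"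
definition "kpt i j \<longleftrightarrow> chd i j &
  (\<forall>i'<n. chd i' j --> i' ~= i --> xf i' j < xf i j | (xf i' j = xf i j & i < i'))"
definition "prt j = lst n (%p. ed p j & ~ chd p j)"
definition "pr i = (if \<exists>j<m. kpt i j then prt (lst m (kpt i)) else i)"
definition "rot i = iter n (%_ v. pr v) i"
text \<open>A cluster that touches a resource of degree 1 needs no thin configuration.\<close>
definition "stf c \<longleftrightarrow> (\<exists>i<n. rot i = c & (\<exists>j<m. ed i j & dg j = 1))"
definition "inV c \<longleftrightarrow> c < n & rot c = c & ~ stf c"

text \<open>\<open>e\<close> encodes the thin configuration that player \<open>e mod n\<close> buys in round \<open>e div n\<close>.\<close>
definition "ise c e \<longleftrightarrow> rot (imd l0 e n) = c & inB (ldt (idv l0 e n)) (imd l0 e n)"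
text \<open>A configuration of the cluster is addressed by its rank, so a uniform rank below
  \<open>LL\<close> selects uniformly among the first \<open>LL\<close> of them.\<close>

definition "sel c r = lst (l0 * n) (%e. ise c e & (\<Sum>e'<l0 * n. of_bool (e' < e & ise c e')) = r)"
definition "cf e = cfg (ldt (idv l0 e n)) (imd l0 e n)"
text \<open>Marginal values in the order of the indices. A configuration suffers on a resource only from
 configurations that value the resource at least as much.\<close>
definition "wt e j = ff I {j'. j' < m & (cf e j' ~= 0 & j' < j + 1)} - ff I {j'. j' < m & (cf e j' ~= 0 & j' < j)}"
definition "dmt e e' j \<longleftrightarrow> cf e j ~= 0 & cf e' j ~= 0 & wt e j <= wt e' j"
definition "a0 e e' = (\<Sum>j<m. if dmt e e' j then wt e j else 0)"

end

locale alg3 = alg + fixes S X Y :: "nat => nat"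
begin

text \<open>\<open>S\<close> selects the samples, \<open>X\<close> the first choice \<open>x1\<close> of every cluster, \<open>Y\<close> the \<open>be\<close> further tries \<open>x2 t\<close> of the
 clusters \<open>bd\<close> whose first choice has a large load.\<close>
definition "sg c r = sel c (S (c * be + r) mod LL)"
definition "x1 c = sg c (X c mod be)"
definition "x2 t c = sg c (Y (t * n + c) mod be)"
definition "bd c \<longleftrightarrow> inV c & real (2 * KK) * T <= (\<Sum>c'<n. if inV c' & c' ~= c then a0 (x1 c) (x1 c') else 0)"
text \<open>The adjacency \<open>adj2\<close> among bad clusters; the factor
  \<open>2 ^ (11 * bb)\<close> clears the denominator of \<open>lo\<close>.\<close>

definition "h2 c c' \<longleftrightarrow> bd c & bd c' & (\<exists>r<be. \<exists>r'<be. T <= a0 (sg c r) (sg c' r') * 2 ^ (11 * bb)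
  | T <= a0 (sg c' r') (sg c r) * 2 ^ (11 * bb))"
definition "rch c = iter n (%_ A. tab n (%v. of_bool (A v ~= 0 | (\<exists>u<n. A u ~= 0 & h2 u v)))) (tab n (%v. of_bool (v = c)))"
definition "tok t c \<longleftrightarrow> (\<Sum>c'<n. if rch c c' ~= 0 & c' ~= c then a0 (x2 t c) (x2 t c') else 0) < real KK * T"
text \<open>A connected component of bad clusters adopts the first try that suits all of its members.\<close>
definition "adp c = lst be (%t. \<forall>c'<n. rch c c' ~= 0 --> tok t c')"
definition "fe c = (if bd c then x2 (adp c) c else x1 c)"
text \<open>A cluster claims the resources of its configuration which few others of the same phase contest. Its
 claims are ranked by weight and cut into groups of \<open>GG\<close>; every full group receives one resource.\<close>
definition "ovl c j = (\<Sum>c'<n. of_bool (inV c' & bd c' = bd c & dmt (fe c) (fe c') j) :: nat)"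
definition "clm c j \<longleftrightarrow> inV c & j < m & cf (fe c) j ~= 0 & ovl c j <= th"
definition "rnk c j = (\<Sum>j'<m. of_bool (clm c j' & (wt (fe c) j < wt (fe c) j' | (wt (fe c) j <= wt (fe c) j' & j' < j))) :: nat)"
definition "ncl c = (\<Sum>j<m. of_bool (clm c j) :: nat)"
definition "gact = tab (n * m) (%u. of_bool ((imd n u m + 1) * GG <= ncl (idv n u m)))"
definition "gcl c g j \<longleftrightarrow> clm c j & g * GG <= rnk c j & rnk c j < (g + 1) * GG"
definition "gadj = tab (n * m * m) (%e. of_bool (gcl (idv n (idv (n * m) e m) m) (imd n (idv (n * m) e m) m) (imd (n * m) e m)))"
definition "gown = auction (n * m) m gact gadj"
definition "tp c = imd l0 (fe c) n"
definition "thn i \<longleftrightarrow> (\<exists>c<n. inV c & tp c = i)"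
definition "fown = auction n m (tab n (%i. of_bool (~ thn i))) fadj"
text \<open>Owners are stored as successors, and group \<open>g\<close> of cluster \<open>c\<close>
  has the index \<open>c * m + g\<close>; truncated subtraction sends unowned resources to index 0.
  As the output has to be a partition also for wrong guesses and failed draws, \<open>own\<close>
  replaces invalid players by player 0.\<close>

definition "out j = (if fat j then fown j - 1 else tp (idv n (gown j - 1) m))"
definition "own j = (if out j < n then out j else 0)"

end

section \<open>Forests of flows and clusters\<close>

text \<open>Elimination: the unknown \<open>e0\<close> is expressed through the equation of
  \<open>v\<close>, which leaves one equation and one unknown fewer.\<close>

lemma common_kernel:
 fixes a :: "'v => 'e => real"
 assumes "finite V" "finite E" "card V < card E"
 shows "\<exists>x. (\<exists>e\<in>E. x e ~= 0) & (\<forall>v\<in>V. (\<Sum>e\<in>E. a v e * x e) = 0)"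
 using assms
proof (induction V arbitrary: E a rule: finite_induct)
 case empty
 then have "E ~= {}" by auto
 then show ?case by (intro exI[of _ "%_. 1"]) auto
next
 case (insert v V)
 show ?case
 proof (cases "\<forall>e\<in>E. a v e = 0")
  case True
  have "card V < card E" using insert by simp
  from insert.IH[OF insert.prems(1) this, of a] obtain x where
   "\<exists>e\<in>E. x e ~= 0" "\<forall>v\<in>V. (\<Sum>e\<in>E. a v e * x e) = 0" by blast
  then show ?thesis using True by (intro exI[of _ x]) auto
 next
  case False
  then obtain e0 where e0: "e0 \<in> E" "a v e0 ~= 0" by blast
  define E' where "E' = E - {e0}"
  have E': "finite E'" "card V < card E'" using insert e0 by (auto simp: E'_def)
  from insert.IH[OF this, of "%u e. a u e - a u e0 * a v e / a v e0"] obtain x where x: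
   "\<exists>e\<in>E'. x e ~= 0" "\<forall>u\<in>V. (\<Sum>e\<in>E'. (a u e - a u e0 * a v e / a v e0) * x e) = 0" by blast
  define s where "s = (\<Sum>e\<in>E'. a v e * x e)"
  define y where "y e = (if e = e0 then - s / a v e0 else x e)" for e
  have sum: "(\<Sum>e\<in>E. a u e * y e) = a u e0 * (- s / a v e0) + (\<Sum>e\<in>E'. a u e * x e)" for u
  proof -
   have "(\<Sum>e\<in>E. a u e * y e) = a u e0 * y e0 + (\<Sum>e\<in>E'. a u e * y e)"
    unfolding E'_def using insert.prems(1) e0(1) by (rule sum.remove)
   also have "(\<Sum>e\<in>E'. a u e * y e) = (\<Sum>e\<in>E'. a u e * x e)" by (rule sum.cong) (auto simp: y_def E'_def)
   finally show ?thesis by (simp add: y_def)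
  qed
  have "(\<Sum>e\<in>E. a u e * y e) = 0" if "u \<in> insert v V" for u
  proof (cases "u = v")
   case True
   then show ?thesis unfolding sum using e0(2) by (simp add: s_def)
  next
   case False
   then have "(\<Sum>e\<in>E'. (a u e - a u e0 * a v e / a v e0) * x e) = 0" using that x(2) by simp
   moreover have "(\<Sum>e\<in>E'. (a u e - a u e0 * a v e / a v e0) * x e) = (\<Sum>e\<in>E'. a u e * x e) - a u e0 / a v e0 * s"
    unfolding s_def sum_distrib_left sum_subtractf[symmetric] by (rule sum.cong) (auto simp: algebra_simps)
   ultimately show ?thesis unfolding sum by simp
  qed
  moreover have "\<exists>e\<in>E. y e ~= 0" using x(1) by (auto simp: y_def E'_def)
  ultimately show ?thesis by (intro exI[of _ y]) blast
 qed
qed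

definition is_flow :: "nat => nat => nat => (nat => nat) => (nat \<times> nat) set => (nat \<times> nat => real) => bool" where
 "is_flow n m l R E x \<longleftrightarrow> (\<forall>e. 0 <= x e) & (\<forall>e. e \<notin> E --> x e = 0) &
   (\<forall>i<n. (\<Sum>j<m. x (i, j)) = real (R i)) & (\<forall>j<m. (\<Sum>i<n. x (i, j)) <= real l)"

text \<open>For the bipartite graph between players and resources: every nonempty set of edges has
  more endpoints than edges, which characterises graphs without cycles.\<close>

definition forest :: "(nat \<times> nat) set => bool" where
 "forest E \<longleftrightarrow> (\<forall>F\<subseteq>E. F ~= {} --> card F < card (fst ` F) + card (snd ` F))"

text \<open>On an edge set with at least as many edges as endpoints there is a nonzero circulation.
  Moving along it preserves all row and column sums until an edge runs empty, against
  minimality.\<close>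

lemma minimal_flow_forest:
 assumes E: "E \<subseteq> {..<n} \<times> {..<m}" and x: "is_flow n m l R E x"
  and min: "!!e x'. e \<in> E ==> ~ is_flow n m l R (E - {e}) x'"
 shows "forest E"
 unfolding forest_def
proof (intro allI impI, rule ccontr)
 fix F assume F: "F \<subseteq> E" "F ~= {}" and neg: "~ card F < card (fst ` F) + card (snd ` F)"
 have finE: "finite E" using E by (rule finite_subset) auto
 then have finF: "finite F" using F finite_subset by blast
 obtain j0 where j0: "j0 \<in> snd ` F" using F by auto
 \<comment> \<open>The equation of \<open>j0\<close> is left out since row sums and column sums have
   the same total. This makes the equations fewer than the edges; \<open>col0\<close> recovers the
   missing one.\<close>
 define W where "W = Inl ` (fst ` F) \<union> Inr ` (snd ` F - {j0})"
 have cW: "card W < card F"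
 proof -
  have "card W = card (fst ` F) + card (snd ` F - {j0})"
   unfolding W_def using finF by (subst card_Un_disjoint) (auto simp: card_image)
  also have "card (snd ` F - {j0}) < card (snd ` F)" using j0 finF by (intro psubset_card_mono) auto
  finally show ?thesis using neg by simp
 qed
 define a where "a v e = (case v of Inl i => (of_bool (fst e = i) :: real) | Inr j => of_bool (snd e = j))"
  for v :: "nat + nat" and e :: "nat \<times> nat"
 have "finite W" using finF by (simp add: W_def)
 from common_kernel[OF this finF cW, of a] obtain d where d: "\<exists>e\<in>F. d e ~= 0" "\<forall>v\<in>W. (\<Sum>e\<in>F. a v e * d e) = 0" by blast
 define \<delta> where "\<delta> e = (if e \<in> F then d e else 0)" for e
 have F_sub: "F \<subseteq> {..<n} \<times> {..<m}" using F E by blast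
 have rowF: "(\<Sum>e\<in>F. of_bool (fst e = i) * d e) = (\<Sum>j<m. \<delta> (i, j))" if "i < n" for i
 proof -
  have "(\<Sum>e\<in>F. of_bool (fst e = i) * d e) = (\<Sum>e\<in>{..<n} \<times> {..<m}. of_bool (fst e = i) * \<delta> e)"
   using F_sub by (intro sum.mono_neutral_cong_left) (auto simp: \<delta>_def)
  also have "... = (\<Sum>i'<n. \<Sum>j<m. of_bool (i' = i) * \<delta> (i', j))"
   unfolding sum.cartesian_product by (rule sum.cong) auto
  also have "... = (\<Sum>i'<n. if i' = i then (\<Sum>j<m. \<delta> (i', j)) else 0)" by (intro sum.cong) auto
  also have "... = (\<Sum>j<m. \<delta> (i, j))" using that by simp
  finally show ?thesis .
 qed
 have colF: "(\<Sum>e\<in>F. of_bool (snd e = j) * d e) = (\<Sum>i<n. \<delta> (i, j))" if "j < m" for j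
 proof -
  have "(\<Sum>e\<in>F. of_bool (snd e = j) * d e) = (\<Sum>e\<in>{..<n} \<times> {..<m}. of_bool (snd e = j) * \<delta> e)"
   using F_sub by (intro sum.mono_neutral_cong_left) (auto simp: \<delta>_def)
  also have "... = (\<Sum>i<n. \<Sum>j'<m. of_bool (j' = j) * \<delta> (i, j'))"
   unfolding sum.cartesian_product by (rule sum.cong) auto
  also have "... = (\<Sum>i<n. \<Sum>j'<m. if j' = j then \<delta> (i, j') else 0)" by (intro sum.cong) auto
  also have "... = (\<Sum>i<n. \<delta> (i, j))" using that by simp
  finally show ?thesis .
 qed
 have row0: "(\<Sum>j<m. \<delta> (i, j)) = 0" if "i < n" for i
 proof (cases "i \<in> fst ` F")
  case True
  then have "Inl i \<in> W" by (simp add: W_def)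
  then have "(\<Sum>e\<in>F. a (Inl i) e * d e) = 0" using d(2) by blast
  then show ?thesis using rowF[OF that] by (simp add: a_def)
 next
  case False
  then show ?thesis by (intro sum.neutral) (force simp: \<delta>_def)
 qed
 have col1: "(\<Sum>i<n. \<delta> (i, j)) = 0" if "j < m" "j ~= j0" for j
 proof (cases "j \<in> snd ` F")
  case True
  then have "Inr j \<in> W" using that by (simp add: W_def)
  then have "(\<Sum>e\<in>F. a (Inr j) e * d e) = 0" using d(2) by blast
  then show ?thesis using colF[OF that(1)] by (simp add: a_def)
 next
  case False
  then show ?thesis by (intro sum.neutral) (force simp: \<delta>_def)
 qed
 have j0m: "j0 < m" using j0 F_sub by auto
 have col0: "(\<Sum>i<n. \<delta> (i, j)) = 0" if "j < m" for j
 proof (cases "j = j0")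
  case True
  have "0 = (\<Sum>i<n. \<Sum>j<m. \<delta> (i, j))" using row0 by simp
  also have "... = (\<Sum>j<m. \<Sum>i<n. \<delta> (i, j))" by (rule sum.swap)
  also have "... = (\<Sum>i<n. \<delta> (i, j0)) + (\<Sum>j\<in>{..<m} - {j0}. \<Sum>i<n. \<delta> (i, j))" using j0m by (intro sum.remove) auto
  also have "(\<Sum>j\<in>{..<m} - {j0}. \<Sum>i<n. \<delta> (i, j)) = 0" using col1 by (intro sum.neutral) auto
  finally show ?thesis using True by simp
 qed (use col1 that in blast)
 have negex: "\<exists>e\<in>F. \<delta> e < 0"
 proof (rule ccontr)
  assume "~ (\<exists>e\<in>F. \<delta> e < 0)"
  then have nn: "0 <= \<delta> e" for e by (cases "e \<in> F") (auto simp: \<delta>_def not_less)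
  obtain e where e: "e \<in> F" "d e ~= 0" using d(1) by blast
  obtain i j where ij: "e = (i, j)" by (cases e)
  have "i < n" "j < m" using e F_sub ij by auto
  then have "\<delta> (i, j) = 0" using row0[of i] nn sum_nonneg_eq_0_iff[of "{..<m}" "%j. \<delta> (i, j)"] by auto
  then show False using e ij by (simp add: \<delta>_def)
 qed
 define S where "S = {e\<in>F. \<delta> e < 0}"
 have S: "finite S" "S ~= {}" using finF negex by (auto simp: S_def)
 \<comment> \<open>Ratio test: among the edges on which the circulation is negative,
   \<open>e0\<close> runs empty first.\<close>
 define e0 where "e0 = arg_min_on (%e. x e / (- \<delta> e)) S"
 have e0: "e0 \<in> S" "!!e. e \<in> S ==> x e0 / (- \<delta> e0) <= x e / (- \<delta> e)"
  using arg_min_if_finite(1)[OF S, of "%e. x e / (- \<delta> e)"] arg_min_least[OF S, of _ "%e. x e / (- \<delta> e)"] by (auto simp: e0_def)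
 define s where "s = x e0 / (- \<delta> e0)"
 have x0: "0 <= x e" for e using x unfolding is_flow_def by blast
 have s0: "0 <= s" using e0(1) x0[of e0] by (auto simp: s_def S_def divide_nonneg_neg)
 define x' where "x' e = x e + s * \<delta> e" for e
 have "is_flow n m l R (E - {e0}) x'"
  unfolding is_flow_def
 proof (intro conjI allI impI)
  fix e
  show "0 <= x' e"
  proof (cases "\<delta> e < 0")
   case True
   then have "e \<in> S" by (auto simp: S_def \<delta>_def split: if_splits)
   then have "s <= x e / (- \<delta> e)" using e0(2) by (simp add: s_def)
   then have "s * (- \<delta> e) <= x e" using True pos_le_divide_eq[of "- \<delta> e" s "x e"] by linarith
   then show ?thesis by (simp add: x'_def)
  next
   case False
   then show ?thesis using x0 s0 by (simp add: x'_def)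
  qed
  assume "e \<notin> E - {e0}"
  then consider "e \<notin> E" | "e = e0" by blast
  then show "x' e = 0"
  proof cases
   case 1
   moreover from this have "x e = 0" using x unfolding is_flow_def by blast
   ultimately show ?thesis using F(1) by (auto simp: x'_def \<delta>_def)
  next
   case 2
   then show ?thesis using e0(1) by (simp add: x'_def s_def S_def)
  qed
 next
  fix i assume "i < n"
  then show "(\<Sum>j<m. x' (i, j)) = real (R i)"
   using x row0[of i] by (simp add: x'_def sum.distrib sum_distrib_left[symmetric] is_flow_def)
 next
  fix j assume "j < m"
  then show "(\<Sum>i<n. x' (i, j)) <= real l"
   using x col0[of j] by (simp add: x'_def sum.distrib sum_distrib_left[symmetric] is_flow_def)
 qed
 moreover have "e0 \<in> E" using e0(1) F(1) by (auto simp: S_def)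
 ultimately show False using min by blast
qed

text \<open>Each resource has one child fewer than neighbours and no player is a child twice, so a
  resource hangs between its parent and its children. Cutting all children but the one with the
  largest flow splits the forest into clusters whose kept resources each join two players.\<close>

locale clusters =
 fixes n m l :: nat and R :: "nat => nat" and E :: "(nat \<times> nat) set" and x :: "nat => nat => nat"
  and child :: "nat => nat => bool"
 assumes E: "E \<subseteq> {..<n} \<times> {..<m}" and forest: "forest E"
  and xE: "!!i j. (i, j) \<notin> E ==> x i j = 0"
  and xrow: "!!i. i < n ==> (\<Sum>j<m. x i j) = R i" and xcol: "!!j. j < m ==> (\<Sum>i<n. x i j) <= l"
  and childE: "!!i j. child i j ==> (i, j) \<in> E"
  and child1: "!!i j j'. child i j ==> child i j' ==> j = j'"
  and child2: "!!j. j < m ==> card {i. child i j} = card {i. (i, j) \<in> E} - 1"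
begin

abbreviation "nb j == {i. (i, j) \<in> E}"

lemma fin_nb: "finite (nb j)" "nb j \<subseteq> {..<n}"
proof -
 show "nb j \<subseteq> {..<n}" using E by blast
 then show "finite (nb j)" by (rule finite_subset) simp
qed

lemma ex1_parent: assumes "nb j ~= {}" shows "\<exists>!p. (p, j) \<in> E & ~ child p j"
proof -
 have jm: "j < m" using assms E by blast
 have sub: "{i. child i j} \<subseteq> nb j" using childE by blast
 then have "card (nb j - {i. child i j}) = card (nb j) - card {i. child i j}"
  by (intro card_Diff_subset finite_subset[OF _ fin_nb(1)])
 also have "... = 1"
 proof -
  have "card (nb j) ~= 0" using assms fin_nb(1) by simp
  then show ?thesis using child2[OF jm] by simp
 qed
 finally obtain p where "nb j - {i. child i j} = {p}" by (auto simp: card_1_singleton_iff)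
 then have "(q, j) \<in> E & ~ child q j \<longleftrightarrow> q = p" for q by blast
 then show ?thesis by simp
qed

definition "parent j = (THE p. (p, j) \<in> E & ~ child p j)"

lemma parent: "nb j ~= {} ==> (parent j, j) \<in> E & ~ child (parent j) j"
 unfolding parent_def using theI'[OF ex1_parent] .

lemma parent_unique: "(p, j) \<in> E ==> ~ child p j ==> p = parent j"
 using ex1_parent[of j] parent[of j] by blast

definition "kept i j \<longleftrightarrow> child i j & (\<forall>i'. child i' j --> i' ~= i --> x i' j < x i j | (x i' j = x i j & i < i'))"

lemma kept_unique: "kept i j ==> kept i' j ==> i = i'"
 unfolding kept_def by (metis less_asym less_irrefl)

lemma kept_ex: assumes "child i j" shows "\<exists>k. kept k j"
proof -
 let ?C = "{i. child i j}"
 have fin: "finite ?C" by (rule finite_subset[OF _ fin_nb(1)[of j]]) (use childE in blast)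
 define M where "M = Max ((%i. x i j) ` ?C)"
 have "M \<in> (%i. x i j) ` ?C" unfolding M_def using fin assms by (intro Max_in) auto
 then have ex: "\<exists>k. child k j & x k j = M" by auto
 define k where "k = (LEAST k. child k j & x k j = M)"
 have k: "child k j" "x k j = M" "!!k'. child k' j & x k' j = M ==> k <= k'"
  using LeastI_ex[OF ex] Least_le[of "%k. child k j & x k j = M"] by (auto simp: k_def)
 have "x i' j <= M" if "child i' j" for i' unfolding M_def using fin that by (intro Max_ge) auto
 then have "kept k j" unfolding kept_def using k by (metis le_neq_implies_less)
 then show ?thesis by blast
qed

definition "par i = (if \<exists>j. kept i j then parent (THE j. kept i j) else i)"
definition "isroot i \<longleftrightarrow> (\<forall>j. ~ kept i j)"
definition "rt i = (par ^^ n) i"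

lemma kept_child: "kept i j ==> child i j" by (simp add: kept_def)
lemma kept1: "kept i j ==> kept i j' ==> j = j'" using child1 kept_child by blast

lemma par_kept: "kept i j ==> par i = parent j"
proof -
 assume k: "kept i j"
 then have "(THE j. kept i j) = j" using kept1 by (intro the_equality) auto
 then show ?thesis using k by (auto simp: par_def)
qed

lemma par_root: "isroot i ==> par i = i" by (auto simp: par_def isroot_def)

lemma kept_E: "kept i j ==> (i, j) \<in> E" using kept_child childE by blast

lemma kept_nb: "kept i j ==> nb j ~= {}" using kept_E by blast

lemma par_lt: "i < n ==> par i < n"
 by (cases "isroot i") (use par_root par_kept parent kept_nb E in \<open>auto simp: isroot_def\<close>, metis (no_types, lifting) kept_nb lessThan_iff mem_Sigma_iff parent subsetD)

text \<open>Each \<open>j\<close> has two edges, to its kept child and to its parent. These are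
  twice as many edges as resources, so the forest bound leaves more players than resources.\<close>

lemma star:
 assumes J: "finite J" "J ~= {}" and kp: "!!j. j \<in> J ==> kept (k j) j"
 shows "card J < card (\<Union>j\<in>J. {k j, parent j})"
proof -
 let ?F = "(%j. (k j, j)) ` J \<union> (%j. (parent j, j)) ` J"
 have ne: "k j ~= parent j" if "j \<in> J" for j using kp[OF that] kept_child parent kept_nb by metis
 have "card ?F = card ((%j. (k j, j)) ` J) + card ((%j. (parent j, j)) ` J)"
  using J ne by (intro card_Un_disjoint) auto
 also have "... = card J + card J" by (subst (1 2) card_image) (auto simp: inj_on_def)
 finally have cF: "card ?F = card J + card J" .
 have "?F \<subseteq> E" using kp kept_E parent kept_nb by blast
 moreover have "?F ~= {}" using J by auto
 ultimately have "card ?F < card (fst ` ?F) + card (snd ` ?F)" using forest unfolding forest_def by blast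
 moreover have "fst ` ?F = (\<Union>j\<in>J. {k j, parent j})" by force
 moreover have "snd ` ?F = J" by force
 ultimately show ?thesis using cF by simp
qed

text \<open>The kept resources of the members of \<open>Q\<close> are as many as the members and
  have both ends in \<open>Q\<close>, which \<open>star\<close> forbids. This is what excludes
  cycles of \<open>par\<close>.\<close>

lemma no_closed:
 assumes Q: "finite Q" "Q ~= {}" "!!q. q \<in> Q ==> ~ isroot q" "!!q. q \<in> Q ==> par q \<in> Q"
 shows False
proof -
 define g where "g q = (SOME j. kept q j)" for q
 have g: "kept q (g q)" if "q \<in> Q" for q unfolding g_def using Q(3)[OF that] by (auto simp: isroot_def intro: someI)
 have inj: "inj_on g Q" using g kept_unique by (intro inj_onI) metis
 define h where "h j = (SOME q. q \<in> Q & g q = j)" for j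
 have h: "h (g q) = q" if "q \<in> Q" for q
 proof -
  have "h (g q) \<in> Q & g (h (g q)) = g q" unfolding h_def by (rule someI[of _ q]) (use that in simp)
  then show ?thesis using inj that by (auto simp: inj_on_def)
 qed
 have "card (g ` Q) < card (\<Union>j\<in>g ` Q. {h j, parent j})"
  by (rule star) (use Q g h in auto)
 also have "(\<Union>j\<in>g ` Q. {h j, parent j}) \<subseteq> Q" using Q(4) h par_kept[OF g] by auto
 then have "card (\<Union>j\<in>g ` Q. {h j, parent j}) <= card Q" by (rule card_mono[OF Q(1)])
 finally show False using card_image[OF inj] by simp
qed

text \<open>If no root were reached, the first repetition among \<open>n + 1\<close> successive
  ancestors would produce a set that \<open>no_closed\<close> excludes.\<close>

lemma isroot_root: assumes "i < n" shows "isroot (rt i)"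
proof (rule ccontr)
 assume nr: "~ isroot (rt i)"
 have st: "isroot ((par ^^ k) i) ==> (par ^^ (k + d)) i = (par ^^ k) i" for k d
  by (induction d) (auto simp: par_root)
 have nrk: "~ isroot ((par ^^ k) i)" if "k <= n" for k
  using nr st[of k "n - k"] that unfolding rt_def by auto
 let ?Q = "%k. (%k. (par ^^ k) i) ` {..k}"
 have "k <= n ==> card (?Q k) = Suc k" for k
 proof (induction k)
  case (Suc k)
  have "(par ^^ Suc k) i \<notin> ?Q k"
  proof
   assume mem: "(par ^^ Suc k) i \<in> ?Q k"
   show False
   proof (rule no_closed[of "?Q k"])
    fix q assume "q \<in> ?Q k"
    then obtain k' where k': "k' <= k" "q = (par ^^ k') i" by auto
    show "~ isroot q" using nrk[of k'] k' Suc.prems by simp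
    show "par q \<in> ?Q k"
    proof (cases "k' = k")
     case True then show ?thesis using mem k' by simp
    next
     case False
     then have "par q = (par ^^ Suc k') i" "Suc k' <= k" using k' by auto
     then show ?thesis by blast
    qed
   qed auto
  qed
  then show ?case using Suc by (simp add: atMost_Suc)
 qed simp
 then have "card (?Q n) = Suc n" by simp
 moreover have "(par ^^ k) i < n" for k by (induction k) (auto simp: assms par_lt)
 then have "?Q n \<subseteq> {..<n}" by auto
 then have "card (?Q n) <= n" using card_mono[of "{..<n}" "?Q n"] by simp
 ultimately show False by simp
qed

lemma root_par: assumes "i < n" shows "rt (par i) = rt i"
proof -
 have "rt (par i) = par (rt i)" unfolding rt_def by (metis comp_apply funpow_Suc_right funpow.simps(2))
 then show ?thesis using par_root[OF isroot_root[OF assms]] by simp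
qed

lemma root_of_root: "isroot c ==> rt c = c"
proof -
 assume c: "isroot c"
 have "(par ^^ k) c = c" for k by (induction k) (auto simp: par_root[OF c])
 then show ?thesis by (simp add: rt_def)
qed

lemma root_lt: "i < n ==> rt i < n"
proof -
 assume i: "i < n"
 have "(par ^^ k) i < n" for k by (induction k) (auto simp: i par_lt)
 then show ?thesis by (simp add: rt_def)
qed

definition "Q c = {i. i < n & rt i = c}"
definition "JQ c = {j. \<exists>i\<in>Q c. kept i j}"
definition "sat c \<longleftrightarrow> (\<exists>i\<in>Q c. \<exists>j. (i, j) \<in> E & card (nb j) = 1)"

lemma JQ_sub: "JQ c \<subseteq> {..<m}" using kept_E E by (auto simp: JQ_def)
lemma finJQ: "finite (JQ c)" by (rule finite_subset[OF JQ_sub]) simp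
lemma finQ: "finite (Q c)" by (simp add: Q_def)

lemma card_JQ: assumes "isroot c" "c < n" shows "Suc (card (JQ c)) = card (Q c)"
proof -
 define k where "k j = (THE i. kept i j)" for j
 have k: "k j = i" if "kept i j" for i j unfolding k_def using that kept_unique by blast
 have bij: "bij_betw k (JQ c) (Q c - {c})"
  unfolding bij_betw_def
 proof
  show "inj_on k (JQ c)"
  proof (rule inj_onI)
   fix j j' assume jj: "j \<in> JQ c" "j' \<in> JQ c" "k j = k j'"
   then obtain i i' where "kept i j" "kept i' j'" by (auto simp: JQ_def)
   then show "j = j'" using k jj(3) kept1 by metis
  qed
  show "k ` JQ c = Q c - {c}"
  proof
   show "k ` JQ c \<subseteq> Q c - {c}" using k assms(1) by (auto simp: JQ_def isroot_def)
   show "Q c - {c} \<subseteq> k ` JQ c"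
   proof
    fix i assume i: "i \<in> Q c - {c}"
    then have "~ isroot i" using root_of_root[of i] by (auto simp: Q_def)
    then obtain j where "kept i j" by (auto simp: isroot_def)
    then show "i \<in> k ` JQ c" using i k by (auto simp: JQ_def intro!: image_eqI[of _ _ j])
   qed
  qed
 qed
 have "c \<in> Q c" using assms root_of_root by (simp add: Q_def)
 then have "card (Q c - {c}) = card (Q c) - 1" "0 < card (Q c)" using finQ by (auto simp: card_gt_0_iff)
 then show ?thesis using bij_betw_same_card[OF bij] by simp
qed

lemma parent_Q: "kept i j ==> i \<in> Q c ==> parent j \<in> Q c"
 using root_par[of i] par_kept[of i j] par_lt[of i] by (auto simp: Q_def)

text \<open>Fat flow reaches the cluster through its kept resources, one fewer than it has players
  and each carrying at most \<open>l\<close>, and through the resource in \<open>X0\<close> of which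
  the root is a child. There the root is not the kept child, so another child has at least as much
  flow and the root gets at most \<open>l / 2\<close>. Hence at least \<open>l / 2\<close> of the
  total demand is left to thin resources.\<close>

lemma thin_mass:
 assumes c: "c < n" "isroot c" "~ sat c" and Rl: "!!i. i < n ==> R i <= l"
 shows "l <= 2 * (\<Sum>i\<in>Q c. l - R i)"
proof -
 define X0 where "X0 = {j. child c j}"
 have X0: "finite X0" "card X0 <= 1"
 proof -
  have sub: "X0 \<subseteq> {..<m}" using childE E by (auto simp: X0_def)
  then show "finite X0" by (rule finite_subset) simp
  show "card X0 <= 1"
  proof (cases "X0 = {}")
   case False
   then obtain j where "child c j" by (auto simp: X0_def)
   then have "X0 = {j}" using child1 by (auto simp: X0_def)
   then show ?thesis by simp
  qed simp
 qed
 have cover: "j \<in> JQ c | (i = c & j \<in> X0)" if i: "i \<in> Q c" "(i, j) \<in> E" for i j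
 proof (cases "child i j")
  case True
  show ?thesis
  proof (cases "kept i j")
   case True then show ?thesis using i by (auto simp: JQ_def)
  next
   case False
   then have "isroot i" using True child1 kept_child unfolding isroot_def by blast
   then have "i = c" using i root_of_root by (auto simp: Q_def)
   then show ?thesis using True by (simp add: X0_def)
  qed
 next
  case False
  then have ip: "i = parent j" using i parent_unique by blast
  have "card (nb j) ~= 1" using c(3) i by (auto simp: sat_def)
  then have "nb j ~= {i}" by auto
  then obtain i' where "(i', j) \<in> E" "i' ~= i" using i(2) by blast
  then have "child i' j" using parent_unique ip by blast
  then obtain k where k: "kept k j" using kept_ex by blast
  have "k < n" using kept_E[OF k] E by auto
  then have "rt k = rt (par k)" using root_par by simp
  also have "... = c" using par_kept[OF k] ip i(1) by (simp add: Q_def)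
  finally have "k \<in> Q c" using \<open>k < n\<close> by (simp add: Q_def)
  then show ?thesis using k by (auto simp: JQ_def)
 qed
 have X0half: "2 * x c j <= l" if "j \<in> X0" for j
 proof -
  have ch: "child c j" using that by (simp add: X0_def)
  then obtain k where k: "kept k j" using kept_ex by blast
  have "k ~= c" using k c(2) by (auto simp: isroot_def)
  then have le: "x c j <= x k j" using k ch unfolding kept_def by (metis less_imp_le order_refl)
  have kn: "k < n" "j < m" using kept_E[OF k] E by auto
  have "x c j + x k j = (\<Sum>i\<in>{c, k}. x i j)" using \<open>k ~= c\<close> by simp
  also have "... <= (\<Sum>i<n. x i j)" using c(1) kn by (intro sum_mono2) auto
  finally show ?thesis using xcol[OF kn(2)] le by simp
 qed
 have "(\<Sum>i\<in>Q c. R i) = (\<Sum>i\<in>Q c. \<Sum>j<m. x i j)" using xrow by (intro sum.cong) (auto simp: Q_def)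
 also have "... <= (\<Sum>i\<in>Q c. (\<Sum>j\<in>JQ c. x i j) + (if i = c then \<Sum>j\<in>X0. x i j else 0))"
 proof (rule sum_mono)
  fix i assume i: "i \<in> Q c"
  have "(\<Sum>j<m. x i j) <= (\<Sum>j\<in>JQ c \<union> (if i = c then X0 else {}). x i j)"
  proof -
   have "(\<Sum>j<m. x i j) = (\<Sum>j\<in>{j\<in>{..<m}. (i, j) \<in> E}. x i j)" using xE by (intro sum.mono_neutral_right) auto
   also have "... <= (\<Sum>j\<in>JQ c \<union> (if i = c then X0 else {}). x i j)"
    using finJQ X0 cover[OF i] by (intro sum_mono2) auto
   finally show ?thesis .
  qed
  also have "... <= (\<Sum>j\<in>JQ c. x i j) + (\<Sum>j\<in>(if i = c then X0 else {}). x i j)"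
   using finJQ X0 sum_Un_nat[of "JQ c" "if i = c then X0 else {}" "x i"] by simp
  finally show "(\<Sum>j<m. x i j) <= (\<Sum>j\<in>JQ c. x i j) + (if i = c then \<Sum>j\<in>X0. x i j else 0)" by (cases "i = c") auto
 qed
 also have "... = (\<Sum>i\<in>Q c. \<Sum>j\<in>JQ c. x i j) + (\<Sum>j\<in>X0. x c j)"
  using finQ c root_of_root by (simp add: sum.distrib Q_def)
 also have "(\<Sum>i\<in>Q c. \<Sum>j\<in>JQ c. x i j) = (\<Sum>j\<in>JQ c. \<Sum>i\<in>Q c. x i j)" by (rule sum.swap)
 also have "... <= (\<Sum>j\<in>JQ c. l)"
 proof (rule sum_mono)
  fix j assume "j \<in> JQ c"
  then have "j < m" using JQ_sub by auto
  have "(\<Sum>i\<in>Q c. x i j) <= (\<Sum>i<n. x i j)" by (rule sum_mono2) (auto simp: Q_def)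
  then show "(\<Sum>i\<in>Q c. x i j) <= l" using xcol[OF \<open>j < m\<close>] by simp
 qed
 finally have A: "(\<Sum>i\<in>Q c. R i) <= card (JQ c) * l + (\<Sum>j\<in>X0. x c j)" by simp
 have B: "2 * (\<Sum>j\<in>X0. x c j) <= l"
 proof -
  have "2 * (\<Sum>j\<in>X0. x c j) = (\<Sum>j\<in>X0. 2 * x c j)" by (simp add: sum_distrib_left)
  also have "... <= (\<Sum>j\<in>X0. l)" by (rule sum_mono) (rule X0half)
  also have "... <= 1 * l" using X0 by (simp add: mult_right_mono)
  finally show ?thesis by simp
 qed
 have "(\<Sum>i\<in>Q c. l - R i) + (\<Sum>i\<in>Q c. R i) = card (Q c) * l"
 proof -
  have "(\<Sum>i\<in>Q c. l - R i) + (\<Sum>i\<in>Q c. R i) = (\<Sum>i\<in>Q c. l)"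
   unfolding sum.distrib[symmetric] using Rl by (intro sum.cong) (auto simp: Q_def)
  then show ?thesis by simp
 qed
 then show ?thesis using A B card_JQ[OF c(2,1)] by (cases "card (Q c)") (auto simp: algebra_simps)
qed

text \<open>Resources are charged to the cluster of their parent, so clusters can be treated
  separately. If \<open>A\<close> misses a player of the cluster, the kept resources without an end
  in \<open>A\<close> are fewer than the missed players, by \<open>star\<close>. If \<open>A\<close>
  contains the whole cluster, then the cluster is \<open>sat\<close>, and its resource of degree 1,
  which is not a kept one, makes up for the deficit of one.\<close>

lemma hall:
 assumes A: "A \<subseteq> {..<n}" and ns: "!!c. c < n ==> isroot c ==> ~ sat c ==> ~ Q c \<subseteq> A"
 shows "card A <= card {j. j < m & (\<exists>i\<in>A. (i, j) \<in> E)}"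
proof -
 define Rt where "Rt = {c. c < n & isroot c}"
 define N where "N c = {j. j < m & (\<exists>i\<in>A \<inter> Q c. (i, j) \<in> E) & rt (parent j) = c}" for c
 have finRt: "finite Rt" by (simp add: Rt_def)
 have le: "card (A \<inter> Q c) <= card (N c)" if c: "c \<in> Rt" for c
 proof -
  have cr: "c < n" "isroot c" using c by (auto simp: Rt_def)
  have fN: "finite (N c)" by (simp add: N_def)
  define k where "k j = (THE i. kept i j)" for j
  have k: "k j = i" if "kept i j" for i j unfolding k_def using that kept_unique by blast
  define J0 where "J0 = {j\<in>JQ c. k j \<notin> A & parent j \<notin> A}"
  have kQ: "kept (k j) j" "k j \<in> Q c" "parent j \<in> Q c" if "j \<in> JQ c" for j
   using that k parent_Q by (auto simp: JQ_def)
  have sub: "JQ c - J0 \<subseteq> N c"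
  proof
   fix j assume j: "j \<in> JQ c - J0"
   then have jm: "j < m" using JQ_sub by auto
   have "(k j, j) \<in> E" "(parent j, j) \<in> E" using j kQ(1) kept_E parent kept_nb by blast+
   moreover have "k j \<in> A | parent j \<in> A" using j by (auto simp: J0_def)
   moreover have "rt (parent j) = c" using kQ(3) j by (auto simp: Q_def)
   ultimately show "j \<in> N c" using jm kQ(2,3) j by (auto simp: N_def)
  qed
  have cJ: "Suc (card (JQ c)) = card (Q c)" by (rule card_JQ[OF cr(2,1)])
  show ?thesis
  proof (cases "Q c \<subseteq> A")
   case True
   then have "sat c" using ns cr by blast
   then obtain i j where ij: "i \<in> Q c" "(i, j) \<in> E" "card (nb j) = 1" by (auto simp: sat_def)
   then have nbj: "nb j = {i}" by (metis (mono_tags, lifting) card_1_singletonE mem_Collect_eq singletonD)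
   have "parent j = i" using parent[of j] ij(2) nbj by blast
   then have jN: "j \<in> N c" using ij True E by (auto simp: N_def Q_def)
   have "j \<notin> JQ c"
   proof
    assume "j \<in> JQ c"
    then have "(k j, j) \<in> E" "child (k j) j" using kQ(1) kept_E kept_child by blast+
    moreover have "(parent j, j) \<in> E" "~ child (parent j) j" using parent[of j] ij(2) by blast+
    moreover from calculation have "k j = i" "parent j = i" using nbj by blast+
    ultimately show False by simp
   qed
   moreover have "J0 = {}" using True kQ by (auto simp: J0_def)
   ultimately have "insert j (JQ c) \<subseteq> N c" "card (insert j (JQ c)) = card (Q c)" using sub jN finJQ cJ by auto
   then have "card (Q c) <= card (N c)" using card_mono[OF fN] by metis
   moreover have "card (A \<inter> Q c) <= card (Q c)" by (rule card_mono[OF finQ]) blast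
   ultimately show ?thesis by simp
  next
   case False
   have "card J0 < card (Q c - A)"
   proof (cases "J0 = {}")
    case True
    then show ?thesis using False finQ by (auto simp: card_gt_0_iff)
   next
    case ne: False
    have "card J0 < card (\<Union>j\<in>J0. {k j, parent j})"
     by (rule star[OF _ ne]) (use finJQ kQ in \<open>auto simp: J0_def\<close>)
    also have "(\<Union>j\<in>J0. {k j, parent j}) \<subseteq> Q c - A" using kQ by (auto simp: J0_def)
    then have "card (\<Union>j\<in>J0. {k j, parent j}) <= card (Q c - A)" using finQ by (intro card_mono) auto
    finally show ?thesis .
   qed
   moreover have "card (Q c - A) = card (Q c) - card (A \<inter> Q c)"
    using finQ by (metis Diff_Int2 Int_commute card_Diff_subset_Int finite_Int Diff_Int_distrib2 inf.idem Diff_Compl)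
   moreover have "card (A \<inter> Q c) <= card (Q c)" by (rule card_mono[OF finQ]) blast
   moreover have "card (JQ c - J0) = card (JQ c) - card J0" "card J0 <= card (JQ c)"
    using finJQ by (auto simp: J0_def intro!: card_Diff_subset card_mono)
   moreover have "card (JQ c - J0) <= card (N c)" by (rule card_mono[OF fN sub])
   ultimately show ?thesis using cJ by linarith
  qed
 qed
 have "A = (\<Union>c\<in>Rt. A \<inter> Q c)" using A isroot_root root_lt by (auto simp: Rt_def Q_def)
 then have "card A = card (\<Union>c\<in>Rt. A \<inter> Q c)" by simp
 also have "... = (\<Sum>c\<in>Rt. card (A \<inter> Q c))" using finRt finQ by (intro card_UN_disjoint) (auto simp: Q_def)
 also have "... <= (\<Sum>c\<in>Rt. card (N c))" by (rule sum_mono) (rule le)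
 also have "... = card (\<Union>c\<in>Rt. N c)" using finRt by (intro card_UN_disjoint[symmetric]) (auto simp: N_def)
 also have "... <= card {j. j < m & (\<exists>i\<in>A. (i, j) \<in> E)}" by (intro card_mono) (auto simp: N_def)
 finally show ?thesis .
qed

end

section \<open>Multiplicative weights\<close>

lemma lst_le: "k < n ==> P k ==> lst n P <= k"
proof (rule ccontr)
 assume *: "k < n" "P k" "~ lst n P <= k"
 show False by (rule lst_cases[of n P]) (use * in auto)
qed

lemma lst_le_n: "lst n P <= n" by (rule lst_cases[of n P]) auto

locale alg_ok = alg +
 assumes inst: "santa_instance {..<n} {..<m} (ff I) (gg I)"
  and T: "0 < T" "T <= santa_opt {..<n} {..<m} (ff I) (gg I)"
begin

abbreviation "F == ff I"

lemma n0: "0 < n" using inst by (auto simp: santa_instance_def)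
lemma gg_sub: "i < n ==> gg I i \<subseteq> {..<m}" using inst by (auto simp: santa_instance_def)
lemma F_nonneg: "S \<subseteq> {..<m} ==> 0 <= F S" using inst by (auto simp: santa_instance_def)
lemma F_empty: "F {} = 0" using inst by (auto simp: santa_instance_def)
lemma F_mono: "S \<subseteq> S' ==> S' \<subseteq> {..<m} ==> F S <= F S'"
 using inst unfolding santa_instance_def monotone_set_function_def by blast

lemma marg_mono:
 assumes "S \<subseteq> S'" "S' \<subseteq> {..<m}" "j < m"
 shows "F (insert j S') - F S' <= F (insert j S) - F S"
proof (cases "j \<in> S'")
 case True
 then have "insert j S' = S'" by auto
 moreover have "F S <= F (insert j S)" using assms by (intro F_mono) auto
 ultimately show ?thesis by simp
next
 case False
 have "submodular {..<m} F" using inst by (simp add: santa_instance_def)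
 then have "F (S' \<union> {j}) - F S' <= F (S \<union> {j}) - F S" using assms False unfolding submodular_def by blast
 then show ?thesis by simp
qed

lemma F_union_le:
 assumes "finite X" "X \<subseteq> {..<m}" "S \<subseteq> {..<m}"
 shows "F (S \<union> X) <= F S + (\<Sum>j\<in>X. F (insert j S) - F S)"
 using assms
proof (induction X rule: finite_induct)
 case (insert j X)
 have "F (insert j (S \<union> X)) - F (S \<union> X) <= F (insert j S) - F S" using insert by (intro marg_mono) auto
 then show ?case using insert by simp
qed simp

text \<open>Marginal values in index order. They add up to \<open>F C\<close>, and by submodularity
  their sum over a subset is a lower bound for its value: a linearisation of \<open>F\<close> on one
  configuration.\<close>

definition wgt :: "nat set => nat => real" where "wgt C j = F (C \<inter> {..<Suc j}) - F (C \<inter> {..<j})"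

lemma wgt_nonneg: "C \<subseteq> {..<m} ==> 0 <= wgt C j"
 unfolding wgt_def using F_mono[of "C \<inter> {..<j}" "C \<inter> {..<Suc j}"] by fastforce

lemma wgt_le: assumes "C \<subseteq> {..<m}" "j \<in> C" shows "wgt C j <= F {j}"
proof -
 have "C \<inter> {..<Suc j} = insert j (C \<inter> {..<j})" using assms by (auto simp: less_Suc_eq)
 then have "wgt C j = F (insert j (C \<inter> {..<j})) - F (C \<inter> {..<j})" by (simp add: wgt_def)
 also have "... <= F (insert j {}) - F {}" using assms by (intro marg_mono) auto
 finally show ?thesis by (simp add: F_empty)
qed

lemma wgt_sum_le: assumes "C \<subseteq> {..<m}" "S \<subseteq> C" shows "(\<Sum>j\<in>S. wgt C j) <= F S"
proof -
 have "(\<Sum>j\<in>S \<inter> {..<k}. wgt C j) <= F (S \<inter> {..<k})" for k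
 proof (induction k)
  case (Suc k)
  show ?case
  proof (cases "k \<in> S")
   case True
   have S: "S \<inter> {..<Suc k} = insert k (S \<inter> {..<k})" "C \<inter> {..<Suc k} = insert k (C \<inter> {..<k})"
    using True assms by (auto simp: less_Suc_eq)
   have "wgt C k <= F (insert k (S \<inter> {..<k})) - F (S \<inter> {..<k})"
    unfolding wgt_def S(2) using assms True by (intro marg_mono) auto
   then show ?thesis using Suc by (simp add: S(1))
  next
   case False
   then have "S \<inter> {..<Suc k} = S \<inter> {..<k}" by (auto simp: less_Suc_eq)
   then show ?thesis using Suc by simp
  qed
 qed (simp add: F_empty)
 from this[of m] show ?thesis using assms by (simp add: Int_absorb2 subset_trans)
qed

lemma wgt_sum: assumes "C \<subseteq> {..<m}" shows "(\<Sum>j\<in>C. wgt C j) = F C"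
proof -
 have "(\<Sum>j\<in>C \<inter> {..<k}. wgt C j) = F (C \<inter> {..<k})" for k
 proof (induction k)
  case (Suc k)
  show ?case
  proof (cases "k \<in> C")
   case True
   then have S: "C \<inter> {..<Suc k} = insert k (C \<inter> {..<k})" by (auto simp: less_Suc_eq)
   have "(\<Sum>j\<in>C \<inter> {..<Suc k}. wgt C j) = wgt C k + (\<Sum>j\<in>C \<inter> {..<k}. wgt C j)" unfolding S by simp
   then show ?thesis using Suc by (simp add: wgt_def)
  next
   case False
   then have "C \<inter> {..<Suc k} = C \<inter> {..<k}" by (auto simp: less_Suc_eq)
   then show ?thesis using Suc by simp
  qed
 qed (simp add: F_empty)
 from this[of m] show ?thesis using assms by (simp add: Int_absorb2)
qed

lemma KK: "60 <= KK" by (simp add: KK_def)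
lemma AA: "100 <= real AA" "0 < AA" using KK by (auto simp: AA_def)

lemma thin_le: assumes "j < m" "~ fat j" shows "F {j} < T / real AA"
proof -
 have "{j'. j' < m & j' = j} = {j}" using assms by auto
 then have "real AA * F {j} < T" using assms by (simp add: fat_def)
 then show ?thesis using AA(2) by (simp add: pos_less_divide_eq mult.commute)
qed

definition Gst :: "(nat => nat) => nat => nat => nat => nat => nat" where
 "Gst ld i \<kappa> k = iter k (%j C. tab m (%j'. if j' = j & gcond ld i \<kappa> j C then 1 else C j')) (tab m (%_. 0))"
definition "Gs ld i \<kappa> k = {j. j < m & Gst ld i \<kappa> k j ~= 0}"

lemma gset_Gst: "gset ld i \<kappa> = Gst ld i \<kappa> m" by (simp add: gset_def Gst_def)
lemma setf_Gs: "setf I (Gst ld i \<kappa> k) = F (Gs ld i \<kappa> k)" by (simp add: setf_def Gs_def)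
lemma Gs_0: "Gs ld i \<kappa> 0 = {}" by (simp add: Gs_def Gst_def tab_def)

definition "gc ld i \<kappa> k \<longleftrightarrow> k \<in> gg I i & i < n & k < m & ~ fat k & 4 * F (Gs ld i \<kappa> k) < T &
  T * 2 ^ price ld k <= (F (insert k (Gs ld i \<kappa> k)) - F (Gs ld i \<kappa> k)) * 2 ^ (\<kappa> + 1)"

lemma Gs_Suc: assumes "k < m" shows "Gs ld i \<kappa> (Suc k) = (if gc ld i \<kappa> k then insert k (Gs ld i \<kappa> k) else Gs ld i \<kappa> k)"
proof -
 have e: "{j'. j' < m & (Gst ld i \<kappa> k j' ~= 0 | j' = k)} = insert k (Gs ld i \<kappa> k)" using assms by (auto simp: Gs_def)
 have q: "x * 2 ^ 2 = 4 * x" for x :: real by simp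
 have "gcond ld i \<kappa> k (Gst ld i \<kappa> k) \<longleftrightarrow> gc ld i \<kappa> k"
  unfolding gcond_def gc_def setf_Gs ing_def e q by blast
 moreover have "Gst ld i \<kappa> (Suc k) = tab m (%j'. if j' = k & gcond ld i \<kappa> k (Gst ld i \<kappa> k) then 1 else Gst ld i \<kappa> k j')"
  by (simp only: Gst_def iter.simps)
 ultimately show ?thesis using assms by (auto simp: Gs_def tab_def)
qed

text \<open>Before its last purchase the set is worth less than \<open>T / 4\<close>, and a thin
  resource adds less than \<open>T / AA <= T / 100\<close>; hence 26 / 100. The price bound adds up
  the test passed by each resource when it was bought.\<close>

lemma Gs_props:
 assumes "k <= m"
 shows "Gs ld i \<kappa> k \<subseteq> {j. j < k & j < m & j \<in> gg I i & ~ fat j}"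
  and "F (Gs ld i \<kappa> k) <= 26 / 100 * T"
  and "(\<Sum>j\<in>Gs ld i \<kappa> k. T * 2 ^ price ld j) <= F (Gs ld i \<kappa> k) * 2 ^ (\<kappa> + 1)"
proof -
 let ?G = "Gs ld i \<kappa>"
 have "?G k \<subseteq> {j. j < k & j < m & j \<in> gg I i & ~ fat j} & F (?G k) <= 26 / 100 * T &
   (\<Sum>j\<in>?G k. T * 2 ^ price ld j) <= F (?G k) * 2 ^ (\<kappa> + 1)" using assms
 proof (induction k)
  case 0 then show ?case using T by (simp add: Gs_0 F_empty)
 next
  case (Suc k)
  then have km: "k < m" and IH: "?G k \<subseteq> {j. j < k & j < m & j \<in> gg I i & ~ fat j}" "F (?G k) <= 26 / 100 * T"
    "(\<Sum>j\<in>?G k. T * 2 ^ price ld j) <= F (?G k) * 2 ^ (\<kappa> + 1)" by auto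
  show ?case
  proof (cases "gc ld i \<kappa> k")
   case False
   then show ?thesis using IH Gs_Suc[OF km, of ld i \<kappa>] by auto
  next
   case True
   have G: "?G (Suc k) = insert k (?G k)" using Gs_Suc[OF km] True by simp
   have knot: "k \<notin> ?G k" using IH(1) by auto
   have fin: "finite (?G k)" by (simp add: Gs_def)
   have sub: "?G k \<subseteq> {..<m}" using IH(1) by auto
   have "F (insert k (?G k)) - F (?G k) <= F (insert k {}) - F {}" using sub km by (intro marg_mono) auto
   then have "F (insert k (?G k)) <= F (?G k) + F {k}" by (simp add: F_empty)
   also have "F {k} < T / real AA" using True by (intro thin_le) (auto simp: gc_def)
   also have "T / real AA <= T / 100" using T AA by (intro divide_left_mono) auto
   finally have "F (?G (Suc k)) <= 26 / 100 * T" using True by (simp add: G gc_def)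
   moreover have "(\<Sum>j\<in>?G (Suc k). T * 2 ^ price ld j) <= F (?G (Suc k)) * 2 ^ (\<kappa> + 1)"
    using True IH(3) knot fin unfolding G gc_def by (simp add: algebra_simps)
   moreover have "?G (Suc k) \<subseteq> {j. j < Suc k & j < m & j \<in> gg I i & ~ fat j}"
    using IH(1) True by (auto simp: G gc_def)
   ultimately show ?thesis by blast
  qed
 qed
 then show "?G k \<subseteq> {j. j < k & j < m & j \<in> gg I i & ~ fat j}" "F (?G k) <= 26 / 100 * T"
  "(\<Sum>j\<in>?G k. T * 2 ^ price ld j) <= F (?G k) * 2 ^ (\<kappa> + 1)" by auto
qed

lemma Gs_mono: assumes "k <= k'" "k' <= m" shows "Gs ld i \<kappa> k \<subseteq> Gs ld i \<kappa> k'"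
 using assms
proof (induction k' rule: dec_induct)
 case (step k')
 then have "Gs ld i \<kappa> k' \<subseteq> Gs ld i \<kappa> (Suc k')" using Gs_Suc[of k' ld i \<kappa>] by auto
 then show ?case using step by auto
qed simp

abbreviation "GS ld i \<kappa> == Gs ld i \<kappa> m"

lemma good_iff: "good ld i \<kappa> \<longleftrightarrow> T <= 4 * F (GS ld i \<kappa>)"
 by (simp add: good_def gset_Gst setf_Gs mult.commute)

text \<open>Suppose the pass ends below \<open>T / 4\<close>. A resource of \<open>D\<close> that it
  bought has marginal value 0 on the final set; any other failed the price test on a smaller set, so
  submodularity keeps its marginal value small. In total \<open>D\<close> adds at most
  \<open>T / 2\<close>, and \<open>F D\<close> stays below \<open>T\<close>.\<close>

lemma good_complete:
 assumes i: "i < n" and D: "D \<subseteq> gg I i" "!!j. j \<in> D ==> ~ fat j" "T <= F D"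
  and w: "(\<Sum>j\<in>D. (2::nat) ^ price ld j) <= 2 ^ \<kappa>"
 shows "good ld i \<kappa>"
proof (rule ccontr)
 assume "~ good ld i \<kappa>"
 then have small: "4 * F (GS ld i \<kappa>) < T" by (simp add: good_iff)
 have Dm: "D \<subseteq> {..<m}" using D(1) gg_sub[OF i] by auto
 then have finD: "finite D" by (rule finite_subset) simp
 have GSm: "GS ld i \<kappa> \<subseteq> {..<m}" by (auto simp: Gs_def)
 have mg: "F (insert j (GS ld i \<kappa>)) - F (GS ld i \<kappa>) <= T * 2 ^ price ld j / 2 ^ (\<kappa> + 1)" if j: "j \<in> D" for j
 proof (cases "gc ld i \<kappa> j")
  case True
  have jm: "j < m" using j Dm by auto
  then have "j \<in> Gs ld i \<kappa> (Suc j)" using Gs_Suc[OF jm] True by simp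
  then have "j \<in> GS ld i \<kappa>" using Gs_mono[of "Suc j" m] jm by auto
  then have "insert j (GS ld i \<kappa>) = GS ld i \<kappa>" by auto
  then show ?thesis using T by simp
 next
  case False
  have jm: "j < m" using j Dm by auto
  have sub: "Gs ld i \<kappa> j \<subseteq> GS ld i \<kappa>" using Gs_mono[of j m] jm by simp
  have "F (Gs ld i \<kappa> j) <= F (GS ld i \<kappa>)" by (rule F_mono[OF sub GSm])
  then have "4 * F (Gs ld i \<kappa> j) < T" using small by simp
  then have "~ T * 2 ^ price ld j <= (F (insert j (Gs ld i \<kappa> j)) - F (Gs ld i \<kappa> j)) * 2 ^ (\<kappa> + 1)"
   using False j D i jm by (auto simp: gc_def)
  then have "F (insert j (Gs ld i \<kappa> j)) - F (Gs ld i \<kappa> j) <= T * 2 ^ price ld j / 2 ^ (\<kappa> + 1)"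
   by (simp add: pos_le_divide_eq)
  then show ?thesis using marg_mono[OF sub GSm jm] by simp
 qed
 have "T <= F D" by (rule D(3))
 also have "... <= F (GS ld i \<kappa> \<union> D)" using GSm Dm by (intro F_mono) auto
 also have "... <= F (GS ld i \<kappa>) + (\<Sum>j\<in>D. F (insert j (GS ld i \<kappa>)) - F (GS ld i \<kappa>))" by (rule F_union_le[OF finD Dm GSm])
 also have "(\<Sum>j\<in>D. F (insert j (GS ld i \<kappa>)) - F (GS ld i \<kappa>)) <= (\<Sum>j\<in>D. T * 2 ^ price ld j / 2 ^ (\<kappa> + 1))" by (rule sum_mono) (rule mg)
 also have "... = T * real (\<Sum>j\<in>D. 2 ^ price ld j) / 2 ^ (\<kappa> + 1)" by (simp add: sum_divide_distrib sum_distrib_left)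
 also have "... <= T * real (2 ^ \<kappa>) / 2 ^ (\<kappa> + 1)" using w T by (intro divide_right_mono mult_left_mono of_nat_mono) auto
 also have "... = T / 2" by simp
 finally show False using small T by simp
qed

definition "Nf u = {r. r < m & fat r & r \<in> gg I u}"

lemma fadj_iff: assumes "u < n" "r < m" shows "fadj (u * m + r) ~= 0 \<longleftrightarrow> r \<in> Nf u"
proof -
 have "u * m + r < n * m"
 proof -
  have "u * m + r < u * m + m" using assms by simp
  also have "... = Suc u * m" by simp
  also have "... <= n * m" using assms by (intro mult_right_mono) auto
  finally show ?thesis .
 qed
 then show ?thesis using assms idv_pair[OF assms] by (auto simp: fadj_def tab_def Nf_def ing_def)
qed

lemma mat_iff: "mat S \<longleftrightarrow> (\<forall>X. X \<subseteq> {u. u < n & S u ~= 0} --> card X <= card (\<Union>(Nf ` X)))"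
proof -
 have "{r. r < m & (\<exists>u\<in>X. fadj (u * m + r) ~= 0)} = \<Union>(Nf ` X)" if "X \<subseteq> {u. u < n & S u ~= 0}" for X
  using that fadj_iff by (auto simp: Nf_def subset_iff)
 then show ?thesis unfolding mat_def perfect_iff_hall by auto
qed

text \<open>The players that the allocation \<open>S\<close> serves by thin resources alone. In an
  optimal allocation each of the others holds a fat resource, so these others are matchable.\<close>

definition "bstar S = {i. i < n & (\<forall>j\<in>S i \<inter> gg I i. ~ fat j)}"

lemma optimum:
 obtains S where "allocation {..<n} {..<m} S" "!!i. i < n ==> T <= F (S i \<inter> gg I i)"
  "!!X. X \<subseteq> {..<n} - bstar S ==> card X <= card (\<Union>(Nf ` X))"
proof -
 obtain S where S: "allocation {..<n} {..<m} S" "santa_value {..<n} F (gg I) S = santa_opt {..<n} {..<m} F (gg I)"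
  using santa_opt_attained[OF inst] by blast
 have val: "T <= F (S i \<inter> gg I i)" if "i < n" for i
 proof -
  have "T <= santa_value {..<n} F (gg I) S" using S T by simp
  also have "... <= F (S i \<inter> gg I i)" unfolding santa_value_def using that by (intro Min_le) auto
  finally show ?thesis .
 qed
 have "card X <= card (\<Union>(Nf ` X))" if X: "X \<subseteq> {..<n} - bstar S" for X
 proof -
  define h where "h i = (SOME j. j \<in> S i \<inter> gg I i & fat j)" for i
  have h: "h i \<in> S i \<inter> gg I i & fat (h i)" if "i \<in> X" for i
  proof -
   have "\<exists>j. j \<in> S i \<inter> gg I i & fat j" using X that by (auto simp: bstar_def)
   then show ?thesis unfolding h_def by (rule someI_ex)
  qed
  show ?thesis
  proof (rule card_inj_on_le[where f = h])
   show "inj_on h X"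
   proof (rule inj_onI, rule ccontr)
    fix i i' assume ii: "i \<in> X" "i' \<in> X" "h i = h i'" "i ~= i'"
    then have "S i \<inter> S i' = {}" using S(1) X unfolding allocation_def disjoint_family_on_def by blast
    then show False using h[OF ii(1)] h[OF ii(2)] ii(3) by auto
   qed
   show "h ` X \<subseteq> \<Union>(Nf ` X)" using h by (auto simp: Nf_def fat_def)
   have "\<Union>(Nf ` X) \<subseteq> {..<m}" by (auto simp: Nf_def)
   then show "finite (\<Union>(Nf ` X))" by (rule finite_subset) simp
  qed
 qed
 then show ?thesis using that S(1) val by blast
qed

definition Mst :: "(nat => nat) => nat => nat => nat" where
 "Mst ld k = iter k (%s S. tab n (%i. if i = imd (Kx + 1) s n & cexp ld i = Kx - idv (Kx + 1) s n
    & mat (tab n (%i'. if i' = i then 1 else S i')) then 1 else S i)) (tab n (%_. 0))"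
definition "Ms ld k = {i. i < n & Mst ld k i ~= 0}"

definition "matc X \<longleftrightarrow> (\<forall>Y\<subseteq>X. card Y <= card (\<Union>(Nf ` Y)))"

lemma Ms_Suc:
 assumes "q <= Kx" "i < n"
 shows "Ms ld (Suc (q * n + i)) = (if cexp ld i = Kx - q & matc (insert i (Ms ld (q * n + i))) then insert i (Ms ld (q * n + i)) else Ms ld (q * n + i))"
proof -
 let ?S = "Mst ld (q * n + i)"
 have dm: "idv (Kx + 1) (q * n + i) n = q" "imd (Kx + 1) (q * n + i) n = i" using assms idv_pair[of q "Kx + 1" i n] by auto
 have "{u. u < n & tab n (%i'. if i' = i then 1 else ?S i') u ~= 0} = insert i (Ms ld (q * n + i))"
  using assms by (auto simp: tab_def Ms_def)
 then have mt: "mat (tab n (%i'. if i' = i then 1 else ?S i')) \<longleftrightarrow> matc (insert i (Ms ld (q * n + i)))"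
  by (simp only: mat_iff matc_def)
 have "Mst ld (Suc (q * n + i)) = tab n (%i''. if i'' = i & cexp ld i'' = Kx - q & mat (tab n (%i'. if i' = i'' then 1 else ?S i')) then 1 else ?S i'')"
  by (simp only: Mst_def iter.simps dm)
 then have "Ms ld (Suc (q * n + i)) = {u. u < n & ((u = i & cexp ld i = Kx - q & matc (insert i (Ms ld (q * n + i)))) | ?S u ~= 0)}"
  using mt by (auto simp: Ms_def tab_def)
 also have "... = (if cexp ld i = Kx - q & matc (insert i (Ms ld (q * n + i))) then insert i (Ms ld (q * n + i)) else Ms ld (q * n + i))"
  using assms by (auto simp: Ms_def)
 finally show ?thesis .
qed

lemma Ms_props:
 assumes "k <= (Kx + 1) * n"
 shows "matc (Ms ld k)" and "Ms ld k \<subseteq> {i. i < n & (Kx - cexp ld i) * n + i < k}"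
  and "k' <= k ==> Ms ld k' \<subseteq> Ms ld k"
proof -
 have step: "\<exists>q i. k = q * n + i & q <= Kx & i < n" if "k < (Kx + 1) * n" for k
 proof (intro exI conjI)
  show "k = (k div n) * n + k mod n" by simp
  show "k div n <= Kx" using less_mult_imp_div_less[OF that] by simp
  show "k mod n < n" using n0 by simp
 qed
 have "matc (Ms ld k) & Ms ld k \<subseteq> {i. i < n & (Kx - cexp ld i) * n + i < k} & (\<forall>k'\<le>k. Ms ld k' \<subseteq> Ms ld k)"
  using assms
 proof (induction k)
  case 0 then show ?case by (auto simp: Ms_def Mst_def tab_def matc_def)
 next
  case (Suc k)
  then obtain q i where k: "k = q * n + i" "q <= Kx" "i < n" using step[of k] by auto
  have IH: "matc (Ms ld k)" "Ms ld k \<subseteq> {i. i < n & (Kx - cexp ld i) * n + i < k}" "\<forall>k'\<le>k. Ms ld k' \<subseteq> Ms ld k" using Suc by auto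
  note S = Ms_Suc[OF k(2,3), of ld, folded k(1)]
  have sub: "Ms ld k \<subseteq> Ms ld (Suc k)" unfolding S by auto
  have "matc (Ms ld (Suc k))" unfolding S using IH(1) by auto
  moreover have "Ms ld (Suc k) \<subseteq> {i. i < n & (Kx - cexp ld i) * n + i < Suc k}"
  proof
   fix u assume u: "u \<in> Ms ld (Suc k)"
   show "u \<in> {i. i < n & (Kx - cexp ld i) * n + i < Suc k}"
   proof (cases "u \<in> Ms ld k")
    case True then show ?thesis using IH(2) by auto
   next
    case False
    then have "u = i" "cexp ld i = Kx - q" using u unfolding S by (auto split: if_splits)
    then show ?thesis using k by simp
   qed
  qed
  moreover have "\<forall>k'\<le>Suc k. Ms ld k' \<subseteq> Ms ld (Suc k)" using IH(3) sub by (auto simp: le_Suc_eq)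
  ultimately show ?case by blast
 qed
 then show "matc (Ms ld k)" "Ms ld k \<subseteq> {i. i < n & (Kx - cexp ld i) * n + i < k}" "k' <= k ==> Ms ld k' \<subseteq> Ms ld k" by auto
qed

abbreviation "Fs ld == Ms ld ((Kx + 1) * n)"

lemma inB_iff: "inB ld i \<longleftrightarrow> i < n & i \<notin> Fs ld" by (auto simp: inB_def mset_def Ms_def Mst_def)

lemma cexp_le: "cexp ld i <= Kx" by (simp add: cexp_def lst_le_n)

text \<open>Players come in the order of decreasing \<open>cexp\<close>, so for every threshold
  \<open>k\<close> the matched players of cost at least \<open>k\<close> are a maximal matchable set
  among all players of such cost. By \<open>greedy_matching_max\<close> no other matchable set
  covers more of them.\<close>

lemma basis_card:
 assumes B: "Bs \<subseteq> {..<n}" "matc ({..<n} - Bs)"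
 shows "card {i\<in>{i. inB ld i}. k <= cexp ld i} <= card {i\<in>Bs. k <= cexp ld i}"
proof -
 let ?P = "{i. i < n & k <= cexp ld i}"
 have "card (({..<n} - Bs) \<inter> ?P) <= card (Fs ld \<inter> ?P)"
 proof (rule greedy_matching_max[where P = ?P and N = Nf])
  show "finite (Nf u)" for u by (simp add: Nf_def)
  show "X \<subseteq> Fs ld \<inter> ?P ==> card X <= card (\<Union>(Nf ` X))" for X using Ms_props(1)[of _ ld] by (auto simp: matc_def)
  show "X \<subseteq> ({..<n} - Bs) \<inter> ?P ==> card X <= card (\<Union>(Nf ` X))" for X using B(2) by (auto simp: matc_def)
  fix u assume u: "u \<in> ?P - Fs ld \<inter> ?P"
  define q where "q = Kx - cexp ld u"
  have q: "q <= Kx" "cexp ld u = Kx - q" using cexp_le[of ld u] by (auto simp: q_def)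
  have le: "Suc (q * n + u) <= (Kx + 1) * n"
  proof -
   have "Suc (q * n + u) <= q * n + n" using u by auto
   also have "... = Suc q * n" by simp
   also have "... <= (Kx + 1) * n" using q by (intro mult_right_mono) auto
   finally show ?thesis .
  qed
  have "u \<notin> Ms ld (Suc (q * n + u))" using u Ms_props(3)[OF order_refl, of "Suc (q * n + u)" ld] le by auto
  then have "~ matc (insert u (Ms ld (q * n + u)))" using Ms_Suc[OF q(1), of u ld] u q(2) by (auto split: if_splits)
  then obtain X where X: "X \<subseteq> insert u (Ms ld (q * n + u))" "card (\<Union>(Nf ` X)) < card X" by (auto simp: matc_def not_le)
  have "Ms ld (q * n + u) \<subseteq> Fs ld \<inter> ?P"
  proof
   fix v assume v: "v \<in> Ms ld (q * n + u)"
   have vF: "v \<in> Fs ld" using v Ms_props(3)[OF order_refl, of "q * n + u" ld] le by auto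
   have "(Kx - cexp ld v) * n + v < q * n + u" "v < n" using v Ms_props(2)[of "q * n + u" ld] le by auto
   have "Kx - cexp ld v <= q"
   proof (rule ccontr)
    assume "~ Kx - cexp ld v <= q"
    then have "Suc q * n <= (Kx - cexp ld v) * n" by (intro mult_le_mono1) simp
    then show False using \<open>(Kx - cexp ld v) * n + v < q * n + u\<close> u by simp
   qed
   then have "cexp ld u <= cexp ld v" using q cexp_le[of ld v] by linarith
   then show "v \<in> Fs ld \<inter> ?P" using vF \<open>v < n\<close> u by auto
  qed
  then show "\<exists>X. X \<subseteq> insert u (Fs ld \<inter> ?P) & card (\<Union>(Nf ` X)) < card X" using X by blast
 qed auto
 moreover have "card ?P = card (Fs ld \<inter> ?P) + card {i\<in>{i. inB ld i}. k <= cexp ld i}"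
  by (subst card_Un_disjoint[symmetric]) (auto simp: inB_iff Ms_def intro!: arg_cong[where f = card])
 moreover have "card ?P = card (({..<n} - Bs) \<inter> ?P) + card {i\<in>Bs. k <= cexp ld i}"
  using B(1) finite_subset[OF B(1)] by (subst card_Un_disjoint[symmetric]) (auto intro!: arg_cong[where f = card])
 ultimately show ?thesis by linarith
qed

section \<open>Rounds, prices and the potential\<close>

definition "Cf t i = GS (ldt t) i (cexp (ldt t) i)"
definition "Bt t = {i. inB (ldt t) i}"

lemma cfg_iff: "j < m ==> cfg (ldt t) i j ~= 0 \<longleftrightarrow> j \<in> Cf t i"
 by (simp add: cfg_def Cf_def gset_Gst Gs_def)

lemma Cf_sub: "Cf t i \<subseteq> {j. j < m & j \<in> gg I i & ~ fat j}"
 using Gs_props(1)[OF order_refl, of "ldt t" i "cexp (ldt t) i"] unfolding Cf_def by blast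

lemma Cf_le: "F (Cf t i) <= 26 / 100 * T"
 using Gs_props(2)[OF order_refl, of "ldt t" i "cexp (ldt t) i"] unfolding Cf_def .

lemma Bt_sub: "Bt t \<subseteq> {..<n}" by (auto simp: Bt_def inB_def)

lemma Bt_fin: "finite (Bt t)" by (rule finite_subset[OF Bt_sub]) simp

lemma Bt_compl: "matc ({..<n} - Bt t)"
proof -
 have "{..<n} - Bt t = Fs (ldt t)" by (auto simp: Bt_def inB_iff Ms_def)
 then show ?thesis using Ms_props(1)[OF order_refl, of "ldt t"] by simp
qed

definition "Dl t j = card {i\<in>Bt t. j \<in> Cf t i}"

lemma ldt_0: "ldt 0 j = 0" by (simp add: ldt_def tab_def)

lemma ldt_Suc: assumes "j < m" shows "ldt (Suc t) j = ldt t j + Dl t j"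
proof -
 have "ldt (Suc t) = tab m (%j. ldt t j + (\<Sum>i<n. of_bool (inB (ldt t) i & cfg (ldt t) i j ~= 0)))"
  by (simp only: ldt_def iter.simps)
 then have "ldt (Suc t) j = ldt t j + (\<Sum>i<n. of_bool (inB (ldt t) i & cfg (ldt t) i j ~= 0))" using assms by (simp add: tab_def)
 also have "(\<Sum>i<n. of_bool (inB (ldt t) i & cfg (ldt t) i j ~= 0)) = (\<Sum>i<n. of_bool (i \<in> Bt t & j \<in> Cf t i) :: nat)"
  using cfg_iff[OF assms] by (simp add: Bt_def)
 also have "... = card {i. i < n & i \<in> Bt t & j \<in> Cf t i}"
  by (simp add: of_bool_def sum.inter_filter[symmetric])
 also have "{i. i < n & i \<in> Bt t & j \<in> Cf t i} = {i\<in>Bt t. j \<in> Cf t i}" using Bt_sub by auto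
 finally show ?thesis by (simp add: Dl_def)
qed

lemma ldt_sum: "j < m ==> ldt t j = (\<Sum>s<t. Dl s j)"
 by (induction t) (auto simp: ldt_0 ldt_Suc)

lemma Dl_le: "Dl t j <= n"
proof -
 have "Dl t j <= card {..<n}" unfolding Dl_def by (rule card_mono) (use Bt_sub in auto)
 then show ?thesis by simp
qed

lemma MM0: "0 < MM" using n0 by (simp add: MM_def)

lemma MM_l0: "MM * MM <= l0"
proof -
 have "MM < 2 ^ lgn MM" by (rule lgn)
 then have "MM * MM <= 2 ^ lgn MM * 2 ^ lgn MM" by (intro mult_mono) auto
 then show ?thesis by (simp add: l0_def MM_def mult_2 power_add)
qed

text \<open>A round adds at most \<open>n\<close> to the load, so the cap on quotients built into
  \<open>idv\<close> is never exceeded.\<close>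

lemma price: assumes "j < m" "t <= l0" shows "price (ldt t) j = ldt t j div MM" "price (ldt t) j <= l0"
proof -
 have "ldt t j <= (\<Sum>s<t. n)" unfolding ldt_sum[OF assms(1)] by (rule sum_mono) (rule Dl_le)
 then have l: "ldt t j <= t * n" by simp
 have "t * n <= l0 * MM" using assms by (intro mult_mono) (auto simp: MM_def)
 with l have l': "ldt t j div MM <= l0 * MM div MM" by (intro div_le_mono) simp
 also have "... = l0" using MM0 by simp
 finally have l'': "ldt t j div MM <= l0" .
 also have "... <= n * l0" using n0 by simp
 finally show "price (ldt t) j = ldt t j div MM" unfolding price_def by (intro idv_eq MM0)
 then show "price (ldt t) j <= l0" using l'' by simp
qed

definition "Ph t = (\<Sum>j<m. (2::nat) ^ price (ldt t) j)"

lemma Ph_lt: assumes "t <= l0" shows "2 * Ph t < 2 ^ Kx"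
proof -
 have "Ph t <= (\<Sum>j<m. 2 ^ l0)" unfolding Ph_def by (rule sum_mono) (use price(2)[OF _ assms] in auto)
 also have "... = m * 2 ^ l0" by simp
 also have "... <= 2 ^ m * 2 ^ l0" by (intro mult_right_mono less_imp_le) (auto simp: less_exp)
 finally have "2 * Ph t <= 2 ^ (m + l0 + 1)" by (simp add: power_add)
 also have "... < (2::nat) ^ Kx" by (rule power_strict_increasing) (auto simp: Kx_def)
 finally show ?thesis .
qed

text \<open>The thin sets of \<open>bstar S\<close> in an optimal allocation are disjoint, so their
  prices sum to at most \<open>Ph t\<close>. Rounding a price up to a power of two at most doubles
  it, and by \<open>good_complete\<close> the pass succeeds there. The greedy basis costs no more
  than \<open>bstar S\<close>, by \<open>sum_pow2_mono\<close>.\<close>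

lemma basis_cost: assumes t: "t <= l0" shows "(\<Sum>i\<in>Bt t. (2::nat) ^ cexp (ldt t) i) <= 2 * Ph t"
proof -
 obtain S where S: "allocation {..<n} {..<m} S" "!!i. i < n ==> T <= F (S i \<inter> gg I i)"
  "!!X. X \<subseteq> {..<n} - bstar S ==> card X <= card (\<Union>(Nf ` X))" using optimum by blast
 have bs: "bstar S \<subseteq> {..<n}" by (auto simp: bstar_def)
 define D where "D i = S i \<inter> gg I i" for i
 have Dm: "D i \<subseteq> {..<m}" if "i < n" for i using gg_sub[OF that] by (auto simp: D_def)
 have one: "2 ^ cexp (ldt t) i <= 2 * (\<Sum>j\<in>D i. (2::nat) ^ price (ldt t) j)" if i: "i \<in> bstar S" for i
 proof -
  have im: "i < n" using i bs by auto
  define w where "w = (\<Sum>j\<in>D i. (2::nat) ^ price (ldt t) j)"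
  have TD: "T <= F (D i)" using S(2)[OF im] by (simp add: D_def)
  then have "D i ~= {}" using T F_empty by auto
  moreover have fD: "finite (D i)" by (rule finite_subset[OF Dm[OF im]]) simp
  ultimately have "0 < w" unfolding w_def by (intro sum_pos) auto
  then have w: "w < 2 ^ lgn w" "2 ^ lgn w <= 2 * w" by (auto intro: lgn)
  have "w <= Ph t" unfolding w_def Ph_def by (rule sum_mono2) (use Dm[OF im] in auto)
  then have "(2::nat) ^ lgn w < 2 ^ Kx" using Ph_lt[OF t] w(2) by linarith
  then have lK: "lgn w < Kx" by simp
  have "good (ldt t) i (lgn w)"
  proof (rule good_complete[OF im _ _ TD])
   show "D i \<subseteq> gg I i" by (simp add: D_def)
   show "j \<in> D i ==> ~ fat j" for j using i by (auto simp: D_def bstar_def)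
   show "(\<Sum>j\<in>D i. (2::nat) ^ price (ldt t) j) <= 2 ^ lgn w" using w(1) by (simp add: w_def)
  qed
  then have "cexp (ldt t) i <= lgn w" unfolding cexp_def by (rule lst_le[OF lK])
  then have "(2::nat) ^ cexp (ldt t) i <= 2 ^ lgn w" by simp
  then show ?thesis using w(2) unfolding w_def by linarith
 qed
 have "(\<Sum>i\<in>Bt t. (2::nat) ^ cexp (ldt t) i) <= (\<Sum>i\<in>bstar S. 2 ^ cexp (ldt t) i)"
 proof (rule sum_pow2_mono[where q = Kx])
  show "card {i \<in> Bt t. k <= cexp (ldt t) i} <= card {i \<in> bstar S. k <= cexp (ldt t) i}" for k
   unfolding Bt_def by (rule basis_card[OF bs]) (use S(3) in \<open>auto simp: matc_def\<close>)
  show "finite (bstar S)" by (rule finite_subset[OF bs]) simp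
 qed (use cexp_le Bt_fin in auto)
 also have "... <= (\<Sum>i\<in>bstar S. 2 * (\<Sum>j\<in>D i. 2 ^ price (ldt t) j))" by (rule sum_mono) (rule one)
 also have "... = 2 * (\<Sum>i\<in>bstar S. \<Sum>j\<in>D i. 2 ^ price (ldt t) j)" by (simp add: sum_distrib_left)
 also have "(\<Sum>i\<in>bstar S. \<Sum>j\<in>D i. (2::nat) ^ price (ldt t) j) = (\<Sum>j\<in>(\<Union>i\<in>bstar S. D i). 2 ^ price (ldt t) j)"
 proof (rule sum.UNION_disjoint[symmetric])
  show "finite (bstar S)" by (rule finite_subset[OF bs]) simp
  show "\<forall>i\<in>bstar S. finite (D i)" using bs Dm finite_subset[OF _ finite_lessThan[of m]] by blast
  show "\<forall>i\<in>bstar S. \<forall>j\<in>bstar S. i ~= j --> D i \<inter> D j = {}"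
   using S(1) bs unfolding allocation_def disjoint_family_on_def D_def by blast
 qed
 also have "... <= Ph t" unfolding Ph_def by (rule sum_mono2) (use Dm bs in auto)
 finally show ?thesis by simp
qed

text \<open>The total cost is below \<open>2 ^ Kx\<close>, so no buying player has the exponent
  \<open>Kx\<close> of a failed search.\<close>

lemma Cf_good: assumes "t <= l0" "i \<in> Bt t" shows "T <= 4 * F (Cf t i)"
proof -
 have "(2::nat) ^ cexp (ldt t) i <= (\<Sum>i\<in>Bt t. 2 ^ cexp (ldt t) i)" by (rule member_le_sum) (use assms Bt_fin in auto)
 also have "... < 2 ^ Kx" using basis_cost[OF assms(1)] Ph_lt[OF assms(1)] by linarith
 finally have lt: "cexp (ldt t) i < Kx" by simp
 have "good (ldt t) i (cexp (ldt t) i)"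
  using lst_less[of Kx "good (ldt t) i"] lt unfolding cexp_def by auto
 then show ?thesis by (simp add: good_iff Cf_def)
qed

lemma Cf_cost: assumes t: "t <= l0" shows "(\<Sum>j<m. 2 ^ price (ldt t) j * Dl t j) <= 2 * Ph t"
proof -
 have one: "(\<Sum>j\<in>Cf t i. (2::nat) ^ price (ldt t) j) <= 2 ^ cexp (ldt t) i" for i
 proof -
  have "T * (\<Sum>j\<in>Cf t i. 2 ^ price (ldt t) j) = (\<Sum>j\<in>Cf t i. T * 2 ^ price (ldt t) j)" by (simp add: sum_distrib_left)
  also have "... <= F (Cf t i) * 2 ^ (cexp (ldt t) i + 1)"
   using Gs_props(3)[OF order_refl, of "ldt t" i "cexp (ldt t) i"] unfolding Cf_def .
  also have "... <= (26 / 100 * T) * 2 ^ (cexp (ldt t) i + 1)" using Cf_le by (intro mult_right_mono) auto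
  also have "... = T * (52 / 100 * 2 ^ cexp (ldt t) i)" by simp
  finally have "(\<Sum>j\<in>Cf t i. 2 ^ price (ldt t) j) <= (52 / 100 :: real) * 2 ^ cexp (ldt t) i"
   using T(1) by (simp only: mult_le_cancel_left_pos)
  also have "... <= 2 ^ cexp (ldt t) i" by simp
  finally have "real (\<Sum>j\<in>Cf t i. 2 ^ price (ldt t) j) <= real (2 ^ cexp (ldt t) i)" by simp
  then show ?thesis by (simp only: of_nat_le_iff)
 qed
 have "(\<Sum>j<m. 2 ^ price (ldt t) j * Dl t j) = (\<Sum>j<m. \<Sum>i\<in>Bt t. if j \<in> Cf t i then 2 ^ price (ldt t) j else 0)"
  unfolding Dl_def using Bt_fin by (intro sum.cong refl) (simp add: sum.inter_filter[symmetric])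
 also have "... = (\<Sum>i\<in>Bt t. \<Sum>j<m. if j \<in> Cf t i then 2 ^ price (ldt t) j else 0)" by (rule sum.swap)
 also have "... = (\<Sum>i\<in>Bt t. \<Sum>j\<in>Cf t i. 2 ^ price (ldt t) j)"
  using Cf_sub by (intro sum.cong refl sum.mono_neutral_cong_right) fastforce+
 also have "... <= (\<Sum>i\<in>Bt t. 2 ^ cexp (ldt t) i)" by (rule sum_mono) (rule one)
 finally show ?thesis using basis_cost[OF t] by linarith
qed

text \<open>\<open>Ps\<close> is \<open>Ph\<close> with exponents \<open>ldt / MM\<close> that are
  not rounded down, hence within a factor 2 of it. As a round buys for a total price of at most
  \<open>2 * Ph t\<close>, it multiplies \<open>Ps\<close> by at most \<open>exp (8 * c)\<close>; no
  single term exceeds the potential, so the load after \<open>l0\<close> rounds is of the order of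
  \<open>l0\<close>.\<close>

lemma load_bound: assumes j: "j < m" shows "real (ldt l0 j) <= 14 * real l0"
proof -
 \<comment> \<open>With this rate a load of \<open>MM\<close> doubles a price, so
   \<open>exp (c * ldt)\<close> and \<open>2 ^ price\<close> differ by a factor of at most
   2.\<close>
 define c where "c = ln 2 / real MM"
 have M: "0 < real MM" using MM0 by simp
 have c0: "0 <= c" by (simp add: c_def)
 have ln2: "ln 2 <= (1::real)" "1/2 <= ln (2::real)" using ln_2_less_1 ln2_ge_two_thirds by auto
 define Ps where "Ps t = (\<Sum>j<m. exp (c * real (ldt t j)))" for t
 have step: "Ps (Suc t) <= Ps t * exp (8 * c)" if t: "t < l0" for t
 proof -
  have t': "t <= l0" using t by simp
  have lo: "2 ^ price (ldt t) j <= exp (c * real (ldt t j))"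
   and hi: "exp (c * real (ldt t j)) <= 2 * 2 ^ price (ldt t) j" if j: "j < m" for j
  proof -
   let ?p = "price (ldt t) j"
   have p: "?p = ldt t j div MM" by (rule price(1)[OF j t'])
   have e: "exp (c * real (MM * k)) = 2 ^ k" for k
    using M by (simp add: c_def exp_of_nat2_mult field_simps) (metis exp_ln exp_of_nat_mult mult.commute zero_less_numeral)
   have "MM * ?p <= ldt t j" by (simp add: p)
   then have "c * real (MM * ?p) <= c * real (ldt t j)" using c0 by (intro mult_left_mono of_nat_mono) auto
   then show "2 ^ ?p <= exp (c * real (ldt t j))" using e[of ?p] by (metis exp_le_cancel_iff)
   have "ldt t j <= MM * Suc ?p" unfolding p using MM0 by (metis dividend_less_times_div less_imp_le mult_Suc_right add.commute)
   then have "c * real (ldt t j) <= c * real (MM * Suc ?p)" using c0 by (intro mult_left_mono of_nat_mono) auto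
   then show "exp (c * real (ldt t j)) <= 2 * 2 ^ ?p" using e[of "Suc ?p"] by (metis exp_le_cancel_iff power_Suc)
  qed
  have "exp (c * real (ldt (Suc t) j)) <= exp (c * real (ldt t j)) + 4 * c * (2 ^ price (ldt t) j * real (Dl t j))" if j: "j < m" for j
  proof -
   \<comment> \<open>A load grows by at most \<open>n <= MM\<close> in a round, so
     \<open>y <= ln 2 < 1\<close> and the linear estimate of the exponential applies.\<close>
   define y where "y = c * real (Dl t j)"
   have "real (Dl t j) <= real MM" using Dl_le[of t j] by (simp add: MM_def)
   then have "y <= c * real MM" unfolding y_def using c0 by (intro mult_left_mono) auto
   also have "... = ln 2" using M by (simp add: c_def)
   finally have y1: "y <= 1" using ln2 by simp
   have y0: "0 <= y" using c0 by (simp add: y_def)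
   have "exp y <= 1 + y + y\<^sup>2" by (rule exp_bound[OF y0 y1])
   also have "y\<^sup>2 <= y" using y0 y1 by (simp add: power2_eq_square mult_left_le)
   finally have ey: "exp y <= 1 + 2 * y" by simp
   have "exp (c * real (ldt (Suc t) j)) = exp (c * real (ldt t j)) * exp y"
    by (simp add: ldt_Suc[OF j] y_def distrib_left exp_add)
   also have "... <= exp (c * real (ldt t j)) * (1 + 2 * y)" by (intro mult_left_mono ey) simp
   also have "... = exp (c * real (ldt t j)) + exp (c * real (ldt t j)) * (2 * y)" by (simp add: distrib_left)
   also have "exp (c * real (ldt t j)) * (2 * y) <= (2 * 2 ^ price (ldt t) j) * (2 * y)"
    using y0 by (intro mult_right_mono hi[OF j]) auto
   also have "... = 4 * c * (2 ^ price (ldt t) j * real (Dl t j))" by (simp add: y_def)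
   finally show ?thesis by simp
  qed
  then have "Ps (Suc t) <= (\<Sum>j<m. exp (c * real (ldt t j)) + 4 * c * (2 ^ price (ldt t) j * real (Dl t j)))"
   unfolding Ps_def by (intro sum_mono) simp
  also have "... = Ps t + 4 * c * real (\<Sum>j<m. 2 ^ price (ldt t) j * Dl t j)"
   by (simp add: Ps_def sum.distrib sum_distrib_left)
  also have "... <= Ps t + 4 * c * real (2 * Ph t)"
   using c0 by (intro add_left_mono mult_left_mono of_nat_mono Cf_cost[OF t']) auto
  also have "real (2 * Ph t) <= 2 * Ps t" unfolding Ph_def Ps_def using lo by (auto intro!: sum_mono)
  then have "Ps t + 4 * c * real (2 * Ph t) <= Ps t + 4 * c * (2 * Ps t)" using c0 by (intro add_left_mono mult_left_mono) auto
  also have "... = Ps t * (1 + 8 * c)" by (simp add: algebra_simps)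
  also have "... <= Ps t * exp (8 * c)" by (intro mult_left_mono exp_ge_add_one_self) (auto simp: Ps_def intro!: sum_nonneg)
  finally show ?thesis .
 qed
 have "Ps t <= real m * exp (8 * c * real t)" if "t <= l0" for t using that
 proof (induction t)
  case 0 then show ?case by (simp add: Ps_def ldt_0)
 next
  case (Suc t)
  then have "Ps (Suc t) <= Ps t * exp (8 * c)" by (intro step) simp
  also have "... <= (real m * exp (8 * c * real t)) * exp (8 * c)" using Suc by (intro mult_right_mono) auto
  also have "... = real m * (exp (8 * c * real t) * exp (8 * c))" by simp
  also have "exp (8 * c * real t) * exp (8 * c) = exp (8 * c * real (Suc t))" unfolding exp_add[symmetric] by (simp add: algebra_simps)
  finally show ?case .
 qed
 then have Pl: "Ps l0 <= real m * exp (8 * c * real l0)" by simp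
 have "exp (c * real (ldt l0 j)) <= Ps l0" unfolding Ps_def by (rule member_le_sum) (use j in auto)
 also note Pl
 \<comment> \<open>A crude bound on the initial potential is enough: it contributes
   \<open>MM * MM\<close>, which is at most \<open>l0\<close>. This is why \<open>l0\<close> is
   quadratic in \<open>n + m\<close>.\<close>
 also have "real m <= exp (real MM)" using exp_ge_add_one_self[of "real MM"] unfolding MM_def of_nat_add by linarith
 then have "real m * exp (8 * c * real l0) <= exp (real MM) * exp (8 * c * real l0)" by (intro mult_right_mono) auto
 also have "... = exp (real MM + 8 * c * real l0)" by (simp add: exp_add)
 finally have "c * real (ldt l0 j) <= real MM + 8 * c * real l0" by simp
 then have *: "ln 2 * real (ldt l0 j) <= real MM * real MM + 8 * ln 2 * real l0"
  using M by (simp add: c_def field_simps)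
 have "real MM * real MM <= real l0" using MM_l0 by (metis of_nat_le_iff of_nat_mult)
 moreover have "real l0 <= (2 * ln 2) * real l0" using mult_right_mono[of 1 "2 * ln 2" "real l0"] ln2 by simp
 ultimately have "ln 2 * real (ldt l0 j) <= (2 * ln 2) * real l0 + 8 * ln 2 * real l0" using * by linarith
 also have "... = ln 2 * (10 * real l0)" by simp
 finally have "ln 2 * real (ldt l0 j) <= ln 2 * (10 * real l0)" .
 then have "real (ldt l0 j) <= 10 * real l0" using ln2 by (simp only: mult_le_cancel_left_pos)
 then show ?thesis by simp
qed

end

section \<open>The clusters of the algorithm\<close>

context alg_ok
begin

lemma l00: "0 < l0" by (simp add: l0_def)

definition "ES E = {(i, j). i < n & j < m & E (i * m + j) ~= 0}"

lemma ES_sub: "ES E \<subseteq> {..<n} \<times> {..<m}" by (auto simp: ES_def)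

lemma rq_card: "rq i = card {t. t < l0 & i \<notin> Bt t}" by (simp add: rq_def sum_of_bool_card Bt_def)

lemma rq_le: "rq i <= l0"
proof -
 have "rq i <= card {..<l0}" unfolding rq_card by (rule card_mono) auto
 then show ?thesis by simp
qed

lemma cact_iff: assumes "u < n * l0" shows "cact u ~= 0 \<longleftrightarrow> u mod l0 < rq (u div l0)"
proof -
 have "u div l0 <= n" using assms less_mult_imp_div_less[of u n l0] by simp
 then show ?thesis using assms idv_eq[OF l00, of u n] imd_eq[OF l00, of u n] by (simp add: cact_def tab_def)
qed

lemma cadj_eq: assumes "u < n * l0" "r < m * l0" shows "cadj E (u * (m * l0) + r) = E (u div l0 * m + r div l0)"
proof -
 have "u div l0 <= n" "r div l0 <= m" using assms less_mult_imp_div_less[of u n l0] less_mult_imp_div_less[of r m l0] by auto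
 then show ?thesis using pair_lt[OF assms] idv_pair[OF assms] idv_eq[OF l00, of u n] idv_eq[OF l00, of r m]
  by (simp add: cadj_def tab_def)
qed

text \<open>A set of active copies has the same neighbours as all active copies of its players, and
  a resource comes with all of its \<open>l0\<close> copies. So Hall's condition on copies is the
  cut condition on players.\<close>

lemma feasI:
 assumes "!!P. P \<subseteq> {..<n} ==> (\<Sum>i\<in>P. rq i) <= l0 * card {j. j < m & (\<exists>i\<in>P. (i, j) \<in> ES E)}"
 shows "feas E"
 unfolding feas_def cfl_def
proof (rule auction_perfect)
 fix U assume U: "U \<subseteq> {u. u < n * l0 & cact u ~= 0}"
 define P where "P = (%u. u div l0) ` U"
 define N where "N = {j. j < m & (\<exists>i\<in>P. (i, j) \<in> ES E)}"
 have finU: "finite U" by (rule finite_subset[OF U]) simp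
 have Pn: "P \<subseteq> {..<n}" using U less_mult_imp_div_less by (auto simp: P_def)
 then have finP: "finite P" by (rule finite_subset) simp
 have "U \<subseteq> (\<Union>i\<in>P. (%p. i * l0 + p) ` {..<rq i})"
 proof
  fix u assume u: "u \<in> U"
  then have "u mod l0 < rq (u div l0)" using U cact_iff[of u] by auto
  moreover have "u = u div l0 * l0 + u mod l0" by simp
  ultimately have "u \<in> (%p. u div l0 * l0 + p) ` {..<rq (u div l0)}" by blast
  then show "u \<in> (\<Union>i\<in>P. (%p. i * l0 + p) ` {..<rq i})" using u by (auto simp: P_def)
 qed
 then have "card U <= card (\<Union>i\<in>P. (%p. i * l0 + p) ` {..<rq i})" using finP by (intro card_mono) auto
 also have "... <= (\<Sum>i\<in>P. card ((%p. i * l0 + p) ` {..<rq i}))" by (rule card_UN_le[OF finP])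
 also have "... = (\<Sum>i\<in>P. rq i)" by (intro sum.cong refl) (simp add: card_image)
 also have "... <= l0 * card N" unfolding N_def by (rule assms[OF Pn])
 also have "... = card (N \<times> {..<l0})" by (simp add: card_cartesian_product)
 also have "... <= card {r. r < m * l0 & (\<exists>u\<in>U. cadj E (u * (m * l0) + r) ~= 0)}"
 proof (rule card_inj_on_le[where f = "%(j, q). j * l0 + q"])
  show "inj_on (%(j, q). j * l0 + q) (N \<times> {..<l0})" by (auto simp: inj_on_def pair_inj)
  show "(%(j, q). j * l0 + q) ` (N \<times> {..<l0}) \<subseteq> {r. r < m * l0 & (\<exists>u\<in>U. cadj E (u * (m * l0) + r) ~= 0)}"
  proof
   fix r assume "r \<in> (%(j, q). j * l0 + q) ` (N \<times> {..<l0})"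
   then obtain j q where j: "j \<in> N" "q < l0" and r: "r = j * l0 + q" by auto
   then obtain u where u: "u \<in> U" "(u div l0, j) \<in> ES E" by (auto simp: N_def P_def)
   have lt: "j * l0 + q < m * l0" using j by (intro pair_lt) (auto simp: N_def)
   have "cadj E (u * (m * l0) + (j * l0 + q)) = E (u div l0 * m + j)"
    using cadj_eq[of u "j * l0 + q" E] u U lt j by auto
   then show "r \<in> {r. r < m * l0 & (\<exists>u\<in>U. cadj E (u * (m * l0) + r) ~= 0)}"
    using u lt unfolding ES_def r by (intro CollectI conjI bexI[of _ u]) auto
  qed
 qed simp
 finally show "card U <= card {r. r < m * l0 & (\<exists>u\<in>U. cadj E (u * (m * l0) + r) ~= 0)}" .
qed

text \<open>Only the cut condition of a real flow is used; the matching of copies then supplies an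
  integral flow, so minimal supports for both notions coincide.\<close>

lemma flow_feas: assumes x: "is_flow n m l0 rq (ES E) x" shows "feas E"
proof (rule feasI)
 fix P assume P: "P \<subseteq> {..<n}"
 let ?N = "{j. j < m & (\<exists>i\<in>P. (i, j) \<in> ES E)}"
 have x': "!!e. 0 <= x e" "!!e. e \<notin> ES E ==> x e = 0" "!!i. i < n ==> (\<Sum>j<m. x (i, j)) = real (rq i)"
  "!!j. j < m ==> (\<Sum>i<n. x (i, j)) <= real l0" using x by (auto simp: is_flow_def)
 have "real (\<Sum>i\<in>P. rq i) = (\<Sum>i\<in>P. \<Sum>j<m. x (i, j))" using P x'(3) by (auto intro!: sum.cong)
 also have "... = (\<Sum>i\<in>P. \<Sum>j\<in>?N. x (i, j))" using x'(2) by (intro sum.cong refl sum.mono_neutral_right) auto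
 also have "... = (\<Sum>j\<in>?N. \<Sum>i\<in>P. x (i, j))" by (rule sum.swap)
 also have "... <= (\<Sum>j\<in>?N. \<Sum>i<n. x (i, j))" using P x'(1) by (intro sum_mono sum_mono2) auto
 also have "... <= (\<Sum>j\<in>?N. real l0)" by (intro sum_mono x'(4)) auto
 also have "... = real (l0 * card ?N)" by simp
 finally show "(\<Sum>i\<in>P. rq i) <= l0 * card ?N" by (simp only: of_nat_le_iff)
qed

definition "xE E i j = card {q. q < l0 & j < m & (\<exists>p<l0. cfl E (j * l0 + q) = i * l0 + p + 1)}"

lemma xE_props:
 assumes "feas E"
 shows "(i, j) \<notin> ES E ==> xE E i j = 0" and "i < n ==> (\<Sum>j<m. xE E i j) = rq i" and "j < m ==> (\<Sum>i<n. xE E i j) <= l0"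
proof -
 have own: "i < n & j < m & p < rq i & (i, j) \<in> ES E"
  if a: "q < l0" "j < m" "p < l0" "cfl E (j * l0 + q) = i * l0 + p + 1" for i j p q
 proof -
  have lt: "j * l0 + q < m * l0" by (rule pair_lt[OF a(2,1)])
  have e: "auction (n * l0) (m * l0) cact (cadj E) (j * l0 + q) = Suc (i * l0 + p)" using a(4) by (simp add: cfl_def)
  note o = auction_owner[OF lt e]
  have u: "(i * l0 + p) div l0 = i" "(i * l0 + p) mod l0 = p" "(j * l0 + q) div l0 = j" using a by auto
  have i: "i < n" using less_mult_imp_div_less[OF o(1)] u by simp
  have "p < rq i" using o(2) cact_iff[OF o(1)] u by simp
  moreover have "E (i * m + j) ~= 0" using o(3) cadj_eq[OF o(1) lt, of E] u by simp
  ultimately show ?thesis using i a(2) by (simp add: ES_def)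
 qed
 show "(i, j) \<notin> ES E ==> xE E i j = 0" using own by (fastforce simp: xE_def)
 show "(\<Sum>j<m. xE E i j) = rq i" if i: "i < n"
 proof -
  define Q where "Q j = {q. q < l0 & j < m & (\<exists>p<l0. cfl E (j * l0 + q) = i * l0 + p + 1)}" for j
  have "(\<Sum>j<m. xE E i j) = card (SIGMA j:{..<m}. Q j)" by (simp add: xE_def Q_def)
  also have "bij_betw (%(j, q). cfl E (j * l0 + q) - 1 - i * l0) (SIGMA j:{..<m}. Q j) {..<rq i}"
   unfolding bij_betw_def
  proof
   show "inj_on (%(j, q). cfl E (j * l0 + q) - 1 - i * l0) (SIGMA j:{..<m}. Q j)"
   proof (rule inj_onI, clarsimp simp: Q_def)
    fix j q p j' q' p' assume a: "q < l0" "j < m" "cfl E (j * l0 + q) = Suc (i * l0 + p)" "q' < l0" "j' < m" "cfl E (j' * l0 + q') = Suc (i * l0 + p)"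
    have "j * l0 + q = j' * l0 + q'"
     by (rule auction_inj[OF pair_lt pair_lt]) (use a in \<open>auto simp: cfl_def\<close>)
    then show "j = j' & q = q'" using a pair_inj by blast
   qed
   show "(%(j, q). cfl E (j * l0 + q) - 1 - i * l0) ` (SIGMA j:{..<m}. Q j) = {..<rq i}"
   proof (intro equalityI subsetI)
    fix p assume "p \<in> (%(j, q). cfl E (j * l0 + q) - 1 - i * l0) ` (SIGMA j:{..<m}. Q j)"
    then show "p \<in> {..<rq i}" using own by (auto simp: Q_def)
   next
    fix p assume p: "p \<in> {..<rq i}"
    then have pl: "p < l0" using rq_le[of i] by simp
    have lt: "i * l0 + p < n * l0" by (rule pair_lt[OF i pl])
    have "cact (i * l0 + p) ~= 0" using cact_iff[OF lt] pl p by simp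
    then obtain r where r: "r < m * l0" "cfl E r = i * l0 + p + 1" using assms lt unfolding feas_def perfect_def by blast
    have "(r div l0, r mod l0) \<in> (SIGMA j:{..<m}. Q j)"
     using r less_mult_imp_div_less[OF r(1)] l00 pl by (auto simp: Q_def)
    moreover have "p = (%(j, q). cfl E (j * l0 + q) - 1 - i * l0) (r div l0, r mod l0)" using r by simp
    ultimately show "p \<in> (%(j, q). cfl E (j * l0 + q) - 1 - i * l0) ` (SIGMA j:{..<m}. Q j)" by (intro image_eqI)
   qed
  qed
  then have "card (SIGMA j:{..<m}. Q j) = card {..<rq i}" by (rule bij_betw_same_card)
  finally show ?thesis by simp
 qed
 show "(\<Sum>i<n. xE E i j) <= l0" if j: "j < m"
 proof -
  have "(\<Sum>i<n. xE E i j) = card (\<Union>i<n. {q. q < l0 & j < m & (\<exists>p<l0. cfl E (j * l0 + q) = i * l0 + p + 1)})"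
   unfolding xE_def by (rule card_UN_disjoint[symmetric]) (auto simp: pair_inj)
  also have "... <= card {..<l0}" by (rule card_mono) auto
  finally show ?thesis by simp
 qed
qed

lemma feas_flow: "feas E ==> is_flow n m l0 rq (ES E) (%(i, j). real (xE E i j))"
proof -
 assume f: "feas E"
 have "(\<Sum>j<m. real (xE E i j)) = real (rq i)" if "i < n" for i using xE_props(2)[OF f that] by (metis of_nat_sum)
 moreover have "(\<Sum>i<n. real (xE E i j)) <= real l0" if "j < m" for j using xE_props(3)[OF f that] by (metis of_nat_sum of_nat_le_iff)
 ultimately show ?thesis using xE_props(1)[OF f] by (simp add: is_flow_def split: prod.splits)
qed

lemma feas_mono: assumes "feas E" "ES E \<subseteq> ES E'" shows "feas E'"
proof (rule flow_feas)
 show "is_flow n m l0 rq (ES E') (%(i, j). real (xE E i j))"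
  using feas_flow[OF assms(1)] assms(2) unfolding is_flow_def by blast
qed

text \<open>In every round the players outside \<open>Bt t\<close> are matchable to fat resources.
  Adding up their Hall conditions over all rounds gives the cut condition for the demands
  \<open>rq\<close>.\<close>

lemma feas_fadj: "feas fadj"
proof (rule feasI)
 fix P assume P: "P \<subseteq> {..<n}"
 have ESN: "{j. j < m & (\<exists>i\<in>P. (i, j) \<in> ES fadj)} = \<Union>(Nf ` P)"
  using P fadj_iff by (auto simp: ES_def Nf_def)
 have finP: "finite P" by (rule finite_subset[OF P]) simp
 have "(\<Sum>i\<in>P. rq i) = (\<Sum>i\<in>P. \<Sum>t<l0. of_bool (i \<notin> Bt t))" by (simp add: rq_def Bt_def)
 also have "... = (\<Sum>t<l0. \<Sum>i\<in>P. of_bool (i \<notin> Bt t))" by (rule sum.swap)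
 also have "... = (\<Sum>t<l0. card (P - Bt t))"
 proof (rule sum.cong[OF refl])
  fix t
  have "(\<Sum>i\<in>P. of_bool (i \<notin> Bt t) :: nat) = (\<Sum>i\<in>{i\<in>P. i \<notin> Bt t}. 1)" unfolding of_bool_def by (rule sum.inter_filter[symmetric, OF finP])
  also have "{i\<in>P. i \<notin> Bt t} = P - Bt t" by auto
  finally show "(\<Sum>i\<in>P. of_bool (i \<notin> Bt t) :: nat) = card (P - Bt t)" by simp
 qed
 also have "... <= (\<Sum>t<l0. card (\<Union>(Nf ` P)))"
 proof (rule sum_mono)
  fix t
  have "card (P - Bt t) <= card (\<Union>(Nf ` (P - Bt t)))" using Bt_compl[of t] P unfolding matc_def by (elim allE[of _ "P - Bt t"] impE) auto
  also have "... <= card (\<Union>(Nf ` P))" by (rule card_mono) (use finP in \<open>auto simp: Nf_def\<close>)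
  finally show "card (P - Bt t) <= card (\<Union>(Nf ` P))" .
 qed
 finally show "(\<Sum>i\<in>P. rq i) <= l0 * card {j. j < m & (\<exists>i\<in>P. (i, j) \<in> ES fadj)}" by (simp add: ESN)
qed

definition "del e E = tab (n * m) (%e''. if e'' = e then 0 else E e'')"

lemma emin_Suc: "emin (Suc k) = tab (n * m) (%e'. if e' = k & feas (del k (emin k)) then 0 else emin k e')"
 by (simp only: emin_def iter.simps del_def)

lemma ES_del: "ES (del e E) = {(i, j) \<in> ES E. i * m + j ~= e}"
 using pair_lt by (auto simp: ES_def del_def tab_def)

text \<open>An edge that was necessary when it was examined stays necessary: later steps only delete
  edges, and feasibility is monotone.\<close>

lemma emin_props:
 "feas (emin k) & ES (emin k) \<subseteq> ES fadj & (\<forall>(i, j)\<in>ES (emin k). i * m + j < k --> ~ feas (del (i * m + j) (emin k)))"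
proof (induction k)
 case 0
 then show ?case using feas_fadj by (simp add: emin_def)
next
 case (Suc k)
 show ?case
 proof (cases "feas (del k (emin k))")
  case True
  have e: "ES (emin (Suc k)) = ES (del k (emin k))" using True by (auto simp: emin_Suc ES_def del_def tab_def)
  have f: "feas (emin (Suc k))" by (rule feas_mono[OF True]) (simp add: e)
  have sub: "ES (emin (Suc k)) \<subseteq> ES (emin k)" using e ES_del by auto
  have "~ feas (del (i * m + j) (emin (Suc k)))" if ij: "(i, j) \<in> ES (emin (Suc k))" "i * m + j < Suc k" for i j
  proof
   assume "feas (del (i * m + j) (emin (Suc k)))"
   then have "feas (del (i * m + j) (emin k))" by (rule feas_mono) (use sub ES_del in auto)
   moreover have "i * m + j < k" using ij e ES_del by (auto simp: less_Suc_eq)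
   ultimately show False using Suc ij sub by blast
  qed
  then show ?thesis using f sub Suc by blast
 next
  case False
  have "emin (Suc k) e = tab (n * m) (emin k) e" for e using False by (simp add: emin_Suc tab_def)
  then have e: "ES (emin (Suc k)) = ES (emin k)" using pair_lt by (auto simp: ES_def tab_def)
  then have f: "feas (emin (Suc k))" using Suc feas_mono[of "emin k" "emin (Suc k)"] by auto
  have d: "feas (del c (emin (Suc k))) ==> feas (del c (emin k))" for c by (erule feas_mono) (simp add: ES_del e)
  have "~ feas (del (i * m + j) (emin (Suc k)))" if ij: "(i, j) \<in> ES (emin (Suc k))" "i * m + j < Suc k" for i j
  proof (cases "i * m + j = k")
   case True then show ?thesis using False d by auto
  next
   case False
   then show ?thesis using Suc ij e d by (auto simp: less_Suc_eq)
  qed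
  then show ?thesis using f e Suc by blast
 qed
qed

definition "EE = ES (emin (n * m))"

lemma ed_iff: "ed i j \<longleftrightarrow> (i, j) \<in> EE" by (simp add: ed_def EE_def ES_def)
lemma EE_sub: "EE \<subseteq> {..<n} \<times> {..<m}" by (simp add: EE_def ES_sub)
lemma EE_fat: assumes "(i, j) \<in> EE" shows "j \<in> Nf i"
proof -
 have "(i, j) \<in> ES fadj" using emin_props[of "n * m"] assms unfolding EE_def by blast
 then show ?thesis using fadj_iff[of i j] by (auto simp: ES_def)
qed

lemma xf_eq: "xf i j = xE (emin (n * m)) i j" by (simp add: xf_def xE_def sum_of_bool_card)

lemma forest_EE: "forest EE"
proof (rule minimal_flow_forest[OF EE_sub])
 show "is_flow n m l0 rq EE (%(i, j). real (xE (emin (n * m)) i j))" using feas_flow emin_props[of "n * m"] by (simp add: EE_def)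
 fix e x' assume e: "e \<in> EE"
 obtain i j where ij: "e = (i, j)" by force
 then have l: "i < n" "j < m" using e EE_sub by auto
 have "i * m + j < n * m" by (rule pair_lt[OF l])
 then have nf: "~ feas (del (i * m + j) (emin (n * m)))" using emin_props[of "n * m"] e ij by (auto simp: EE_def)
 have "ES (del (i * m + j) (emin (n * m))) = EE - {e}"
  unfolding ES_del EE_def ij using l ES_sub[of "emin (n * m)"] by (auto simp: pair_inj)
 then show "~ is_flow n m l0 rq (EE - {e}) x'" using flow_feas nf by metis
qed

lemma dg_card: "dg j = card {i. (i, j) \<in> EE}"
proof -
 have "{i. i < n & (i, j) \<in> EE} = {i. (i, j) \<in> EE}" using EE_sub by auto
 then show ?thesis by (simp add: dg_def sum_of_bool_card ed_iff)
qed

lemma dg_le: "dg j <= n"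
proof -
 have "dg j <= card {..<n}" unfolding dg_card by (rule card_mono) (use EE_sub in auto)
 then show ?thesis by simp
qed

lemma chact_iff: assumes "u < m * n" shows "chact u ~= 0 \<longleftrightarrow> u mod n + 1 < dg (u div n)"
proof -
 have "u div n <= m" using assms less_mult_imp_div_less[of u m n] by simp
 then show ?thesis using assms idv_eq[OF n0, of u m] imd_eq[OF n0, of u m] by (simp add: chact_def tab_def)
qed

lemma chadj_iff: assumes "u < m * n" "i < n" shows "chadj (u * n + i) ~= 0 \<longleftrightarrow> (i, u div n) \<in> EE"
proof -
 have "u div n <= m" using assms less_mult_imp_div_less[of u m n] by simp
 then show ?thesis using assms pair_lt[OF assms] idv_pair[OF assms] idv_eq[OF n0, of u m]
  by (simp add: chadj_def tab_def ed_iff)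
qed

text \<open>The edges at a set \<open>J\<close> of resources number fewer than their players plus
  \<open>card J\<close>, because the support is a forest. Subtracting one per resource, the child
  slots do not outnumber the neighbouring players.\<close>

lemma chown_perfect: "perfect (m * n) n chact chown"
 unfolding chown_def
proof (rule auction_perfect)
 fix U assume U: "U \<subseteq> {u. u < m * n & chact u ~= 0}"
 define J where "J = (%u. u div n) ` U"
 define F where "F = {(i, j). (i, j) \<in> EE & j \<in> J}"
 have finU: "finite U" by (rule finite_subset[OF U]) simp
 then have finJ: "finite J" by (simp add: J_def)
 have dJ: "1 < dg j" if "j \<in> J" for j using that U chact_iff by (fastforce simp: J_def)
 have "U \<subseteq> (\<Union>j\<in>J. (%q. j * n + q) ` {..<dg j - 1})"
 proof
  fix u assume u: "u \<in> U"
  then have "u mod n < dg (u div n) - 1" using U chact_iff[of u] by auto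
  moreover have "u = u div n * n + u mod n" by simp
  ultimately have "u \<in> (%p. u div n * n + p) ` {..<dg (u div n) - 1}" by blast
  then show "u \<in> (\<Union>j\<in>J. (%q. j * n + q) ` {..<dg j - 1})" using u by (auto simp: J_def)
 qed
 then have "card U <= card (\<Union>j\<in>J. (%q. j * n + q) ` {..<dg j - 1})" using finJ by (intro card_mono) auto
 also have "... <= (\<Sum>j\<in>J. card ((%q. j * n + q) ` {..<dg j - 1}))" by (rule card_UN_le[OF finJ])
 also have "... = (\<Sum>j\<in>J. dg j - 1)" by (intro sum.cong refl) (simp add: card_image)
 finally have cU: "card U <= (\<Sum>j\<in>J. dg j - 1)" .
 have FE: "F \<subseteq> EE" by (auto simp: F_def)
 have cF: "card F = (\<Sum>j\<in>J. dg j)"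
 proof -
  have "card F = card (SIGMA j:J. {i. (i, j) \<in> EE})"
   by (rule bij_betw_same_card[of prod.swap]) (auto simp: bij_betw_def inj_on_def F_def image_iff)
  also have "... = (\<Sum>j\<in>J. dg j)" unfolding dg_card
  proof (rule card_SigmaI[OF finJ], rule ballI)
   fix j
   have "{i. (i, j) \<in> EE} \<subseteq> {..<n}" using EE_sub by auto
   then show "finite {i. (i, j) \<in> EE}" by (rule finite_subset) simp
  qed
  finally show ?thesis .
 qed
 have "(\<Sum>j\<in>J. dg j) = (\<Sum>j\<in>J. (dg j - 1) + 1)" using dJ by (intro sum.cong refl) fastforce
 then have sJ: "(\<Sum>j\<in>J. dg j) = (\<Sum>j\<in>J. dg j - 1) + card J" by (simp only: sum.distrib card_eq_sum)
 show "card U <= card {r. r < n & (\<exists>u\<in>U. chadj (u * n + r) ~= 0)}"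
 proof (cases "F = {}")
  case True
  then have "(\<Sum>j\<in>J. dg j) = 0" using cF by simp
  then have "\<forall>j\<in>J. dg j = 0" using finJ by simp
  then have "J = {}" using dJ by fastforce
  then show ?thesis using cU by simp
 next
  case False
  then have "card F < card (fst ` F) + card (snd ` F)" using forest_EE FE unfolding forest_def by blast
  moreover have "card (snd ` F) <= card J" by (rule card_mono[OF finJ]) (auto simp: F_def)
  moreover have "fst ` F \<subseteq> {r. r < n & (\<exists>u\<in>U. chadj (u * n + r) ~= 0)}"
  proof
   fix i assume "i \<in> fst ` F"
   then obtain u where u: "u \<in> U" "(i, u div n) \<in> EE" by (auto simp: F_def J_def)
   then have "i < n" using EE_sub by auto
   then have "chadj (u * n + i) ~= 0" using chadj_iff[of u i] u U by auto
   then show "i \<in> {r. r < n & (\<exists>u\<in>U. chadj (u * n + r) ~= 0)}" using \<open>i < n\<close> u(1) by blast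
  qed
  then have "card (fst ` F) <= card {r. r < n & (\<exists>u\<in>U. chadj (u * n + r) ~= 0)}" by (intro card_mono) auto
  ultimately show ?thesis using cU cF sJ by linarith
 qed
qed

lemma chd_D: assumes "chd i j" shows "(i, j) \<in> EE" "\<exists>q. q + 1 < dg j & q < n & chown i = j * n + q + 1"
proof -
 obtain q where q: "i < n" "j < m" "q < n" "chown i = j * n + q + 1" using assms by (auto simp: chd_def)
 have e: "auction (m * n) n chact chadj i = Suc (j * n + q)" using q by (simp add: chown_def)
 note o = auction_owner[OF q(1) e]
 have d: "(j * n + q) div n = j" "(j * n + q) mod n = q" using q by auto
 show "(i, j) \<in> EE" using o(3) chadj_iff[OF o(1) q(1)] d by simp
 show "\<exists>q. q + 1 < dg j & q < n & chown i = j * n + q + 1" using o(2) chact_iff[OF o(1)] d q by auto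
qed

lemma chd_card: assumes j: "j < m" shows "card {i. chd i j} = dg j - 1"
proof -
 have "bij_betw (%i. chown i - 1 - j * n) {i. chd i j} {..<dg j - 1}"
  unfolding bij_betw_def
 proof
  show "inj_on (%i. chown i - 1 - j * n) {i. chd i j}"
  proof (rule inj_onI)
   fix i i' assume a: "i \<in> {i. chd i j}" "i' \<in> {i. chd i j}" "chown i - 1 - j * n = chown i' - 1 - j * n"
   then obtain q where "chown i = j * n + q + 1" "chown i' = j * n + q + 1" using chd_D(2)[of i j] chd_D(2)[of i' j] by auto
   then show "i = i'" using a by (intro auction_inj[of i n i']) (auto simp: chown_def chd_def)
  qed
  show "(%i. chown i - 1 - j * n) ` {i. chd i j} = {..<dg j - 1}"
  proof (intro equalityI subsetI)
   fix q assume "q \<in> (%i. chown i - 1 - j * n) ` {i. chd i j}"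
   then show "q \<in> {..<dg j - 1}" using chd_D(2) by fastforce
  next
   fix q assume q: "q \<in> {..<dg j - 1}"
   then have qn: "q < n" using dg_le[of j] by simp
   have lt: "j * n + q < m * n" by (rule pair_lt[OF j qn])
   have "chact (j * n + q) ~= 0" using chact_iff[OF lt] q qn by simp
   then obtain i where i: "i < n" "chown i = j * n + q + 1" using chown_perfect lt unfolding perfect_def by blast
   then have "chd i j" using j qn by (auto simp: chd_def)
   then show "q \<in> (%i. chown i - 1 - j * n) ` {i. chd i j}" using i by force
  qed
 qed
 then show ?thesis using bij_betw_same_card by fastforce
qed

sublocale cl: clusters n m l0 rq EE xf chd
proof
 show "EE \<subseteq> {..<n} \<times> {..<m}" by (rule EE_sub)
 show "forest EE" by (rule forest_EE)
 have f: "feas (emin (n * m))" using emin_props by blast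
 show "(i, j) \<notin> EE ==> xf i j = 0" for i j using xE_props(1)[OF f] by (simp add: EE_def xf_eq)
 show "i < n ==> (\<Sum>j<m. xf i j) = rq i" for i using xE_props(2)[OF f] by (simp add: xf_eq)
 show "j < m ==> (\<Sum>i<n. xf i j) <= l0" for j using xE_props(3)[OF f] by (simp add: xf_eq)
 show "chd i j ==> (i, j) \<in> EE" for i j by (rule chd_D)
 show "chd i j ==> chd i j' ==> j = j'" for i j j'
 proof -
  assume "chd i j" "chd i j'"
  then obtain q q' where "q < n" "q' < n" "j * n + q = j' * n + q'" using chd_D(2)[of i j] chd_D(2)[of i j'] by auto
  then show "j = j'" using pair_inj by blast
 qed
 show "j < m ==> card {i. chd i j} = card {i. (i, j) \<in> EE} - 1" for j using chd_card dg_card by simp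
qed

lemma chd_lt: "chd i j ==> i < n & j < m" by (simp add: chd_def)

lemma kpt_iff: "kpt i j \<longleftrightarrow> cl.kept i j" unfolding kpt_def cl.kept_def using chd_lt by blast

lemma prt_eq: assumes "(i, j) \<in> EE" shows "prt j = cl.parent j"
proof -
 have p: "(cl.parent j, j) \<in> EE & ~ chd (cl.parent j) j" using assms by (intro cl.parent) auto
 then have "cl.parent j < n" using EE_sub by auto
 then show ?thesis unfolding prt_def ed_iff using p cl.parent_unique by (intro lst_eqI) auto
qed

lemma pr_eq: "pr i = cl.par i"
proof (cases "\<exists>j. cl.kept i j")
 case True
 then obtain j where j: "cl.kept i j" by blast
 then have jm: "j < m" using cl.kept_E EE_sub by blast
 have "lst m (kpt i) = j" using j jm cl.kept1 by (intro lst_eqI) (auto simp: kpt_iff)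
 then show ?thesis using j jm cl.par_kept[OF j] prt_eq[OF cl.kept_E[OF j]] by (auto simp: pr_def kpt_iff)
next
 case False
 then show ?thesis by (simp add: pr_def kpt_iff cl.par_def)
qed

lemma rot_eq: "rot i = cl.rt i"
proof -
 have "iter k (%_ v. pr v) i = (cl.par ^^ k) i" for k by (induction k) (auto simp: pr_eq)
 then show ?thesis by (simp add: rot_def cl.rt_def)
qed

lemma stf_iff: "stf c \<longleftrightarrow> cl.sat c"
 unfolding stf_def cl.sat_def cl.Q_def ed_iff rot_eq dg_card using EE_sub by auto

lemma inV_iff: "inV c \<longleftrightarrow> c < n & cl.isroot c & ~ cl.sat c"
 unfolding inV_def stf_iff rot_eq using cl.root_of_root cl.isroot_root by metis

lemma ise_iff: assumes "i < n" "t < l0" shows "ise c (t * n + i) \<longleftrightarrow> i \<in> cl.Q c & i \<in> Bt t"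
 using assms idv_pair[of t l0 i n] by (simp add: ise_def cl.Q_def rot_eq Bt_def)

lemma l0_LL: "l0 = 2 * LL"
proof -
 have "0 < lgn (n + m)" using lgn(1)[of "n + m"] n0 by (cases "lgn (n + m)") auto
 then obtain k where "2 * lgn (n + m) = Suc k" by (cases "2 * lgn (n + m)") auto
 then show ?thesis by (simp add: l0_def LL_def)
qed

text \<open>Player \<open>i\<close> buys a thin configuration in \<open>l0 - rq i\<close> rounds;
  \<open>thin_mass\<close> bounds the sum of these numbers over the cluster by at least half of the
  rounds.\<close>

lemma many_configs: assumes "inV c" shows "LL <= card {e. e < l0 * n & ise c e}"
proof -
 let ?Q = "cl.Q c"
 have c: "c < n" "cl.isroot c" "~ cl.sat c" using assms by (auto simp: inV_iff)
 have "l0 <= 2 * (\<Sum>i\<in>?Q. l0 - rq i)" by (rule cl.thin_mass[OF c]) (rule rq_le)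
 then have "LL <= (\<Sum>i\<in>?Q. l0 - rq i)" using l0_LL by simp
 also have "... = (\<Sum>i\<in>?Q. card {t. t < l0 & i \<in> Bt t})"
 proof (rule sum.cong[OF refl])
  fix i
  have "card {t. t < l0 & i \<in> Bt t} + rq i = card ({t. t < l0 & i \<in> Bt t} \<union> {t. t < l0 & i \<notin> Bt t})"
   unfolding rq_card by (rule card_Un_disjoint[symmetric]) auto
  also have "{t. t < l0 & i \<in> Bt t} \<union> {t. t < l0 & i \<notin> Bt t} = {..<l0}" by auto
  finally show "l0 - rq i = card {t. t < l0 & i \<in> Bt t}" by simp
 qed
 also have "... = card (SIGMA i:?Q. {t. t < l0 & i \<in> Bt t})" by (rule card_SigmaI[symmetric]) (use cl.finQ in auto)
 also have "... <= card {e. e < l0 * n & ise c e}"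
 proof (rule card_inj_on_le[where f = "%(i, t). t * n + i"])
  show "inj_on (%(i, t). t * n + i) (SIGMA i:?Q. {t. t < l0 & i \<in> Bt t})"
   by (auto simp: inj_on_def pair_inj cl.Q_def)
  show "(%(i, t). t * n + i) ` (SIGMA i:?Q. {t. t < l0 & i \<in> Bt t}) \<subseteq> {e. e < l0 * n & ise c e}"
   using ise_iff pair_lt by (auto simp: cl.Q_def)
 qed simp
 finally show ?thesis .
qed

lemma players_hall:
 assumes A: "A \<subseteq> {..<n}" and ns: "!!c. inV c ==> \<exists>i. i < n & rot i = c & i \<notin> A"
 shows "card A <= card (\<Union>(Nf ` A))"
proof -
 have "card A <= card {j. j < m & (\<exists>i\<in>A. (i, j) \<in> EE)}"
  by (rule cl.hall[OF A]) (use ns in \<open>auto simp: inV_iff cl.Q_def rot_eq\<close>)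
 also have "... <= card (\<Union>(Nf ` A))"
  by (rule card_mono) (use A EE_fat finite_subset[OF A] in \<open>auto simp: Nf_def\<close>)
 finally show ?thesis .
qed

end

section \<open>Configurations and their loads\<close>

text \<open>A round that changes the set adds an element, so \<open>n\<close> rounds reach the
  closure; once stationary, the set is closed under \<open>R\<close>.\<close>

lemma closure_iter:
 fixes A :: "nat => nat set"
 assumes 0: "A 0 = {c}" and sub: "!!k. A k \<subseteq> {..<n}" and S: "!!k. A (Suc k) = A k \<union> (R `` A k \<inter> {..<n})"
  and Rn: "R \<subseteq> {..<n} \<times> {..<n}"
 shows "A n = R\<^sup>* `` {c}"
proof -
 have fin: "finite (A k)" for k by (rule finite_subset[OF sub]) simp
 have st: "A (Suc k) = A k ==> A (k + d) = A k" for k d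
  by (induction d) (auto simp: S)
 have "A (Suc n) = A n"
 proof (rule ccontr)
  assume ne: "A (Suc n) ~= A n"
  have "Suc k <= card (A k)" if "k <= n" for k using that
  proof (induction k)
   case 0 then show ?case by (simp add: assms(1))
  next
   case (Suc k)
   have "A (Suc k) ~= A k"
   proof
    assume e: "A (Suc k) = A k"
    have "A n = A k" "A (Suc n) = A k" using st[OF e, of "n - k"] st[OF e, of "Suc n - k"] Suc by auto
    then show False using ne by simp
   qed
   then have "A k \<subset> A (Suc k)" using S by blast
   then have "card (A k) < card (A (Suc k))" by (rule psubset_card_mono[OF fin])
   then show ?case using Suc by simp
  qed
  from this[of n] have "Suc n <= card (A n)" by simp
  also have "... <= card {..<n}" by (rule card_mono) (use sub in auto)
  finally show False by simp
 qed
 then have cl: "R `` A n \<subseteq> A n" using S[of n] Rn by blast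
 have c: "c \<in> A k" for k by (induction k) (auto simp: 0 S)
 have "A k \<subseteq> R\<^sup>* `` {c}" for k
 proof (induction k)
  case (Suc k)
  then show ?case unfolding S by (auto intro: rtrancl_into_rtrancl)
 qed (simp add: 0)
 moreover have "v \<in> A n" if "(c, v) \<in> R\<^sup>*" for v
  using that by (induction rule: rtrancl_induct) (use c cl in auto)
 ultimately show ?thesis by blast
qed

context alg_ok
begin

definition "CS e = {j. j < m & cf e j ~= 0}"

lemma CS_eq: "CS e = Cf (idv l0 e n) (imd l0 e n)"
 unfolding CS_def cf_def using cfg_iff[of _ "idv l0 e n" "imd l0 e n"] Cf_sub[of "idv l0 e n" "imd l0 e n"] by blast

lemma CS_m: "CS e \<subseteq> {..<m}" by (auto simp: CS_def)
lemma CS_fin: "finite (CS e)" by (simp add: CS_def)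
lemma CS_le: "F (CS e) <= 26 / 100 * T" unfolding CS_eq by (rule Cf_le)

lemma wt_eq: "wt e j = wgt (CS e) j"
proof -
 have "{j'. j' < m & cf e j' ~= 0 & j' < j + 1} = CS e \<inter> {..<Suc j}" "{j'. j' < m & cf e j' ~= 0 & j' < j} = CS e \<inter> {..<j}"
  by (auto simp: CS_def)
 then show ?thesis by (simp only: wt_def wgt_def)
qed

lemma wt_nonneg: "0 <= wt e j" by (simp add: wt_eq wgt_nonneg CS_m)

lemma a0_eq: "a0 e e' = (\<Sum>j\<in>{j. j < m & dmt e e' j}. wt e j)"
proof -
 have "a0 e e' = (\<Sum>j\<in>{j\<in>{..<m}. dmt e e' j}. wt e j)" unfolding a0_def by (rule sum.inter_filter[symmetric]) simp
 then show ?thesis by simp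
qed

lemma a0_nonneg: "0 <= a0 e e'" unfolding a0_def by (rule sum_nonneg) (simp add: wt_nonneg)

lemma a0_le: "a0 e e' <= 26 / 100 * T"
proof -
 have "a0 e e' <= (\<Sum>j\<in>CS e. wt e j)" unfolding a0_eq by (rule sum_mono2) (auto simp: CS_def dmt_def wt_nonneg)
 also have "... = F (CS e)" by (simp add: wt_eq wgt_sum CS_m)
 finally show ?thesis using CS_le[of e] by simp
qed

definition "valid e \<longleftrightarrow> e < l0 * n & e mod n \<in> Bt (e div n)"

lemma valid_dm: assumes "e < l0 * n" shows "idv l0 e n = e div n" "imd l0 e n = e mod n" "e div n < l0"
proof -
 show lt: "e div n < l0" using assms by (rule less_mult_imp_div_less)
 then show "idv l0 e n = e div n" "imd l0 e n = e mod n" using idv_eq[OF n0] imd_eq[OF n0] by auto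
qed

text \<open>A code determines its round and its player, so distinct members of \<open>W\<close>
  stand for distinct purchases, all of which \<open>ldt\<close> has counted.\<close>

lemma valid_load: assumes W: "!!e. e \<in> W ==> valid e" and j: "j < m" shows "card {e\<in>W. j \<in> CS e} <= ldt l0 j"
proof -
 have "card {e\<in>W. j \<in> CS e} <= card (SIGMA t:{..<l0}. {i\<in>Bt t. j \<in> Cf t i})"
 proof (rule card_inj_on_le[where f = "%e. (e div n, e mod n)"])
  show "inj_on (%e. (e div n, e mod n)) {e\<in>W. j \<in> CS e}"
   by (rule inj_onI) (metis div_mult_mod_eq prod.inject)
  show "(%e. (e div n, e mod n)) ` {e\<in>W. j \<in> CS e} \<subseteq> (SIGMA t:{..<l0}. {i\<in>Bt t. j \<in> Cf t i})"
  proof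
   fix z assume "z \<in> (%e. (e div n, e mod n)) ` {e\<in>W. j \<in> CS e}"
   then obtain e where e: "e \<in> W" "j \<in> CS e" "z = (e div n, e mod n)" by auto
   have v: "e < l0 * n" "e mod n \<in> Bt (e div n)" using W[OF e(1)] by (auto simp: valid_def)
   show "z \<in> (SIGMA t:{..<l0}. {i\<in>Bt t. j \<in> Cf t i})" using e v valid_dm[OF v(1)] by (simp add: CS_eq)
  qed
  show "finite (SIGMA t:{..<l0}. {i\<in>Bt t. j \<in> Cf t i})" using Bt_fin by auto
 qed
 also have "... = (\<Sum>t<l0. Dl t j)" using Bt_fin by (simp add: Dl_def)
 finally show ?thesis by (simp add: ldt_sum[OF j])
qed

lemma count_swap: "finite W ==> (\<Sum>e\<in>W. \<Sum>j\<in>{j\<in>D. P e j}. g j) = (\<Sum>j\<in>D. real (card {e\<in>W. P e j}) * g j)" if "finite D"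
proof -
 assume W: "finite W"
 have "(\<Sum>e\<in>W. \<Sum>j\<in>{j\<in>D. P e j}. g j) = (\<Sum>e\<in>W. \<Sum>j\<in>D. if P e j then g j else 0)"
  by (rule sum.cong[OF refl]) (rule sum.inter_filter[OF that])
 also have "... = (\<Sum>j\<in>D. \<Sum>e\<in>W. if P e j then g j else 0)" by (rule sum.swap)
 also have "... = (\<Sum>j\<in>D. real (card {e\<in>W. P e j}) * g j)"
  by (rule sum.cong[OF refl]) (simp add: sum.inter_filter[OF W, symmetric])
 finally show ?thesis .
qed

text \<open>A resource lies in at most \<open>14 * l0\<close> configurations and the weights of
  \<open>CS e\<close> sum to at most \<open>26 / 100 * T\<close>, which gives
  \<open>7.28 * LL * T\<close>. For columns, the overlap of \<open>e'\<close> with \<open>e\<close>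
  counts the weights of \<open>e'\<close>; but \<open>dmt\<close> admits only resources where these
  do not exceed the weights of \<open>e\<close>, so the same sum bounds both.\<close>

lemma row_bound: assumes W: "finite W" "!!e. e \<in> W ==> valid e" shows "(\<Sum>e'\<in>W. a0 e e') <= 10 * real LL * T"
  and "(\<Sum>e'\<in>W. a0 e' e) <= 10 * real LL * T"
proof -
 let ?P = "%e' j. j \<in> CS e'"
 have fin: "(\<Sum>j\<in>CS e. real (card {e'\<in>W. j \<in> CS e'}) * wt e j) <= 10 * real LL * T"
 proof -
  have "(\<Sum>j\<in>CS e. real (card {e'\<in>W. j \<in> CS e'}) * wt e j) <= (\<Sum>j\<in>CS e. (14 * real l0) * wt e j)"
  proof (rule sum_mono)
   fix j assume "j \<in> CS e"
   then have j: "j < m" using CS_m by auto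
   have "real (card {e'\<in>W. j \<in> CS e'}) <= real (ldt l0 j)" using valid_load[OF W(2) j] by simp
   also have "... <= 14 * real l0" by (rule load_bound[OF j])
   finally show "real (card {e'\<in>W. j \<in> CS e'}) * wt e j <= (14 * real l0) * wt e j" by (rule mult_right_mono) (rule wt_nonneg)
  qed
  also have "... = 14 * real l0 * F (CS e)" by (simp add: sum_distrib_left[symmetric] wt_eq wgt_sum CS_m)
  also have "... <= 14 * real l0 * (26 / 100 * T)" using CS_le by (intro mult_left_mono) auto
  also have "... = 728 / 100 * (real LL * T)" by (simp add: l0_LL)
  also have "... <= 10 * (real LL * T)" using T by (intro mult_right_mono) auto
  finally show ?thesis by simp
 qed
 have "(\<Sum>e'\<in>W. a0 e e') <= (\<Sum>e'\<in>W. \<Sum>j\<in>{j\<in>CS e. ?P e' j}. wt e j)"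
  unfolding a0_eq by (intro sum_mono sum_mono2) (auto simp: CS_def dmt_def wt_nonneg)
 also have "... = (\<Sum>j\<in>CS e. real (card {e'\<in>W. j \<in> CS e'}) * wt e j)" by (rule count_swap[OF CS_fin W(1)])
 finally show "(\<Sum>e'\<in>W. a0 e e') <= 10 * real LL * T" using fin by simp
 have "(\<Sum>e'\<in>W. a0 e' e) <= (\<Sum>e'\<in>W. \<Sum>j\<in>{j\<in>CS e. ?P e' j}. wt e j)"
 proof (rule sum_mono)
  fix e'
  have "a0 e' e <= (\<Sum>j\<in>{j. j < m & dmt e' e j}. wt e j)" unfolding a0_eq by (rule sum_mono) (auto simp: dmt_def)
  also have "... <= (\<Sum>j\<in>{j\<in>CS e. ?P e' j}. wt e j)" by (rule sum_mono2) (auto simp: CS_def dmt_def wt_nonneg)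
  finally show "a0 e' e <= (\<Sum>j\<in>{j\<in>CS e. ?P e' j}. wt e j)" .
 qed
 also have "... = (\<Sum>j\<in>CS e. real (card {e'\<in>W. j \<in> CS e'}) * wt e j)" by (rule count_swap[OF CS_fin W(1)])
 finally show "(\<Sum>e'\<in>W. a0 e' e) <= 10 * real LL * T" using fin by simp
qed

lemma sel: assumes c: "inV c" "r < LL"
 shows "sel c r < l0 * n" "ise c (sel c r)" "card {e'. e' < sel c r & ise c e'} = r"
proof -
 let ?I = "{e. e < l0 * n & ise c e}"
 let ?g = "%e. card {e'. e' < e & ise c e'}"
 have "\<exists>e. e < l0 * n & ise c e & ?g e = r"
 proof -
  have "\<exists>e\<le>l0 * n. ?g e = r"
  proof -
   have st: "?g (Suc k) <= Suc (?g k)" for k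
   proof -
    have "{e'. e' < Suc k & ise c e'} \<subseteq> insert k {e'. e' < k & ise c e'}" by auto
    then have "?g (Suc k) <= card (insert k {e'. e' < k & ise c e'})" by (intro card_mono) auto
    then show ?thesis using card_insert_le_m1 by (simp add: card_insert_if)
   qed
   have "q <= ?g k ==> \<exists>e\<le>k. ?g e = q" for k q
   proof (induction k)
    case (Suc k)
    show ?case
    proof (cases "q <= ?g k")
     case True
     then obtain e where "e <= k" "?g e = q" using Suc.IH by blast
     then show ?thesis by (intro exI[of _ e]) auto
    next
     case False
     then have "?g (Suc k) = q" using Suc.prems st[of k] by linarith
     then show ?thesis by blast
    qed
   qed auto
   then show ?thesis using many_configs[OF c(1)] c(2) by simp
  qed
  then have ex: "\<exists>e. e <= l0 * n & ?g e = r" by blast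
  \<comment> \<open>The number of earlier configurations grows by steps of at most one and so takes
    the value \<open>r\<close>; the last position with this value must itself be a configuration of
    the cluster.\<close>
  define e where "e = (GREATEST e. e <= l0 * n & ?g e = r)"
  have e: "e <= l0 * n" "?g e = r" using GreatestI_ex_nat[OF ex, of "l0 * n"] by (auto simp: e_def)
  have ne: "e ~= l0 * n" using e many_configs[OF c(1)] c(2) by auto
  have "ise c e"
  proof (rule ccontr)
   assume "~ ise c e"
   then have "{e'. e' < Suc e & ise c e'} = {e'. e' < e & ise c e'}" by (auto simp: less_Suc_eq)
   then have "Suc e <= l0 * n & ?g (Suc e) = r" using e ne by auto
   then have "Suc e <= e" unfolding e_def by (rule Greatest_le_nat[of _ _ "l0 * n"]) auto
   then show False by simp
  qed
  then show ?thesis using e ne by (intro exI[of _ e]) auto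
 qed
 then obtain e where e: "e < l0 * n" "ise c e" "?g e = r" by blast
 have g: "(\<Sum>e'<l0 * n. of_bool (e' < e & ise c e')) = ?g e" if "e < l0 * n" for e
  using that by (auto simp: sum_of_bool_card intro!: arg_cong[where f = card])
 have "sel c r < l0 * n" unfolding sel_def by (rule lst_ex[OF e(1)]) (use e g in auto)
 moreover have "ise c (sel c r) & (\<Sum>e'<l0 * n. of_bool (e' < sel c r & ise c e')) = r"
  using lst_less[OF calculation[unfolded sel_def]] by (simp add: sel_def)
 ultimately show "sel c r < l0 * n" "ise c (sel c r)" "card {e'. e' < sel c r & ise c e'} = r" using g by auto
qed

lemma ise_D: assumes "ise c e" "e < l0 * n" shows "valid e" "e mod n < n" "rot (e mod n) = c"
 using assms valid_dm[OF assms(2)] n0 by (auto simp: ise_def valid_def Bt_def)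

lemma sel_inj: "inj_on (%(c, r). sel c r) ({c. inV c} \<times> {..<LL})"
proof (rule inj_onI, clarsimp)
 fix c r c' r' assume a: "inV c" "r < LL" "inV c'" "r' < LL" "sel c r = sel c' r'"
 have "c = c'" using sel(2)[OF a(1,2)] sel(2)[OF a(3,4)] a(5) by (simp add: ise_def)
 then show "c = c' & r = r'" using sel(3)[OF a(1,2)] sel(3)[OF a(3,4)] a(5) by metis
qed

lemma VV: "finite {c. inV c}" "card {c. inV c} <= n" "{c. inV c} \<subseteq> {..<n}"
proof -
 show s: "{c. inV c} \<subseteq> {..<n}" by (auto simp: inV_def)
 then show "finite {c. inV c}" by (rule finite_subset) simp
 show "card {c. inV c} <= n" using card_mono[OF _ s] by simp
qed

lemma be: "64 <= be" "n <= 2 ^ be"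
proof -
 have *: "lgn n + 64 < be" unfolding be_def bb_def by (rule lgn)
 then show "64 <= be" by simp
 have "n < 2 ^ lgn n" by (rule lgn)
 also have "(2::nat) ^ lgn n <= 2 ^ be" using * by (intro power_increasing) auto
 finally show "n <= 2 ^ be" by simp
qed

definition "aL c r c' r' = a0 (sel c r) (sel c' r') / T"

lemma aL_bound: "0 <= aL c r c' r'" "aL c r c' r' <= 1"
proof -
 show "0 <= aL c r c' r'" unfolding aL_def using a0_nonneg T by simp
 have "a0 (sel c r) (sel c' r') <= T" using a0_le[of "sel c r" "sel c' r'"] T by simp
 then show "aL c r c' r' <= 1" unfolding aL_def using T by simp
qed

lemma aL_rows:
 assumes "inV c" "r < LL"
 shows "(\<Sum>c'\<in>{c. inV c} - {c}. \<Sum>r'<LL. aL c r c' r') <= 10 * real LL"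
  and "(\<Sum>c'\<in>{c. inV c} - {c}. \<Sum>r'<LL. aL c' r' c r) <= 10 * real LL"
proof -
 let ?D = "({c. inV c} - {c}) \<times> {..<LL}"
 define W where "W = (%(c, r). sel c r) ` ?D"
 have finD: "finite ?D" using VV by auto
 have inj: "inj_on (%(c, r). sel c r) ?D" by (rule inj_on_subset[OF sel_inj]) auto
 have re: "(\<Sum>c'\<in>{c. inV c} - {c}. \<Sum>r'<LL. g (sel c' r')) = (\<Sum>e\<in>W. g e)" for g :: "nat => real"
  unfolding W_def sum.cartesian_product by (subst sum.reindex[OF inj]) (auto intro!: sum.cong)
 have W: "finite W" "!!e. e \<in> W ==> valid e"
 proof -
  show "finite W" using finD by (simp add: W_def)
  fix e assume "e \<in> W"
  then obtain c' r' where e: "inV c'" "r' < LL" "e = sel c' r'" by (auto simp: W_def)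
  show "valid e" unfolding e(3) by (rule ise_D(1)[OF sel(2,1)[OF e(1,2)]])
 qed
 have "(\<Sum>c'\<in>{c. inV c} - {c}. \<Sum>r'<LL. aL c r c' r') = (\<Sum>e\<in>W. a0 (sel c r) e) / T"
  unfolding aL_def sum_divide_distrib by (rule re)
 also have "... <= 10 * real LL" using row_bound(1)[OF W, of "sel c r"] T by (simp add: pos_divide_le_eq)
 finally show "(\<Sum>c'\<in>{c. inV c} - {c}. \<Sum>r'<LL. aL c r c' r') <= 10 * real LL" .
 have "(\<Sum>c'\<in>{c. inV c} - {c}. \<Sum>r'<LL. aL c' r' c r) = (\<Sum>e\<in>W. a0 e (sel c r)) / T"
  unfolding aL_def sum_divide_distrib by (rule re)
 also have "... <= 10 * real LL" using row_bound(2)[OF W, of "sel c r"] T by (simp add: pos_divide_le_eq)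
 finally show "(\<Sum>c'\<in>{c. inV c} - {c}. \<Sum>r'<LL. aL c' r' c r) <= 10 * real LL" .
qed

lemma many_le: "LL > 0" by (simp add: LL_def)

lemma KKb: "exp (60 - real KK) <= 1 / real be ^ 28" "61 <= real KK"
proof -
 have "exp (60 - real KK) = exp (- real (28 * bb))" by (simp add: KK_def)
 also have "... = 1 / exp 1 ^ (28 * bb)" by (simp add: exp_minus exp_of_nat_mult[symmetric] inverse_eq_divide)
 also have "... <= 1 / 2 ^ (28 * bb)" using exp_ge_add_one_self[of "1::real"] by (intro divide_left_mono power_mono) auto
 also have "(2::real) ^ (28 * bb) = real be ^ 28" by (simp add: be_def power_mult[symmetric] mult.commute)
 finally show "exp (60 - real KK) <= 1 / real be ^ 28" .
 have "bb ~= 0"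
 proof
  assume "bb = 0"
  then have "be = 1" by (simp add: be_def)
  then show False using be(1) by simp
 qed
 then show "61 <= real KK" by (simp add: KK_def)
qed

lemma rsampleI:
 assumes A: "finite A" "!!c r. inV c ==> r < be ==> c * be + r \<in> A" and w: "2 * lgn (n + m) - 1 <= w"
 shows "rsample {c. inV c} be n LL (2 * lgn (n + m) - 1) aL A w"
 by unfold_locales (use VV be aL_bound aL_rows A w in \<open>auto simp: LL_def\<close>)

end

locale alg_run = alg_ok + alg3
begin

abbreviation "V == {c. inV c}"

definition "aS c r c' r' = a0 (sg c r) (sg c' r') / T"

lemma aS_bound: "0 <= aS c r c' r'" "aS c r c' r' <= 1"
 using aL_bound unfolding aL_def aS_def sg_def by auto

lemma rdrawI:
 assumes rs: "rsample V be n LL ll aL A w" and ok: "rsample.sample_ok V be LL aL S" and A: "finite A" "V \<subseteq> A" "bb <= w"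
 shows "rdraw V be bb n (real KK) aS A w"
proof -
 have *: "(\<Sum>c'\<in>V - {c}. \<Sum>r'<be. aS c r c' r') <= 30 * real be & (\<Sum>c'\<in>V - {c}. \<Sum>r'<be. aS c' r' c r) <= 30 * real be"
  if "inV c" "r < be" for c r
  using ok that unfolding rsample.sample_ok_def[OF rs] rsample.smp_def[OF rs] aS_def aL_def sg_def by blast
 show ?thesis
  by unfold_locales (use VV be n0 KKb aS_bound * A in \<open>auto simp: be_def\<close>)
qed

lemma sumV: "(\<Sum>c'<n. if inV c' & P c' then g c' else 0) = (\<Sum>c'\<in>{c'. inV c' & P c'}. (g c' :: real))"
proof -
 have "(\<Sum>c'<n. if inV c' & P c' then g c' else 0) = (\<Sum>c'\<in>{c'\<in>{..<n}. inV c' & P c'}. g c')" by (rule sum.inter_filter[symmetric]) simp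
 also have "{c'\<in>{..<n}. inV c' & P c'} = {c'. inV c' & P c'}" by (auto simp: inV_def)
 finally show ?thesis .
qed

context
 fixes A w assumes rd: "rdraw V be bb n (real KK) aS A w"
begin

interpretation rd: rdraw V be bb n "real KK" aS A w by (rule rd)

lemma bad_iff: "c \<in> rd.bad X \<longleftrightarrow> bd c"
proof -
 have "(\<Sum>c'\<in>V - {c}. rd.entry X c c') = (\<Sum>c'\<in>V - {c}. a0 (x1 c) (x1 c')) / T"
  unfolding rd.entry_def aS_def x1_def by (simp add: sum_divide_distrib)
 moreover have "V - {c} = {c'. inV c' & c' ~= c}" by auto
 ultimately have "(\<Sum>c'\<in>V - {c}. rd.entry X c c') = (\<Sum>c'<n. if inV c' & c' ~= c then a0 (x1 c) (x1 c') else 0) / T"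
  by (simp only: sumV)
 then show ?thesis using T unfolding rd.bad_def bd_def by (simp add: pos_le_divide_eq)
qed

lemma h2_iff: "h2 u v \<longleftrightarrow> (u, v) \<in> rd.brel X"
proof -
 have e: "rd.lo <= a0 e e' / T \<longleftrightarrow> T <= a0 e e' * 2 ^ (11 * bb)" for e e'
 proof -
  have "real be ^ 11 = 2 ^ (11 * bb)" by (simp add: be_def power_mult[symmetric] mult.commute)
  then show ?thesis using T by (simp add: rd.lo_def field_simps)
 qed
 have "rd.adj2 u v \<longleftrightarrow> (\<exists>r<be. \<exists>r'<be. T <= a0 (sg u r) (sg v r') * 2 ^ (11 * bb) | T <= a0 (sg v r') (sg u r) * 2 ^ (11 * bb))"
  unfolding rd.adj2_def by (simp only: aS_def e)
 then show ?thesis unfolding h2_def rd.brel_def by (simp add: bad_iff)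
qed

lemma rch_iff: assumes "c < n" shows "{v. v < n & rch c v ~= 0} = (rd.brel X)\<^sup>* `` {c}"
proof -
 define B where "B k = iter k (%_ A. tab n (%v. of_bool (A v ~= 0 | (\<exists>u<n. A u ~= 0 & h2 u v)))) (tab n (%v. of_bool (v = c)))" for k
 have BS: "B (Suc k) = tab n (%v. of_bool (B k v ~= 0 | (\<exists>u<n. B k u ~= 0 & h2 u v)))" for k by (simp only: B_def iter.simps)
 have "{v. v < n & B n v ~= 0} = (rd.brel X)\<^sup>* `` {c}"
 proof (rule closure_iter[where A = "%k. {v. v < n & B k v ~= 0}" and n = n])
  show "{v. v < n & B 0 v ~= 0} = {c}" using assms by (auto simp: B_def tab_def)
  show "{v. v < n & B (Suc k) v ~= 0} = {v. v < n & B k v ~= 0} \<union> (rd.brel X `` {v. v < n & B k v ~= 0} \<inter> {..<n})" for k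
   unfolding BS by (auto simp: tab_def h2_iff)
  show "rd.brel X \<subseteq> {..<n} \<times> {..<n}" using VV(3) unfolding rd.brel_def rd.bad_def by auto
 qed auto
 then show ?thesis by (simp add: B_def rch_def)
qed

lemma tok_iff: assumes c: "bd c" shows "tok t c \<longleftrightarrow> rd.try_ok X Y t c"
proof -
 have cn: "c < n" using c by (simp add: bd_def inV_def)
 have "(\<Sum>c'<n. if rch c c' ~= 0 & c' ~= c then a0 (x2 t c) (x2 t c') else 0) = (\<Sum>c'\<in>{c'\<in>{..<n}. rch c c' ~= 0 & c' ~= c}. a0 (x2 t c) (x2 t c'))"
  by (rule sum.inter_filter[symmetric]) simp
 also have "{c'\<in>{..<n}. rch c c' ~= 0 & c' ~= c} = (rd.brel X)\<^sup>* `` {c} - {c}" using rch_iff[OF cn] by auto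
 also have "(\<Sum>c'\<in>(rd.brel X)\<^sup>* `` {c} - {c}. a0 (x2 t c) (x2 t c')) = T * (\<Sum>c'\<in>(rd.brel X)\<^sup>* `` {c} - {c}. aS c (rd.tcell Y t c) c' (rd.tcell Y t c'))"
  using T by (simp add: aS_def x2_def rd.tcell_def sum_divide_distrib[symmetric])
 finally show ?thesis using T unfolding tok_def rd.try_ok_def by (simp add: mult.commute)
qed

text \<open>A cluster that is not bad keeps its first draw, whose load from all clusters is below
  \<open>2 * KK * T\<close> by definition. Bad clusters are covered by \<open>phase2_load\<close>:
  \<open>adp\<close> is constant on components, since their members have the same \<open>rch\<close>
  and hence search for the same try. The two phases are never compared with each other.\<close>

lemma load_ok:
 assumes p1: "rd.phase1_ok X" and tr: "rd.tries_ok X Y" and c: "inV c"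
 shows "(\<Sum>c'\<in>{c'. inV c' & bd c' = bd c & c' ~= c}. a0 (fe c) (fe c')) <= 2 * real KK * T"
proof (cases "bd c")
 case False
 have finV: "finite {c'. inV c' & c' ~= c}" using VV(1) by (rule rev_finite_subset) auto
 have "(\<Sum>c'\<in>{c'. inV c' & bd c' = bd c & c' ~= c}. a0 (fe c) (fe c')) = (\<Sum>c'\<in>{c'. inV c' & bd c' = bd c & c' ~= c}. a0 (x1 c) (x1 c'))"
  using False by (intro sum.cong refl) (auto simp: fe_def)
 also have "... <= (\<Sum>c'\<in>{c'. inV c' & c' ~= c}. a0 (x1 c) (x1 c'))"
  using finV a0_nonneg by (intro sum_mono2) auto
 also have "... <= real (2 * KK) * T" using False c unfolding bd_def sumV by simp
 finally show ?thesis by simp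
next
 case True
 have bb': "c \<in> rd.bad X" using True bad_iff by simp
 define ad where "ad = adp"
 have adp: "adp u < be & tok (adp u) u" if u: "u \<in> rd.bad X" for u
 proof -
  have un: "u < n" using u bad_iff by (simp add: bd_def inV_def)
  obtain t where t: "t < be" "\<forall>c'\<in>(rd.brel X)\<^sup>* `` {u}. rd.try_ok X Y t c'" using tr u unfolding rd.tries_ok_def by blast
  have "\<forall>c'<n. rch u c' ~= 0 --> tok t c'"
  proof (intro allI impI)
   fix c' assume "c' < n" "rch u c' ~= 0"
   then have r: "c' \<in> (rd.brel X)\<^sup>* `` {u}" using rch_iff[OF un] by auto
   then have "bd c'" using rd.brel_bad[OF u] bad_iff by blast
   then show "tok t c'" using tok_iff t(2) r by blast
  qed
  then have lt: "adp u < be" unfolding adp_def by (intro lst_ex[OF t(1)])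
  have "\<forall>c'<n. rch u c' ~= 0 --> tok (adp u) c'" using lst_less[OF lt[unfolded adp_def]] unfolding adp_def .
  moreover have "rch u u ~= 0" using rch_iff[OF un] by auto
  ultimately show ?thesis using un lt by blast
 qed
 have eq: "adp u = adp v" if uv: "(u, v) \<in> (rd.brel X)\<^sup>*" for u v
 proof (cases "u = v")
  case False
  then obtain z where "(u, z) \<in> rd.brel X" using uv by (meson converse_rtranclE)
  then have ub: "u \<in> rd.bad X" by (auto simp: rd.brel_def)
  then have vb: "v \<in> rd.bad X" using rd.brel_bad uv by blast
  have un: "u < n" "v < n" using ub vb bad_iff by (auto simp: bd_def inV_def)
  have "rch u c' ~= 0 \<longleftrightarrow> rch v c' ~= 0" if "c' < n" for c'
   using rch_iff[OF un(1)] rch_iff[OF un(2)] rd.brel_eq[OF uv] that by blast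
  then have "(%t. \<forall>c'<n. rch u c' ~= 0 --> tok t c') = (%t. \<forall>c'<n. rch v c' ~= 0 --> tok t c')" by blast
  then show ?thesis unfolding adp_def by simp
 qed simp
 have "rd.try_ok X Y (adp c) c" using adp[OF bb'] tok_iff[OF True] by blast
 then have "(\<Sum>c'\<in>rd.bad X - {c}. aS c (rd.tcell Y (adp c) c) c' (rd.tcell Y (adp c') c')) < real KK + 1"
  using rd.phase2_load[OF p1 bb', of adp Y] eq by blast
 moreover have "{c'. inV c' & bd c' = bd c & c' ~= c} = rd.bad X - {c}" using True bad_iff by (auto simp: bd_def)
 moreover have "(\<Sum>c'\<in>rd.bad X - {c}. a0 (fe c) (fe c')) = T * (\<Sum>c'\<in>rd.bad X - {c}. aS c (rd.tcell Y (adp c) c) c' (rd.tcell Y (adp c') c'))"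
  using T True bad_iff unfolding sum_distrib_left by (intro sum.cong refl) (auto simp: aS_def fe_def x2_def rd.tcell_def)
 ultimately have "(\<Sum>c'\<in>{c'. inV c' & bd c' = bd c & c' ~= c}. a0 (fe c) (fe c')) <= T * (real KK + 1)"
  using T by (simp add: mult_left_mono)
 also have "... <= T * (2 * real KK)" using T KKb(2) by (intro mult_left_mono) auto
 finally show ?thesis by (simp add: mult.commute)
qed

end

lemma fe_sel: assumes "inV c" shows "fe c < l0 * n" "ise c (fe c)"
proof -
 have "S k mod LL < LL" for k using many_le by simp
 then have "sg c r < l0 * n & ise c (sg c r)" for r unfolding sg_def using sel[OF assms] by blast
 then show "fe c < l0 * n" "ise c (fe c)" unfolding fe_def x1_def x2_def by auto
qed

end

section \<open>The allocation\<close>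

lemma rank_bij:
 assumes S: "finite S" and tr: "!!x y z. R x y ==> R y z ==> R x z" and ir: "!!x. ~ R x x"
  and tot: "!!x y. x \<in> S ==> y \<in> S ==> x ~= y ==> R x y | R y x"
 shows "bij_betw (%x. card {y\<in>S. R y x}) S {..<card S}"
  and "x \<in> S ==> y \<in> S ==> card {z\<in>S. R z x} < card {z\<in>S. R z y} ==> R x y"
proof -
 have mono: "card {z\<in>S. R z x} < card {z\<in>S. R z y}" if "x \<in> S" "R x y" for x y
 proof (rule psubset_card_mono)
  have "x \<in> {z\<in>S. R z y}" "x \<notin> {z\<in>S. R z x}" using that ir by auto
  then show "{z\<in>S. R z x} \<subset> {z\<in>S. R z y}" using tr that by blast
 qed (use S in simp)
 show "x \<in> S ==> y \<in> S ==> card {z\<in>S. R z x} < card {z\<in>S. R z y} ==> R x y"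
  using mono[of y x] tot[of x y] by fastforce
 have inj: "inj_on (%x. card {y\<in>S. R y x}) S"
 proof (rule inj_onI, rule ccontr)
  fix x y assume a: "x \<in> S" "y \<in> S" "card {z\<in>S. R z x} = card {z\<in>S. R z y}" "x ~= y"
  then show False using tot[OF a(1,2,4)] mono[of x y] mono[of y x] by auto
 qed
 have sub: "(%x. card {y\<in>S. R y x}) ` S \<subseteq> {..<card S}"
 proof
  fix k assume "k \<in> (%x. card {y\<in>S. R y x}) ` S"
  then obtain x where x: "x \<in> S" "k = card {y\<in>S. R y x}" by auto
  have "card {y\<in>S. R y x} < card S" by (rule psubset_card_mono[OF S]) (use x ir in auto)
  then show "k \<in> {..<card S}" using x by simp
 qed
 have "(%x. card {y\<in>S. R y x}) ` S = {..<card S}"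
  by (rule card_subset_eq[OF _ sub]) (simp_all add: card_image[OF inj])
 then show "bij_betw (%x. card {y\<in>S. R y x}) S {..<card S}" using inj by (simp add: bij_betw_def)
qed

text \<open>An element picked from a full group dominates all elements of the next group.\<close>
lemma grouping:
 fixes w :: "'a => real" and G :: nat
 assumes S: "finite S" "bij_betw rk S {..<card S}" and G: "0 < G"
  and mono: "!!x y. x \<in> S ==> y \<in> S ==> rk x < rk y ==> w y <= w x"
  and w: "!!x. x \<in> S ==> 0 <= w x" "!!x. x \<in> S ==> w x <= M"
  and pick: "!!g. g < card S div G ==> pick g \<in> S & rk (pick g) < (g + 1) * G" and M: "0 <= M"
 shows "(\<Sum>x\<in>S. w x) <= real G * (\<Sum>g<card S div G. w (pick g)) + real G * M"
proof -
 define h where "h g = (if g < card S div G then w (pick g) else 0)" for g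
 have h0: "0 <= h g" for g using w(1) pick by (simp add: h_def)
 let ?A = "{x\<in>S. rk x < G}" and ?B = "{x\<in>S. G <= rk x}"
 have inj: "inj_on rk S" and rklt: "!!x. x \<in> S ==> rk x < card S" using S(2) by (auto simp: bij_betw_def)
 have "(\<Sum>x\<in>S. w x) = (\<Sum>x\<in>?A \<union> ?B. w x)" by (rule sum.cong) auto
 also have "... = (\<Sum>x\<in>?A. w x) + (\<Sum>x\<in>?B. w x)" by (rule sum.union_disjoint) (use S in auto)
 also have "(\<Sum>x\<in>?A. w x) <= (\<Sum>x\<in>?A. M)" by (rule sum_mono) (use w in auto)
 also have "... <= real G * M"
 proof -
  have "card ?A <= card {..<G}" by (rule card_inj_on_le[where f = rk]) (auto intro: inj_on_subset[OF inj])
  then show ?thesis using M by (simp add: mult_right_mono)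
 qed
 also have "(\<Sum>x\<in>?B. w x) <= (\<Sum>x\<in>?B. h (rk x div G - 1))"
 proof (rule sum_mono)
  fix x assume x: "x \<in> ?B"
  let ?g = "rk x div G - 1"
  have 1: "1 <= rk x div G" using x G by (simp add: div_greater_zero_iff Suc_le_eq)
  have "rk x div G <= card S div G" using rklt[of x] x by (intro div_le_mono) auto
  then have g: "?g < card S div G" using 1 by simp
  have "(?g + 1) * G <= rk x" using 1 by simp
  then have "rk (pick ?g) < rk x" using pick[OF g] by linarith
  then show "w x <= h ?g" unfolding h_def using mono[of "pick ?g" x] pick[OF g] x g by simp
 qed
 also have "... = (\<Sum>r\<in>rk ` ?B. h (r div G - 1))" by (subst sum.reindex) (auto intro: inj_on_subset[OF inj])
 also have "... <= (\<Sum>r\<in>(%(g, s). (g + 1) * G + s) ` ({..<card S div G} \<times> {..<G}). h (r div G - 1))"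
 proof (rule sum_mono2)
  show "rk ` ?B \<subseteq> (%(g, s). (g + 1) * G + s) ` ({..<card S div G} \<times> {..<G})"
  proof
   fix r assume "r \<in> rk ` ?B"
   then have r: "G <= r" "r < card S" using rklt by auto
   have 1: "1 <= r div G" using r G by (simp add: div_greater_zero_iff Suc_le_eq)
   have "r div G <= card S div G" using r by (intro div_le_mono) auto
   moreover have "r = (r div G - 1 + 1) * G + r mod G" using 1 by simp
   ultimately show "r \<in> (%(g, s). (g + 1) * G + s) ` ({..<card S div G} \<times> {..<G})"
    using 1 G by (intro image_eqI[where x = "(r div G - 1, r mod G)"]) (simp_all only: prod.case, auto)
  qed
 qed (use h0 in auto)
 also have "... = (\<Sum>(g, s)\<in>{..<card S div G} \<times> {..<G}. h g)"
  by (subst sum.reindex) (auto simp: inj_on_def pair_inj simp del: mult_Suc add_Suc intro!: sum.cong)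
 also have "... = real G * (\<Sum>g<card S div G. h g)" by (simp add: sum.cartesian_product[symmetric] sum_distrib_left)
 also have "(\<Sum>g<card S div G. h g) = (\<Sum>g<card S div G. w (pick g))" by (rule sum.cong) (auto simp: h_def)
 finally show ?thesis by simp
qed

text \<open>The only fact about the random choices on which the allocation relies.\<close>

locale alg_fin = alg_run +
 assumes load: "!!c. inV c ==> (\<Sum>c'\<in>{c'. inV c' & bd c' = bd c & c' ~= c}. a0 (fe c) (fe c')) <= 2 * real KK * T"
begin

definition "Cl c = {j. clm c j}"

lemma Cl_sub: "Cl c \<subseteq> CS (fe c)" by (auto simp: Cl_def clm_def CS_def)
lemma Cl_fin: "finite (Cl c)" by (rule finite_subset[OF Cl_sub CS_fin])

lemma tp: assumes "inV c" shows "tp c < n" "rot (tp c) = c" "CS (fe c) \<subseteq> {j. j < m & j \<in> gg I (tp c) & ~ fat j}" "T <= 4 * F (CS (fe c))"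
proof -
 note f = fe_sel[OF assms]
 note dm = valid_dm[OF f(1)]
 have t: "tp c = fe c mod n" by (simp add: tp_def dm)
 show "tp c < n" using n0 by (simp add: t)
 show "rot (tp c) = c" using ise_D(3)[OF f(2,1)] t by simp
 show "CS (fe c) \<subseteq> {j. j < m & j \<in> gg I (tp c) & ~ fat j}" unfolding CS_eq tp_def by (rule Cf_sub)
 have "fe c mod n \<in> Bt (fe c div n)" using ise_D(1)[OF f(2,1)] by (simp add: valid_def)
 then show "T <= 4 * F (CS (fe c))" unfolding CS_eq dm(1,2) using Cf_good[of "fe c div n" "fe c mod n"] dm(3) by simp
qed

lemma ovl_card: "ovl c j = card {c'. inV c' & bd c' = bd c & dmt (fe c) (fe c') j}"
 unfolding ovl_def sum_of_bool_card by (rule arg_cong[where f = card]) (auto simp: inV_def)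

text \<open>Weighted by their overlaps, the resources of the configuration sum to at most
  \<open>3 * KK * T\<close>. Those contested more than \<open>24 * KK\<close> times hence have
  weight at most \<open>T / 8\<close>, half of what the configuration is worth.\<close>

lemma Cl_weight: assumes c: "inV c" shows "T / 8 <= (\<Sum>j\<in>Cl c. wt (fe c) j)"
proof -
 let ?C = "CS (fe c)" and ?w = "wt (fe c)"
 let ?V = "{c'. inV c' & bd c' = bd c}"
 have finV: "finite ?V" using VV(1) by (rule rev_finite_subset) auto
 have "(\<Sum>j\<in>?C. real (ovl c j) * ?w j) = (\<Sum>j\<in>?C. real (card {c'\<in>?V. dmt (fe c) (fe c') j}) * ?w j)"
  by (simp add: ovl_card conj_assoc)
 also have "... = (\<Sum>c'\<in>?V. \<Sum>j\<in>{j\<in>?C. dmt (fe c) (fe c') j}. ?w j)" by (rule count_swap[OF CS_fin finV, symmetric])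
 also have "... = (\<Sum>c'\<in>?V. a0 (fe c) (fe c'))"
  unfolding a0_eq by (intro sum.cong refl) (auto simp: CS_def dmt_def)
 also have "?V = insert c {c'. inV c' & bd c' = bd c & c' ~= c}" using c by auto
 also have "(\<Sum>c'\<in>insert c {c'. inV c' & bd c' = bd c & c' ~= c}. a0 (fe c) (fe c')) =
   a0 (fe c) (fe c) + (\<Sum>c'\<in>{c'. inV c' & bd c' = bd c & c' ~= c}. a0 (fe c) (fe c'))"
  by (rule sum.insert) (use finV in \<open>auto intro: rev_finite_subset\<close>)
 also have "... <= 26 / 100 * T + 2 * real KK * T" by (intro add_mono a0_le load c)
 also have "... <= 3 * real KK * T"
 proof -
  have "26 / 100 * T <= real KK * T" using KK T by (intro mult_right_mono) auto
  then show ?thesis by (simp add: algebra_simps)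
 qed
 finally have tot: "(\<Sum>j\<in>?C. real (ovl c j) * ?w j) <= 3 * real KK * T" .
 let ?D = "{j\<in>?C. th < ovl c j}"
 have "real th * (\<Sum>j\<in>?D. ?w j) = (\<Sum>j\<in>?D. real th * ?w j)" by (rule sum_distrib_left)
 also have "... <= (\<Sum>j\<in>?D. real (ovl c j) * ?w j)" by (intro sum_mono mult_right_mono) (auto simp: wt_nonneg)
 also have "... <= (\<Sum>j\<in>?C. real (ovl c j) * ?w j)" by (rule sum_mono2) (auto simp: CS_fin wt_nonneg)
 finally have "real th * (\<Sum>j\<in>?D. ?w j) <= 3 * real KK * T" using tot by simp
 then have "(24 * real KK) * (\<Sum>j\<in>?D. ?w j) <= (24 * real KK) * (T / 8)" by (simp add: th_def)
 then have D: "(\<Sum>j\<in>?D. ?w j) <= T / 8" using KK by (subst (asm) mult_le_cancel_left_pos) auto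
 have "?C = Cl c \<union> ?D" using c by (auto simp: CS_def Cl_def clm_def)
 moreover have "(\<Sum>j\<in>Cl c \<union> ?D. ?w j) = (\<Sum>j\<in>Cl c. ?w j) + (\<Sum>j\<in>?D. ?w j)"
  by (rule sum.union_disjoint) (auto simp: Cl_fin CS_fin Cl_def clm_def)
 moreover have "(\<Sum>j\<in>?C. ?w j) = F ?C" by (simp add: wt_eq wgt_sum CS_m)
 ultimately show ?thesis using D tp(4)[OF c] by simp
qed

text \<open>Within one phase, a claimant to which \<open>j\<close> is worth least is contested by
  every claimant of that phase, itself included, so its own overlap bound \<open>th\<close> counts
  them all. Two phases give \<open>2 * th = GG\<close>.\<close>

lemma claims: "card {c. clm c j} <= GG"
proof -
 have fin: "finite {c. clm c j}" by (rule finite_subset[OF _ VV(1)]) (auto simp: clm_def)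
 have ph: "card {c. clm c j & bd c = p} <= th" for p
 proof (cases "{c. clm c j & bd c = p} = {}")
  case False
  have finp: "finite {c. clm c j & bd c = p}" using fin by (rule rev_finite_subset) auto
  define c where "c = arg_min_on (%c. wt (fe c) j) {c. clm c j & bd c = p}"
  have c: "clm c j" "bd c = p" using arg_min_if_finite(1)[OF finp False] by (auto simp: c_def)
  have le: "wt (fe c) j <= wt (fe c') j" if "clm c' j" "bd c' = p" for c'
   unfolding c_def by (rule arg_min_least[OF finp False]) (use that in auto)
  have "card {c. clm c j & bd c = p} <= ovl c j" unfolding ovl_card
   by (rule card_mono) (use c le VV(1) in \<open>auto simp: clm_def dmt_def intro: rev_finite_subset\<close>)
  then show ?thesis using c by (simp add: clm_def)
 next
  case True
  then show ?thesis by (simp only: card.empty)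
 qed
 have "{c. clm c j} = {c. clm c j & bd c = True} \<union> {c. clm c j & bd c = False}" by auto
 then have "card {c. clm c j} <= card {c. clm c j & bd c = True} + card {c. clm c j & bd c = False}" by (metis card_Un_le)
 also have "... <= th + th" by (intro add_mono ph)
 finally show ?thesis by (simp add: th_def GG_def)
qed

definition "bef c j' j \<longleftrightarrow> wt (fe c) j < wt (fe c) j' | (wt (fe c) j <= wt (fe c) j' & j' < j)"

lemma rnk_card: "rnk c j = card {j'\<in>Cl c. bef c j' j}"
 unfolding rnk_def sum_of_bool_card by (rule arg_cong[where f = card]) (auto simp: Cl_def clm_def bef_def)

lemma ncl_card: "ncl c = card (Cl c)"
 unfolding ncl_def sum_of_bool_card by (rule arg_cong[where f = card]) (auto simp: Cl_def clm_def)

lemma rnk_bij: "bij_betw (rnk c) (Cl c) {..<ncl c}"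
proof -
 have "bij_betw (%x. card {y\<in>Cl c. bef c y x}) (Cl c) {..<card (Cl c)}"
  by (rule rank_bij(1)[OF Cl_fin]) (auto simp: bef_def)
 moreover have "rnk c = (%x. card {y\<in>Cl c. bef c y x})" by (rule ext) (rule rnk_card)
 ultimately show ?thesis by (simp only: ncl_card)
qed

lemma rnk_mono: assumes "x \<in> Cl c" "y \<in> Cl c" "rnk c x < rnk c y" shows "wt (fe c) y <= wt (fe c) x"
proof -
 have "bef c x y" by (rule rank_bij(2)[where S = "Cl c"]) (use Cl_fin assms in \<open>auto simp: bef_def rnk_card\<close>)
 then show ?thesis by (auto simp: bef_def)
qed

lemma GG0: "0 < GG" using KK by (simp add: GG_def)

lemma ncl_le: "ncl c <= m"
proof -
 have "card (Cl c) <= card {..<m}" by (rule card_mono) (auto simp: Cl_def clm_def)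
 then show ?thesis by (simp add: ncl_card)
qed

lemma gact_iff: assumes "c < n" "g < m" shows "gact (c * m + g) ~= 0 \<longleftrightarrow> (g + 1) * GG <= ncl c"
 using pair_lt[OF assms] idv_pair[OF assms] by (simp add: gact_def tab_def)

lemma gadj_iff: assumes "c < n" "g < m" "j < m" shows "gadj ((c * m + g) * m + j) ~= 0 \<longleftrightarrow> gcl c g j"
 using pair_lt[OF pair_lt[OF assms(1,2)] assms(3)] idv_pair[OF pair_lt[OF assms(1,2)] assms(3)] idv_pair[OF assms(1,2)]
 by (simp add: gadj_def tab_def)

lemma gcl_unique: "gcl c g j ==> gcl c g' j ==> g = g'"
proof -
 assume a: "gcl c g j" "gcl c g' j"
 have "rnk c j div GG = g" if "gcl c g j" for g
  using that GG0 by (intro div_nat_eqI) (auto simp: gcl_def mult.commute)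
 then show "g = g'" using a by blast
qed

text \<open>Double counting for Hall's condition: a full group has exactly \<open>GG\<close>
  resources, while a resource has at most \<open>GG\<close> claimants and lies in a single group of
  each.\<close>

lemma gown_perfect: "perfect (n * m) m gact gown"
 unfolding gown_def
proof (rule auction_perfect)
 fix U assume U: "U \<subseteq> {u. u < n * m & gact u ~= 0}"
 have finU: "finite U" by (rule finite_subset[OF U]) simp
 let ?N = "{r. r < m & (\<exists>u\<in>U. gadj (u * m + r) ~= 0)}"
 let ?nb = "%u. {r. r < m & gadj (u * m + r) ~= 0}"
 have dec: "\<exists>c g. u = c * m + g & c < n & g < m" if "u < n * m" for u
 proof (intro exI conjI)
  show "u = u div m * m + u mod m" by simp
  show "u div m < n" by (rule less_mult_imp_div_less[OF that])
  show "u mod m < m" using that by (cases m) auto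
 qed
 have deg: "card (?nb u) = GG" if u: "u \<in> U" for u
 proof -
  obtain c g where cg: "u = c * m + g" "c < n" "g < m" using dec[of u] u U by blast
  have full: "(g + 1) * GG <= ncl c" using gact_iff[OF cg(2,3)] u U cg(1) by auto
  have nb: "?nb u = {j\<in>Cl c. rnk c j \<in> {g * GG..<(g + 1) * GG}}"
   using gadj_iff[OF cg(2,3)] by (auto simp: cg(1) gcl_def Cl_def clm_def)
  have "bij_betw (rnk c) (?nb u) {g * GG..<(g + 1) * GG}"
   unfolding bij_betw_def
  proof
   show "inj_on (rnk c) (?nb u)" unfolding nb by (rule inj_on_subset[OF bij_betw_imp_inj_on[OF rnk_bij]]) auto
   have "{g * GG..<(g + 1) * GG} \<subseteq> rnk c ` Cl c" using full bij_betw_imp_surj_on[OF rnk_bij, of c] by auto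
   then show "rnk c ` ?nb u = {g * GG..<(g + 1) * GG}" unfolding nb by blast
  qed
  then have "card (?nb u) = card {g * GG..<(g + 1) * GG}" by (rule bij_betw_same_card)
  then show ?thesis by simp
 qed
 have "card U * GG = (\<Sum>u\<in>U. card (?nb u))" using deg by simp
 also have "... = card (SIGMA u:U. ?nb u)" using finU by simp
 also have "... <= card (SIGMA r:?N. {u\<in>U. gadj (u * m + r) ~= 0})"
  by (rule card_inj_on_le[where f = prod.swap]) (use finU in \<open>auto simp: inj_on_def\<close>)
 also have "... = (\<Sum>r\<in>?N. card {u\<in>U. gadj (u * m + r) ~= 0})" using finU by simp
 also have "... <= (\<Sum>r\<in>?N. GG)"
 proof (rule sum_mono)
  fix r assume r: "r \<in> ?N"
  have "card {u\<in>U. gadj (u * m + r) ~= 0} <= card {c. clm c r}"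
  proof (rule card_inj_on_le[where f = "%u. u div m"])
   have ex: "\<exists>c g. u = c * m + g & g < m & gcl c g r & u div m = c" if u: "u \<in> U" "gadj (u * m + r) ~= 0" for u
   proof -
    obtain c g where cg: "u = c * m + g" "c < n" "g < m" using dec[of u] u U by blast
    then show ?thesis using gadj_iff[OF cg(2,3), of r] r u by auto
   qed
   show "inj_on (%u. u div m) {u\<in>U. gadj (u * m + r) ~= 0}"
   proof (rule inj_onI)
    fix u u' assume a: "u \<in> {u\<in>U. gadj (u * m + r) ~= 0}" "u' \<in> {u\<in>U. gadj (u * m + r) ~= 0}" "u div m = u' div m"
    obtain c g where 1: "u = c * m + g" "gcl c g r" "u div m = c" using ex[of u] a(1) by blast
    obtain c' g' where 2: "u' = c' * m + g'" "gcl c' g' r" "u' div m = c'" using ex[of u'] a(2) by blast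
    have "c = c'" using 1(3) 2(3) a(3) by simp
    moreover have "g = g'" using gcl_unique 1(2) 2(2) calculation by blast
    ultimately show "u = u'" using 1(1) 2(1) by simp
   qed
   show "(%u. u div m) ` {u\<in>U. gadj (u * m + r) ~= 0} \<subseteq> {c. clm c r}"
   proof
    fix c assume "c \<in> (%u. u div m) ` {u\<in>U. gadj (u * m + r) ~= 0}"
    then obtain u where u: "u \<in> U" "gadj (u * m + r) ~= 0" "c = u div m" by blast
    then show "c \<in> {c. clm c r}" using ex[OF u(1,2)] by (auto simp: gcl_def)
   qed
   show "finite {c. clm c r}" by (rule finite_subset[OF _ VV(1)]) (auto simp: clm_def)
  qed
  then show "card {u\<in>U. gadj (u * m + r) ~= 0} <= GG" using claims[of r] by simp
 qed
 finally have "card U * GG <= card ?N * GG" by simp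
 then show "card U <= card ?N" using GG0 by simp
qed

lemma AA_GG: "real AA = 16 * real GG" by (simp add: AA_def GG_def)

text \<open>By \<open>grouping\<close>, the claims of weight at least \<open>T / 8\<close> are
  bounded by \<open>GG\<close> times the weight of the received resources plus \<open>GG\<close>
  times the largest single weight. The latter is at most \<open>T / AA\<close>, so the extra term is
  \<open>T / 16\<close> and half of the weight remains.\<close>

lemma thin_value:
 assumes c: "inV c" shows "T / (16 * real GG) <= F ({j. j < m & own j = tp c} \<inter> gg I (tp c))"
proof -
 have cn: "c < n" using c by (simp add: inV_def)
 let ?k = "ncl c div GG"
 let ?w = "wt (fe c)"
 define pick where "pick g = (SOME r. r < m & gown r = c * m + g + 1)" for g
 have pk: "pick g < m & gown (pick g) = c * m + g + 1 & gcl c g (pick g) & g < m" if g: "g < ?k" for g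
 proof -
  have "g + 1 <= ncl c div GG" using g by simp
  then have full: "(g + 1) * GG <= ncl c" using GG0 by (simp add: less_eq_div_iff_mult_less_eq)
  have "g + 1 <= (g + 1) * GG" using mult_le_mono2[of 1 GG "g + 1"] GG0 by simp
  then have gm: "g < m" using full ncl_le[of c] by linarith
  have lt: "c * m + g < n * m" by (rule pair_lt[OF cn gm])
  have "\<exists>r. r < m & gown r = c * m + g + 1"
   using gown_perfect gact_iff[OF cn gm] full lt unfolding perfect_def by blast
  then have p: "pick g < m & gown (pick g) = c * m + g + 1" unfolding pick_def by (rule someI_ex)
  then have "gadj ((c * m + g) * m + pick g) ~= 0" using auction_owner(3)[of "pick g" m "n * m" gact gadj "c * m + g"] by (simp add: gown_def)
  then show ?thesis using p gm gadj_iff[OF cn gm] by auto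
 qed
 have inj: "inj_on pick {..<?k}"
 proof (rule inj_onI)
  fix g g' assume a: "g \<in> {..<?k}" "g' \<in> {..<?k}" "pick g = pick g'"
  have "gcl c g (pick g)" using pk[of g] a(1) by simp
  moreover have "gcl c g' (pick g)" unfolding a(3) using pk[of g'] a(2) by simp
  ultimately show "g = g'" by (rule gcl_unique)
 qed
 have "(\<Sum>j\<in>Cl c. ?w j) <= real GG * (\<Sum>g<card (Cl c) div GG. ?w (pick g)) + real GG * (T / real AA)"
 proof (rule grouping[where rk = "rnk c"])
  show "bij_betw (rnk c) (Cl c) {..<card (Cl c)}" using rnk_bij by (simp add: ncl_card)
  show "?w x <= T / real AA" if "x \<in> Cl c" for x
  proof -
   have x: "x \<in> CS (fe c)" using that Cl_sub by blast
   have "?w x <= F {x}" unfolding wt_eq by (rule wgt_le[OF CS_m x])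
   also have "... < T / real AA" using tp(3)[OF c] x by (intro thin_le) auto
   finally show ?thesis by simp
  qed
  show "pick g \<in> Cl c & rnk c (pick g) < (g + 1) * GG" if "g < card (Cl c) div GG" for g
   using pk[of g] that by (simp add: ncl_card gcl_def Cl_def)
 qed (use Cl_fin GG0 rnk_mono wt_nonneg T in auto)
 then have "T / 8 <= real GG * (\<Sum>g<?k. ?w (pick g)) + real GG * (T / real AA)" using Cl_weight[OF c] unfolding ncl_card by linarith
 moreover have "real GG * (T / real AA) = T / 16" using GG0 by (simp add: AA_GG)
 ultimately have "T / 8 <= real GG * (\<Sum>g<?k. ?w (pick g)) + T / 16" by (simp only:)
 then have "T / 16 <= real GG * (\<Sum>g<?k. ?w (pick g))" by linarith
 then have "T / (16 * real GG) <= (\<Sum>g<?k. ?w (pick g))" using GG0 by (simp add: field_simps)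
 also have "... = (\<Sum>j\<in>pick ` {..<?k}. ?w j)" by (simp add: sum.reindex[OF inj])
 also have "... <= F (pick ` {..<?k})" unfolding wt_eq
 proof (rule wgt_sum_le[OF CS_m])
  show "pick ` {..<?k} \<subseteq> CS (fe c)" using pk Cl_sub by (auto simp: gcl_def Cl_def)
 qed
 also have "... <= F ({j. j < m & own j = tp c} \<inter> gg I (tp c))"
 proof (rule F_mono)
  show "pick ` {..<?k} \<subseteq> {j. j < m & own j = tp c} \<inter> gg I (tp c)"
  proof
   fix j assume "j \<in> pick ` {..<?k}"
   then obtain g where g: "g < ?k" "j = pick g" by auto
   note p = pk[OF g(1)]
   have j: "j \<in> CS (fe c)" using p Cl_sub g by (auto simp: gcl_def Cl_def)
   then have "~ fat j" "j \<in> gg I (tp c)" using tp(3)[OF c] by auto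
   moreover have "idv n (gown j - 1) m = c" using p g idv_pair(1)[OF cn, of g m] by simp
   ultimately show "j \<in> {j. j < m & own j = tp c} \<inter> gg I (tp c)"
    using p g tp(1)[OF c] by (simp add: own_def out_def)
  qed
 qed auto
 finally show ?thesis .
qed

text \<open>Every cluster that has to buy gives up its player \<open>tp c\<close> to thin resources,
  which is the one omission per cluster that \<open>players_hall\<close> asks for.\<close>

lemma fat_value:
 assumes i: "i < n" "~ thn i" shows "T / (16 * real GG) <= F ({j. j < m & own j = i} \<inter> gg I i)"
proof -
 let ?act = "tab n (%i. of_bool (~ thn i))"
 have act: "?act u ~= 0 \<longleftrightarrow> ~ thn u" if "u < n" for u using that by (simp add: tab_def)
 have "perfect n m ?act fown" unfolding fown_def
 proof (rule auction_perfect)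
  fix U assume U: "U \<subseteq> {u. u < n & ?act u ~= 0}"
  have "card U <= card (\<Union>(Nf ` U))"
  proof (rule players_hall)
   show "U \<subseteq> {..<n}" using U by auto
   fix c assume c: "inV c"
   have "thn (tp c)" using c by (auto simp: thn_def inV_def)
   then have "tp c \<notin> U" using U act by blast
   then show "\<exists>i. i < n & rot i = c & i \<notin> U" using tp[OF c] by blast
  qed
  also have "\<Union>(Nf ` U) = {r. r < m & (\<exists>u\<in>U. fadj (u * m + r) ~= 0)}"
  proof -
   have "r \<in> Nf u \<longleftrightarrow> r < m & fadj (u * m + r) ~= 0" if "u \<in> U" for u r
    using that U fadj_iff[of u r] by (auto simp: Nf_def)
   then show ?thesis by blast
  qed
  finally show "card U <= card {r. r < m & (\<exists>u\<in>U. fadj (u * m + r) ~= 0)}" .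
 qed
 then obtain r where r: "r < m" "fown r = i + 1" using i act unfolding perfect_def by blast
 then have "fadj (i * m + r) ~= 0" using auction_owner(3)[of r m n ?act fadj i] by (simp add: fown_def)
 then have N: "r \<in> Nf i" using fadj_iff i r by blast
 then have ft: "fat r" "r \<in> gg I i" by (auto simp: Nf_def)
 have "{j'. j' < m & j' = r} = {r}" using r by auto
 then have "T <= real AA * F {r}" using ft(1) by (simp add: fat_def)
 then have "T / (16 * real GG) <= F {r}" using GG0 by (simp add: AA_GG field_simps)
 also have "... <= F ({j. j < m & own j = i} \<inter> gg I i)"
  by (rule F_mono) (use r ft i in \<open>auto simp: own_def out_def\<close>)
 finally show ?thesis .
qed

lemma player_value: "i < n ==> T / (16 * real GG) <= F ({j. j < m & own j = i} \<inter> gg I i)"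
 using thin_value fat_value by (cases "thn i") (auto simp: thn_def)

end

section \<open>The algorithm runs in polynomial time\<close>

text \<open>Marks array accesses, which would otherwise be flexible applications in the rules below.\<close>
definition ix :: "(nat => nat) => nat => nat" where "ix A i = A i"

definition gar :: "inst => nat => nat" where
 "gar I = tab (nn I * mm I) (%e. of_bool (e mod mm I \<in> gg I (e div mm I)))"

text \<open>What a context must offer for the rules below: the two sizes and the incidence matrix,
  the oracle being available anyway.\<close>

definition base :: "nat => ('c => store => bool) => ('c => inst) => bool" where
 "base k R I \<longleftrightarrow> comp k R I rdn (%x. nn (I x)) & comp k R I rdn (%x. mm (I x)) & comp k R I rda (%x. gar (I x))"

lemma base_stable: "base k R I ==> stable k R" using comp_stable by (auto simp: base_def)
lemma base_n: "base k R I ==> comp k R I rdn (%x. nn (I x))" by (simp add: base_def)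
lemma base_m: "base k R I ==> comp k R I rdn (%x. mm (I x))" by (simp add: base_def)
lemma base_g: "base k R I ==> comp k R I rda (%x. gar (I x))" by (simp add: base_def)
lemma base_mono: "base k R I ==> k <= k' ==> base k' R I" unfolding base_def
 by (elim conjE) (intro conjI; erule comp_mono, assumption)
lemma comp_lift1: "comp k R I rd \<sigma> ==> r < k ==> localrd rd' ==> comp k (ext r rd' R) (%p. I (fst p)) rd (%p. \<sigma> (fst p))"
 by (rule comp_lift) auto
lemma base_ext: "base k R I ==> r < k ==> localrd rd ==> base k (ext r rd R) (%p. I (fst p))"
 unfolding base_def by (intro conjI comp_lift1[where \<sigma> = "%x. nn (I x)"] comp_lift1[where \<sigma> = "%x. mm (I x)"] comp_lift1[where \<sigma> = "%x. gar (I x)"]) auto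
lemma base_var: "base k R I ==> r < k ==> localrd rd ==> comp k (ext r rd R) (%p. I (fst p)) rd (%p. snd p)"
 using comp_var[of k R k r rd] base_stable by blast
lemma base_num: "base k R I ==> comp k R I rdn (%x. v)" by (rule comp_num[OF base_stable])
lemma base_rif: "base k R I ==> compb k R I P ==> comp k R I rdr \<sigma> ==> comp k R I rdr (%x. if P x then \<sigma> x else 0)"
 by (rule comp_rif[OF _ _ base_stable])

lemma pbd_lift: "pbd I \<sigma> ==> pbd (%p. I (fst p)) (%p. \<sigma> (fst p))" by (auto simp: pbd_def)
lemma pbd_n: "pbd I (%x. nn (I x))" by (rule pbd_mono[OF pbd_pow[of I 1]]) (simp add: isz_def)
lemma pbd_m: "pbd I (%x. mm (I x))" by (rule pbd_mono[OF pbd_pow[of I 1]]) (simp add: isz_def)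
lemma pbd_min: "pbd I \<tau> ==> pbd I (%x. min (\<sigma> x) (\<tau> x))" by (erule pbd_mono) simp
lemma pbd_sub: "pbd I \<sigma> ==> pbd I (%x. \<sigma> x - \<tau> x)" by (erule pbd_mono) simp
lemma sum_of_bool_le: "(\<Sum>i<(k::nat). of_bool (P i) :: nat) <= k"
proof -
 have "(\<Sum>i<k. of_bool (P i) :: nat) <= (\<Sum>i<k. 1)" by (rule sum_mono) simp
 then show ?thesis by simp
qed
lemma pbd_lgn: "pbd I \<sigma> ==> pbd I (%x. lgn (\<sigma> x))" by (erule pbd_mono) (simp only: lgn_def sum_of_bool_le)
lemma pbd_idv: "pbd I B ==> pbd I (%x. idv (B x) (\<sigma> x) (\<tau> x))" by (erule pbd_mono) (simp only: idv_def sum_of_bool_le)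
lemma pbd_pow2lgn: assumes "pbd I \<sigma>" shows "pbd I (%x. 2 ^ lgn (\<sigma> x))"
proof (rule pbd_mono)
 show "pbd I (%x. 2 * \<sigma> x + 1)" by (intro pbd_add pbd_mult pbd_const assms)
 show "2 ^ lgn (\<sigma> x) <= 2 * \<sigma> x + 1" for x using lgn(2)[of "\<sigma> x"] by (cases "\<sigma> x = 0") (auto simp: lgn_def)
qed

lemmas pbd1 = pbd_n pbd_m pbd_const pbd_add pbd_mult pbd_Suc pbd_min pbd_lgn pbd_idv pbd_sub pbd_pow2lgn
lemma pbd_bb: "pbd I (%x. alg.bb (I x))" unfolding alg.bb_def by (intro pbd1)
lemma pbd_be: "pbd I (%x. alg.be (I x))" unfolding alg.be_def alg.bb_def by (intro pbd1)
lemma pbd_KK: "pbd I (%x. alg.KK (I x))" unfolding alg.KK_def by (intro pbd1 pbd_bb)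
lemma pbd_MM: "pbd I (%x. alg.MM (I x))" unfolding alg.MM_def by (intro pbd1)
lemma pbd_l0: "pbd I (%x. alg.l0 (I x))" unfolding alg.l0_def mult_2 power_add by (intro pbd1)
lemmas pbd2 = pbd_bb pbd_be pbd_KK pbd_MM pbd_l0 pbd1
lemma pbd_GG: "pbd I (%x. alg.GG (I x))" unfolding alg.GG_def by (intro pbd2)
lemma pbd_AA: "pbd I (%x. alg.AA (I x))" unfolding alg.AA_def by (intro pbd2)
lemma pbd_Kx: "pbd I (%x. alg.Kx (I x))" unfolding alg.Kx_def by (intro pbd2)
lemma pbd_price: "pbd I (%x. alg.price (I x) (ld x) (j x))" unfolding alg.price_def by (intro pbd2)
lemmas pbds = pbd_GG pbd_AA pbd_Kx pbd_price pbd2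

lemma comp_ix: "comp k R I rda A ==> comp k R I rdn i ==> comp k R I rdn (%x. ix (A x) (i x))"
 unfolding ix_def by (rule comp_nth)
lemma comp_mult2: "comp k R I rdn \<sigma> ==> comp k R I rdn \<tau> ==> pbd I \<tau> ==> comp k R I rdn (%x. \<sigma> x * \<tau> x)"
 by (subst mult.commute) (rule comp_mult)
lemma comp_pow2: "base k R I ==> comp k R I rdn \<tau> ==> pbd I \<tau> ==> comp k R I rdn (%x. 2 ^ \<tau> x)"
 using comp_dbl[OF base_num[of k R I 1]] by simp
lemma comp_iff: "compb k R I P ==> compb k R I Q ==> compb k R I (%x. P x = Q x)"
 using comp_eq[of k R I "%x. of_bool (P x)" "%x. of_bool (Q x)"] by (simp add: of_bool_eq_iff)
lemma comp_Suc: "base k R I ==> comp k R I rdn \<sigma> ==> comp k R I rdn (%x. Suc (\<sigma> x))"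
 using comp_add[OF _ base_num[of k R I 1]] by simp
lemma comp_niter:
 assumes "comp k R I rdn \<tau>" "pbd I \<tau>" "comp k R I rdn ini"
  and "!!r r' k'. k <= k' ==> r < k' ==> r' < k' ==>
   comp k' (ext r' rdn (ext r rdn R)) (%p. I (fst (fst p))) rdn (%p. g (fst (fst p)) (snd (fst p)) (snd p))"
 shows "comp k R I rdn (%x. iter (\<tau> x) (g x) (ini x))"
 by (rule comp_iter[OF assms(1,3) movable_rdn assms(4,2) pbd_const[of I 1]]) auto

text \<open>The rules follow the syntax of a definition, so one and the same proof line compiles all
  the functions below. Each later collection puts the functions just compiled in front, and a
  definition refers to them as units.\<close>

lemmas cmp0 = base_n base_m base_g base_num base_var base_ext base_rif comp_ix comp_Suc comp_add comp_sub comp_mult2 comp_pow2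
 comp_radd comp_rsub comp_rmult comp_rdbl comp_less comp_rless comp_le comp_rle comp_eq comp_iff comp_not comp_conj comp_disj comp_imp
 comp_if comp_sum comp_rsum comp_Ball comp_Bex comp_query comp_tab comp_aiter comp_niter comp_mod_pow localrd pbds comp_lift1 pbd_lift
lemmas cmp_mono = comp_mono base_mono

lemma comp_min: "comp k R I rdn \<sigma> ==> comp k R I rdn \<tau> ==> comp k R I rdn (%x. min (\<sigma> x) (\<tau> x))"
 unfolding min_def by (intro comp_if comp_le)

lemma lst_cong: "(!!j. j < n ==> P j \<longleftrightarrow> Q j) ==> lst n P = lst n Q" unfolding lst_def by (intro sum.cong refl arg_cong[where f = of_bool]) blast

lemma comp_lst_aux: "base k R I ==> comp k R I rdn \<tau> ==> pbd I \<tau> ==> comp k R I rda c ==>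
  comp k R I rdn (%x. \<Sum>i<\<tau> x. of_bool (\<forall>j<\<tau> x. j <= i --> ix (c x) j = 0))"
 by (assumption | rule cmp0 | (rule cmp_mono, assumption) | linarith)+

text \<open>\<open>P\<close> is known to be computable under one bound variable only, but
  \<open>lst\<close> needs it under two. Tabulating it yields a value of the outer context, which
  lifts to any depth.\<close>

lemma comp_lst:
 assumes "base k R I" "comp k R I rdn \<tau>" "pbd I \<tau>"
  "!!r k'. k <= k' ==> r < k' ==> compb k' (ext r rdn R) (%p. I (fst p)) (%p. P (fst p) (snd p))"
 shows "comp k R I rdn (%x. lst (\<tau> x) (P x))"
proof -
 let ?c = "%x. tab (\<tau> x) (%i. of_bool (P x i))"
 have c: "comp k R I rda ?c" by (rule comp_tab) (use assms in auto)
 have "lst (\<tau> x) (P x) = (\<Sum>i<\<tau> x. of_bool (\<forall>j<\<tau> x. j <= i --> ix (?c x) j = 0))" for x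
  unfolding lst_def by (intro sum.cong refl arg_cong[where f = of_bool]) (auto simp: ix_def tab_def)
 then show ?thesis using comp_lst_aux[OF assms(1-3) c] by simp
qed

text \<open>\<open>pbd\<close> speaks about all contexts, also those in which a loop variable is out
  of range, so an exponent must be capped explicitly. The same reason lies behind
  \<open>cexp_min\<close>, \<open>rq_min\<close> and the minimum in \<open>gT\<close>.\<close>

lemma lgn_min: "lgn x = (\<Sum>e<x. of_bool (2 ^ min e x <= x))" unfolding lgn_def by (intro sum.cong refl) simp
text \<open>\<open>comp_mult2\<close> wants a polynomial bound on the second factor, and the loop
  variable has none.\<close>

lemma idv_swap: "idv B x y = (\<Sum>i<B. of_bool ((i + 1) * y <= x))" by (simp add: idv_def mult.commute)

lemmas cmp1 = comp_min comp_lst cmp0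

lemma comp_lgn: "base k R I ==> comp k R I rdn \<sigma> ==> pbd I \<sigma> ==> comp k R I rdn (%x. lgn (\<sigma> x))"
 unfolding lgn_min
 by (assumption | rule cmp1 | (rule cmp_mono, assumption) | linarith)+

lemma comp_idv: "base k R I ==> comp k R I rdn B ==> comp k R I rdn u ==> comp k R I rdn y ==> pbd I B ==> pbd I y ==> comp k R I rdn (%x. idv (B x) (u x) (y x))"
 unfolding idv_swap
 by (assumption | rule cmp1 | (rule cmp_mono, assumption) | linarith)+

lemmas cmp2 = comp_lgn comp_idv cmp1

lemma comp_imd: "base k R I ==> comp k R I rdn B ==> comp k R I rdn u ==> comp k R I rdn y ==> pbd I B ==> pbd I y ==> comp k R I rdn (%x. imd (B x) (u x) (y x))"
 unfolding imd_def mult.commute[of _ "idv _ _ _"] mult.commute[of "_ :: nat" "idv _ _ _"]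
 by (assumption | rule cmp2 | (rule cmp_mono, assumption) | linarith)+

lemma comp_bb: "base k R I ==> comp k R I rdn (%x. alg.bb (I x))"
 unfolding alg.bb_def
 by (assumption | rule cmp2 | (rule cmp_mono, assumption) | linarith)+

lemma comp_MM: "base k R I ==> comp k R I rdn (%x. alg.MM (I x))"
 unfolding alg.MM_def
 by (assumption | rule cmp2 | (rule cmp_mono, assumption) | linarith)+

lemmas cmp3 = comp_imd comp_bb comp_MM cmp2

lemma comp_be: "base k R I ==> comp k R I rdn (%x. alg.be (I x))"
 unfolding alg.be_def
 by (assumption | rule cmp3 | (rule cmp_mono, assumption) | linarith)+

lemma comp_KK: "base k R I ==> comp k R I rdn (%x. alg.KK (I x))"
 unfolding alg.KK_def
 by (assumption | rule cmp3 | (rule cmp_mono, assumption) | linarith)+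

lemma comp_l0: "base k R I ==> comp k R I rdn (%x. alg.l0 (I x))"
 unfolding alg.l0_def
 by (assumption | rule cmp3 | (rule cmp_mono, assumption) | linarith)+

lemmas cmp4 = comp_be comp_KK comp_l0 cmp3

lemma comp_th: "base k R I ==> comp k R I rdn (%x. alg.th (I x))"
 unfolding alg.th_def
 by (assumption | rule cmp4 | (rule cmp_mono, assumption) | linarith)+

lemma comp_GG: "base k R I ==> comp k R I rdn (%x. alg.GG (I x))"
 unfolding alg.GG_def
 by (assumption | rule cmp4 | (rule cmp_mono, assumption) | linarith)+

lemma comp_AA: "base k R I ==> comp k R I rdn (%x. alg.AA (I x))"
 unfolding alg.AA_def
 by (assumption | rule cmp4 | (rule cmp_mono, assumption) | linarith)+

lemma comp_Kx: "base k R I ==> comp k R I rdn (%x. alg.Kx (I x))"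
 unfolding alg.Kx_def
 by (assumption | rule cmp4 | (rule cmp_mono, assumption) | linarith)+

lemma ing_ix: "ing I i j = (i < nn I & j < mm I & ix (gar I) (i * mm I + j) ~= 0)"
proof -
 have "ix (gar I) (i * mm I + j) ~= 0 \<longleftrightarrow> j \<in> gg I i" if "i < nn I" "j < mm I"
  using pair_lt[OF that] that by (simp add: ix_def gar_def tab_def)
 then show ?thesis by (auto simp: ing_def)
qed

lemma comp_ing: "base k R I ==> comp k R I rdn i ==> comp k R I rdn j ==> compb k R I (%x. ing (I x) (i x) (j x))"
 unfolding ing_ix
 by (assumption | rule cmp4 | (rule cmp_mono, assumption) | linarith)+

lemma setf_ix: "setf I C = (ff I {j. j < mm I & ix C j ~= 0})"
 unfolding setf_def ix_def by (rule refl)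

lemma comp_setf: "base k R I ==> comp k R I rda C ==> comp k R I rdr (%x. setf (I x) (C x))"
 unfolding setf_ix
 by (assumption | rule cmp4 | (rule cmp_mono, assumption) | linarith)+

lemmas cmp5 = comp_th comp_GG comp_AA comp_Kx comp_ing comp_setf cmp4

lemma comp_fat: "base k R I ==> comp k R I rdr T ==> comp k R I rdn j ==> compb k R I (%x. alg.fat (I x) (T x) (j x))"
 unfolding alg.fat_def
 by (assumption | rule cmp5 | (rule cmp_mono, assumption) | linarith)+

lemma price_ix: "alg.price I ld j = (idv (nn I * alg.l0 I) (ix ld j) (alg.MM I))"
 unfolding alg.price_def ix_def by (rule refl)

lemma comp_price: "base k R I ==> comp k R I rda ld ==> comp k R I rdn j ==> comp k R I rdn (%x. alg.price (I x) (ld x) (j x))"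
 unfolding price_ix
 by (assumption | rule cmp5 | (rule cmp_mono, assumption) | linarith)+

lemmas cmp6 = comp_fat comp_price cmp5

lemma gcond_ix: "alg.gcond I T ld i \<kappa> j C = (ing I i j & ~ alg.fat I T j & setf I C * 2 ^ 2 < T &
   T * 2 ^ alg.price I ld j <= (ff I {j'. j' < mm I & (ix C j' ~= 0 | j' = j)} - setf I C) * 2 ^ (\<kappa> + 1))"
 unfolding alg.gcond_def ix_def by (rule refl)

lemma comp_gcond: "base k R I ==> comp k R I rdr T ==> comp k R I rda ld ==> comp k R I rdn i ==> comp k R I rdn \<kappa> ==> comp k R I rdn j ==> comp k R I rda C ==> pbd I \<kappa> ==> compb k R I (%x. alg.gcond (I x) (T x) (ld x) (i x) (\<kappa> x) (j x) (C x))"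
 unfolding gcond_ix
 by (assumption | rule cmp6 | (rule cmp_mono, assumption) | linarith)+

lemmas cmp7 = comp_gcond cmp6

lemma gset_ix: "alg.gset I T ld i \<kappa> = (iter (mm I) (%j C. tab (mm I) (%j'. if j' = j & alg.gcond I T ld i \<kappa> j C then 1 else ix C j')) (tab (mm I) (%_. 0)))"
 unfolding alg.gset_def ix_def by (rule refl)

lemma comp_gset: "base k R I ==> comp k R I rdr T ==> comp k R I rda ld ==> comp k R I rdn i ==> comp k R I rdn \<kappa> ==> pbd I \<kappa> ==> comp k R I rda (%x. alg.gset (I x) (T x) (ld x) (i x) (\<kappa> x))"
 unfolding gset_ix
 by (assumption | rule cmp7 | (rule cmp_mono, assumption) | linarith)+

lemmas cmp8 = comp_gset cmp7

lemma comp_good: "base k R I ==> comp k R I rdr T ==> comp k R I rda ld ==> comp k R I rdn i ==> comp k R I rdn \<kappa> ==> pbd I \<kappa> ==> compb k R I (%x. alg.good (I x) (T x) (ld x) (i x) (\<kappa> x))"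
 unfolding alg.good_def
 by (assumption | rule cmp8 | (rule cmp_mono, assumption) | linarith)+

lemmas cmp9 = comp_good cmp8

lemma cexp_min: "alg.cexp I T ld i = lst (alg.Kx I) (%\<kappa>. alg.good I T ld i (min \<kappa> (alg.Kx I)))"
 unfolding alg.cexp_def by (rule lst_cong) simp

lemma comp_cexp: "base k R I ==> comp k R I rdr T ==> comp k R I rda ld ==> comp k R I rdn i ==> comp k R I rdn (%x. alg.cexp (I x) (T x) (ld x) (i x))"
 unfolding cexp_min
 by (assumption | rule cmp9 | (rule cmp_mono, assumption) | linarith)+

lemma pbd_cexp: "pbd I (%x. alg.cexp (I x) (T x) (ld x) (i x))"
proof (rule pbd_mono[OF pbd_Kx])
 show "alg.cexp (I x) (T x) (ld x) (i x) <= alg.Kx (I x)" for x unfolding alg.cexp_def lst_def by (rule sum_of_bool_le)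
qed

lemma comp_fadj: "base k R I ==> comp k R I rdr T ==> comp k R I rda (%x. alg.fadj (I x) (T x))"
 unfolding alg.fadj_def
 by (assumption | rule cmp9 | (rule cmp_mono, assumption) | linarith)+

lemma mleft_ix: "mleft nl nr act A = (lst nl (%u. ix act u ~= 0 & (\<forall>r<nr. ix A r ~= u + 1)))"
 unfolding mleft_def ix_def by (rule refl)

lemma comp_mleft: "base k R I ==> comp k R I rdn nl ==> comp k R I rdn nr ==> comp k R I rda act ==> comp k R I rda A ==> pbd I nl ==> pbd I nr ==> comp k R I rdn (%x. mleft (nl x) (nr x) (act x) (A x))"
 unfolding mleft_ix
 by (assumption | rule cmp9 | (rule cmp_mono, assumption) | linarith)+

lemma mright_ix: "mright nr adj A u = (lst nr (%r. ix adj (u * nr + r) ~= 0 &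
   (\<forall>r'<nr. ix adj (u * nr + r') ~= 0 --> ix A (nr + r) <= ix A (nr + r'))))"
 unfolding mright_def ix_def by (rule refl)

lemma comp_mright: "base k R I ==> comp k R I rdn nr ==> comp k R I rda adj ==> comp k R I rda A ==> comp k R I rdn u ==> pbd I nr ==> comp k R I rdn (%x. mright (nr x) (adj x) (A x) (u x))"
 unfolding mright_ix
 by (assumption | rule cmp9 | (rule cmp_mono, assumption) | linarith)+

lemma mcell_ix: "mcell nl nr A u r i = (if u < nl & r < nr & ix A (nr + r) <= nl then
   (if i = r then u + 1 else if i = nr + r then ix A i + 1 else ix A i) else ix A i)"
 unfolding mcell_def ix_def by (rule refl)

lemma comp_mcell: "base k R I ==> comp k R I rdn nl ==> comp k R I rdn nr ==> comp k R I rda A ==> comp k R I rdn u ==> comp k R I rdn r ==> comp k R I rdn i ==> comp k R I rdn (%x. mcell (nl x) (nr x) (A x) (u x) (r x) (i x))"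
 unfolding mcell_ix
 by (assumption | rule cmp9 | (rule cmp_mono, assumption) | linarith)+

lemmas cmp10 = comp_cexp pbd_cexp comp_fadj comp_mleft comp_mright comp_mcell cmp9

lemma comp_mnext: "base k R I ==> comp k R I rdn nl ==> comp k R I rdn nr ==> comp k R I rda act ==> comp k R I rda adj ==> comp k R I rdn t ==> comp k R I rda A ==> comp k R I rdn i ==> pbd I nl ==> pbd I nr ==> comp k R I rdn (%x. mnext (nl x) (nr x) (act x) (adj x) (t x) (A x) (i x))"
 unfolding mnext_def
 by (assumption | rule cmp10 | (rule cmp_mono, assumption) | linarith)+

lemmas cmp11 = comp_mnext cmp10

lemma comp_auction: "base k R I ==> comp k R I rdn nl ==> comp k R I rdn nr ==> comp k R I rda act ==> comp k R I rda adj ==> pbd I nl ==> pbd I nr ==> comp k R I rda (%x. auction (nl x) (nr x) (act x) (adj x))"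
 unfolding auction_def
 by (assumption | rule cmp11 | (rule cmp_mono, assumption) | linarith)+

lemma perfect_ix: "perfect nl nr act A = (\<forall>u<nl. ix act u ~= 0 --> (\<exists>r<nr. ix A r = u + 1))"
 unfolding perfect_def ix_def by (rule refl)

lemma comp_perfect: "base k R I ==> comp k R I rdn nl ==> comp k R I rdn nr ==> comp k R I rda act ==> comp k R I rda A ==> pbd I nl ==> pbd I nr ==> compb k R I (%x. perfect (nl x) (nr x) (act x) (A x))"
 unfolding perfect_ix
 by (assumption | rule cmp11 | (rule cmp_mono, assumption) | linarith)+

lemmas cmp12 = comp_auction comp_perfect cmp11

lemma comp_mat: "base k R I ==> comp k R I rdr T ==> comp k R I rda SS ==> compb k R I (%x. alg.mat (I x) (T x) (SS x))"
 unfolding alg.mat_def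
 by (assumption | rule cmp12 | (rule cmp_mono, assumption) | linarith)+

lemmas cmp13 = comp_mat cmp12

lemma mset_ix: "alg.mset I T ld = (iter ((alg.Kx I + 1) * nn I) (%s S. tab (nn I) (%i. if i = imd (alg.Kx I + 1) s (nn I) & alg.cexp I T ld i = alg.Kx I - idv (alg.Kx I + 1) s (nn I)
    & alg.mat I T (tab (nn I) (%i'. if i' = i then 1 else ix S i')) then 1 else ix S i)) (tab (nn I) (%_. 0)))"
 unfolding alg.mset_def ix_def by (rule refl)

lemma comp_mset: "base k R I ==> comp k R I rdr T ==> comp k R I rda ld ==> comp k R I rda (%x. alg.mset (I x) (T x) (ld x))"
 unfolding mset_ix
 by (assumption | rule cmp13 | (rule cmp_mono, assumption) | linarith)+

lemmas cmp14 = comp_mset cmp13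

lemma inB_ix: "alg.inB I T ld i = (i < nn I & ix (alg.mset I T ld) i = 0)"
 unfolding alg.inB_def ix_def by (rule refl)

lemma comp_inB: "base k R I ==> comp k R I rdr T ==> comp k R I rda ld ==> comp k R I rdn i ==> compb k R I (%x. alg.inB (I x) (T x) (ld x) (i x))"
 unfolding inB_ix
 by (assumption | rule cmp14 | (rule cmp_mono, assumption) | linarith)+

lemma comp_cfg: "base k R I ==> comp k R I rdr T ==> comp k R I rda ld ==> comp k R I rdn i ==> comp k R I rda (%x. alg.cfg (I x) (T x) (ld x) (i x))"
 unfolding alg.cfg_def
 by (assumption | rule cmp14 | (rule cmp_mono, assumption) | linarith)+

lemmas cmp15 = comp_inB comp_cfg cmp14

lemma ldt_ix: "alg.ldt I T t = (iter t (%_ ld. tab (mm I) (%j. ix ld j + (\<Sum>i<nn I. of_bool (alg.inB I T ld i & ix (alg.cfg I T ld i) j ~= 0)))) (tab (mm I) (%_. 0)))"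
 unfolding alg.ldt_def ix_def by (rule refl)

lemma comp_ldt: "base k R I ==> comp k R I rdr T ==> comp k R I rdn t ==> pbd I t ==> comp k R I rda (%x. alg.ldt (I x) (T x) (t x))"
 unfolding ldt_ix
 by (assumption | rule cmp15 | (rule cmp_mono, assumption) | linarith)+

lemmas cmp16 = comp_ldt cmp15

lemma rq_min: "alg.rq I T i = (\<Sum>t<alg.l0 I. of_bool (~ alg.inB I T (alg.ldt I T (min t (alg.l0 I))) i) :: nat)"
 unfolding alg.rq_def by (intro sum.cong refl) simp
lemma comp_rq: "base k R I ==> comp k R I rdr T ==> comp k R I rdn i ==> comp k R I rdn (%x. alg.rq (I x) (T x) (i x))" unfolding rq_min
 by (assumption | rule cmp16 | (rule cmp_mono, assumption) | linarith)+
lemmas cmp17 = comp_rq cmp16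

lemma comp_cact: "base k R I ==> comp k R I rdr T ==> comp k R I rda (%x. alg.cact (I x) (T x))" unfolding alg.cact_def
 by (assumption | rule cmp17 | (rule cmp_mono, assumption) | linarith)+
lemma cadj_ix: "alg.cadj I E = (tab (nn I * alg.l0 I * (mm I * alg.l0 I))
 (%e. ix E (idv (nn I) (idv (nn I * alg.l0 I) e (mm I * alg.l0 I)) (alg.l0 I) * mm I + idv (mm I) (imd (nn I * alg.l0 I) e (mm I * alg.l0 I)) (alg.l0 I))))"
 unfolding alg.cadj_def ix_def by (rule refl)
lemma comp_cadj: "base k R I ==> comp k R I rda E ==> comp k R I rda (%x. alg.cadj (I x) (E x))" unfolding cadj_ix
 by (assumption | rule cmp17 | (rule cmp_mono, assumption) | linarith)+
lemmas cmp18 = comp_cact comp_cadj cmp17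

lemma comp_cfl: "base k R I ==> comp k R I rdr T ==> comp k R I rda E ==> comp k R I rda (%x. alg.cfl (I x) (T x) (E x))" unfolding alg.cfl_def
 by (assumption | rule cmp18 | (rule cmp_mono, assumption) | linarith)+
lemmas cmp19 = comp_cfl cmp18

lemma comp_feas: "base k R I ==> comp k R I rdr T ==> comp k R I rda E ==> compb k R I (%x. alg.feas (I x) (T x) (E x))" unfolding alg.feas_def
 by (assumption | rule cmp19 | (rule cmp_mono, assumption) | linarith)+
lemmas cmp20 = comp_feas cmp19

lemma emin_ix: "alg.emin I T k = (iter k (%e E. tab (nn I * mm I) (%e'. if e' = e & alg.feas I T (tab (nn I * mm I) (%e''. if e'' = e then 0 else ix E e''))
  then 0 else ix E e')) (tab (nn I * mm I) (%e. of_bool (alg.fat I T (imd (nn I) e (mm I)) & ing I (idv (nn I) e (mm I)) (imd (nn I) e (mm I))))))"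
 unfolding alg.emin_def alg.fadj_def ix_def by (rule refl)
lemma comp_emin: "base k R I ==> comp k R I rdr T ==> comp k R I rdn t ==> pbd I t ==> comp k R I rda (%x. alg.emin (I x) (T x) (t x))" unfolding emin_ix
 by (assumption | rule cmp20 | (rule cmp_mono, assumption) | linarith)+
lemmas cmp21 = comp_emin cmp20

lemma ed_ix: "alg.ed I T i j = (i < nn I & j < mm I & ix (alg.emin I T (nn I * mm I)) (i * mm I + j) ~= 0)"
 unfolding alg.ed_def ix_def by (rule refl)
lemma comp_ed: "base k R I ==> comp k R I rdr T ==> comp k R I rdn i ==> comp k R I rdn j ==> compb k R I (%x. alg.ed (I x) (T x) (i x) (j x))" unfolding ed_ix
 by (assumption | rule cmp21 | (rule cmp_mono, assumption) | linarith)+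
lemma xf_ix: "alg.xf I T i j = (\<Sum>q<alg.l0 I. of_bool (j < mm I & (\<exists>p<alg.l0 I. ix (alg.cfl I T (alg.emin I T (nn I * mm I))) (j * alg.l0 I + q) = i * alg.l0 I + p + 1)) :: nat)"
 unfolding alg.xf_def ix_def by (rule refl)
lemma comp_xf: "base k R I ==> comp k R I rdr T ==> comp k R I rdn i ==> comp k R I rdn j ==> comp k R I rdn (%x. alg.xf (I x) (T x) (i x) (j x))" unfolding xf_ix
 by (assumption | rule cmp21 | (rule cmp_mono, assumption) | linarith)+
lemmas cmp22 = comp_ed comp_xf cmp21

lemma comp_dg: "base k R I ==> comp k R I rdr T ==> comp k R I rdn j ==> comp k R I rdn (%x. alg.dg (I x) (T x) (j x))" unfolding alg.dg_def
 by (assumption | rule cmp22 | (rule cmp_mono, assumption) | linarith)+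
lemma comp_chadj: "base k R I ==> comp k R I rdr T ==> comp k R I rda (%x. alg.chadj (I x) (T x))" unfolding alg.chadj_def
 by (assumption | rule cmp22 | (rule cmp_mono, assumption) | linarith)+
lemmas cmp23 = comp_dg comp_chadj cmp22

lemma comp_chact: "base k R I ==> comp k R I rdr T ==> comp k R I rda (%x. alg.chact (I x) (T x))" unfolding alg.chact_def
 by (assumption | rule cmp23 | (rule cmp_mono, assumption) | linarith)+
lemmas cmp24 = comp_chact cmp23

lemma comp_chown: "base k R I ==> comp k R I rdr T ==> comp k R I rda (%x. alg.chown (I x) (T x))" unfolding alg.chown_def
 by (assumption | rule cmp24 | (rule cmp_mono, assumption) | linarith)+
lemmas cmp25 = comp_chown cmp24

lemma chd_ix: "alg.chd I T i j = (i < nn I & j < mm I & (\<exists>q<nn I. ix (alg.chown I T) i = j * nn I + q + 1))"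
 unfolding alg.chd_def ix_def by (rule refl)
lemma comp_chd: "base k R I ==> comp k R I rdr T ==> comp k R I rdn i ==> comp k R I rdn j ==> compb k R I (%x. alg.chd (I x) (T x) (i x) (j x))" unfolding chd_ix
 by (assumption | rule cmp25 | (rule cmp_mono, assumption) | linarith)+
lemmas cmp26 = comp_chd cmp25

lemma comp_kpt: "base k R I ==> comp k R I rdr T ==> comp k R I rdn i ==> comp k R I rdn j ==> compb k R I (%x. alg.kpt (I x) (T x) (i x) (j x))" unfolding alg.kpt_def
 by (assumption | rule cmp26 | (rule cmp_mono, assumption) | linarith)+
lemma comp_prt: "base k R I ==> comp k R I rdr T ==> comp k R I rdn j ==> comp k R I rdn (%x. alg.prt (I x) (T x) (j x))" unfolding alg.prt_def
 by (assumption | rule cmp26 | (rule cmp_mono, assumption) | linarith)+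
lemmas cmp27 = comp_kpt comp_prt cmp26

lemma comp_pr: "base k R I ==> comp k R I rdr T ==> comp k R I rdn i ==> comp k R I rdn (%x. alg.pr (I x) (T x) (i x))" unfolding alg.pr_def
 by (assumption | rule cmp27 | (rule cmp_mono, assumption) | linarith)+
lemmas cmp28 = comp_pr cmp27

lemma comp_rot: "base k R I ==> comp k R I rdr T ==> comp k R I rdn i ==> comp k R I rdn (%x. alg.rot (I x) (T x) (i x))" unfolding alg.rot_def
 by (assumption | rule cmp28 | (rule cmp_mono, assumption) | linarith)+
lemmas cmp29 = comp_rot cmp28

lemma comp_stf: "base k R I ==> comp k R I rdr T ==> comp k R I rdn c ==> compb k R I (%x. alg.stf (I x) (T x) (c x))" unfolding alg.stf_def
 by (assumption | rule cmp29 | (rule cmp_mono, assumption) | linarith)+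
lemmas cmp30 = comp_stf cmp29

lemma comp_inV: "base k R I ==> comp k R I rdr T ==> comp k R I rdn c ==> compb k R I (%x. alg.inV (I x) (T x) (c x))" unfolding alg.inV_def
 by (assumption | rule cmp30 | (rule cmp_mono, assumption) | linarith)+
lemma comp_ise: "base k R I ==> comp k R I rdr T ==> comp k R I rdn c ==> comp k R I rdn e ==> compb k R I (%x. alg.ise (I x) (T x) (c x) (e x))" unfolding alg.ise_def
 by (assumption | rule cmp30 | (rule cmp_mono, assumption) | linarith)+
lemma comp_cf: "base k R I ==> comp k R I rdr T ==> comp k R I rdn e ==> comp k R I rda (%x. alg.cf (I x) (T x) (e x))" unfolding alg.cf_def
 by (assumption | rule cmp30 | (rule cmp_mono, assumption) | linarith)+
lemmas cmp31 = comp_inV comp_ise comp_cf cmp30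

lemma comp_sel: "base k R I ==> comp k R I rdr T ==> comp k R I rdn c ==> comp k R I rdn r ==> comp k R I rdn (%x. alg.sel (I x) (T x) (c x) (r x))" unfolding alg.sel_def
 by (assumption | rule cmp31 | (rule cmp_mono, assumption) | linarith)+
lemma wt_ix: "alg.wt I T e j = (ff I {j'. j' < mm I & (ix (alg.cf I T e) j' ~= 0 & j' < j + 1)} - ff I {j'. j' < mm I & (ix (alg.cf I T e) j' ~= 0 & j' < j)})"
 unfolding alg.wt_def ix_def by (rule refl)
lemma comp_wt: "base k R I ==> comp k R I rdr T ==> comp k R I rdn e ==> comp k R I rdn j ==> comp k R I rdr (%x. alg.wt (I x) (T x) (e x) (j x))" unfolding wt_ix
 by (assumption | rule cmp31 | (rule cmp_mono, assumption) | linarith)+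
lemmas cmp32 = comp_sel comp_wt cmp31

lemma dmt_ix: "alg.dmt I T e e' j = (ix (alg.cf I T e) j ~= 0 & ix (alg.cf I T e') j ~= 0 & alg.wt I T e j <= alg.wt I T e' j)"
 unfolding alg.dmt_def ix_def by (rule refl)
lemma comp_dmt: "base k R I ==> comp k R I rdr T ==> comp k R I rdn e ==> comp k R I rdn e' ==> comp k R I rdn j ==> compb k R I (%x. alg.dmt (I x) (T x) (e x) (e' x) (j x))" unfolding dmt_ix
 by (assumption | rule cmp32 | (rule cmp_mono, assumption) | linarith)+
lemmas cmp33 = comp_dmt cmp32

lemma comp_a0: "base k R I ==> comp k R I rdr T ==> comp k R I rdn e ==> comp k R I rdn e' ==> comp k R I rdr (%x. alg.a0 (I x) (T x) (e x) (e' x))" unfolding alg.a0_def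
 by (assumption | rule cmp33 | (rule cmp_mono, assumption) | linarith)+
lemma comp_modbe: "base k R I ==> comp k R I rdn \<sigma> ==> comp k R I rdn (%x. \<sigma> x mod alg.be (I x))"
 unfolding alg.be_def
 by (assumption | rule cmp33)+
lemma comp_modLL: "base k R I ==> comp k R I rdn \<sigma> ==> comp k R I rdn (%x. \<sigma> x mod alg.LL (I x))"
 unfolding alg.LL_def
 by (assumption | rule cmp33)+
lemmas cmp34 = comp_a0 comp_modbe comp_modLL cmp33

lemma sg_ix: "alg3.sg I T S c r = (alg.sel I T c (ix S (c * alg.be I + r) mod alg.LL I))"
 unfolding alg3.sg_def ix_def by (rule refl)
lemma comp_sg: "base k R I ==> comp k R I rdr T ==> comp k R I rda S ==> comp k R I rdn c ==> comp k R I rdn r ==> comp k R I rdn (%x. alg3.sg (I x) (T x) (S x) (c x) (r x))" unfolding sg_ix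
 by (assumption | rule cmp34 | (rule cmp_mono, assumption) | linarith)+
lemmas cmp35 = comp_sg cmp34

lemma x1_ix: "alg3.x1 I T S X c = (alg3.sg I T S c (ix X c mod alg.be I))"
 unfolding alg3.x1_def ix_def by (rule refl)
lemma comp_x1: "base k R I ==> comp k R I rdr T ==> comp k R I rda S ==> comp k R I rda X ==> comp k R I rdn c ==> comp k R I rdn (%x. alg3.x1 (I x) (T x) (S x) (X x) (c x))" unfolding x1_ix
 by (assumption | rule cmp35 | (rule cmp_mono, assumption) | linarith)+
lemma x2_ix: "alg3.x2 I T S Y t c = (alg3.sg I T S c (ix Y (t * nn I + c) mod alg.be I))"
 unfolding alg3.x2_def ix_def by (rule refl)
lemma comp_x2: "base k R I ==> comp k R I rdr T ==> comp k R I rda S ==> comp k R I rda Y ==> comp k R I rdn t ==> comp k R I rdn c ==> comp k R I rdn (%x. alg3.x2 (I x) (T x) (S x) (Y x) (t x) (c x))" unfolding x2_ix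
 by (assumption | rule cmp35 | (rule cmp_mono, assumption) | linarith)+
lemmas cmp36 = comp_x1 comp_x2 cmp35

lemma comp_bd: "base k R I ==> comp k R I rdr T ==> comp k R I rda S ==> comp k R I rda X ==> comp k R I rdn c ==> compb k R I (%x. alg3.bd (I x) (T x) (S x) (X x) (c x))" unfolding alg3.bd_def
 by (assumption | rule cmp36 | (rule cmp_mono, assumption) | linarith)+
lemmas cmp37 = comp_bd cmp36

lemma comp_h2: "base k R I ==> comp k R I rdr T ==> comp k R I rda S ==> comp k R I rda X ==> comp k R I rdn c ==> comp k R I rdn c' ==> compb k R I (%x. alg3.h2 (I x) (T x) (S x) (X x) (c x) (c' x))" unfolding alg3.h2_def
 by (assumption | rule cmp37 | (rule cmp_mono, assumption) | linarith)+
lemmas cmp38 = comp_h2 cmp37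

lemma rch_ix: "alg3.rch I T S X c = (iter (nn I) (%_ A. tab (nn I) (%v. of_bool (ix A v ~= 0 | (\<exists>u<nn I. ix A u ~= 0 & alg3.h2 I T S X u v)))) (tab (nn I) (%v. of_bool (v = c))))"
 unfolding alg3.rch_def ix_def by (rule refl)
lemma comp_rch: "base k R I ==> comp k R I rdr T ==> comp k R I rda S ==> comp k R I rda X ==> comp k R I rdn c ==> comp k R I rda (%x. alg3.rch (I x) (T x) (S x) (X x) (c x))" unfolding rch_ix
 by (assumption | rule cmp38 | (rule cmp_mono, assumption) | linarith)+
lemmas cmp39 = comp_rch cmp38

lemma tok_ix: "alg3.tok I T S X Y t c = ((\<Sum>c'<nn I. if ix (alg3.rch I T S X c) c' ~= 0 & c' ~= c then alg.a0 I T (alg3.x2 I T S Y t c) (alg3.x2 I T S Y t c') else 0) < real (alg.KK I) * T)"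
 unfolding alg3.tok_def ix_def by (rule refl)
lemma comp_tok: "base k R I ==> comp k R I rdr T ==> comp k R I rda S ==> comp k R I rda X ==> comp k R I rda Y ==> comp k R I rdn t ==> comp k R I rdn c ==> compb k R I (%x. alg3.tok (I x) (T x) (S x) (X x) (Y x) (t x) (c x))" unfolding tok_ix
 by (assumption | rule cmp39 | (rule cmp_mono, assumption) | linarith)+
lemmas cmp40 = comp_tok cmp39

lemma adp_ix: "alg3.adp I T S X Y c = (lst (alg.be I) (%t. \<forall>c'<nn I. ix (alg3.rch I T S X c) c' ~= 0 --> alg3.tok I T S X Y t c'))"
 unfolding alg3.adp_def ix_def by (rule refl)
lemma comp_adp: "base k R I ==> comp k R I rdr T ==> comp k R I rda S ==> comp k R I rda X ==> comp k R I rda Y ==> comp k R I rdn c ==> comp k R I rdn (%x. alg3.adp (I x) (T x) (S x) (X x) (Y x) (c x))" unfolding adp_ix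
 by (assumption | rule cmp40 | (rule cmp_mono, assumption) | linarith)+
lemmas cmp41 = comp_adp cmp40

lemma comp_fe: "base k R I ==> comp k R I rdr T ==> comp k R I rda S ==> comp k R I rda X ==> comp k R I rda Y ==> comp k R I rdn c ==> comp k R I rdn (%x. alg3.fe (I x) (T x) (S x) (X x) (Y x) (c x))" unfolding alg3.fe_def
 by (assumption | rule cmp41 | (rule cmp_mono, assumption) | linarith)+
lemmas cmp42 = comp_fe cmp41

lemma comp_ovl: "base k R I ==> comp k R I rdr T ==> comp k R I rda S ==> comp k R I rda X ==> comp k R I rda Y ==> comp k R I rdn c ==> comp k R I rdn j ==> comp k R I rdn (%x. alg3.ovl (I x) (T x) (S x) (X x) (Y x) (c x) (j x))" unfolding alg3.ovl_def
 by (assumption | rule cmp42 | (rule cmp_mono, assumption) | linarith)+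
lemma comp_tp: "base k R I ==> comp k R I rdr T ==> comp k R I rda S ==> comp k R I rda X ==> comp k R I rda Y ==> comp k R I rdn c ==> comp k R I rdn (%x. alg3.tp (I x) (T x) (S x) (X x) (Y x) (c x))" unfolding alg3.tp_def
 by (assumption | rule cmp42 | (rule cmp_mono, assumption) | linarith)+
lemmas cmp43 = comp_ovl comp_tp cmp42

lemma clm_ix: "alg3.clm I T S X Y c j = (alg.inV I T c & j < mm I & ix (alg.cf I T (alg3.fe I T S X Y c)) j ~= 0 & alg3.ovl I T S X Y c j <= alg.th I)"
 unfolding alg3.clm_def ix_def by (rule refl)
lemma comp_clm: "base k R I ==> comp k R I rdr T ==> comp k R I rda S ==> comp k R I rda X ==> comp k R I rda Y ==> comp k R I rdn c ==> comp k R I rdn j ==> compb k R I (%x. alg3.clm (I x) (T x) (S x) (X x) (Y x) (c x) (j x))" unfolding clm_ix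
 by (assumption | rule cmp43 | (rule cmp_mono, assumption) | linarith)+
lemmas cmp44 = comp_clm cmp43

lemma comp_rnk: "base k R I ==> comp k R I rdr T ==> comp k R I rda S ==> comp k R I rda X ==> comp k R I rda Y ==> comp k R I rdn c ==> comp k R I rdn j ==> comp k R I rdn (%x. alg3.rnk (I x) (T x) (S x) (X x) (Y x) (c x) (j x))" unfolding alg3.rnk_def
 by (assumption | rule cmp44 | (rule cmp_mono, assumption) | linarith)+
lemma comp_ncl: "base k R I ==> comp k R I rdr T ==> comp k R I rda S ==> comp k R I rda X ==> comp k R I rda Y ==> comp k R I rdn c ==> comp k R I rdn (%x. alg3.ncl (I x) (T x) (S x) (X x) (Y x) (c x))" unfolding alg3.ncl_def
 by (assumption | rule cmp44 | (rule cmp_mono, assumption) | linarith)+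
lemmas cmp45 = comp_rnk comp_ncl cmp44

lemma comp_gact: "base k R I ==> comp k R I rdr T ==> comp k R I rda S ==> comp k R I rda X ==> comp k R I rda Y ==> comp k R I rda (%x. alg3.gact (I x) (T x) (S x) (X x) (Y x))" unfolding alg3.gact_def
 by (assumption | rule cmp45 | (rule cmp_mono, assumption) | linarith)+
lemma comp_gcl: "base k R I ==> comp k R I rdr T ==> comp k R I rda S ==> comp k R I rda X ==> comp k R I rda Y ==> comp k R I rdn c ==> comp k R I rdn g ==> comp k R I rdn j ==> compb k R I (%x. alg3.gcl (I x) (T x) (S x) (X x) (Y x) (c x) (g x) (j x))" unfolding alg3.gcl_def
 by (assumption | rule cmp45 | (rule cmp_mono, assumption) | linarith)+
lemmas cmp46 = comp_gact comp_gcl cmp45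

lemma comp_gadj: "base k R I ==> comp k R I rdr T ==> comp k R I rda S ==> comp k R I rda X ==> comp k R I rda Y ==> comp k R I rda (%x. alg3.gadj (I x) (T x) (S x) (X x) (Y x))" unfolding alg3.gadj_def
 by (assumption | rule cmp46 | (rule cmp_mono, assumption) | linarith)+
lemma comp_thn: "base k R I ==> comp k R I rdr T ==> comp k R I rda S ==> comp k R I rda X ==> comp k R I rda Y ==> comp k R I rdn i ==> compb k R I (%x. alg3.thn (I x) (T x) (S x) (X x) (Y x) (i x))" unfolding alg3.thn_def
 by (assumption | rule cmp46 | (rule cmp_mono, assumption) | linarith)+
lemmas cmp47 = comp_gadj comp_thn cmp46

lemma comp_gown: "base k R I ==> comp k R I rdr T ==> comp k R I rda S ==> comp k R I rda X ==> comp k R I rda Y ==> comp k R I rda (%x. alg3.gown (I x) (T x) (S x) (X x) (Y x))" unfolding alg3.gown_def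
 by (assumption | rule cmp47 | (rule cmp_mono, assumption) | linarith)+
lemma comp_fown: "base k R I ==> comp k R I rdr T ==> comp k R I rda S ==> comp k R I rda X ==> comp k R I rda Y ==> comp k R I rda (%x. alg3.fown (I x) (T x) (S x) (X x) (Y x))" unfolding alg3.fown_def
 by (assumption | rule cmp47 | (rule cmp_mono, assumption) | linarith)+
lemmas cmp48 = comp_gown comp_fown cmp47

lemma out_ix: "alg3.out I T S X Y j = (if alg.fat I T j then ix (alg3.fown I T S X Y) j - 1 else alg3.tp I T S X Y (idv (nn I) (ix (alg3.gown I T S X Y) j - 1) (mm I)))"
 unfolding alg3.out_def ix_def by (rule refl)
lemma comp_out: "base k R I ==> comp k R I rdr T ==> comp k R I rda S ==> comp k R I rda X ==> comp k R I rda Y ==> comp k R I rdn j ==> comp k R I rdn (%x. alg3.out (I x) (T x) (S x) (X x) (Y x) (j x))" unfolding out_ix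
 by (assumption | rule cmp48 | (rule cmp_mono, assumption) | linarith)+
lemmas cmp49 = comp_out cmp48

lemma comp_own: "base k R I ==> comp k R I rdr T ==> comp k R I rda S ==> comp k R I rda X ==> comp k R I rda Y ==> comp k R I rdn j ==> comp k R I rdn (%x. alg3.own (I x) (T x) (S x) (X x) (Y x) (j x))" unfolding alg3.own_def
 by (assumption | rule cmp49 | (rule cmp_mono, assumption) | linarith)+
lemmas cmp50 = comp_own cmp49

text \<open>A guess of the optimum: the value of one resource times a power of two.\<close>
definition "gT I g = ff I {j. j < mm I & j = idv (mm I) g (lgn (mm I) + 1)} * 2 ^ min (imd (mm I) g (lgn (mm I) + 1)) (lgn (mm I))"
definition "pv I S X Y g i = ff I {j. j < mm I & (alg3.own I (gT I g) S X Y j = i & ing I i j)}"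
definition "NG I = mm I * (lgn (mm I) + 1)"
text \<open>Minima are compared without being computed: the worst-off player under the guess
  \<open>g\<close> fares at least as well as the worst-off player under any other guess.\<close>

definition "bsg I S X Y = lst (NG I) (%g. \<forall>g'<NG I. \<exists>i'<nn I. \<forall>i<nn I. pv I S X Y g' i' <= pv I S X Y g i)"
definition "res I S X Y j = alg3.own I (gT I (bsg I S X Y)) S X Y j"

lemma comp_gT: "base k R I ==> comp k R I rdn g ==> comp k R I rdr (%x. gT (I x) (g x))" unfolding gT_def
 by (assumption | rule cmp50 | (rule cmp_mono, assumption) | linarith)+
lemmas cmp51 = comp_gT cmp50

lemma comp_pv: "base k R I ==> comp k R I rda S ==> comp k R I rda X ==> comp k R I rda Y ==> comp k R I rdn g ==> comp k R I rdn i ==> comp k R I rdr (%x. pv (I x) (S x) (X x) (Y x) (g x) (i x))" unfolding pv_def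
 by (assumption | rule cmp51 | (rule cmp_mono, assumption) | linarith)+
lemmas cmp52 = comp_pv cmp51

lemma comp_bsg: "base k R I ==> comp k R I rda S ==> comp k R I rda X ==> comp k R I rda Y ==> comp k R I rdn (%x. bsg (I x) (S x) (X x) (Y x))" unfolding bsg_def NG_def
 by (assumption | rule cmp52 | (rule cmp_mono, assumption) | linarith)+
lemmas cmp53 = comp_bsg cmp52

lemma comp_res: "base k R I ==> comp k R I rda S ==> comp k R I rda X ==> comp k R I rda Y ==> comp k R I rdn j ==> comp k R I rdn (%x. res (I x) (S x) (X x) (Y x) (j x))" unfolding res_def
 by (assumption | rule cmp53 | (rule cmp_mono, assumption) | linarith)+

section \<open>Random bits\<close>

primrec bindn :: "nat => (nat => 'v => 'v pmf) => nat => 'v => 'v pmf" where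
 "bindn 0 K i u = return_pmf u"
| "bindn (Suc d) K i u = bind_pmf (K i u) (bindn d K (Suc i))"

lemma outs_Flip: "outs f m (Flip x e) s (Suc 0) (map_pmf (%b. put_nat x (aval e s) (of_bool b) s) (bernoulli_pmf (1/2)))"
proof -
 have "run f m 0 = return_pmf" by (rule ext) simp
 then show ?thesis by (simp add: outs_def map_pmf_comp bind_return_pmf')
qed

text \<open>The view \<open>v\<close> of the store evolves as a Markov chain with kernels
  \<open>K\<close>, although the store itself also contains counters and scratch values;
  \<open>P\<close> collects what holds with certainty.\<close>

lemma outs_For:
 assumes inv: "!!i s. P i s ==> nats s x 0 = i & nats s y 0 = N"
  and body: "!!i s. i < N ==> P i s ==> \<exists>D. outs f m c s t D &
   (\<forall>s'\<in>set_pmf D. nats s' x 0 = i & P (Suc i) (put_nat x 0 (Suc i) s')) &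
   map_pmf (%s'. v (put_nat x 0 (Suc i) s')) D = K i (v s)"
 shows "i + d = N ==> P i s ==> \<exists>D. outs f m (For x y c) s (Suc (d * (t + 4))) D & (\<forall>s'\<in>set_pmf D. P N s') &
   map_pmf v D = bindn d K i (v s)"
proof (induction d arbitrary: i s)
 case 0
 then have "~ bval (Less (Get x (Num 0)) (Get y (Num 0))) s" using inv[OF 0(2)] by simp
 then have "outs f m (For x y c) s (Suc 0) (return_pmf s)" unfolding For_def using exec_Loop_False by (simp add: exec_def)
 then show ?case using 0 by (intro exI[of _ "return_pmf s"]) simp
next
 case (Suc d)
 let ?inc = "Assign x (Num 0) (Add (Get x (Num 0)) (Num 1))"
 have iN: "i < N" using Suc by simp
 obtain D where D: "outs f m c s t D" "!!s'. s' \<in> set_pmf D ==> nats s' x 0 = i & P (Suc i) (put_nat x 0 (Suc i) s')"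
  "map_pmf (%s'. v (put_nat x 0 (Suc i) s')) D = K i (v s)" using body[OF iN Suc.prems(2)] by blast
 have inc: "outs f m ?inc s' (Suc 0) (return_pmf (put_nat x 0 (Suc i) s'))" if "s' \<in> set_pmf D" for s'
  using exec_Assign[of f m x "Num 0" "Add (Get x (Num 0)) (Num 1)" s'] D(2)[OF that] by (simp add: exec_def)
 define D1 where "D1 = map_pmf (put_nat x 0 (Suc i)) D"
 have "outs f m (Seq c ?inc) s (Suc (t + Suc 0)) (bind_pmf D (%s'. return_pmf (put_nat x 0 (Suc i) s')))"
  by (rule outs_Seq[OF D(1) inc])
 then have o1: "outs f m (Seq c ?inc) s (Suc (t + Suc 0)) D1" by (simp add: D1_def map_pmf_def)
 have "\<forall>s'\<in>set_pmf D1. \<exists>E. outs f m (For x y c) s' (Suc (d * (t + 4))) E & (\<forall>s''\<in>set_pmf E. P N s'') & map_pmf v E = bindn d K (Suc i) (v s')"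
 proof
  fix s' assume "s' \<in> set_pmf D1"
  then have "P (Suc i) s'" using D(2) by (auto simp: D1_def)
  then show "\<exists>E. outs f m (For x y c) s' (Suc (d * (t + 4))) E & (\<forall>s''\<in>set_pmf E. P N s'') & map_pmf v E = bindn d K (Suc i) (v s')"
   using Suc.IH[of "Suc i" s'] Suc.prems by simp
 qed
 then obtain E where E: "!!s'. s' \<in> set_pmf D1 ==> outs f m (For x y c) s' (Suc (d * (t + 4))) (E s') & (\<forall>s''\<in>set_pmf (E s'). P N s'') & map_pmf v (E s') = bindn d K (Suc i) (v s')"
  by metis
 have "outs f m (Seq (Seq c ?inc) (For x y c)) s (Suc (Suc (t + Suc 0) + Suc (d * (t + 4)))) (bind_pmf D1 E)"
  by (rule outs_Seq[OF o1]) (use E in blast)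
 then have "outs f m (For x y c) s (Suc (Suc (Suc (t + Suc 0) + Suc (d * (t + 4))))) (bind_pmf D1 E)"
  unfolding For_def using inv[OF Suc.prems(2)] iN by (intro outs_Loop_True) auto
 moreover have "Suc (Suc (Suc (t + Suc 0) + Suc (d * (t + 4)))) = Suc (Suc d * (t + 4))" by simp
 ultimately have "outs f m (For x y c) s (Suc (Suc d * (t + 4))) (bind_pmf D1 E)" by (simp only:)
 moreover have "\<forall>s'\<in>set_pmf (bind_pmf D1 E). P N s'" using E by (auto simp: set_bind_pmf)
 moreover have "map_pmf v (bind_pmf D1 E) = bindn (Suc d) K i (v s)"
 proof -
  have "map_pmf v (bind_pmf D1 E) = bind_pmf D1 (%s'. map_pmf v (E s'))" by (simp add: map_bind_pmf)
  also have "... = bind_pmf D1 (%s'. bindn d K (Suc i) (v s'))" by (rule bind_pmf_cong) (use E in auto)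
  also have "... = bind_pmf (map_pmf v D1) (bindn d K (Suc i))" by (simp add: bind_map_pmf)
  also have "map_pmf v D1 = K i (v s)" using D(3) by (simp add: D1_def map_pmf_comp)
  finally show ?thesis by simp
 qed
 ultimately show ?case by blast
qed

text \<open>Appending a fair bit at the low end maps a uniform number of \<open>d\<close> bits to
  one of \<open>d + 1\<close> bits. The generalised start value \<open>u\<close> occupies the high
  bits.\<close>

lemma bindn_bits:
 "bindn d (%_ u. map_pmf (%z. 2 * u + of_bool z) (bernoulli_pmf (1/2))) i u = map_pmf (%w. u * 2 ^ d + w) (pmf_of_set {..<(2::nat) ^ d})"
proof (induction d arbitrary: i u)
 case 0
 have "{..<Suc 0} = {0::nat}" by auto
 then show ?case by (simp add: pmf_of_set_singleton)
next
 case (Suc d)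
 let ?B = "pmf_of_set (UNIV :: bool set)" and ?U = "pmf_of_set {..<(2::nat) ^ d}"
 let ?h = "%(z, w). of_bool z * 2 ^ d + w :: nat"
 have ne: "{..<(2::nat) ^ d} ~= {}" by (metis lessThan_iff empty_iff zero_less_numeral zero_less_power)
 have bern: "bernoulli_pmf (1/2) = ?B" by (rule bernoulli_pmf_half_conv_pmf_of_set)
 have "bij_betw ?h (UNIV \<times> {..<2 ^ d}) {..<2 ^ Suc d}"
  unfolding bij_betw_def
 proof
  show "inj_on ?h (UNIV \<times> {..<2 ^ d})" by (auto simp: inj_on_def of_bool_def split: if_splits)
  show "?h ` (UNIV \<times> {..<2 ^ d}) = {..<2 ^ Suc d}"
  proof (intro equalityI subsetI)
   fix k assume "k \<in> {..<(2::nat) ^ Suc d}"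
   then have "k = ?h (2 ^ d <= k, if 2 ^ d <= k then k - 2 ^ d else k)" "(2 ^ d <= k, if 2 ^ d <= k then k - 2 ^ d else k) \<in> UNIV \<times> {..<2 ^ d}"
    by auto
   then show "k \<in> ?h ` (UNIV \<times> {..<2 ^ d})" by (rule image_eqI)
  qed (auto simp: of_bool_def)
 qed
 then have "map_pmf ?h (pmf_of_set (UNIV \<times> {..<2 ^ d})) = pmf_of_set {..<2 ^ Suc d}"
  using map_pmf_of_set_bij_betw[of ?h "UNIV \<times> {..<2 ^ d}" "{..<2 ^ Suc d}"] ne by simp
 moreover have "pmf_of_set (UNIV \<times> {..<2 ^ d}) = pair_pmf ?B ?U" 
 proof (rule pmf_eqI)
  fix x :: "bool \<times> nat"
  obtain z w where "x = (z, w)" by force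
  then show "pmf (pmf_of_set (UNIV \<times> {..<2 ^ d})) x = pmf (pair_pmf ?B ?U) x"
   using ne by (simp add: pmf_pair pmf_of_set indicator_def card_cartesian_product)
 qed
 ultimately have un: "pmf_of_set {..<2 ^ Suc d} = map_pmf ?h (pair_pmf ?B ?U)" by simp
 have "bindn (Suc d) (%_ u. map_pmf (%z. 2 * u + of_bool z) (bernoulli_pmf (1/2))) i u =
   bind_pmf ?B (%z. map_pmf (%w. (2 * u + of_bool z) * 2 ^ d + w) ?U)"
  unfolding bindn.simps Suc.IH unfolding bind_map_pmf bern by (rule refl)
 also have "... = map_pmf (%w. u * 2 ^ Suc d + w) (map_pmf ?h (pair_pmf ?B ?U))"
  by (simp add: pair_pmf_def map_pmf_def bind_assoc_pmf bind_return_pmf algebra_simps)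
 finally show ?case unfolding un .
qed

lemma bindn_Pi:
 "bindn d (%k g. map_pmf (%u. g(k := u)) U) i g =
  map_pmf (%h j. if i <= j & j < i + d then h j else g j) (Pi_pmf {i..<i + d} 0 (%_. U))"
proof (induction d arbitrary: i g)
 case 0
 then show ?case by (auto simp: fun_eq_iff)
next
 case (Suc d)
 have s: "{i..<i + Suc d} = insert i {Suc i..<Suc i + d}" by auto
 have "Pi_pmf {i..<i + Suc d} 0 (%_. U) = map_pmf (%(y, f). f(i := y)) (pair_pmf U (Pi_pmf {Suc i..<Suc i + d} 0 (%_. U)))"
  unfolding s by (rule Pi_pmf_insert) auto
 then have "map_pmf (%h j. if i <= j & j < i + Suc d then h j else g j) (Pi_pmf {i..<i + Suc d} 0 (%_. U)) =
   bind_pmf U (%u. map_pmf (%h j. if i <= j & j < i + Suc d then (h(i := u)) j else g j) (Pi_pmf {Suc i..<Suc i + d} 0 (%_. U)))"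
  by (simp add: pair_pmf_def map_pmf_def bind_assoc_pmf bind_return_pmf)
 also have "... = bind_pmf U (%u. map_pmf (%h j. if Suc i <= j & j < Suc i + d then h j else (g(i := u)) j) (Pi_pmf {Suc i..<Suc i + d} 0 (%_. U)))"
  by (intro bind_pmf_cong refl map_pmf_cong ext) auto
 also have "... = bindn (Suc d) (%k g. map_pmf (%u. g(k := u)) U) i g"
  by (simp add: Suc.IH bind_map_pmf del: fun_upd_apply)
 finally show ?case by (rule sym)
qed

text \<open>One parameter serves as the number of random words and as their length, since both only
  have to be large enough.\<close>

definition Dr :: "nat => (nat => nat) pmf" where "Dr N = Pi_pmf {..<N} 0 (%_. pmf_of_set {..<2 ^ N})"

lemma bindn_Dr: "bindn N (%k g. map_pmf (%u. g(k := u)) (pmf_of_set {..<2 ^ N})) 0 (%_. 0) = Dr N"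
proof -
 have "map_pmf (%h j. if 0 <= j & j < 0 + N then h j else 0) (Dr N) = map_pmf (%h. h) (Dr N)"
 proof (rule map_pmf_cong[OF refl])
  fix h assume "h \<in> set_pmf (Dr N)"
  then have "\<forall>j. j \<notin> {..<N} --> h j = 0" using set_Pi_pmf_subset[of "{..<N}" 0 "%_. pmf_of_set {..<2 ^ N}"] unfolding Dr_def by auto
  then show "(%j. if 0 <= j & j < 0 + N then h j else 0) = h" by auto
 qed
 then show ?thesis unfolding bindn_Pi by (simp add: Dr_def lessThan_atLeast0)
qed

text \<open>Array 7 holds the index of the word, array 8 that of the bit and array 9 the bit; array
  6 holds the common bound. Words start at cell 1 of \<open>y\<close>, because cell 0 holds the
  length expected by \<open>rda\<close>.\<close>

definition flipbody :: "nat => com" where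
 "flipbody y = Seq (Flip 9 (Num 0)) (Assign y (Add (Get 7 (Num 0)) (Num 1))
   (Add (Add (Get y (Add (Get 7 (Num 0)) (Num 1))) (Get y (Add (Get 7 (Num 0)) (Num 1)))) (Get 9 (Num 0))))"

definition fillprog :: "nat => com" where
 "fillprog y = Seq (Assign y (Num 0) (Get 6 (Num 0))) (Seq (Assign 7 (Num 0) (Num 0))
   (For 7 6 (Seq (Assign 8 (Num 0) (Num 0)) (For 8 6 (flipbody y)))))"

lemma outs_inner:
 assumes y: "y < 6" and s: "nats s 8 0 = 0" "nats s 6 0 = N" "nats s 7 0 = k" "nats s y (Suc k) = 0"
 shows "\<exists>D. outs f m (For 8 6 (flipbody y)) s (Suc (N * 7)) D & (\<forall>s'\<in>set_pmf D. (\<forall>x. x ~= y & x ~= 8 & x ~= 9 --> nats s' x = nats s x) &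
   (\<forall>j. j ~= Suc k --> nats s' y j = nats s y j) & reals s' = reals s) & map_pmf (%s'. nats s' y (Suc k)) D = pmf_of_set {..<2 ^ N}"
proof -
 define P where "P b s' \<longleftrightarrow> nats s' 8 0 = b & (\<forall>x. x ~= y & x ~= 8 & x ~= 9 --> nats s' x = nats s x) &
   (\<forall>j. j ~= Suc k --> nats s' y j = nats s y j) & reals s' = reals s" for b and s' :: store
 let ?K = "%(_::nat) u. map_pmf (%z. 2 * u + of_bool z) (bernoulli_pmf (1/2)) :: nat pmf"
 have "\<exists>D. outs f m (For 8 6 (flipbody y)) s (Suc (N * (3 + 4))) D & (\<forall>s'\<in>set_pmf D. P N s') &
   map_pmf (%s'. nats s' y (Suc k)) D = bindn N ?K 0 (nats s y (Suc k))"
 proof (rule outs_For[where P = P])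
  show "P i s' ==> nats s' 8 0 = i & nats s' 6 0 = N" for i s' using y s by (auto simp: P_def)
  show "0 + N = N" by simp
  show "P 0 s" using s by (simp add: P_def)
  fix i s' assume P: "P i s'"
  have k7: "nats s' 7 0 = k" using P y s by (auto simp: P_def)
  define D where "D = map_pmf (%z. put_nat y (Suc k) (nats s' y (Suc k) + nats s' y (Suc k) + of_bool z) (put_nat 9 0 (of_bool z) s')) (bernoulli_pmf (1/2))"
  have "outs f m (flipbody y) s' (Suc (Suc 0 + Suc 0)) (bind_pmf (map_pmf (%b. put_nat 9 (aval (Num 0) s') (of_bool b) s') (bernoulli_pmf (1/2)))
    (%s''. return_pmf (put_nat y (Suc k) (nats s'' y (Suc k) + nats s'' y (Suc k) + nats s'' 9 0) s'')))"
   unfolding flipbody_def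
  proof (rule outs_Seq[OF outs_Flip])
   fix s'' assume "s'' \<in> set_pmf (map_pmf (%b. put_nat 9 (aval (Num 0) s') (of_bool b) s') (bernoulli_pmf (1/2)))"
   then have "nats s'' 7 0 = k" using k7 by auto
   then show "outs f m (Assign y (Add (Get 7 (Num 0)) (Num 1)) (Add (Add (Get y (Add (Get 7 (Num 0)) (Num 1))) (Get y (Add (Get 7 (Num 0)) (Num 1)))) (Get 9 (Num 0)))) s'' (Suc 0)
     (return_pmf (put_nat y (Suc k) (nats s'' y (Suc k) + nats s'' y (Suc k) + nats s'' 9 0) s''))"
    using exec_Assign[of f m y "Add (Get 7 (Num 0)) (Num 1)" "Add (Add (Get y (Add (Get 7 (Num 0)) (Num 1))) (Get y (Add (Get 7 (Num 0)) (Num 1)))) (Get 9 (Num 0))" s'']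
    by (simp add: exec_def)
  qed
  moreover have "bind_pmf (map_pmf (%b. put_nat 9 (aval (Num 0) s') (of_bool b) s') (bernoulli_pmf (1/2)))
    (%s''. return_pmf (put_nat y (Suc k) (nats s'' y (Suc k) + nats s'' y (Suc k) + nats s'' 9 0) s'')) = D"
   unfolding D_def bind_map_pmf using y by (simp add: map_pmf_def)
  ultimately have "outs f m (flipbody y) s' 3 D" by (simp add: eval_nat_numeral)
  moreover have "\<forall>s''\<in>set_pmf D. nats s'' 8 0 = i & P (Suc i) (put_nat 8 0 (Suc i) s'')"
   using P y by (auto simp: D_def P_def)
  moreover have "map_pmf (%s''. nats (put_nat 8 0 (Suc i) s'') y (Suc k)) D = ?K i (nats s' y (Suc k))"
   unfolding D_def using y by (simp add: map_pmf_comp mult_2)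
  ultimately show "\<exists>D. outs f m (flipbody y) s' 3 D & (\<forall>s''\<in>set_pmf D. nats s'' 8 0 = i & P (Suc i) (put_nat 8 0 (Suc i) s'')) &
    map_pmf (%s''. nats (put_nat 8 0 (Suc i) s'') y (Suc k)) D = ?K i (nats s' y (Suc k))" by blast
 qed
 then obtain D where D: "outs f m (For 8 6 (flipbody y)) s (Suc (N * (3 + 4))) D" "\<forall>s'\<in>set_pmf D. P N s'"
  "map_pmf (%s'. nats s' y (Suc k)) D = bindn N ?K 0 (nats s y (Suc k))" by blast
 have "map_pmf (%w. 0 * 2 ^ N + w) (pmf_of_set {..<(2::nat) ^ N}) = pmf_of_set {..<2 ^ N}" by (simp add: map_pmf_idI)
 then have "map_pmf (%s'. nats s' y (Suc k)) D = pmf_of_set {..<2 ^ N}" using D(3) unfolding bindn_bits s(4) by (simp only:)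
 then show ?thesis using D(1,2) by (intro exI[of _ D]) (auto simp: P_def)
qed

lemma outs_fill:
 assumes y: "y < 6" and s: "nats s 6 0 = N" "!!j. nats s y (Suc j) = 0"
 shows "\<exists>D. outs f m (fillprog y) s (N * (N * 7 + 7) + 10) D & (\<forall>s'\<in>set_pmf D. (\<forall>x. x ~= y & x < 7 --> nats s' x = nats s x) &
   reals s' = reals s) & map_pmf (rda y) D = Dr N"
proof -
 define P where "P k s' \<longleftrightarrow> nats s' 7 0 = k & (\<forall>x. x ~= y & x < 7 --> nats s' x = nats s x) & nats s' y 0 = N &
   (\<forall>j\<ge>k. nats s' y (Suc j) = 0) & reals s' = reals s" for k and s' :: store
 define v where "v s' j = nats s' y (Suc j)" for s' :: store and j
 let ?U = "pmf_of_set {..<(2::nat) ^ N}"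
 let ?K = "%k g. map_pmf (%u. g(k := u)) ?U"
 define s1 where "s1 = put_nat 7 0 0 (put_nat y 0 N s)"
 have "\<exists>D. outs f m (For 7 6 (Seq (Assign 8 (Num 0) (Num 0)) (For 8 6 (flipbody y)))) s1 (Suc (N * ((N * 7 + 3) + 4))) D & (\<forall>s'\<in>set_pmf D. P N s') &
   map_pmf v D = bindn N ?K 0 (v s1)"
 proof (rule outs_For[where P = P])
  show "P i s' ==> nats s' 7 0 = i & nats s' 6 0 = N" for i s' using y s by (auto simp: P_def)
  show "0 + N = N" by simp
  show "P 0 s1" using s y by (auto simp: P_def s1_def)
  fix k s' assume P: "P k s'" and kN: "k < N"
  define s2 where "s2 = put_nat 8 0 0 s'"
  have o1: "outs f m (Assign 8 (Num 0) (Num 0)) s' (Suc 0) (return_pmf s2)"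
   using exec_Assign[of f m 8 "Num 0" "Num 0" s'] by (simp add: exec_def s2_def)
  have pre: "nats s2 8 0 = 0" "nats s2 6 0 = N" "nats s2 7 0 = k" "nats s2 y (Suc k) = 0"
   using P y s by (auto simp: P_def s2_def)
  obtain D where D: "outs f m (For 8 6 (flipbody y)) s2 (Suc (N * 7)) D"
   "!!s''. s'' \<in> set_pmf D ==> (\<forall>x. x ~= y & x ~= 8 & x ~= 9 --> nats s'' x = nats s2 x) & (\<forall>j. j ~= Suc k --> nats s'' y j = nats s2 y j) & reals s'' = reals s2"
   "map_pmf (%s'. nats s' y (Suc k)) D = ?U" using outs_inner[OF y pre, of f m] by blast
  have "outs f m (Seq (Assign 8 (Num 0) (Num 0)) (For 8 6 (flipbody y))) s' (Suc (Suc 0 + Suc (N * 7))) (bind_pmf (return_pmf s2) (%_. D))"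
   by (rule outs_Seq[OF o1]) (use D(1) in auto)
  then have 1: "outs f m (Seq (Assign 8 (Num 0) (Num 0)) (For 8 6 (flipbody y))) s' (N * 7 + 3) D"
   by (simp add: bind_return_pmf eval_nat_numeral)
  have 2: "\<forall>s''\<in>set_pmf D. nats s'' 7 0 = k & P (Suc k) (put_nat 7 0 (Suc k) s'')"
  proof
   fix s'' assume "s'' \<in> set_pmf D"
   note d = D(2)[OF this]
   have e: "nats s'' x = nats s' x" if "x ~= y" "x ~= 8" "x ~= 9" for x using d that by (auto simp: s2_def)
   have e2: "nats s'' y j = nats s' y j" if "j ~= Suc k" for j using d that y by (auto simp: s2_def)
   have e3: "reals s'' = reals s'" using d by (simp add: s2_def)
   show "nats s'' 7 0 = k & P (Suc k) (put_nat 7 0 (Suc k) s'')"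
    using P y e e2 e3 by (auto simp: P_def)
  qed
  have "map_pmf (%s''. v (put_nat 7 0 (Suc k) s'')) D = map_pmf (%s''. (v s')(k := nats s'' y (Suc k))) D"
  proof (rule map_pmf_cong[OF refl], rule ext)
   fix s'' j assume "s'' \<in> set_pmf D"
   note d = D(2)[OF this]
   have e2: "nats s'' y j = nats s' y j" if "j ~= Suc k" for j using d that y by (auto simp: s2_def)
   show "v (put_nat 7 0 (Suc k) s'') j = ((v s')(k := nats s'' y (Suc k))) j"
    using y e2[of "Suc j"] by (auto simp: v_def)
  qed
  also have "... = map_pmf (%u. (v s')(k := u)) (map_pmf (%s'. nats s' y (Suc k)) D)" by (simp add: map_pmf_comp)
  finally have 3: "map_pmf (%s''. v (put_nat 7 0 (Suc k) s'')) D = ?K k (v s')" by (simp only: D(3))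
  show "\<exists>D. outs f m (Seq (Assign 8 (Num 0) (Num 0)) (For 8 6 (flipbody y))) s' (N * 7 + 3) D &
    (\<forall>s''\<in>set_pmf D. nats s'' 7 0 = k & P (Suc k) (put_nat 7 0 (Suc k) s'')) & map_pmf (%s''. v (put_nat 7 0 (Suc k) s'')) D = ?K k (v s')"
   using 1 2 3 by blast
 qed
 then obtain D where D: "outs f m (For 7 6 (Seq (Assign 8 (Num 0) (Num 0)) (For 8 6 (flipbody y)))) s1 (Suc (N * ((N * 7 + 3) + 4))) D"
  "!!s'. s' \<in> set_pmf D ==> P N s'" "map_pmf v D = bindn N ?K 0 (v s1)" by blast
 have v0: "v s1 = (%_. 0)" using s(2) y by (auto simp: v_def s1_def)
 have e1: "exec f m (Assign y (Num 0) (Get 6 (Num 0))) s (Suc 0) (put_nat y 0 N s)"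
  using exec_Assign[of f m y "Num 0" "Get 6 (Num 0)" s] s by simp
 have e2: "exec f m (Assign 7 (Num 0) (Num 0)) (put_nat y 0 N s) (Suc 0) s1"
  using exec_Assign[of f m 7 "Num 0" "Num 0" "put_nat y 0 N s"] by (simp add: s1_def)
 have "outs f m (Seq (Assign 7 (Num 0) (Num 0)) (For 7 6 (Seq (Assign 8 (Num 0) (Num 0)) (For 8 6 (flipbody y))))) (put_nat y 0 N s)
   (Suc (Suc 0 + Suc (N * ((N * 7 + 3) + 4)))) (bind_pmf (return_pmf s1) (%_. D))"
  by (rule outs_Seq[OF e2[unfolded exec_def]]) (use D(1) in auto)
 then have "outs f m (Seq (Assign 7 (Num 0) (Num 0)) (For 7 6 (Seq (Assign 8 (Num 0) (Num 0)) (For 8 6 (flipbody y))))) (put_nat y 0 N s)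
   (Suc (Suc 0 + Suc (N * ((N * 7 + 3) + 4)))) D" by (simp add: bind_return_pmf)
 then have "outs f m (fillprog y) s (Suc (Suc 0 + Suc (Suc 0 + Suc (N * ((N * 7 + 3) + 4))))) (bind_pmf (return_pmf (put_nat y 0 N s)) (%_. D))"
  unfolding fillprog_def by (intro outs_Seq[OF e1[unfolded exec_def]]) auto
 then have "outs f m (fillprog y) s (Suc (Suc 0 + Suc (Suc 0 + Suc (N * ((N * 7 + 3) + 4))))) D" by (simp only: bind_return_pmf)
 then have "outs f m (fillprog y) s (N * (N * 7 + 7) + 10) D" by (rule outs_mono) (simp add: algebra_simps)
 moreover have "map_pmf (rda y) D = map_pmf v D"
 proof (rule map_pmf_cong[OF refl], rule ext)
  fix s' j assume "s' \<in> set_pmf D"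
  then show "rda y s' j = v s' j" using D(2) by (auto simp: P_def rda_def v_def)
 qed
 ultimately show ?thesis using D(2,3) v0 bindn_Dr by (intro exI[of _ D]) (auto simp: P_def)
qed

section \<open>Success probability\<close>

text \<open>The bound \<open>q - p\<close> is weaker than \<open>q * (1 - p)\<close>, but it lets
  the stages of a random process simply subtract their failure probabilities.\<close>

lemma prob_bind_ge:
 assumes K: "!!x. x \<in> set_pmf M ==> G x ==> q <= mprob (K x) A" and q: "0 <= q" "q <= 1"
  and M: "mprob M {x. ~ G x} <= p"
 shows "q - p <= mprob (bind_pmf M K) A"
proof -
 have "ennreal (q * mprob M {x. G x}) = ennreal q * emeasure (measure_pmf M) {x. G x}"
  using q by (simp add: measure_pmf.emeasure_eq_measure ennreal_mult)
 also have "... = (\<integral>\<^sup>+x. ennreal q * indicator {x. G x} x \<partial>measure_pmf M)" by (simp add: nn_integral_cmult_indicator)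
 also have "... <= (\<integral>\<^sup>+x. emeasure (measure_pmf (K x)) A \<partial>measure_pmf M)"
  by (intro nn_integral_mono_AE) (auto simp: AE_measure_pmf_iff measure_pmf.emeasure_eq_measure indicator_def intro!: ennreal_leI K)
 also have "... = emeasure (measure_pmf (bind_pmf M K)) A" by (simp add: emeasure_bind_pmf)
 also have "... = ennreal (mprob (bind_pmf M K) A)" by (simp add: measure_pmf.emeasure_eq_measure)
 finally have 1: "q * mprob M {x. G x} <= mprob (bind_pmf M K) A" by simp
 have "mprob M {x. ~ G x} = 1 - mprob M {x. G x}"
  using measure_pmf.prob_compl[of "{x. G x}" M] by (simp add: Collect_neg_eq Compl_eq_Diff_UNIV)
 then have "1 - p <= mprob M {x. G x}" using M by simp
 then have "q * (1 - p) <= q * mprob M {x. G x}" using q by (intro mult_left_mono)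
 moreover have "0 <= p" using M measure_nonneg order_trans by blast
 then have "q * p <= p" using q by (simp add: mult_left_le_one_le)
 then have "q - p <= q * (1 - p)" by (simp add: right_diff_distrib)
 ultimately show ?thesis using 1 by linarith
qed

definition Dr3 :: "nat => ((nat => nat) \<times> (nat => nat) \<times> (nat => nat)) pmf" where
 "Dr3 N = bind_pmf (Dr N) (%S. bind_pmf (Dr N) (%X. bind_pmf (Dr N) (%Y. return_pmf (S, X, Y))))"

context alg_ok
begin

lemma prob_alg_fin:
 assumes N: "n * be <= N" "bb <= N" "2 * lgn (n + m) - 1 <= N"
 shows "94 / 100 <= mprob (Dr3 N) {(S, X, Y). alg_fin I T S X Y}"
proof -
 let ?V = "{c. inV c}" and ?A = "{..<N}"
 have idx: "c * be + r \<in> ?A" if "inV c" "r < be" for c r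
 proof -
  have "c < n" using that by (simp add: inV_def)
  then have "c * be + r < n * be" using that(2) by (rule pair_lt)
  then show ?thesis using N by simp
 qed
 have idx2: "t * n + c \<in> ?A" if "t < be" "inV c" for t c
 proof -
  have "c < n" using that by (simp add: inV_def)
  then have "t * n + c < be * n" using that(1) by (intro pair_lt)
  then show ?thesis using N by (simp add: mult.commute)
 qed
 have VA: "?V \<subseteq> ?A"
 proof
  fix c assume "c \<in> ?V"
  then have "c * be + 0 \<in> ?A" using idx[of c 0] be(1) by auto
  moreover have "c <= c * be" using be(1) by simp
  ultimately show "c \<in> ?A" using le_less_trans[of c "c * be" N] by auto
 qed
 have rs: "rsample ?V be n LL (2 * lgn (n + m) - 1) aL ?A N" by (rule rsampleI) (use idx N in auto)
 have ar: "alg_run I T" by unfold_locales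
 have rd: "rdraw ?V be bb n (real KK) (alg_run.aS I T S) ?A N" if "rsample.sample_ok ?V be LL aL S" for S
  by (rule alg_run.rdrawI[OF ar rs that]) (use VA N in auto)
 have step3: "99 / 100 <= mprob (bind_pmf (Dr N) (%Y. return_pmf (S, X, Y))) {(S, X, Y). alg_fin I T S X Y}"
  if S: "rsample.sample_ok ?V be LL aL S" and X: "rdraw.phase1_ok ?V be (real KK) (alg_run.aS I T S) X" for S X
 proof -
  have "1 - 1 / 100 <= mprob (bind_pmf (Dr N) (%Y. return_pmf (S, X, Y))) {(S, X, Y). alg_fin I T S X Y}"
  proof (rule prob_bind_ge[where G = "%Y. rdraw.tries_ok ?V be n (real KK) (alg_run.aS I T S) X Y"])
   fix Y assume Y: "rdraw.tries_ok ?V be n (real KK) (alg_run.aS I T S) X Y"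
   have "alg_fin I T S X Y"
    by unfold_locales (rule alg_run.load_ok[OF ar rd[OF S] X Y])
   then show "1 <= mprob (return_pmf (S, X, Y)) {(S, X, Y). alg_fin I T S X Y}" by simp
  next
   show "mprob (Dr N) {Y. ~ rdraw.tries_ok ?V be n (real KK) (alg_run.aS I T S) X Y} <= 1 / 100"
    unfolding Dr_def by (rule rdraw.prob_tries_ok[OF rd[OF S] X VV(3)]) (use idx2 in auto)
  qed auto
  then show ?thesis by simp
 qed
 have step2: "96 / 100 <= mprob (bind_pmf (Dr N) (%X. bind_pmf (Dr N) (%Y. return_pmf (S, X, Y)))) {(S, X, Y). alg_fin I T S X Y}"
  if S: "rsample.sample_ok ?V be LL aL S" for S
 proof -
  have "99 / 100 - 3 / 100 <= mprob (bind_pmf (Dr N) (%X. bind_pmf (Dr N) (%Y. return_pmf (S, X, Y)))) {(S, X, Y). alg_fin I T S X Y}"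
  proof (rule prob_bind_ge[where G = "%X. rdraw.phase1_ok ?V be (real KK) (alg_run.aS I T S) X"])
   show "mprob (Dr N) {X. ~ rdraw.phase1_ok ?V be (real KK) (alg_run.aS I T S) X} <= 3 / 100"
    unfolding Dr_def by (rule rdraw.prob_phase1[OF rd[OF S]])
  qed (use step3[OF S] in auto)
  then show ?thesis by simp
 qed
 have "96 / 100 - 2 / 100 <= mprob (Dr3 N) {(S, X, Y). alg_fin I T S X Y}"
  unfolding Dr3_def
 proof (rule prob_bind_ge[where G = "%S. rsample.sample_ok ?V be LL aL S"])
  show "mprob (Dr N) {S. ~ rsample.sample_ok ?V be LL aL S} <= 2 / 100"
   unfolding Dr_def by (rule rsample.prob_sample_ok[OF rs])
 qed (use step2 in auto)
 then show ?thesis by simp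
qed

end

text \<open>Let \<open>j\<close> be the most valuable single resource in the bundle of a worst-off
  player of an optimal allocation. Subadditivity places the optimum between the value of
  \<open>j\<close> and \<open>m\<close> times this value, so the largest admissible power of two is
  within a factor 2.\<close>

lemma guess_exists:
 fixes I :: inst
 assumes inst: "santa_instance {..<nn I} {..<mm I} (ff I) (gg I)" and opt: "0 < santa_opt {..<nn I} {..<mm I} (ff I) (gg I)"
 shows "\<exists>g<NG I. 0 < gT I g & gT I g <= santa_opt {..<nn I} {..<mm I} (ff I) (gg I) & santa_opt {..<nn I} {..<mm I} (ff I) (gg I) < 2 * gT I g"
proof -
 let ?O = "santa_opt {..<nn I} {..<mm I} (ff I) (gg I)"
 let ?F = "ff I"
 obtain S where S: "allocation {..<nn I} {..<mm I} S" "santa_value {..<nn I} ?F (gg I) S = ?O" using santa_opt_attained[OF inst] by blast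
 \<comment> \<open>The optimum itself is used as the threshold here, only to make the elementary
   facts about \<open>F\<close> available.\<close>
 interpret alg_ok I ?O by unfold_locales (use inst opt in auto)
 have "?O \<in> (%i. ?F (S i \<inter> gg I i)) ` {..<nn I}"
  unfolding S(2)[symmetric] santa_value_def by (rule Min_in) (use n0 in auto)
 then obtain i where i: "i < nn I" "?O = ?F (S i \<inter> gg I i)" by auto
 let ?D = "S i \<inter> gg I i"
 have D: "?D \<subseteq> {..<mm I}" using gg_sub[OF i(1)] by auto
 then have finD: "finite ?D" by (rule finite_subset) simp
 have "?D ~= {}" using opt i(2) F_empty by auto
 then obtain j where j: "j \<in> ?D" "!!j'. j' \<in> ?D ==> ?F {j'} <= ?F {j}"
 proof -
  have "Max ((%j. ?F {j}) ` ?D) \<in> (%j. ?F {j}) ` ?D" by (rule Max_in) (use finD \<open>?D ~= {}\<close> in auto)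
  then obtain j where j: "j \<in> ?D" "Max ((%j. ?F {j}) ` ?D) = ?F {j}" by auto
  have "?F {j'} <= ?F {j}" if "j' \<in> ?D" for j' unfolding j(2)[symmetric] by (rule Max_ge) (use finD that in auto)
  then show thesis using that j(1) by blast
 qed
 have jm: "j < mm I" using j D by auto
 have up: "?O <= real (mm I) * ?F {j}"
 proof -
  have "?F ({} \<union> ?D) <= ?F {} + (\<Sum>j'\<in>?D. ?F (insert j' {}) - ?F {})" by (rule F_union_le[OF finD D]) simp
  then have "?O <= (\<Sum>j'\<in>?D. ?F {j'})" by (simp add: i(2) F_empty)
  also have "... <= (\<Sum>j'\<in>?D. ?F {j})" by (rule sum_mono) (rule j(2))
  also have "... = real (card ?D) * ?F {j}" by simp
  also have "... <= real (mm I) * ?F {j}"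
   using card_mono[OF _ D] F_nonneg[of "{j}"] jm by (intro mult_right_mono) auto
  finally show ?thesis .
 qed
 have pos: "0 < ?F {j}" using up opt F_nonneg[of "{j}"] jm by (cases "?F {j} = 0") auto
 have low: "?F {j} <= ?O" unfolding i(2) by (rule F_mono) (use j D in auto)
 define k where "k = (GREATEST k. k <= lgn (mm I) & ?F {j} * 2 ^ k <= ?O)"
 have ex: "\<exists>k. k <= lgn (mm I) & ?F {j} * 2 ^ k <= ?O" using low by (intro exI[of _ 0]) simp
 have k: "k <= lgn (mm I)" "?F {j} * 2 ^ k <= ?O"
  using GreatestI_ex_nat[OF ex, of "lgn (mm I)"] unfolding k_def by auto
 have kl: "?O < ?F {j} * 2 ^ lgn (mm I)"
 proof -
  have "real (mm I) < 2 ^ lgn (mm I)" using lgn(1)[of "mm I"] by (metis of_nat_less_iff of_nat_numeral of_nat_power)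
  then have "real (mm I) * ?F {j} < 2 ^ lgn (mm I) * ?F {j}" using pos by (rule mult_strict_right_mono)
  then show ?thesis using up by (simp add: mult.commute)
 qed
 have k2: "?O < 2 * (?F {j} * 2 ^ k)"
 proof (rule ccontr)
  assume "~ ?O < 2 * (?F {j} * 2 ^ k)"
  then have le: "?F {j} * 2 ^ Suc k <= ?O" by simp
  have "k ~= lgn (mm I)" using kl k(2) by auto
  then have "Suc k <= lgn (mm I) & ?F {j} * 2 ^ Suc k <= ?O" using k(1) le by simp
  then have "Suc k <= k" unfolding k_def by (rule Greatest_le_nat[of _ _ "lgn (mm I)"]) auto
  then show False by simp
 qed
 let ?g = "j * (lgn (mm I) + 1) + k"
 have kk: "k < lgn (mm I) + 1" using k(1) by simp
 have g: "?g < NG I" unfolding NG_def by (rule pair_lt[OF jm kk])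
 have "{j'. j' < mm I & j' = j} = {j}" using jm by auto
 then have "gT I ?g = ?F {j} * 2 ^ k" unfolding gT_def idv_pair[OF jm kk] using k(1) by (simp add: min_def)
 then show ?thesis using g pos k(2) k2 by (intro exI[of _ ?g]) auto
qed

lemma own_lt: "0 < nn I ==> alg3.own I T S X Y j < nn I" by (simp add: alg3.own_def)

lemma res_lt: "0 < nn I ==> res I S X Y j < nn I" by (simp add: res_def own_lt)

text \<open>Only the guess \<open>g\<close> is assumed to succeed. The program evaluates the outcome
  of every guess and keeps the best, which is at least as good as that of \<open>g\<close> even if
  it comes from a wrong guess.\<close>

lemma res_value:
 assumes inst: "santa_instance {..<nn I} {..<mm I} (ff I) (gg I)" and g: "g < NG I" and fin: "alg_fin I (gT I g) S X Y"
 shows "gT I g / (16 * real (alg.GG I)) <= santa_value {..<nn I} (ff I) (gg I) (%i. {j. j < mm I & res I S X Y j = i})"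
proof -
 interpret alg_fin I "gT I g" S X Y by (rule fin)
 let ?n = "nn I"
 let ?Q = "%b. \<forall>g'<NG I. \<exists>i'<?n. \<forall>i<?n. pv I S X Y g' i' <= pv I S X Y b i"
 have pv: "pv I S X Y g' i = ff I ({j. j < mm I & alg3.own I (gT I g') S X Y j = i} \<inter> gg I i)" if "i < ?n" for g' i
  unfolding pv_def by (rule arg_cong[where f = "ff I"]) (use that in \<open>auto simp: ing_def\<close>)
 define mv where "mv g' = Min ((%i. pv I S X Y g' i) ` {..<?n})" for g'
 have mv1: "\<exists>i'<?n. pv I S X Y g' i' = mv g'" for g'
 proof -
  have "mv g' \<in> (%i. pv I S X Y g' i) ` {..<?n}" unfolding mv_def by (rule Min_in) (use n0 in auto)
  then show ?thesis by auto
 qed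
 have mv2: "mv g' <= pv I S X Y g' i" if "i < ?n" for g' i unfolding mv_def by (rule Min_le) (use that in auto)
 have "\<exists>b<NG I. \<forall>g'<NG I. mv g' <= mv b"
 proof -
  have "Max (mv ` {..<NG I}) \<in> mv ` {..<NG I}" by (rule Max_in) (use g in auto)
  then obtain b where b: "b < NG I" "Max (mv ` {..<NG I}) = mv b" by auto
  have "mv g' <= mv b" if "g' < NG I" for g' unfolding b(2)[symmetric] by (rule Max_ge) (use that in auto)
  then show ?thesis using b(1) by blast
 qed
 then obtain b where b: "b < NG I" "!!g'. g' < NG I ==> mv g' <= mv b" by blast
 have "\<forall>g'<NG I. \<exists>i'<?n. \<forall>i<?n. pv I S X Y g' i' <= pv I S X Y b i"
 proof (intro allI impI)
  fix g' assume "g' < NG I"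
  then have "mv g' <= mv b" by (rule b(2))
  then have le: "mv g' <= pv I S X Y b i" if "i < ?n" for i using mv2[OF that, of b] by linarith
  obtain i' where i': "i' < ?n" "pv I S X Y g' i' = mv g'" using mv1 by blast
  show "\<exists>i'<?n. \<forall>i<?n. pv I S X Y g' i' <= pv I S X Y b i"
   by (rule exI[of _ i'], simp only: i'(2)) (use le i'(1) in simp)
 qed
 then have Qb: "?Q b" .
 have lt: "lst (NG I) ?Q < NG I" by (rule lst_ex[where P = ?Q, OF b(1) Qb])
 have "?Q (lst (NG I) ?Q)" by (rule lst_less[where P = ?Q, OF lt])
 then have "?Q (bsg I S X Y)" by (simp only: bsg_def)
 then obtain i' where i': "i' < ?n" "!!i. i < ?n ==> pv I S X Y g i' <= pv I S X Y (bsg I S X Y) i"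
  using g by blast
 have "gT I g / (16 * real GG) <= pv I S X Y g i'" unfolding pv[OF i'(1)] by (rule player_value[OF i'(1)])
 then have "gT I g / (16 * real GG) <= ff I ({j. j < mm I & res I S X Y j = i} \<inter> gg I i)" if "i < ?n" for i
  using i'(2)[OF that] unfolding pv[OF that] res_def by linarith
 then show ?thesis unfolding santa_value_def using n0 by (subst Min_ge_iff) auto
qed

text \<open>This is \<open>32 * GG\<close>: the allocation loses \<open>16 * GG\<close> and the
  guess of the optimum a factor 2, with \<open>GG = 48 * KK\<close>.\<close>

definition apx :: "nat => real" where "apx n = 1536 * real (60 + 28 * lgn (lgn n + 64))"

lemma apx_pos: "0 < apx n" by (simp add: apx_def)

lemma value_nonneg:
 assumes inst: "santa_instance {..<nn I} {..<mm I} (ff I) (gg I)"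
 shows "0 <= santa_value {..<nn I} (ff I) (gg I) (%i. {j. j < mm I & res I S X Y j = i})"
proof -
 have "0 < nn I" using inst by (auto simp: santa_instance_def)
 moreover have "0 <= ff I ({j. j < mm I & res I S X Y j = i} \<inter> gg I i)" for i
 proof -
  have "{j. j < mm I & res I S X Y j = i} \<inter> gg I i \<subseteq> {..<mm I}" by auto
  then show ?thesis using inst unfolding santa_instance_def by blast
 qed
 ultimately show ?thesis unfolding santa_value_def by (subst Min_ge_iff) auto
qed

lemma success:
 assumes inst: "santa_instance {..<nn I} {..<mm I} (ff I) (gg I)"
  and N: "nn I * alg.be I <= N" "alg.bb I <= N" "2 * lgn (nn I + mm I) - 1 <= N"
 shows "2 / 3 <= mprob (Dr3 N) {(S, X, Y). santa_opt {..<nn I} {..<mm I} (ff I) (gg I) / apx (nn I) \<le>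
   santa_value {..<nn I} (ff I) (gg I) (%i. {j. j < mm I & res I S X Y j = i})}" (is "_ <= mprob _ ?E")
proof (cases "0 < santa_opt {..<nn I} {..<mm I} (ff I) (gg I)")
 case True
 let ?O = "santa_opt {..<nn I} {..<mm I} (ff I) (gg I)"
 obtain g where g: "g < NG I" "0 < gT I g" "gT I g <= ?O" "?O < 2 * gT I g" using guess_exists[OF inst True] by blast
 interpret alg_ok I "gT I g" by unfold_locales (use inst g in auto)
 have "94 / 100 <= mprob (Dr3 N) {(S, X, Y). alg_fin I (gT I g) S X Y}" by (rule prob_alg_fin) (use N in auto)
 also have "... <= mprob (Dr3 N) ?E"
 proof (rule measure_pmf.finite_measure_mono)
  show "{(S, X, Y). alg_fin I (gT I g) S X Y} \<subseteq> ?E"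
  proof safe
   fix S X Y assume "alg_fin I (gT I g) S X Y"
   note v = res_value[OF inst g(1) this]
   have GG: "0 < real GG" using KK by (simp add: GG_def)
   have "apx (nn I) = 32 * real GG" by (simp add: apx_def GG_def KK_def bb_def)
   then have "?O / apx (nn I) <= (2 * gT I g) / (32 * real GG)" 
    using divide_right_mono[of ?O "2 * gT I g" "32 * real GG"] g(4) GG by simp
   also have "... = gT I g / (16 * real GG)" by simp
   finally show "?O / apx (nn I) <= santa_value {..<nn I} (ff I) (gg I) (%i. {j. j < mm I & res I S X Y j = i})" using v by linarith
  qed
 qed auto
 finally show ?thesis by simp
next
 case False
 \<comment> \<open>Without a positive optimum every outcome qualifies, as values are
   nonnegative.\<close>
 have "?E = UNIV"
 proof -
  have "santa_opt {..<nn I} {..<mm I} (ff I) (gg I) / apx (nn I) <= 0" using False apx_pos[of "nn I"] by (simp add: divide_nonpos_pos)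
  then show ?thesis using value_nonneg[OF inst] order_trans by fastforce
 qed
 then show ?thesis by simp
qed

text \<open>For \<open>ln n >= 10\<close> the number \<open>lgn n + 64\<close> is at most the square
  of \<open>ln n\<close>, so its bit length is bounded by a constant multiple of
  \<open>ln (ln n)\<close> plus a constant, and \<open>ln (ln n) >= 1\<close> absorbs the
  constants.\<close>

lemma apx_bigo: "apx \<in> O(%n. ln (ln (real n)))"
proof (rule bigoI)
 show "\<forall>\<^sub>F n in sequentially. norm (apx n) <= (1536 * 200) * norm (ln (ln (real n)))"
 proof (rule eventually_sequentiallyI[of "nat \<lceil>exp 10\<rceil>"])
  fix n assume n: "nat \<lceil>exp (10::real)\<rceil> <= n"
  define L where "L = ln (real n)"
  have en: "exp 10 <= real n" using n by linarith
  then have n0: "0 < real n" using exp_gt_zero[of "10::real"] by linarith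
  have L: "10 <= L" unfolding L_def using en n0 by (simp add: ln_ge_iff)
  have ln2: "2 / 3 <= ln (2::real)" by (rule ln2_ge_two_thirds)
  have lg: "real (lgn x) * ln 2 <= ln 2 + ln (real x)" if "0 < x" for x
  proof -
   have "real (2 ^ lgn x) <= real (2 * x)" using lgn(2)[OF that] by (simp only: of_nat_le_iff)
   then have "ln (2 ^ lgn x) <= ln (2 * real x)" using that by (subst ln_le_cancel_iff) auto
   then show ?thesis using that by (simp add: ln_realpow ln_mult)
  qed
  have "real (lgn n) * (2 / 3) <= real (lgn n) * ln 2" using ln2 by (intro mult_left_mono) auto
  also have "... <= ln 2 + L" using lg[of n] n0 by (simp add: L_def)
  also have "ln 2 <= (1::real)" using ln_2_less_1 by simp
  finally have "real (lgn n + 64) <= 66 + 3 / 2 * L" by simp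
  also have "... <= L * L"
  proof -
   have "10 * L <= L * L" using L by (intro mult_right_mono) auto
   then show ?thesis using L by linarith
  qed
  finally have x: "real (lgn n + 64) <= L * L" .
  define bb where "bb = lgn (lgn n + 64)"
  have lnL: "1 <= ln L"
  proof -
   have "exp 1 <= L" using exp_le L by linarith
   then show ?thesis using L by (subst ln_ge_iff) auto
  qed
  have "real bb * (2 / 3) <= real bb * ln 2" using ln2 by (intro mult_left_mono) auto
  also have "... <= ln 2 + ln (real (lgn n + 64))" unfolding bb_def by (rule lg) simp
  also have "ln (real (lgn n + 64)) <= ln (L * L)" using x by (subst ln_le_cancel_iff) auto
  also have "ln (L * L) = 2 * ln L" using L by (simp add: ln_mult)
  also have "ln 2 <= (1::real)" using ln_2_less_1 by simp
  finally have "real bb <= 3 / 2 * (1 + 2 * ln L)" by simp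
  then have "real (60 + 28 * bb) <= 200 * ln L" using lnL by simp
  then have "apx n <= 1536 * (200 * ln L)" unfolding apx_def bb_def[symmetric] by (intro mult_left_mono) auto
  then show "norm (apx n) <= (1536 * 200) * norm (ln (ln (real n)))"
   using apx_pos[of n] lnL by (simp add: L_def)
 qed
qed

section \<open>The program\<close>

definition R0 :: "inst => store => bool" where
 "R0 I s \<longleftrightarrow> nats s 0 0 = nn I & nats s 0 1 = mm I &
   nats s 1 = (%k. of_bool (k < nn I * mm I & k mod mm I \<in> gg I (k div mm I)))"

lemma R0_stable: "stable 2 R0" unfolding stable_def agree_def R0_def by auto

lemma base_R0: "base 2 R0 (%I. I)"
 unfolding base_def
proof (intro conjI)
 show n: "comp 2 R0 (%I. I) rdn (%I. nn I)"
  by (rule comp_aexp[OF R0_stable, where e = "Get 0 (Num 0)"]) (simp add: R0_def)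
 show m: "comp 2 R0 (%I. I) rdn (%I. mm I)"
  by (rule comp_aexp[OF R0_stable, where e = "Get 0 (Num 1)"]) (simp add: R0_def)
 have "gar I = tab (nn I * mm I) (%e. of_bool (e < nn I * mm I & e mod mm I \<in> gg I (e div mm I)))" for I :: inst
  by (auto simp: gar_def tab_def fun_eq_iff)
 moreover have "comp 2 R0 (%I. I) rda (%I. tab (nn I * mm I) (%e. of_bool (e < nn I * mm I & e mod mm I \<in> gg I (e div mm I))))"
 proof (rule comp_tab)
  show "comp 2 R0 (%I. I) rdn (%I. nn I * mm I)" by (rule comp_mult2[OF n m pbd_m])
  show "pbd (%I. I) (%I. nn I * mm I)" by (rule pbd_mult[OF pbd_n pbd_m])
  fix r k' :: nat assume k: "2 <= k'" "r < k'"
  show "comp k' (ext r rdn R0) (%p. fst p) rdn (%p. of_bool (snd p < nn (fst p) * mm (fst p) & snd p mod mm (fst p) \<in> gg (fst p) (snd p div mm (fst p))))"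
   by (rule comp_aexp[OF stable_ext[OF R0_stable localrd(1) k], where e = "Get 1 (Get r (Num 0))"])
     (auto simp: ext_def R0_def rdn_def)
 qed
 ultimately show "comp 2 R0 (%I. I) rda (%I. gar I)" by simp
qed

text \<open>A polynomial that dominates the number \<open>n * be\<close> of samples as well as the
  word lengths; \<open>be\<close> is at most linear in \<open>lgn n + 64\<close>, which explains the
  factor 200.\<close>

definition NN :: "inst => nat" where "NN I = 200 * (nn I + mm I + 2) * (nn I + mm I + 2)"

lemma comp_NN: "comp 2 R0 (%I. I) rdn NN"
proof -
 have "comp 2 R0 (%I. I) rdn (%I. 200 * (nn I + mm I + 2) * (nn I + mm I + 2))"
  by (rule base_R0 cmp0)+
 then show ?thesis by (simp add: NN_def[abs_def])
qed

lemma NN_pbd: "pbd (%I. I) NN"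
proof -
 have "pbd (%I. I) (%I. 200 * (nn I + mm I + 2) * (nn I + mm I + 2))" by (rule pbds)+
 then show ?thesis by (simp add: NN_def[abs_def])
qed

lemma NN_bounds: "nn I * alg.be I <= NN I" "alg.bb I <= NN I" "2 * lgn (nn I + mm I) - 1 <= NN I"
proof -
 have lg: "lgn x <= x" for x unfolding lgn_def by (rule sum_of_bool_le)
 let ?z = "nn I + mm I + 2"
 have "alg.be I <= 2 * (lgn (nn I) + 64)" unfolding alg.be_def alg.bb_def by (rule lgn(2)) simp
 also have "... <= 200 * ?z" using lg[of "nn I"] by simp
 finally have "nn I * alg.be I <= ?z * (200 * ?z)" by (intro mult_mono) auto
 then show "nn I * alg.be I <= NN I" by (simp only: NN_def mult.commute mult.left_commute)
 have z: "200 * ?z <= NN I" unfolding NN_def by simp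
 have "alg.bb I <= lgn (nn I) + 64" unfolding alg.bb_def by (rule lg)
 also have "... <= 200 * ?z" using lg[of "nn I"] by simp
 finally show "alg.bb I <= NN I" using z by linarith
 have "2 * lgn (nn I + mm I) - 1 <= 200 * ?z" using lg[of "nn I + mm I"] by simp
 then show "2 * lgn (nn I + mm I) - 1 <= NN I" using z by linarith
qed

definition copyprog :: "nat => com" where
 "copyprog y = Seq (Assign 6 (Num 0) (Get 0 (Num 1))) (Seq (Assign 7 (Num 0) (Num 0))
   (For 7 6 (Assign 2 (Get 7 (Num 0)) (Get y (Get 7 (Num 0))))))"

lemma exec_copy:
 assumes y: "10 <= y" and s: "nats s 0 1 = M"
 shows "\<exists>s'. exec f m (copyprog y) s (M * 5 + 6) s' & (\<forall>j<M. nats s' 2 j = nats s y j) & (\<forall>x. x ~= 2 & x ~= 6 & x ~= 7 --> nats s' x = nats s x)"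
proof -
 define s1 where "s1 = put_nat 7 0 0 (put_nat 6 0 M s)"
 define P where "P i s' \<longleftrightarrow> nats s' 7 0 = i & nats s' 6 0 = M & (\<forall>j<i. nats s' 2 j = nats s y j) &
   (\<forall>x. x ~= 2 & x ~= 6 & x ~= 7 --> nats s' x = nats s x)" for i and s' :: store
 have "\<exists>s'. exec f m (For 7 6 (Assign 2 (Get 7 (Num 0)) (Get y (Get 7 (Num 0))))) s1 (Suc ((M - 0) * (Suc 0 + 4))) s' & P M s'"
 proof (rule exec_For)
  show "0 <= M" by simp
  show "P 0 s1" by (simp add: P_def s1_def)
  show "P i s' ==> nats s' 7 0 = i & nats s' 6 0 = M" for i s' by (simp add: P_def)
  fix i s' assume i: "i < M" and P: "P i s'"
  have yy: "nats s' y = nats s y" using P y by (auto simp: P_def)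
  have e: "exec f m (Assign 2 (Get 7 (Num 0)) (Get y (Get 7 (Num 0)))) s' (Suc 0) (put_nat 2 i (nats s y i) s')"
   using exec_Assign[of f m 2 "Get 7 (Num 0)" "Get y (Get 7 (Num 0))" s'] P yy by (simp add: P_def)
  show "\<exists>s''. exec f m (Assign 2 (Get 7 (Num 0)) (Get y (Get 7 (Num 0)))) s' (Suc 0) s'' & nats s'' 7 0 = i & P (Suc i) (put_nat 7 0 (Suc i) s'')"
   by (rule exI, rule conjI[OF e]) (use P in \<open>auto simp: P_def less_Suc_eq\<close>)
 qed
 then obtain s' where s': "exec f m (For 7 6 (Assign 2 (Get 7 (Num 0)) (Get y (Get 7 (Num 0))))) s1 (Suc (M * 5)) s'" "P M s'" by auto
 have e1: "exec f m (Assign 6 (Num 0) (Get 0 (Num 1))) s (Suc 0) (put_nat 6 0 M s)"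
  using exec_Assign[of f m 6 "Num 0" "Get 0 (Num 1)" s] s by simp
 have e2: "exec f m (Assign 7 (Num 0) (Num 0)) (put_nat 6 0 M s) (Suc 0) s1"
  using exec_Assign[of f m 7 "Num 0" "Num 0" "put_nat 6 0 M s"] by (simp add: s1_def)
 have "exec f m (copyprog y) s (Suc (Suc 0 + Suc (Suc 0 + Suc (M * 5)))) s'"
  unfolding copyprog_def by (rule exec_Seq[OF e1 exec_Seq[OF e2 s'(1)]])
 then have "exec f m (copyprog y) s (M * 5 + 6) s'" by (rule exec_mono) simp
 then show ?thesis using s'(2) by (intro exI[of _ s']) (auto simp: P_def)
qed

definition vw :: "store => (nat => nat) \<times> (nat => nat) \<times> (nat => nat)" where "vw s = (rda 3 s, rda 4 s, rda 5 s)"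

text \<open>The output is a function of the random words left in arrays 3, 4 and 5, so the analysis
  can be done on the distribution of the words instead of the stores.\<close>

definition Z :: "inst => store => bool" where
 "Z I s \<longleftrightarrow> (\<forall>j<mm I. nats s 2 j = res I (rda 3 s) (rda 4 s) (rda 5 s) j)"

definition OK :: "inst => com => store => nat => ((nat => nat) \<times> (nat => nat) \<times> (nat => nat)) pmf => bool" where
 "OK I c s t K \<longleftrightarrow> (\<exists>D. outs (ff I) (mm I) c s t D & (\<forall>s'\<in>set_pmf D. Z I s') & map_pmf vw D = K)"

lemma OK_fill:
 assumes y: "y < 6" and s: "nats s 6 0 = N" "!!j. nats s y (Suc j) = 0"
  and rest: "!!s'. (!!x. x ~= y ==> x < 7 ==> nats s' x = nats s x) ==> OK I c s' t (K (rda y s'))"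
 shows "OK I (Seq (fillprog y) c) s (Suc ((N * (N * 7 + 7) + 10) + t)) (bind_pmf (Dr N) K)"
proof -
 obtain D where D: "outs (ff I) (mm I) (fillprog y) s (N * (N * 7 + 7) + 10) D"
  "\<forall>s'\<in>set_pmf D. (\<forall>x. x ~= y & x < 7 --> nats s' x = nats s x) & reals s' = reals s" "map_pmf (rda y) D = Dr N"
  using outs_fill[OF y s, of "ff I" "mm I"] by blast
 have "\<forall>s'\<in>set_pmf D. \<exists>E. outs (ff I) (mm I) c s' t E & (\<forall>s''\<in>set_pmf E. Z I s'') & map_pmf vw E = K (rda y s')"
  using D(2) rest unfolding OK_def by blast
 then obtain E where E: "!!s'. s' \<in> set_pmf D ==> outs (ff I) (mm I) c s' t (E s') & (\<forall>s''\<in>set_pmf (E s'). Z I s'') & map_pmf vw (E s') = K (rda y s')"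
  by metis
 have 1: "outs (ff I) (mm I) (Seq (fillprog y) c) s (Suc ((N * (N * 7 + 7) + 10) + t)) (bind_pmf D E)"
  by (rule outs_Seq[OF D(1)]) (use E in blast)
 have "map_pmf vw (bind_pmf D E) = bind_pmf D (%s'. map_pmf vw (E s'))" by (simp add: map_bind_pmf)
 also have "... = bind_pmf D (%s'. K (rda y s'))" by (rule bind_pmf_cong) (use E in auto)
 also have "... = bind_pmf (map_pmf (rda y) D) K" by (simp add: bind_map_pmf)
 finally have "map_pmf vw (bind_pmf D E) = bind_pmf (Dr N) K" by (simp only: D(3))
 then show ?thesis using 1 E unfolding OK_def by (intro exI[of _ "bind_pmf D E"]) (auto simp: set_bind_pmf)
qed

lemma OK_exec:
 assumes "exec (ff I) (mm I) c s t s'" "OK I d s' u K" shows "OK I (Seq c d) s (Suc (t + u)) K"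
proof -
 obtain D where D: "outs (ff I) (mm I) d s' u D" "\<forall>s'\<in>set_pmf D. Z I s'" "map_pmf vw D = K" using assms(2) by (auto simp: OK_def)
 have "outs (ff I) (mm I) (Seq c d) s (Suc (t + u)) (bind_pmf (return_pmf s') (%_. D))"
  by (rule outs_Seq[OF assms(1)[unfolded exec_def]]) (use D in auto)
 then show ?thesis using D by (auto simp: OK_def bind_return_pmf)
qed

lemma rda_cong: "nats s' x = nats s x ==> rda x s' = rda x s" by (auto simp: rda_def fun_eq_iff)

lemma tail_prog:
 "\<exists>c e. \<forall>I s. R0 I s --> OK I c s (isz I ^ e) (return_pmf (vw s))"
proof -
 let ?R = "ext 5 rda (ext 4 rda (ext 3 rda R0))" and ?I = "%p. fst (fst (fst p)) :: inst"
 have b3: "base 6 R0 (%I. I)" by (rule base_mono[OF base_R0]) simp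
 have v1: "comp 6 (ext 3 rda R0) (%p. fst p) rda (%p. snd p)" by (rule base_var[OF b3]) auto
 have b4: "base 6 (ext 3 rda R0) (%p. fst p)" by (rule base_ext[OF b3]) auto
 have v2: "comp 6 (ext 4 rda (ext 3 rda R0)) (%p. fst (fst p)) rda (%p. snd p)" by (rule base_var[OF b4]) auto
 have b5: "base 6 (ext 4 rda (ext 3 rda R0)) (%p. fst (fst p))" by (rule base_ext[OF b4]) auto
 have v3: "comp 6 ?R ?I rda (%p. snd p)" by (rule base_var[OF b5]) auto
 have b6: "base 6 ?R ?I" by (rule base_ext[OF b5]) auto
 have v2': "comp 6 ?R ?I rda (%p. snd (fst p))" by (rule comp_lift1[OF v2]) auto
 have v1': "comp 6 (ext 4 rda (ext 3 rda R0)) (%p. fst (fst p)) rda (%p. snd (fst p))" by (rule comp_lift1[OF v1]) auto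
 have v1'': "comp 6 ?R ?I rda (%p. snd (fst (fst p)))" by (rule comp_lift1[OF v1']) auto
 have body: "comp k' (ext r rdn ?R) (%p. ?I (fst p)) rdn (%p. res (?I (fst p)) (snd (fst (fst (fst p)))) (snd (fst (fst p))) (snd (fst p)) (snd p))"
  if k: "6 <= k'" "r < k'" for k' r
 proof (rule comp_res)
  have bk: "base k' ?R ?I" by (rule base_mono[OF b6 k(1)])
  show "base k' (ext r rdn ?R) (%p. ?I (fst p))" by (rule base_ext[OF bk k(2)]) simp
  show "comp k' (ext r rdn ?R) (%p. ?I (fst p)) rda (%p. snd (fst (fst (fst p))))" by (rule comp_lift1[OF comp_mono[OF v1'' k(1)] k(2)]) simp
  show "comp k' (ext r rdn ?R) (%p. ?I (fst p)) rda (%p. snd (fst (fst p)))" by (rule comp_lift1[OF comp_mono[OF v2' k(1)] k(2)]) simp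
  show "comp k' (ext r rdn ?R) (%p. ?I (fst p)) rda (%p. snd (fst p))" by (rule comp_lift1[OF comp_mono[OF v3 k(1)] k(2)]) simp
  show "comp k' (ext r rdn ?R) (%p. ?I (fst p)) rdn (%p. snd p)" by (rule base_var[OF bk k(2)]) simp
 qed
 \<comment> \<open>Starting at array 10 keeps the program away from the input, the output, the
   random words and the counters in arrays 6 to 9.\<close>
 obtain c t y r where c: "pbd ?I t" "10 <= y" "r < y" "!!x s. ?R x s ==>
   \<exists>s'. exec (ff (?I x)) (mm (?I x)) c s (t x) s' & agree 10 s s' & nats s' r 0 = mm (?I x) &
    (\<forall>j<mm (?I x). nats s' y (j + 0) = res (?I x) (snd (fst (fst x))) (snd (fst x)) (snd x) j)"
  by (rule comp_fill[where d = 0 and b = 10 and h = "%x. res (?I x) (snd (fst (fst x))) (snd (fst x)) (snd x)",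
    OF base_m[OF b6] pbd_m _ body]) auto
 obtain e where e: "!!x. t x <= isz (?I x) ^ e" using pbd_obtain[OF c(1)] by blast
 have OKI: "OK I (Seq c (copyprog y)) s (Suc (isz I ^ e + (mm I * 5 + 6))) (return_pmf (vw s))" if R: "R0 I s" for I s
 proof -
  let ?x = "(((I, rda 3 s), rda 4 s), rda 5 s)"
  have "?R ?x s" using R by (simp add: ext_def)
  from c(4)[OF this] obtain s1 where s1: "exec (ff I) (mm I) c s (t ?x) s1" "agree 10 s s1"
   "\<forall>j<mm I. nats s1 y j = res I (rda 3 s) (rda 4 s) (rda 5 s) j" by auto
  have ag: "nats s1 x = nats s x" if "x < 10" for x using agreeD(1)[OF s1(2) that] .
  have "nats s1 0 1 = mm I" using ag[of 0] R by (simp add: R0_def)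
  from exec_copy[OF c(2) this, of "ff I" "mm I"] obtain s2 where s2: "exec (ff I) (mm I) (copyprog y) s1 (mm I * 5 + 6) s2"
   "\<forall>j<mm I. nats s2 2 j = nats s1 y j" "\<forall>x. x ~= 2 & x ~= 6 & x ~= 7 --> nats s2 x = nats s1 x" by blast
  have rd: "rda 3 s2 = rda 3 s" "rda 4 s2 = rda 4 s" "rda 5 s2 = rda 5 s"
   using s2(3) ag by (auto intro!: rda_cong)
  have "t ?x <= isz I ^ e" using e[of ?x] by simp
  then have "exec (ff I) (mm I) c s (isz I ^ e) s1" using exec_mono[OF s1(1)] by blast
  then have "exec (ff I) (mm I) (Seq c (copyprog y)) s (Suc (isz I ^ e + (mm I * 5 + 6))) s2" by (rule exec_Seq[OF _ s2(1)])
  moreover have "Z I s2" using s1(3) s2(2) by (simp add: Z_def rd)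
  moreover have "vw s2 = vw s" by (simp add: vw_def rd)
  ultimately show ?thesis unfolding OK_def exec_def by (intro exI[of _ "return_pmf s2"]) simp
 qed
 have "pbd (%I. I) (%I. Suc (isz I ^ e + (mm I * 5 + 6)))" by (rule pbd_pow pbds)+
 then obtain e' where e': "!!I. Suc (isz I ^ e + (mm I * 5 + 6)) <= isz I ^ e'" using pbd_obtain by blast
 have "OK I (Seq c (copyprog y)) s (isz I ^ e') (return_pmf (vw s))" if "R0 I s" for I s
  using OKI[OF that] e'[of I] outs_mono unfolding OK_def by blast
 then show ?thesis by blast
qed

lemma whole_prog:
 "\<exists>c e. \<forall>I. OK I c (input_store (nn I) (mm I) (gg I)) (isz I ^ e) (Dr3 (NN I))"
proof -
 obtain c1 e1 where c1: "!!I s. R0 I s ==> OK I c1 s (isz I ^ e1) (return_pmf (vw s))" using tail_prog by blast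
 obtain c0 e0 r0 where c0: "!!I s. R0 I s ==> \<exists>s'. exec (ff I) (mm I) c0 s (isz I ^ e0) s' & agree 10 s s' & rdn r0 s' = NN I"
 proof (rule compE[OF comp_NN, of 10])
  show "2 <= (10::nat)" by simp
 qed blast
 let ?f = "%I. NN I * (NN I * 7 + 7) + 10"
 let ?T = "%I. Suc (isz I ^ e0 + Suc (Suc 0 + Suc (?f I + Suc (?f I + Suc (?f I + isz I ^ e1)))))"
 let ?c = "Seq c0 (Seq (Assign 6 (Num 0) (Get r0 (Num 0))) (Seq (fillprog 3) (Seq (fillprog 4) (Seq (fillprog 5) c1))))"
 have main: "OK I ?c (input_store (nn I) (mm I) (gg I)) (?T I) (Dr3 (NN I))" for I
 proof -
  let ?s = "input_store (nn I) (mm I) (gg I)"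
  have R: "R0 I ?s" by (auto simp: R0_def input_store_def fun_eq_iff)
  obtain s1 where s1: "exec (ff I) (mm I) c0 ?s (isz I ^ e0) s1" "agree 10 ?s s1" "rdn r0 s1 = NN I" using c0[OF R] by blast
  define s2 where "s2 = put_nat 6 0 (NN I) s1"
  have e2: "exec (ff I) (mm I) (Assign 6 (Num 0) (Get r0 (Num 0))) s1 (Suc 0) s2"
   using exec_Assign[of "ff I" "mm I" 6 "Num 0" "Get r0 (Num 0)" s1] s1(3) by (simp add: rdn_def s2_def)
  have a2: "nats s2 x = nats ?s x" if "x < 6" for x using agreeD(1)[OF s1(2), of x] that by (simp add: s2_def)
  have R2: "R0 I s2" using R a2[of 0] a2[of 1] by (simp add: R0_def)
  have N2: "nats s2 6 0 = NN I" by (simp add: s2_def)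
  have z2: "nats s2 x (Suc j) = 0" if "x \<in> {3, 4, 5}" for x j using a2[of x] that by (auto simp: input_store_def)
  have Rc: "R0 I s'" if "nats s' 0 = nats s 0" "nats s' 1 = nats s 1" "R0 I s" for s s' :: store using that by (simp add: R0_def)
  have t5: "OK I (Seq (fillprog 5) c1) s (Suc (?f I + isz I ^ e1)) (bind_pmf (Dr (NN I)) (%Y. return_pmf (rda 3 s, rda 4 s, Y)))"
   if s: "R0 I s" "nats s 6 0 = NN I" "!!j. nats s 5 (Suc j) = 0" for s
  proof (rule OK_fill[OF _ s(2,3)])
   fix s' :: store assume a: "!!x. x ~= 5 ==> x < 7 ==> nats s' x = nats s x"
   have "R0 I s'" by (rule Rc[OF a a s(1)]) auto
   moreover have "rda 3 s' = rda 3 s" "rda 4 s' = rda 4 s" by (auto intro!: rda_cong a)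
   ultimately show "OK I c1 s' (isz I ^ e1) (return_pmf (rda 3 s, rda 4 s, rda 5 s'))" using c1[of I s'] by (simp add: vw_def)
  qed simp
  have t4: "OK I (Seq (fillprog 4) (Seq (fillprog 5) c1)) s (Suc (?f I + Suc (?f I + isz I ^ e1)))
    (bind_pmf (Dr (NN I)) (%X. bind_pmf (Dr (NN I)) (%Y. return_pmf (rda 3 s, X, Y))))"
   if s: "R0 I s" "nats s 6 0 = NN I" "!!j. nats s 4 (Suc j) = 0" "!!j. nats s 5 (Suc j) = 0" for s
  proof (rule OK_fill[OF _ s(2,3)])
   fix s' :: store assume a: "!!x. x ~= 4 ==> x < 7 ==> nats s' x = nats s x"
   have "R0 I s'" by (rule Rc[OF a a s(1)]) auto
   moreover have "rda 3 s' = rda 3 s" by (auto intro!: rda_cong a)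
   ultimately show "OK I (Seq (fillprog 5) c1) s' (Suc (?f I + isz I ^ e1)) (bind_pmf (Dr (NN I)) (%Y. return_pmf (rda 3 s, rda 4 s', Y)))"
    using t5[of s'] a[of 6] a[of 5] s by simp
  qed simp
  have "OK I (Seq (fillprog 3) (Seq (fillprog 4) (Seq (fillprog 5) c1))) s2 (Suc (?f I + Suc (?f I + Suc (?f I + isz I ^ e1)))) (Dr3 (NN I))"
   unfolding Dr3_def
  proof (rule OK_fill[OF _ N2])
   fix s' :: store assume a: "!!x. x ~= 3 ==> x < 7 ==> nats s' x = nats s2 x"
   have "R0 I s'" by (rule Rc[OF a a R2]) auto
   then show "OK I (Seq (fillprog 4) (Seq (fillprog 5) c1)) s' (Suc (?f I + Suc (?f I + isz I ^ e1)))
    (bind_pmf (Dr (NN I)) (%X. bind_pmf (Dr (NN I)) (%Y. return_pmf (rda 3 s', X, Y))))"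
    using t4[of s'] a[of 6] a[of 4] a[of 5] N2 z2 by simp
  qed (use z2 in auto)
  then show ?thesis by (intro OK_exec[OF s1(1)] OK_exec[OF e2])
 qed
 have "pbd (%I. I) ?T" by (rule pbd_pow pbds NN_pbd)+
 then obtain e where e: "!!I. ?T I <= isz I ^ e" using pbd_obtain by blast
 have "OK I ?c (input_store (nn I) (mm I) (gg I)) (isz I ^ e) (Dr3 (NN I))" for I
  using main[of I] e[of I] outs_mono unfolding OK_def by blast
 then show ?thesis by blast
qed

theorem theorem1:
 "\<exists>(A :: com) (\<alpha> :: nat \<Rightarrow> real).
   \<alpha> \<in> O(\<lambda>n. ln (ln (real n))) \<and> (\<forall>n. \<alpha> n > 0) \<and>
   randomized_poly_time_santa_approx A \<alpha>"
proof -
 obtain c e where c: "!!I. OK I c (input_store (nn I) (mm I) (gg I)) (isz I ^ e) (Dr3 (NN I))" using whole_prog by blast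
 have "randomized_poly_time_santa_approx c apx"
  unfolding randomized_poly_time_santa_approx_def Let_def
 \<comment> \<open>The polynomial is the \<open>e\<close>-th power of \<open>x + 2\<close>, whose
   value at \<open>n + m\<close> is \<open>isz I ^ e\<close>.\<close>
 proof (intro exI[of _ "[:2, 1:] ^ e"] allI impI)
  fix n m :: nat and f :: "nat set => real" and \<Gamma> :: "nat => nat set"
  assume inst: "santa_instance {..<n} {..<m} f \<Gamma>"
  define I where "I = \<lparr>nn = n, mm = m, ff = f, gg = \<Gamma>\<rparr>"
  have I: "nn I = n" "mm I = m" "ff I = f" "gg I = \<Gamma>" by (auto simp: I_def)
  have inst': "santa_instance {..<nn I} {..<mm I} (ff I) (gg I)" using inst by (simp add: I)
  have n0: "0 < nn I" using inst' by (auto simp: santa_instance_def)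
  obtain D where D: "outs f m c (input_store n m \<Gamma>) (isz I ^ e) D" "\<forall>s\<in>set_pmf D. Z I s" "map_pmf vw D = Dr3 (NN I)"
   using c[of I] unfolding OK_def I by blast
  have "poly ([:2, 1:] ^ e) (n + m) = isz I ^ e" by (simp add: isz_def I poly_power add.commute add.left_commute)
  then have run: "run f m (poly ([:2, 1:] ^ e) (n + m)) (c, input_store n m \<Gamma>) = map_pmf (Pair Skip) D"
   using D(1) by (simp add: outs_def)
  have parts: "output_parts m s = (%i. {j. j < m & res I (rda 3 s) (rda 4 s) (rda 5 s) j = i})" if "s \<in> set_pmf D" for s
   using D(2) that by (auto simp: output_parts_def Z_def I fun_eq_iff)
  have al: "allocation {..<n} {..<m} (output_parts m s)" if "s \<in> set_pmf D" for s
   unfolding parts[OF that] allocation_def disjoint_family_on_def using res_lt[OF n0] by (auto simp: I)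
  let ?E = "{(S, X, Y). santa_opt {..<nn I} {..<mm I} (ff I) (gg I) / apx (nn I) \<le>
   santa_value {..<nn I} (ff I) (gg I) (%i. {j. j < mm I & res I S X Y j = i})}"
  let ?G = "{(c :: com, s). santa_value {..<n} f \<Gamma> (output_parts m s) \<ge> santa_opt {..<n} {..<m} f \<Gamma> / apx n}"
  have "2 / 3 <= mprob (Dr3 (NN I)) ?E" by (rule success[OF inst' NN_bounds])
  also have "... = mprob D (vw -` ?E)" unfolding D(3)[symmetric] by simp
  also have "... = mprob D (vw -` ?E \<inter> set_pmf D)" by (simp add: measure_Int_set_pmf)
  also have "... <= mprob D (Pair Skip -` ?G)"
   by (rule measure_pmf.finite_measure_mono) (auto simp: vw_def parts I)
  also have "... = mprob (map_pmf (Pair Skip) D) ?G" by simp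
  finally have "2 / 3 <= mprob (map_pmf (Pair Skip) D) ?G" .
  then show "(\<forall>(c, s)\<in>set_pmf (run f m (poly ([:2, 1:] ^ e) (n + m)) (c, input_store n m \<Gamma>)). c = Skip & allocation {..<n} {..<m} (output_parts m s)) &
    2 / 3 <= mprob (run f m (poly ([:2, 1:] ^ e) (n + m)) (c, input_store n m \<Gamma>)) ?G"
   unfolding run using al by auto
 qed
 then show ?thesis using apx_bigo apx_pos by blast
qed

end
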